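(* Let $T\in\mathcal{K}(V)$ be bisectorial of angle $\omega\in(0,\frac{\pi}{2})$, let $\theta\in(\omega,\frac{\pi}{2})$, let $p$ be an intrinsic polynomial and $f\in\mathcal{SH}_L^{\mathrm{reg}}(D_\theta)$. Then $$(pf)(T)\supseteq p[T]f(T),$$ where $(pf)(T)$ and $f(T)$ are given by the $H^\infty$-functional calculus.
   Context: Clifford setting. Fix an integer $n\geq 1$. $\mathbb{R}_n$ is the real Clifford algebra generated by $e_1,\dots,e_n$ with $e_i^2=-1$, $e_ie_j=-e_je_i$ ($i\neq j$), with basis $e_A=e_{i_1}\cdots e_{i_r}$ for $A=(i_1<\dots<i_r)$, $e_\emptyset=1$, and $|s|^2=\sum_As_A^2$ for $s=\sum_As_Ae_A$. Paravectors: $\mathbb{R}^{n+1}=\{s_0+s_1e_1+\dots+s_ne_n\}\subseteq\mathbb{R}_n$ with $\overline{s}=s_0-s_1e_1-\dots-s_ne_n$. $\mathbb{S}=\{s\in\mathbb{R}^{n+1}: s_0=0,|s|=1\}$ and $\mathbb{C}_J=\{x+Jy: x,y\in\mathbb{R}\}$ for $J\in\mathbb{S}$. $U\subseteq\mathbb{R}^{n+1}$ is axially symmetric if $x+Jy\in U$ ($x,y\in\mathbb{R}$, $J\in\mathbb{S}$) implies $x+Iy\in U$ for all $I\in\mathbb{S}$. Slice hyperholomorphic functions. For $U$ open and axially symmetric, $f:U\to\mathbb{R}_n$ is left slice hyperholomorphic ($f\in\mathcal{SH}_L(U)$) if there are continuously differentiable $f_0,f_1:\{(x,y)\in\mathbb{R}^2: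 x+\mathbb{S}y\subseteq U\}\to\mathbb{R}_n$ with $f(x+Jy)=f_0(x,y)+Jf_1(x,y)$ for all $J\in\mathbb{S}$, $f_0(x,-y)=f_0(x,y)$, $f_1(x,-y)=-f_1(x,y)$, $\partial_xf_0=\partial_yf_1$, $\partial_yf_0=-\partial_xf_1$. If $f_0,f_1$ are real valued, $f$ is called intrinsic ($f\in\mathcal{N}(U)$). Operators. $V_\mathbb{R}$ is a real Banach space, $V=\{\sum_Av_A\otimes e_A: v_A\in V_\mathbb{R}\}$ the corresponding Clifford module with norm $\|v\|^2=\sum_A\|v_A\|^2$ and the natural left and right multiplications by $\mathbb{R}_n$. $\mathcal{B}(V)$: bounded everywhere defined right-linear operators; $\mathcal{K}(V)$: closed right-linear operators $T:\operatorname{dom}(T)\to V$ with right-linear domain $\operatorname{dom}(T)\subseteq V$. A Clifford number $a$ is identified with the operator $v\mapsto av$, so $(aT)v=a(Tv)$, $(Ta)v=T(av)$. For operators, $A\subseteq B$ means $\operatorname{dom}(A)\subseteq\operatorname{dom}(B)$ and $Av=Bv$ for $v\in\operatorname{dom}(A)$; products have their natural domains. For $s\in\mathbb{R}^{n+1}$, $Q_s[T]=T^2-2s_0T+|s|^2$ on $\operatorname{dom}(T^2)$; $\rho_S(T)=\{s\in\mathbb{R}^{n+1}: Q_s[T]^{-1}\in\mathcal{B}(V)\}$, $\sigma_S(T)=\mathbb{R}^{n+1}\setminus\rho_S(T)$, and $S_L^{-1}(s,T)=Q_s[T]^{-1}\overline{s}-TQ_s[T]^{-1}$ for $s\in\rho_S(T)$.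 Bisectorial operators. For $\omega\in(0,\frac{\pi}{2})$, $I_\omega=(-\omega,\omega)\cup(\pi-\omega,\pi+\omega)$ and $D_\omega=\{re^{J\phi}: r>0,\,J\in\mathbb{S},\,\phi\in I_\omega\}\subseteq\mathbb{R}^{n+1}$. $T\in\mathcal{K}(V)$ is bisectorial of angle $\omega$ if $\sigma_S(T)\subseteq\overline{D_\omega}$ and for every $\varphi\in(\omega,\frac{\pi}{2})$ there is $C_\varphi\geq 0$ with $\|S_L^{-1}(s,T)\|\leq\frac{C_\varphi}{|s|}$ for all $s\in\mathbb{R}^{n+1}\setminus(D_\varphi\cup\{0\})$. $\omega$-functional calculus. $\mathcal{SH}_L^0(D_\theta)$ is the set of bounded $f\in\mathcal{SH}_L(D_\theta)$ with $\int_0^\infty|f(te^{J\phi})|\frac{dt}{t}<\infty$ for all $J\in\mathbb{S}$, $\phi\in I_\theta$; $\mathcal{N}^0(D_\theta)$ is the set of intrinsic such functions. For $T$ bisectorial of angle $\omega$, $\theta\in(\omega,\frac{\pi}{2})$ and $f\in\mathcal{SH}_L^0(D_\theta)$, $$f(T)=\frac{1}{2\pi}\int_{\partial D_\varphi\cap\mathbb{C}_J}S_L^{-1}(s,T)ds_Jf(s):=\frac{1}{2\pi}\sum_\pm\int_\mathbb{R}S_L^{-1}(\gamma_\pm(t),T)\frac{\gamma_\pm'(t)}{J}f(\gamma_\pm(t))dt\in\mathcal{B}(V),$$ with $\gamma_\pm(t)=\pm|t|e^{-\operatorname{sgn}(t)J\varphi}$; it does not depend on the choice of $\varphi\in(\omega,\theta)$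 and $J\in\mathbb{S}$. Extended $\omega$-functional calculus. $\mathcal{SH}_L^{\mathrm{bnd}}(D_\theta)$ is the set of functions $f(s)=f_\infty+\frac{1}{1+s^2}(f_0-f_\infty)+\widetilde{f}(s)$ on $D_\theta$ with $f_0,f_\infty\in\mathbb{R}_n$, $\widetilde{f}\in\mathcal{SH}_L^0(D_\theta)$ (unique components); $\mathcal{N}^{\mathrm{bnd}}(D_\theta)$ is the analogous set with $f_0,f_\infty\in\mathbb{R}$, $\widetilde{f}\in\mathcal{N}^0(D_\theta)$. For such $f$, $f(T):=f_\infty+(1+T^2)^{-1}(f_0-f_\infty)+\widetilde{f}(T)\in\mathcal{B}(V)$; here $1+T^2$ is boundedly invertible since $\mathbb{S}\subseteq\rho_S(T)$. $H^\infty$-functional calculus. $\mathcal{SH}_L^{\mathrm{reg}}(D_\theta)$ is the set of $f\in\mathcal{SH}_L(D_\theta)$ for which there exists $e\in\mathcal{N}^{\mathrm{bnd}}(D_\theta)$ (a regularizer of $f$) such that $ef\in\mathcal{SH}_L^{\mathrm{bnd}}(D_\theta)$ and $e(T)$ is injective. For such $f$, $f(T):=e(T)^{-1}(ef)(T)$ with its natural domain $\operatorname{dom}(f(T))=\{v\in V: (ef)(T)v\in\operatorname{ran}(e(T))\}$; this is independent of the regularizer $e$. $(pf)(T)$ denotes the $H^\infty$-functional calculus applied to the pointwise product $pf$, which is again in $\mathcal{SH}_L^{\mathrm{reg}}(D_\theta)$. Polynomials. An intrinsic polynomial of degree $m$ is $p(s)=p_0+p_1s+\dots+p_ms^m$ with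 real coefficients, $p_m\neq 0$; $p[T]=p_0+p_1T+\dots+p_mT^m$ with $\operatorname{dom}(p[T])=\operatorname{dom}(T^m)$. *)

theory Defs
  imports "HOL-Analysis.Analysis" "HOL-Computational_Algebra.Polynomial"
begin

section \<open>The Clifford algebra and its modules\<close>

text \<open>
  The generators \<open>e\<^sub>1, \<dots>, e\<^sub>n\<close> are indexed by a finite linearly ordered type \<open>'n\<close> (so \<open>n \<ge> 1\<close>), and
  the basis elements \<open>e\<^sub>A\<close> by the sets \<open>A :: 'n set\<close>; \<open>e\<^sub>A\<close> is \<open>axis A 1\<close>.  The Euclidean norm of
  \<^typ>\<open>real ^ 'n set\<close> and the norm of \<open>'v ^ 'n set\<close> in the library are the norms
  \<open>|s|\<^sup>2 = \<Sum>\<^sub>A s\<^sub>A\<^sup>2\<close> and \<open>\<parallel>v\<parallel>\<^sup>2 = \<Sum>\<^sub>A \<parallel>v\<^sub>A\<parallel>\<^sup>2\<close>.  The library operations \<open>*\<close> and \<open>1\<close> on vectors are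
  componentwise and are not the Clifford operations; they are never used below.
\<close>

type_synonym 'n clifford = "real ^ ('n set)"
type_synonym ('v, 'n) clmodule = "'v ^ ('n set)"

text \<open>
  \<open>e\<^sub>A e\<^sub>B = cl_sgn A B \<cdot> e\<^bsub>A \<triangle> B\<^esub>\<close>: sorting \<open>e\<^sub>A e\<^sub>B\<close> gives one sign for each pair \<open>a > b\<close> that has to be
  interchanged, and one more sign from \<open>e\<^sub>i\<^sup>2 = -1\<close> for each common index \<open>a = b\<close>.
\<close>

definition cl_sgn :: "'n::{finite,linorder} set \<Rightarrow> 'n set \<Rightarrow> real" where
  "cl_sgn A B = (-1) ^ card {(a, b). a \<in> A \<and> b \<in> B \<and> b \<le> a}"

text \<open>
  Left multiplication \<open>a v\<close> in \<open>V\<close>; with \<open>'v = real\<close> this is also the product of the Clifford algebra.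
\<close>

definition lmul :: "'n::{finite,linorder} clifford \<Rightarrow> ('v::real_normed_vector, 'n) clmodule \<Rightarrow> ('v, 'n) clmodule"
    (infixr \<open>\<cdot>\<close> 75) where
  "a \<cdot> v = (\<Sum>A\<in>UNIV. \<Sum>B\<in>UNIV. axis (sym_diff A B) ((a $ A * cl_sgn A B) *\<^sub>R (v $ B)))"

definition rmul :: "('v::real_normed_vector, 'n) clmodule \<Rightarrow> 'n::{finite,linorder} clifford \<Rightarrow> ('v, 'n) clmodule"
    (infixl \<open>\<cdot>\<^sub>r\<close> 75) where
  "v \<cdot>\<^sub>r a = (\<Sum>A\<in>UNIV. \<Sum>B\<in>UNIV. axis (sym_diff A B) ((cl_sgn A B * a $ B) *\<^sub>R (v $ A)))"

definition cl_real :: "real \<Rightarrow> 'n::{finite,linorder} clifford" where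
  "cl_real x = axis {} x"

definition cl_gen :: "'n::{finite,linorder} \<Rightarrow> 'n clifford" where
  "cl_gen i = axis {i} 1"

definition cl_pow :: "'n::{finite,linorder} clifford \<Rightarrow> nat \<Rightarrow> 'n clifford" where
  "cl_pow s k = ((\<lambda>x. s \<cdot> x) ^^ k) (cl_real 1)"

definition paravectors :: "'n::{finite,linorder} clifford set" where
  "paravectors = {s. \<forall>A. card A \<ge> 2 \<longrightarrow> s $ A = 0}"

abbreviation scal :: "'n::{finite,linorder} clifford \<Rightarrow> real" where
  "scal s \<equiv> s $ {}"

text \<open>Conjugate and inverse are used for paravectors only.\<close>

definition cl_cnj :: "'n::{finite,linorder} clifford \<Rightarrow> 'n clifford" where
  "cl_cnj s = (\<chi> A. if A = {} then s $ A else - (s $ A))"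

definition cl_inv :: "'n::{finite,linorder} clifford \<Rightarrow> 'n clifford" where
  "cl_inv s = (1 / (norm s)\<^sup>2) *\<^sub>R cl_cnj s"

definition imag_units :: "'n::{finite,linorder} clifford set" where
  "imag_units = {s \<in> paravectors. scal s = 0 \<and> norm s = 1}"

definition slice_pt :: "'n::{finite,linorder} clifford \<Rightarrow> real \<Rightarrow> real \<Rightarrow> 'n clifford" where
  "slice_pt J x y = cl_real x + y *\<^sub>R J"

definition cl_cis :: "'n::{finite,linorder} clifford \<Rightarrow> real \<Rightarrow> 'n clifford" where
  "cl_cis J \<phi> = slice_pt J (cos \<phi>) (sin \<phi>)"

subsection \<open>The defining relations\<close>

lemma lmul_axis:
  fixes A B :: "'n::{finite,linorder} set" and y :: "'v::real_normed_vector"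
  shows "axis A x \<cdot> axis B y = axis (sym_diff A B) ((x * cl_sgn A B) *\<^sub>R y)"
proof -
  have nth: "axis i c $ j = (if j = i then c else 0)" for i j and c :: "'c::zero"
    by (simp add: axis_def)
  have [simp]: "axis i 0 = 0" for i :: "'n set"
    by (simp add: axis_def vec_eq_iff)
  have "axis A x \<cdot> axis B y = (\<Sum>A'\<in>UNIV. \<Sum>B'\<in>UNIV. if A' = A then
      (if B' = B then axis (sym_diff A B) ((x * cl_sgn A B) *\<^sub>R y) else 0) else 0)"
    unfolding lmul_def nth
  proof (intro sum.cong refl)
    fix A' B' :: "'n set"
    show "axis (sym_diff A' B') (((if A' = A then x else 0) * cl_sgn A' B') *\<^sub>R (if B' = B then y else 0)) =
      (if A' = A then if B' = B then axis (sym_diff A B) ((x * cl_sgn A B) *\<^sub>R y) else 0 else 0)"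
      by (cases "A' = A"; cases "B' = B"; simp only: if_True if_False; simp)
  qed
  also have "\<dots> = (\<Sum>A'\<in>UNIV. if A' = A then
      (\<Sum>B'\<in>UNIV. if B' = B then axis (sym_diff A B) ((x * cl_sgn A B) *\<^sub>R y) else 0) else 0)"
    by (intro sum.cong refl) simp
  finally have "axis A x \<cdot> axis B y = (\<Sum>A'\<in>UNIV. if A' = A then
      (\<Sum>B'\<in>UNIV. if B' = B then axis (sym_diff A B) ((x * cl_sgn A B) *\<^sub>R y) else 0) else 0)" .
  thus ?thesis by simp
qed

lemma lmul_add_left: "(a + b) \<cdot> v = a \<cdot> v + b \<cdot> v"
  unfolding lmul_def sum.distrib[symmetric]
  by (intro sum.cong refl) (auto simp: axis_def vec_eq_iff algebra_simps)

lemma lmul_add_right: "a \<cdot> (v + w) = a \<cdot> v + a \<cdot> w"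
  unfolding lmul_def sum.distrib[symmetric]
  by (intro sum.cong refl) (auto simp: axis_def vec_eq_iff algebra_simps)

lemma lmul_sum_left: "finite I \<Longrightarrow> (\<Sum>i\<in>I. f i) \<cdot> v = (\<Sum>i\<in>I. f i \<cdot> v)"
  by (induction rule: finite_induct) (auto simp: lmul_add_left, simp add: lmul_def axis_def vec_eq_iff)

lemma lmul_sum_right: "finite I \<Longrightarrow> a \<cdot> (\<Sum>i\<in>I. f i) = (\<Sum>i\<in>I. a \<cdot> f i)"
  by (induction rule: finite_induct) (auto simp: lmul_add_right, simp add: lmul_def axis_def vec_eq_iff)

lemma axis_expansion: "v = (\<Sum>A\<in>UNIV. axis A (v $ A))"
  by (simp add: vec_eq_iff axis_def)

lemma cl_sgn_prod: "cl_sgn A B = (\<Prod>a\<in>A. \<Prod>b\<in>B. if b \<le> a then -1 else 1)"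
proof -
  have "{(a, b). a \<in> A \<and> b \<in> B \<and> b \<le> a} = {p \<in> A \<times> B. snd p \<le> fst p}"
    by auto
  moreover have "(\<Prod>p\<in>A \<times> B. if snd p \<le> fst p then -1 else (1::real)) = (-1) ^ card {p \<in> A \<times> B. snd p \<le> fst p}"
    by (subst prod.inter_filter[symmetric]) (auto simp: finite_cartesian_product)
  ultimately show ?thesis
    by (simp add: cl_sgn_def prod.cartesian_product case_prod_beta)
qed

lemma prod_sym_diff:
  fixes g :: "'a::finite \<Rightarrow> real"
  assumes "\<And>x. g x * g x = 1"
  shows "prod g (sym_diff A B) = prod g A * prod g B"
proof -
  have A: "prod g A = prod g (A - B) * prod g (A \<inter> B)"
    by (subst prod.union_disjoint[symmetric]) (auto intro: prod.cong)
  have B: "prod g B = prod g (B - A) * prod g (A \<inter> B)"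
    by (subst prod.union_disjoint[symmetric]) (auto intro: prod.cong)
  have C: "prod g (A \<inter> B) * prod g (A \<inter> B) = 1"
    by (simp add: prod.distrib[symmetric] assms)
  have "prod g (sym_diff A B) = prod g (A - B) * prod g (B - A)"
    by (rule prod.union_disjoint) auto
  also have "\<dots> = prod g (A - B) * prod g (B - A) * (prod g (A \<inter> B) * prod g (A \<inter> B))"
    by (simp add: C)
  finally show ?thesis
    unfolding A B by (simp add: mult_ac)
qed

lemma cl_sgn_sym_diff:
  "cl_sgn (sym_diff A B) C = cl_sgn A C * cl_sgn B C"
  "cl_sgn A (sym_diff B C) = cl_sgn A B * cl_sgn A C"
proof -
  show "cl_sgn (sym_diff A B) C = cl_sgn A C * cl_sgn B C"
    unfolding cl_sgn_prod
  proof (rule prod_sym_diff)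
    show "(\<Prod>b\<in>C. if b \<le> x then -1 else 1) * (\<Prod>b\<in>C. if b \<le> x then -1 else (1::real)) = 1" for x
      unfolding prod.distrib[symmetric] by (rule prod.neutral) simp
  qed
  show "cl_sgn A (sym_diff B C) = cl_sgn A B * cl_sgn A C"
    unfolding cl_sgn_prod prod.distrib[symmetric]
    by (intro prod.cong refl prod_sym_diff) simp
qed

lemma lmul_assoc:
  fixes a b :: "'n::{finite,linorder} clifford" and v :: "('v::real_normed_vector, 'n) clmodule"
  shows "(a \<cdot> b) \<cdot> v = a \<cdot> (b \<cdot> v)"
proof -
  have *: "(axis A x \<cdot> axis B y) \<cdot> axis C z = axis A x \<cdot> (axis B y \<cdot> axis C z)"
    for A B C :: "'n set" and x y :: real and z :: 'v
  proof -
    have "sym_diff (sym_diff A B) C = sym_diff A (sym_diff B C)" by blast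
    thus ?thesis by (simp add: lmul_axis cl_sgn_sym_diff mult_ac)
  qed
  have "((\<Sum>A\<in>UNIV. axis A (a $ A)) \<cdot> (\<Sum>B\<in>UNIV. axis B (b $ B))) \<cdot> (\<Sum>C\<in>UNIV. axis C (v $ C))
      = (\<Sum>A\<in>UNIV. axis A (a $ A)) \<cdot> ((\<Sum>B\<in>UNIV. axis B (b $ B)) \<cdot> (\<Sum>C\<in>UNIV. axis C (v $ C)))"
    by (simp add: lmul_sum_left lmul_sum_right *)
  thus ?thesis by (simp flip: axis_expansion)
qed

lemma cl_gen_square: "cl_gen i \<cdot> cl_gen i = cl_real (-1)"
proof -
  have "{(a, b). a \<in> {i} \<and> b \<in> {i} \<and> b \<le> a} = {(i, i)}" by auto
  thus ?thesis by (simp add: cl_gen_def cl_real_def lmul_axis cl_sgn_def)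
qed

lemma cl_gen_anticommute:
  assumes "i \<noteq> j"
  shows "cl_gen i \<cdot> cl_gen j = - (cl_gen j \<cdot> cl_gen i)"
proof -
  have eq: "{(a, b). a \<in> {k} \<and> b \<in> {l} \<and> b \<le> a} = (if l \<le> k then {(k, l)} else {})" for k l :: 'a
    by auto
  from assms have "i < j \<or> j < i" by auto
  hence "cl_sgn {i} {j} = - cl_sgn {j} {i}"
    unfolding cl_sgn_def eq by auto
  moreover from assms have "sym_diff {i} {j} = sym_diff {j} {i}" by auto
  ultimately show ?thesis
    unfolding cl_gen_def lmul_axis by (simp add: axis_def vec_eq_iff)
qed

text \<open>\<open>e\<^sub>A = e\<^bsub>i\<^sub>1\<^esub> \<cdots> e\<^bsub>i\<^sub>r\<^esub>\<close> for \<open>i\<^sub>1 < \<dots> < i\<^sub>r\<close>:\<close>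

lemma cl_basis_insert:
  assumes "\<And>a. a \<in> A \<Longrightarrow> i < a"
  shows "axis (insert i A) (1::real) = cl_gen i \<cdot> axis A 1"
proof -
  have "{(a, b). a \<in> {i} \<and> b \<in> A \<and> b \<le> a} = {}" and i: "i \<notin> A" using assms by force+
  hence "cl_sgn {i} A = 1" unfolding cl_sgn_def by (simp only: card.empty power_0)
  moreover have "sym_diff {i} A = insert i A" using i by auto
  ultimately show ?thesis unfolding cl_gen_def lmul_axis by simp
qed

lemma cl_real_lmul: "cl_real x \<cdot> v = x *\<^sub>R v"
proof -
  have "axis {} x \<cdot> (\<Sum>B\<in>UNIV. axis B (v $ B)) = x *\<^sub>R (\<Sum>B\<in>UNIV. axis B (v $ B))"
    by (auto simp: lmul_sum_right lmul_axis cl_sgn_def scaleR_sum_right intro!: sum.cong)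
       (auto simp: axis_def vec_eq_iff)
  thus ?thesis by (simp add: cl_real_def flip: axis_expansion)
qed

lemma rmul_eq_lmul: "(b :: 'n::{finite,linorder} clifford) \<cdot>\<^sub>r a = b \<cdot> a"
  unfolding lmul_def rmul_def by (simp add: mult_ac)


section \<open>Slice hyperholomorphic functions\<close>

definition axially_symmetric :: "'n::{finite,linorder} clifford set \<Rightarrow> bool" where
  "axially_symmetric U \<longleftrightarrow> U \<subseteq> paravectors \<and>
     (\<forall>x y. \<forall>J\<in>imag_units. slice_pt J x y \<in> U \<longrightarrow> (\<forall>I\<in>imag_units. slice_pt I x y \<in> U))"

definition slice_dom :: "'n::{finite,linorder} clifford set \<Rightarrow> (real \<times> real) set" where
  "slice_dom U = {(x, y). \<forall>J\<in>imag_units. slice_pt J x y \<in> U}"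

text \<open>
  \<open>f\<^sub>0\<close> and \<open>f\<^sub>1\<close> are the components of \<open>f\<close>; \<open>D\<^sub>0\<close>, \<open>D\<^sub>1\<close> are their (continuous) total derivatives, and
  \<open>D z (1, 0)\<close>, \<open>D z (0, 1)\<close> the partial derivatives with respect to \<open>x\<close> and \<open>y\<close>.
\<close>

definition slice_components ::
  "'n::{finite,linorder} clifford set \<Rightarrow> ('n clifford \<Rightarrow> 'n clifford) \<Rightarrow>
   (real \<times> real \<Rightarrow> 'n clifford) \<Rightarrow> (real \<times> real \<Rightarrow> 'n clifford) \<Rightarrow> bool" where
  "slice_components U f f0 f1 \<longleftrightarrow>
     (\<forall>(x, y)\<in>slice_dom U.
        (\<forall>J\<in>imag_units. f (slice_pt J x y) = f0 (x, y) + J \<cdot> f1 (x, y)) \<and>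
        f0 (x, -y) = f0 (x, y) \<and> f1 (x, -y) = - f1 (x, y)) \<and>
     (\<exists>D0 D1 :: real \<times> real \<Rightarrow> (real \<times> real) \<Rightarrow>\<^sub>L 'n clifford.
        continuous_on (slice_dom U) D0 \<and> continuous_on (slice_dom U) D1 \<and>
        (\<forall>z\<in>slice_dom U.
           (f0 has_derivative blinfun_apply (D0 z)) (at z) \<and>
           (f1 has_derivative blinfun_apply (D1 z)) (at z) \<and>
           D0 z (1, 0) = D1 z (0, 1) \<and> D0 z (0, 1) = - D1 z (1, 0)))"

definition SHL :: "'n::{finite,linorder} clifford set \<Rightarrow> ('n clifford \<Rightarrow> 'n clifford) set" where
  "SHL U = {f. openin (top_of_set paravectors) U \<and> axially_symmetric U \<and>
               (\<exists>f0 f1. slice_components U f f0 f1)}"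

definition intrinsic :: "'n::{finite,linorder} clifford set \<Rightarrow> ('n clifford \<Rightarrow> 'n clifford) set" where
  "intrinsic U = {f. openin (top_of_set paravectors) U \<and> axially_symmetric U \<and>
     (\<exists>f0 f1. slice_components U f f0 f1 \<and>
        (\<forall>z\<in>slice_dom U. f0 z \<in> range cl_real \<and> f1 z \<in> range cl_real))}"


section \<open>Operators\<close>

text \<open>
  An operator with domain in \<open>V\<close> is a partial map.  Then \<open>dom\<close> is its domain, \<open>\<circ>\<^sub>m\<close> the product with
  its natural domain and \<open>\<subseteq>\<^sub>m\<close> the inclusion of operators.
\<close>

definition right_linear :: "(('v::real_normed_vector, 'n::{finite,linorder}) clmodule \<rightharpoonup> ('v, 'n) clmodule) \<Rightarrow> bool" where
  "right_linear T \<longleftrightarrow> T 0 = Some 0 \<and>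
     (\<forall>v w v' w'. T v = Some v' \<longrightarrow> T w = Some w' \<longrightarrow> T (v + w) = Some (v' + w')) \<and>
     (\<forall>v v' a. T v = Some v' \<longrightarrow> T (v \<cdot>\<^sub>r a) = Some (v' \<cdot>\<^sub>r a))"

definition closed_ops :: "(('v::real_normed_vector, 'n::{finite,linorder}) clmodule \<rightharpoonup> ('v, 'n) clmodule) set" where
  "closed_ops = {T. right_linear T \<and> closed {(v, w). T v = Some w}}"

definition bounded_ops :: "(('v::real_normed_vector, 'n::{finite,linorder}) clmodule \<rightharpoonup> ('v, 'n) clmodule) set" where
  "bounded_ops = {T. dom T = UNIV \<and> right_linear T \<and> bounded_linear (\<lambda>v. the (T v))}"

text \<open>Only used for members of \<^const>\<open>bounded_ops\<close>; the norm becomes the operator norm.\<close>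

definition to_blinfun :: "('a::real_normed_vector \<rightharpoonup> 'b::real_normed_vector) \<Rightarrow> 'a \<Rightarrow>\<^sub>L 'b" where
  "to_blinfun T = Blinfun (\<lambda>v. the (T v))"

definition of_blinfun :: "('a::real_normed_vector \<Rightarrow>\<^sub>L 'b::real_normed_vector) \<Rightarrow> ('a \<rightharpoonup> 'b)" where
  "of_blinfun A = (\<lambda>v. Some (blinfun_apply A v))"

text \<open>The operator \<open>v \<mapsto> a v\<close> belonging to a Clifford number \<open>a\<close>.\<close>

definition cl_op :: "'n::{finite,linorder} clifford \<Rightarrow> ('v::real_normed_vector, 'n) clmodule \<Rightarrow>\<^sub>L ('v, 'n) clmodule" where
  "cl_op a = Blinfun (\<lambda>v. a \<cdot> v)"

text \<open>The inverse of an injective operator, with domain the range of the operator.\<close>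

definition op_inv :: "('a \<rightharpoonup> 'b) \<Rightarrow> ('b \<rightharpoonup> 'a)" where
  "op_inv T = (\<lambda>w. if w \<in> ran T then Some (THE v. T v = Some w) else None)"

definition op_diff :: "('a \<rightharpoonup> 'b::minus) \<Rightarrow> ('a \<rightharpoonup> 'b) \<Rightarrow> ('a \<rightharpoonup> 'b)" where
  "op_diff S T = (\<lambda>v. if v \<in> dom S \<inter> dom T then Some (the (S v) - the (T v)) else None)"

primrec op_pow :: "('a \<rightharpoonup> 'a) \<Rightarrow> nat \<Rightarrow> ('a \<rightharpoonup> 'a)" where
  "op_pow T 0 = Some"
| "op_pow T (Suc k) = T \<circ>\<^sub>m op_pow T k"

definition op_poly :: "real poly \<Rightarrow> ('a::real_vector \<rightharpoonup> 'a) \<Rightarrow> ('a \<rightharpoonup> 'a)" where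
  "op_poly p T = (\<lambda>v. if v \<in> dom (op_pow T (degree p))
     then Some (\<Sum>k\<le>degree p. coeff p k *\<^sub>R the (op_pow T k v)) else None)"

definition Q_op :: "'n::{finite,linorder} clifford \<Rightarrow> (('v::real_normed_vector, 'n) clmodule \<rightharpoonup> ('v, 'n) clmodule)
    \<Rightarrow> (('v, 'n) clmodule \<rightharpoonup> ('v, 'n) clmodule)" where
  "Q_op s T = (\<lambda>v. if v \<in> dom (op_pow T 2)
     then Some (the (op_pow T 2 v) - (2 * scal s) *\<^sub>R the (T v) + (norm s)\<^sup>2 *\<^sub>R v) else None)"

definition S_resolvent_set :: "(('v::real_normed_vector, 'n::{finite,linorder}) clmodule \<rightharpoonup> ('v, 'n) clmodule) \<Rightarrow> 'n clifford set" where
  "S_resolvent_set T = {s \<in> paravectors. inj_on (Q_op s T) (dom (Q_op s T)) \<and> op_inv (Q_op s T) \<in> bounded_ops}"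

definition S_spectrum :: "(('v::real_normed_vector, 'n::{finite,linorder}) clmodule \<rightharpoonup> ('v, 'n) clmodule) \<Rightarrow> 'n clifford set" where
  "S_spectrum T = paravectors - S_resolvent_set T"

definition SL_resolvent :: "'n::{finite,linorder} clifford \<Rightarrow> (('v::real_normed_vector, 'n) clmodule \<rightharpoonup> ('v, 'n) clmodule)
    \<Rightarrow> (('v, 'n) clmodule \<Rightarrow>\<^sub>L ('v, 'n) clmodule)" where
  "SL_resolvent s T = to_blinfun
     (op_diff (op_inv (Q_op s T) \<circ>\<^sub>m of_blinfun (cl_op (cl_cnj s))) (T \<circ>\<^sub>m op_inv (Q_op s T)))"


section \<open>Bisectorial operators\<close>

definition I_angles :: "real \<Rightarrow> real set" where
  "I_angles \<omega> = {-\<omega><..<\<omega>} \<union> {pi - \<omega><..<pi + \<omega>}"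

definition D_sector :: "real \<Rightarrow> 'n::{finite,linorder} clifford set" where
  "D_sector \<omega> = {r *\<^sub>R cl_cis J \<phi> |r J \<phi>. r > 0 \<and> J \<in> imag_units \<and> \<phi> \<in> I_angles \<omega>}"

definition bisectorial :: "real \<Rightarrow> (('v::real_normed_vector, 'n::{finite,linorder}) clmodule \<rightharpoonup> ('v, 'n) clmodule) \<Rightarrow> bool" where
  "bisectorial \<omega> T \<longleftrightarrow> T \<in> closed_ops \<and> S_spectrum T \<subseteq> closure (D_sector \<omega>) \<and>
     (\<forall>\<phi>. \<omega> < \<phi> \<and> \<phi> < pi / 2 \<longrightarrow>
        (\<exists>C\<ge>0. \<forall>s \<in> paravectors - (D_sector \<phi> \<union> {0}). norm (SL_resolvent s T) \<le> C / norm s))"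


section \<open>The \<open>\<omega>\<close>-functional calculus\<close>

definition SHL0 :: "real \<Rightarrow> ('n::{finite,linorder} clifford \<Rightarrow> 'n clifford) set" where
  "SHL0 \<theta> = {f \<in> SHL (D_sector \<theta>). bounded (f ` D_sector \<theta>) \<and>
     (\<forall>J\<in>imag_units. \<forall>\<phi>\<in>I_angles \<theta>.
        set_integrable lborel {0<..} (\<lambda>t. norm (f (t *\<^sub>R cl_cis J \<phi>)) / t))}"

definition N0 :: "real \<Rightarrow> ('n::{finite,linorder} clifford \<Rightarrow> 'n clifford) set" where
  "N0 \<theta> = SHL0 \<theta> \<inter> intrinsic (D_sector \<theta>)"

text \<open>The paths \<open>\<gamma>\<^sub>\<plusminus>\<close>, with the sign as the first argument.\<close>

definition sector_path :: "real \<Rightarrow> real \<Rightarrow> 'n::{finite,linorder} clifford \<Rightarrow> real \<Rightarrow> 'n clifford" where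
  "sector_path \<epsilon> \<phi> J t = (\<epsilon> * \<bar>t\<bar>) *\<^sub>R cl_cis J (- sgn t * \<phi>)"

text \<open>
  The integral is taken in the Banach space of bounded operators.  It is the Henstock-Kurzweil integral,
  since the Bochner integral of the library needs a separable codomain.
\<close>

definition omega_integral :: "real \<Rightarrow> 'n::{finite,linorder} clifford
    \<Rightarrow> (('v::banach, 'n) clmodule \<rightharpoonup> ('v, 'n) clmodule) \<Rightarrow> ('n clifford \<Rightarrow> 'n clifford)
    \<Rightarrow> (('v, 'n) clmodule \<Rightarrow>\<^sub>L ('v, 'n) clmodule)" where
  "omega_integral \<phi> J T f = (1 / (2 * pi)) *\<^sub>R (\<Sum>\<epsilon>\<in>{1, -1}.
     integral UNIV (\<lambda>t. SL_resolvent (sector_path \<epsilon> \<phi> J t) T o\<^sub>L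
       cl_op ((vector_derivative (sector_path \<epsilon> \<phi> J) (at t) \<cdot> cl_inv J) \<cdot> f (sector_path \<epsilon> \<phi> J t))))"

text \<open>
  The value does not depend on the angle, on the imaginary unit, or (below) on the representation of \<open>f\<close>
  and on the regularizer; the choice operator only picks admissible ones.
\<close>

definition omega_calc :: "real \<Rightarrow> real \<Rightarrow> (('v::banach, 'n::{finite,linorder}) clmodule \<rightharpoonup> ('v, 'n) clmodule)
    \<Rightarrow> ('n clifford \<Rightarrow> 'n clifford) \<Rightarrow> (('v, 'n) clmodule \<Rightarrow>\<^sub>L ('v, 'n) clmodule)" where
  "omega_calc \<omega> \<theta> T f = omega_integral (SOME \<phi>. \<omega> < \<phi> \<and> \<phi> < \<theta>) (SOME J. J \<in> imag_units) T f"


section \<open>The extended \<open>\<omega>\<close>-functional calculus\<close>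

definition bnd_repr :: "real \<Rightarrow> ('n::{finite,linorder} clifford \<Rightarrow> 'n clifford)
    \<Rightarrow> 'n clifford \<Rightarrow> 'n clifford \<Rightarrow> ('n clifford \<Rightarrow> 'n clifford) \<Rightarrow> bool" where
  "bnd_repr \<theta> f f0 finf ft \<longleftrightarrow> ft \<in> SHL0 \<theta> \<and>
     (\<forall>s\<in>D_sector \<theta>. f s = finf + cl_inv (cl_real 1 + s \<cdot> s) \<cdot> (f0 - finf) + ft s)"

definition SHLbnd :: "real \<Rightarrow> ('n::{finite,linorder} clifford \<Rightarrow> 'n clifford) set" where
  "SHLbnd \<theta> = {f. \<exists>f0 finf ft. bnd_repr \<theta> f f0 finf ft}"

definition Nbnd :: "real \<Rightarrow> ('n::{finite,linorder} clifford \<Rightarrow> 'n clifford) set" where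
  "Nbnd \<theta> = {f. \<exists>f0 finf ft. bnd_repr \<theta> f f0 finf ft \<and>
     f0 \<in> range cl_real \<and> finf \<in> range cl_real \<and> ft \<in> N0 \<theta>}"

definition one_plus_square :: "('a::plus \<rightharpoonup> 'a) \<Rightarrow> ('a \<rightharpoonup> 'a)" where
  "one_plus_square T = (\<lambda>v. map_option (\<lambda>w. v + w) (op_pow T 2 v))"

definition bnd_calc :: "real \<Rightarrow> real \<Rightarrow> (('v::banach, 'n::{finite,linorder}) clmodule \<rightharpoonup> ('v, 'n) clmodule)
    \<Rightarrow> ('n clifford \<Rightarrow> 'n clifford) \<Rightarrow> (('v, 'n) clmodule \<Rightarrow>\<^sub>L ('v, 'n) clmodule)" where
  "bnd_calc \<omega> \<theta> T f =
     (let (f0, finf, ft) = (SOME (f0, finf, ft). bnd_repr \<theta> f f0 finf ft)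
      in cl_op finf + (to_blinfun (op_inv (one_plus_square T)) o\<^sub>L cl_op (f0 - finf)) + omega_calc \<omega> \<theta> T ft)"


section \<open>The \<open>H\<^sup>\<infinity>\<close>-functional calculus\<close>

definition regularizer :: "real \<Rightarrow> real \<Rightarrow> (('v::banach, 'n::{finite,linorder}) clmodule \<rightharpoonup> ('v, 'n) clmodule)
    \<Rightarrow> ('n clifford \<Rightarrow> 'n clifford) \<Rightarrow> ('n clifford \<Rightarrow> 'n clifford) \<Rightarrow> bool" where
  "regularizer \<omega> \<theta> T f e \<longleftrightarrow>
     e \<in> Nbnd \<theta> \<and> (\<lambda>s. e s \<cdot> f s) \<in> SHLbnd \<theta> \<and> inj (blinfun_apply (bnd_calc \<omega> \<theta> T e))"

definition SHLreg :: "real \<Rightarrow> real \<Rightarrow> (('v::banach, 'n::{finite,linorder}) clmodule \<rightharpoonup> ('v, 'n) clmodule)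
    \<Rightarrow> ('n clifford \<Rightarrow> 'n clifford) set" where
  "SHLreg \<omega> \<theta> T = {f \<in> SHL (D_sector \<theta>). \<exists>e. regularizer \<omega> \<theta> T f e}"

definition Hinf_calc :: "real \<Rightarrow> real \<Rightarrow> (('v::banach, 'n::{finite,linorder}) clmodule \<rightharpoonup> ('v, 'n) clmodule)
    \<Rightarrow> ('n clifford \<Rightarrow> 'n clifford) \<Rightarrow> (('v, 'n) clmodule \<rightharpoonup> ('v, 'n) clmodule)" where
  "Hinf_calc \<omega> \<theta> T f =
     (let e = (SOME e. regularizer \<omega> \<theta> T f e)
      in op_inv (of_blinfun (bnd_calc \<omega> \<theta> T e)) \<circ>\<^sub>m of_blinfun (bnd_calc \<omega> \<theta> T (\<lambda>s. e s \<cdot> f s)))"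

definition cl_poly :: "real poly \<Rightarrow> 'n::{finite,linorder} clifford \<Rightarrow> 'n clifford" where
  "cl_poly p s = (\<Sum>k\<le>degree p. coeff p k *\<^sub>R cl_pow s k)"

end

theory Submission
  imports Defs "HOL-Complex_Analysis.Complex_Analysis" "HOL-Real_Asymp.Real_Asymp"
begin

text \<open>
  Right multiplication by an imaginary unit \<open>J\<close> turns \<open>V\<close> into a complex Banach space on which \<open>T\<close> is
  complex linear with an ordinary resolvent \<open>R w = (w - T)\<^sup>-\<^sup>1\<close> off the closed double sector.  A slice
  hyperholomorphic \<open>f\<close> is \<open>\<Sum>\<^sub>A f\<^sub>A e\<^sub>A\<close> with holomorphic \<open>f\<^sub>A\<close> that are symmetric under conjugation, and adding the
  integrand at conjugate points turns the slice Cauchy integral into \<open>f(T) = \<Sum>\<^sub>A f\<^sub>A(T) e\<^sub>A\<close>, where \<open>f\<^sub>A(T)\<close>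
  is the Riesz-Dunford integral against \<open>R\<close>.  The latter is multiplicative, also after \<open>1\<close> and
  \<open>(1 + z\<^sup>2)\<^sup>-\<^sup>1\<close> are adjoined, because \<open>z (1 + z\<^sup>2)\<^sup>-\<^sup>1\<close> is sent to \<open>T (1 + T\<^sup>2)\<^sup>-\<^sup>1\<close>.

  If \<open>e\<close> regularizes \<open>f\<close> and \<open>m\<close> is the degree of \<open>p\<close>, then \<open>(1 + z\<^sup>2)\<^sup>-\<^sup>m e\<close> regularizes \<open>p f\<close>.  With
  \<open>B = (1 + T\<^sup>2)\<^sup>-\<^sup>1\<close> and \<open>A = T B\<close> one has \<open>B\<^sup>m p[T] w = \<Sum>\<^sub>k p\<^sub>k B\<^sup>m\<^sup>-\<^sup>k A\<^sup>k w\<close> on the domain of \<open>T\<^sup>m\<close>, so multiplying the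
  claim by the injective operator \<open>B\<^sup>m e(T)\<close> leaves an identity between values of the calculus at the
  same functions.
\<close>

section \<open>Integrals over a half-line with values in a Banach space\<close>

text \<open>Left multiplication by an imaginary unit does not commute with \<open>T\<close>, so the
  left S-resolvent cannot be treated as an ordinary resolvent. The unit can be moved to the right
  only once the sum over conjugate points has made the coefficients real, which is why symmetric
  functions with real constants run through everything.

  Two more obstacles shape the proof. The bounded operators need not form a separable space, so
  dominated convergence and Fubini are derived for gauge integrals from real majorants. And
  functions in \<open>SHL0\<close> are only integrable against dt/t on each ray, with no bound
  uniform in the angle, so neither rotation of contours nor Cauchy's formula applies to them
  directly: products are computed for functions bounded by |z| / (1 + |z|^2), up to a factor, and
  extended along the multipliers \<open>reg n\<close>.

  Finally, values of the calculus are fixed by choice operators. This is harmless because the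
  splitting into a constant, a multiple of \<open>fB\<close> and a null function is unique, 1/t
  being integrable at neither end of the half-line.\<close>

lemma tagged_sum_close:
  fixes g :: "'a::euclidean_space \<Rightarrow> real" and f f' :: "'a \<Rightarrow> 'b::banach"
  assumes "\<D> tagged_division_of cbox a b" and "\<And>x. x \<in> cbox a b \<Longrightarrow> norm (f x - f' x) \<le> g x"
  shows "norm ((\<Sum>(x,K)\<in>\<D>. measure lborel K *\<^sub>R f x) - (\<Sum>(x,K)\<in>\<D>. measure lborel K *\<^sub>R f' x))
    \<le> (\<Sum>(x,K)\<in>\<D>. measure lborel K *\<^sub>R g x)"
proof -
  have "(\<Sum>(x,K)\<in>\<D>. measure lborel K *\<^sub>R f x) - (\<Sum>(x,K)\<in>\<D>. measure lborel K *\<^sub>R f' x) =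
      (\<Sum>(x,K)\<in>\<D>. measure lborel K *\<^sub>R (f x - f' x))"
    by (simp add: sum_subtractf[symmetric] case_prod_beta scaleR_diff_right)
  also have "norm \<dots> \<le> (\<Sum>(x,K)\<in>\<D>. measure lborel K *\<^sub>R g x)"
  proof (rule sum_norm_le, clarify)
    fix x K assume "(x, K) \<in> \<D>"
    then have "x \<in> cbox a b" using assms(1) by (meson subsetD tagged_division_ofD(2,3))
    then show "norm (measure lborel K *\<^sub>R (f x - f' x)) \<le> measure lborel K *\<^sub>R g x"
      using assms(2) by (simp add: mult_left_mono)
  qed
  finally show ?thesis .
qed

text \<open>Over a fine division the Riemann sum of \<open>f\<close> differs from that of
  \<open>f'\<close> by at most the Riemann sum of \<open>g\<close>, which is below e/6 + e/6. The
  Cauchy criterion for \<open>f'\<close> therefore passes to \<open>f\<close> with total error e/3 +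
  e/6 + e/3. Only Riemann sums occur, so the values may lie in a nonseparable space.\<close>

lemma integrable_L1_limit_cbox:
  fixes f :: "'a::euclidean_space \<Rightarrow> 'b::banach"
  assumes "\<And>e. e > 0 \<Longrightarrow> \<exists>f' g. f' integrable_on cbox a b \<and> g integrable_on cbox a b \<and>
      (\<forall>x\<in>cbox a b. norm (f x - f' x) \<le> g x) \<and> integral (cbox a b) g < e"
  shows "f integrable_on cbox a b"
  unfolding integrable_Cauchy
proof (intro allI impI)
  fix e :: real assume "e > 0"
  then obtain f' g where f': "f' integrable_on cbox a b" and g: "g integrable_on cbox a b"
    and le: "\<And>x. x \<in> cbox a b \<Longrightarrow> norm (f x - f' x) \<le> g x" and small: "integral (cbox a b) g < e/6"
    using assms[of "e/6"] by auto
  obtain \<gamma>1 where \<gamma>1: "gauge \<gamma>1" "\<And>\<D>1 \<D>2. \<D>1 tagged_division_of (cbox a b) \<and> \<gamma>1 fine \<D>1 \<and>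
            \<D>2 tagged_division_of (cbox a b) \<and> \<gamma>1 fine \<D>2 \<Longrightarrow>
            norm ((\<Sum>(x,K)\<in>\<D>1. measure lborel K *\<^sub>R f' x) - (\<Sum>(x,K)\<in>\<D>2. measure lborel K *\<^sub>R f' x)) < e/6"
    using f' \<open>e > 0\<close> unfolding integrable_Cauchy by (metis zero_less_divide_iff zero_less_numeral)
  obtain \<gamma>2 where \<gamma>2: "gauge \<gamma>2" "\<And>\<D>. \<D> tagged_division_of (cbox a b) \<Longrightarrow> \<gamma>2 fine \<D> \<Longrightarrow>
            norm ((\<Sum>(x,K)\<in>\<D>. measure lborel K *\<^sub>R g x) - integral (cbox a b) g) < e/6"
    using integrable_integral[OF g] \<open>e > 0\<close> unfolding has_integral
    by (metis zero_less_divide_iff zero_less_numeral)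
  have g12: "gauge (\<lambda>x. \<gamma>1 x \<inter> \<gamma>2 x)" using \<gamma>1(1) \<gamma>2(1) by (rule gauge_Int)
  have close: "norm ((\<Sum>(x,K)\<in>\<D>1. measure lborel K *\<^sub>R f x) - (\<Sum>(x,K)\<in>\<D>2. measure lborel K *\<^sub>R f x)) < e"
    if 1: "\<D>1 tagged_division_of cbox a b" "(\<lambda>x. \<gamma>1 x \<inter> \<gamma>2 x) fine \<D>1"
      and 2: "\<D>2 tagged_division_of cbox a b" "(\<lambda>x. \<gamma>1 x \<inter> \<gamma>2 x) fine \<D>2" for \<D>1 \<D>2
  proof -
    note fine = 1(2)[unfolded fine_Int] 2(2)[unfolded fine_Int]
    define s where "s f \<D> = (\<Sum>(x,K)\<in>\<D>. measure lborel K *\<^sub>R f x)" for f :: "'a \<Rightarrow> 'b" and \<D> :: "('a \<times> 'a set) set"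
    have a: "norm (s f \<D> - s f' \<D>) < e/3" if "\<D> tagged_division_of cbox a b" "\<gamma>2 fine \<D>" for \<D>
    proof -
      have aux: "x < e/3" if "norm (x - i) < e/6" "i < e/6" for x i :: real
        using that unfolding real_norm_def by linarith
      have "norm (s f \<D> - s f' \<D>) \<le> (\<Sum>(x,K)\<in>\<D>. measure lborel K *\<^sub>R g x)"
        unfolding s_def by (rule tagged_sum_close[OF that(1) le])
      also have "\<dots> < e/3" by (rule aux[OF \<gamma>2(2)[OF that] small])
      finally show ?thesis .
    qed
    have b: "norm (s f' \<D>1 - s f' \<D>2) < e/6"
      unfolding s_def by (rule \<gamma>1(2)) (use 1(1) 2(1) fine in auto)
    have "norm (s f \<D>1 - s f \<D>2) < e"
      using norm_triangle_ineq4[of "(s f \<D>1 - s f' \<D>1) + (s f' \<D>1 - s f' \<D>2)" "s f \<D>2 - s f' \<D>2"]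
        norm_triangle_ineq[of "s f \<D>1 - s f' \<D>1" "s f' \<D>1 - s f' \<D>2"]
        a[OF 1(1) fine(1)[THEN conjunct2]] a[OF 2(1) fine(2)[THEN conjunct2]] b \<open>e > 0\<close> by simp
    then show ?thesis unfolding s_def .
  qed
  show "\<exists>\<gamma>. gauge \<gamma> \<and>
          (\<forall>\<D>1 \<D>2. \<D>1 tagged_division_of (cbox a b) \<and> \<gamma> fine \<D>1 \<and>
            \<D>2 tagged_division_of (cbox a b) \<and> \<gamma> fine \<D>2 \<longrightarrow>
            norm ((\<Sum>(x,K)\<in>\<D>1. measure lborel K *\<^sub>R f x) - (\<Sum>(x,K)\<in>\<D>2. measure lborel K *\<^sub>R f x)) < e)"
    by (intro exI[of _ "\<lambda>x. \<gamma>1 x \<inter> \<gamma>2 x"] conjI g12 allI impI) (elim conjE, rule close)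
qed

lemma integral_L1_dist:
  fixes f f' :: "'a::euclidean_space \<Rightarrow> 'b::banach"
  assumes "f integrable_on S" "f' integrable_on S" "g integrable_on S"
    and "\<And>x. x \<in> S \<Longrightarrow> norm (f x - f' x) \<le> g x"
  shows "norm (integral S f - integral S f') \<le> integral S g"
  using integral_norm_bound_integral[OF integrable_diff[OF assms(1,2)] assms(3,4)]
  by (simp add: integral_diff[OF assms(1,2)])

text \<open>The box version applied to the extension by zero. The majorants are nonnegative, so
  their integrals over any box stay below the integral over \<open>S\<close>.\<close>

lemma integrable_L1_limit:
  fixes f :: "'a::euclidean_space \<Rightarrow> 'b::banach"
  assumes ex: "\<And>e. e > 0 \<Longrightarrow> \<exists>f' g. f' integrable_on S \<and> g integrable_on S \<and>
      (\<forall>x\<in>S. norm (f x - f' x) \<le> g x) \<and> integral S g < e"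
  shows "f integrable_on S"
proof -
  let ?r = "\<lambda>f x. if x \<in> S then f x else 0"
  have sub: "integral (cbox a b) (?r g) \<le> integral S g"
    if g: "g integrable_on S" and pos: "\<And>x. x \<in> S \<Longrightarrow> 0 \<le> g x" for g :: "'a \<Rightarrow> real" and a b
  proof -
    have "integral (cbox a b) (?r g) \<le> integral UNIV (?r g)"
      by (intro integral_subset_le) (use g pos in \<open>auto simp: integrable_restrict_UNIV integrable_altD(1)\<close>)
    then show ?thesis by (simp add: integral_restrict_UNIV)
  qed
  have int: "?r f integrable_on cbox a b" for a b
  proof (rule integrable_L1_limit_cbox)
    fix e :: real assume "e > 0"
    from ex[OF this] obtain f' g where *: "f' integrable_on S" "g integrable_on S"
      "\<forall>x\<in>S. norm (f x - f' x) \<le> g x" "integral S g < e" by blast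
    have "integral (cbox a b) (?r g) \<le> integral S g"
      using *(2) order_trans[OF norm_ge_zero *(3)[rule_format]] by (rule sub)
    with * show "\<exists>f' g. f' integrable_on cbox a b \<and> g integrable_on cbox a b \<and>
      (\<forall>x\<in>cbox a b. norm (?r f x - f' x) \<le> g x) \<and> integral (cbox a b) g < e"
      by (intro exI[of _ "?r f'"] exI[of _ "?r g"]) (auto simp: integrable_altD(1))
  qed
  show ?thesis
    unfolding integrable_alt[of f]
  proof (intro conjI allI impI)
    fix a b show "?r f integrable_on cbox a b" by (rule int)
  next
    fix e :: real assume "e > 0"
    then have "e/3 > 0" by simp
    from ex[OF this] obtain f' g where *: "f' integrable_on S" "g integrable_on S"
      "\<forall>x\<in>S. norm (f x - f' x) \<le> g x" "integral S g < e/3" by blast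
    have close: "norm (integral (cbox a b) (?r f) - integral (cbox a b) (?r f')) < e/3" for a b
    proof -
      have "norm (integral (cbox a b) (?r f) - integral (cbox a b) (?r f')) \<le> integral (cbox a b) (?r g)"
        by (rule integral_L1_dist) (use * in \<open>auto simp: integrable_altD(1) int\<close>)
      also have "\<dots> \<le> integral S g"
        using *(2) order_trans[OF norm_ge_zero *(3)[rule_format]] by (rule sub)
      finally show ?thesis using *(4) by simp
    qed
    from integrable_altD(2)[OF *(1) \<open>e/3 > 0\<close>] obtain B where "B > 0" and
      B: "\<And>a b c d. ball 0 B \<subseteq> cbox a b \<and> ball 0 B \<subseteq> cbox c d \<Longrightarrow>
        norm (integral (cbox a b) (?r f') - integral (cbox c d) (?r f')) < e/3" by blast
    \<comment> \<open>The radius that is good for \<open>f'\<close> with e/3 is good for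
      \<open>f\<close> with e: by \<open>close\<close> the two integrals over any box differ by less
      than e/3.\<close>
    show "\<exists>B>0. \<forall>a b c d. ball 0 B \<subseteq> cbox a b \<and> ball 0 B \<subseteq> cbox c d \<longrightarrow>
        norm (integral (cbox a b) (?r f) - integral (cbox c d) (?r f)) < e"
    proof (intro exI[of _ B] conjI allI impI \<open>B > 0\<close>)
      fix a b c d :: 'a assume "ball 0 B \<subseteq> cbox a b \<and> ball 0 B \<subseteq> cbox c d"
      from B[OF this] have B': "norm (integral (cbox a b) (?r f') - integral (cbox c d) (?r f')) < e/3" .
      have tri: "norm (x - y) \<le> norm (x - x') + norm (x' - y') + norm (y - y')" for x y x' y' :: 'b
        using norm_triangle_ineq4[of "(x - x') + (x' - y')" "y - y'"] norm_triangle_ineq[of "x - x'" "x' - y'"]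
        by simp
      show "norm (integral (cbox a b) (?r f) - integral (cbox c d) (?r f)) < e"
        using B' close[of a b] close[of c d] tri[of "integral (cbox a b) (?r f)" "integral (cbox c d) (?r f)"
            "integral (cbox a b) (?r f')" "integral (cbox c d) (?r f')"] by linarith
    qed
  qed
qed

text \<open>The replacement for dominated convergence: the errors are controlled by real functions
  \<open>gn\<close>, and to these the real convergence theorems apply.\<close>

lemma L1_limit_seq:
  fixes f :: "'a::euclidean_space \<Rightarrow> 'b::banach" and fn :: "nat \<Rightarrow> 'a \<Rightarrow> 'b" and gn :: "nat \<Rightarrow> 'a \<Rightarrow> real"
  assumes fn: "\<And>n. fn n integrable_on S" and gn: "\<And>n. gn n integrable_on S"
    and le: "\<And>n x. x \<in> S \<Longrightarrow> norm (f x - fn n x) \<le> gn n x"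
    and lim: "(\<lambda>n. integral S (gn n)) \<longlonglongrightarrow> 0"
  shows "f integrable_on S" and "(\<lambda>n. integral S (fn n)) \<longlonglongrightarrow> integral S f"
proof -
  show int: "f integrable_on S"
  proof (rule integrable_L1_limit)
    fix e :: real assume "e > 0"
    from order_tendstoD(2)[OF lim this] obtain n where "integral S (gn n) < e"
      unfolding eventually_sequentially by blast
    then show "\<exists>f' g. f' integrable_on S \<and> g integrable_on S \<and>
      (\<forall>x\<in>S. norm (f x - f' x) \<le> g x) \<and> integral S g < e"
      using fn gn le by blast
  qed
  have "norm (integral S f - integral S (fn n)) \<le> integral S (gn n)" for n
    by (rule integral_L1_dist[OF int fn gn le])
  then have "(\<lambda>n. integral S (fn n) - integral S f) \<longlonglongrightarrow> 0"
    by (intro Lim_null_comparison[OF _ lim]) (simp add: norm_minus_commute)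
  then show "(\<lambda>n. integral S (fn n)) \<longlonglongrightarrow> integral S f"
    by (rule LIM_zero_cancel)
qed

text \<open>A compact exhaustion of the open half-line that avoids both ends, since the integrands
  may be singular at \<open>0\<close>. The end points are reciprocal to each other;
  \<open>sector_rotate\<close> uses this to estimate both boundary terms by the same
  quantity.\<close>

definition expanding :: "nat \<Rightarrow> real set" where
  "expanding n = {inverse (real (Suc n)) .. real (Suc n)}"

lemma expanding_eventually:
  assumes "t > 0" shows "eventually (\<lambda>n. t \<in> expanding n) sequentially"
proof -
  obtain n1 where n1: "inverse (real (Suc n1)) < t" using reals_Archimedean[OF assms] by blast
  obtain n2 where n2: "t < real n2" using reals_Archimedean2 by blast
  have "t \<in> expanding n" if "n \<ge> max n1 n2" for n
  proof -
    have "inverse (real (Suc n)) \<le> inverse (real (Suc n1))" using that by (intro le_imp_inverse_le) auto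
    moreover have "real n2 \<le> real (Suc n)" using that by simp
    ultimately show ?thesis using n1 n2 unfolding expanding_def atLeastAtMost_iff by linarith
  qed
  then show ?thesis unfolding eventually_sequentially by blast
qed

lemma expanding_pos: "t \<in> expanding n \<Longrightarrow> t > 0"
  unfolding expanding_def by (smt (verit) atLeastAtMost_iff inverse_positive_iff_positive of_nat_0_less_iff zero_less_Suc)

lemma expanding_subset: "expanding n \<subseteq> {0<..}"
  using expanding_pos by auto

lemma integrable_on_expanding:
  "f integrable_on {0<..} \<Longrightarrow> f integrable_on expanding n" for f :: "real \<Rightarrow> 'b::banach"
  using integrable_on_subcbox[of f "{0<..}"] expanding_subset[of n] unfolding expanding_def by simp

lemma integrable_expanding_restrict:
  "f integrable_on expanding n \<Longrightarrow> (\<lambda>t. if t \<in> expanding n then f t else 0) integrable_on {0<..}"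
  for f :: "real \<Rightarrow> 'b::banach"
  unfolding integrable_restrict_Int using expanding_subset[of n] by (simp add: inf.absorb1)

lemma integral_expanding_restrict:
  "integral {0<..} (\<lambda>t. if t \<in> expanding n then f t else 0) = integral (expanding n) f"
  for f :: "real \<Rightarrow> 'b::banach"
  unfolding integral_restrict_Int using expanding_subset[of n] by (simp add: inf.absorb1)

lemma integral_tail_tendsto_0:
  fixes g :: "real \<Rightarrow> real"
  assumes g: "g integrable_on {0<..}" and pos: "\<And>t. t > 0 \<Longrightarrow> 0 \<le> g t"
  shows "(\<lambda>t. if t \<in> expanding n then 0 else g t) integrable_on {0<..}"
    and "(\<lambda>n. integral {0<..} (\<lambda>t. if t \<in> expanding n then 0 else g t)) \<longlonglongrightarrow> 0"
proof -
  show int: "(\<lambda>t. if t \<in> expanding n then 0 else g t) integrable_on {0<..}" for n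
  proof -
    have "(\<lambda>t. g t - (if t \<in> expanding n then g t else 0)) integrable_on {0<..}"
      by (rule integrable_diff[OF g integrable_expanding_restrict[OF integrable_on_expanding[OF g]]])
    then show ?thesis by (rule integrable_eq) auto
  qed
  have "(\<lambda>n. integral {0<..} (\<lambda>t. if t \<in> expanding n then 0 else g t)) \<longlonglongrightarrow> integral {0<..} (\<lambda>t::real. 0::real)"
  proof (rule dominated_convergence(2)[of "\<lambda>n t. if t \<in> expanding n then 0 else g t" _ g "\<lambda>t. 0"])
    show "(\<lambda>t. if t \<in> expanding n then 0 else g t) integrable_on {0<..}" for n by (rule int)
    show "g integrable_on {0<..}" by (rule g)
  next
    fix t :: real assume t: "t \<in> {0<..}"
    show "norm (if t \<in> expanding n then 0 else g t) \<le> g t" for n using pos t by auto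
    show "(\<lambda>n. if t \<in> expanding n then 0 else g t) \<longlonglongrightarrow> 0"
      by (rule tendsto_eventually, rule eventually_mono[OF expanding_eventually[of t]]) (use t in auto)
  qed
  then show "(\<lambda>n. integral {0<..} (\<lambda>t. if t \<in> expanding n then 0 else g t)) \<longlonglongrightarrow> 0" by simp
qed

text \<open>Cutting \<open>f\<close> off outside \<open>expanding n\<close> costs at most the tail
  of \<open>g\<close>, whose integral tends to 0.\<close>

lemma dominated_on_ray:
  fixes f :: "real \<Rightarrow> 'b::banach"
  assumes f: "\<And>n. f integrable_on expanding n" and g: "g integrable_on {0<..}"
    and le: "\<And>t. t > 0 \<Longrightarrow> norm (f t) \<le> g t"
  shows "f integrable_on {0<..}" and "(\<lambda>n. integral (expanding n) f) \<longlonglongrightarrow> integral {0<..} f"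
proof -
  have pos: "\<And>t. t > 0 \<Longrightarrow> 0 \<le> g t" using le by (metis norm_ge_zero order_trans)
  have 1: "(\<lambda>t. if t \<in> expanding n then f t else 0) integrable_on {0<..}" for n
    by (rule integrable_expanding_restrict[OF f])
  have 2: "norm (f t - (if t \<in> expanding n then f t else 0)) \<le> (if t \<in> expanding n then 0 else g t)"
    if "t \<in> {0<..}" for t n using that le by auto
  note lim = L1_limit_seq[OF 1 integral_tail_tendsto_0(1)[OF g pos] 2 integral_tail_tendsto_0(2)[OF g pos]]
  show "f integrable_on {0<..}" by (rule lim(1))
  show "(\<lambda>n. integral (expanding n) f) \<longlonglongrightarrow> integral {0<..} f"
    using lim(2) by (simp add: integral_expanding_restrict)
qed

lemma continuous_dominated_on_ray:
  fixes f :: "real \<Rightarrow> 'b::banach"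
  assumes "continuous_on {0<..} f" "g integrable_on {0<..}" "\<And>t. t > 0 \<Longrightarrow> norm (f t) \<le> g t"
  shows "f integrable_on {0<..}"
proof (rule dominated_on_ray(1)[OF _ assms(2,3)])
  show "f integrable_on expanding n" for n
    unfolding expanding_def
    by (rule integrable_continuous_interval)
       (use continuous_on_subset[OF assms(1)] expanding_subset[of n] in \<open>auto simp: expanding_def\<close>)
qed

section \<open>Fubini's theorem on a quadrant\<close>

lemma fubini_rays_limit:
  fixes K :: "real \<Rightarrow> real \<Rightarrow> 'b::banach"
  assumes K: "continuous_on ({0<..} \<times> {0<..}) (\<lambda>(t, u). K t u)"
    and G: "G integrable_on {0<..}" "\<And>t. t > 0 \<Longrightarrow> 0 \<le> G t" and E: "E integrable_on {0<..}" "\<And>u. u > 0 \<Longrightarrow> 0 \<le> E u"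
    and le: "\<And>t u. t > 0 \<Longrightarrow> u > 0 \<Longrightarrow> norm (K t u) \<le> G t * E u"
  shows "(\<lambda>t. integral {0<..} (K t)) integrable_on {0<..}"
    and "(\<lambda>n. integral (expanding n) (\<lambda>t. integral (expanding n) (K t))) \<longlonglongrightarrow> integral {0<..} (\<lambda>t. integral {0<..} (K t))"
proof -
  define tail where "tail n = integral {0<..} (\<lambda>u. if u \<in> expanding n then 0 else E u)" for n
  have tail0: "tail n \<ge> 0" for n
    unfolding tail_def using E by (intro integral_nonneg integral_tail_tendsto_0) auto
  have taillim: "tail \<longlonglongrightarrow> 0" unfolding tail_def[abs_def] by (rule integral_tail_tendsto_0(2)[OF E])
  have cK: "continuous_on {0<..} (K t)" if "t > 0" for t
    by (rule continuous_on_compose2[OF K, where f="\<lambda>u. (t, u)", simplified])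
       (use that in \<open>auto intro!: continuous_intros\<close>)
  have GE: "(\<lambda>u. G t * E u) integrable_on {0<..}" for t
    using E(1) by (rule integrable_on_mult_right)
  have iK: "K t integrable_on {0<..}" if "t > 0" for t
    by (rule continuous_dominated_on_ray[OF cK[OF that] GE[of t]]) (use le that in auto)
  have close: "norm (integral {0<..} (K t) - integral (expanding n) (K t)) \<le> G t * tail n" if t: "t > 0" for t n
  proof -
    have "norm (integral {0<..} (K t) - integral {0<..} (\<lambda>u. if u \<in> expanding n then K t u else 0))
      \<le> integral {0<..} (\<lambda>u. G t * (if u \<in> expanding n then 0 else E u))"
    proof (rule integral_L1_dist)
      show "K t integrable_on {0<..}" by (rule iK[OF t])
      then show "(\<lambda>u. if u \<in> expanding n then K t u else 0) integrable_on {0<..}"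
        by (rule integrable_expanding_restrict[OF integrable_on_expanding])
      show "(\<lambda>u. G t * (if u \<in> expanding n then 0 else E u)) integrable_on {0<..}"
        using E by (intro integrable_on_mult_right integral_tail_tendsto_0(1)) auto
    qed (use le t in auto)
    then show ?thesis by (simp add: integral_expanding_restrict tail_def)
  qed
  have bnd: "norm (integral {0<..} (K t)) \<le> G t * integral {0<..} E" if t: "t > 0" for t
    using integral_norm_bound_integral[OF iK[OF t] GE[of t]] le t by (simp add: integral_mult_right)
  define fn where "fn n t = (if t \<in> expanding n then integral (expanding n) (K t) else 0)" for n t
  \<comment> \<open>The first summand pays for truncating the inner integral in \<open>u\<close>,
    the second for truncating the outer one in \<open>t\<close>.\<close>
  define gn where "gn n t = G t * tail n + (if t \<in> expanding n then 0 else G t) * integral {0<..} E" for n t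
  have 1: "fn n integrable_on {0<..}" for n
  proof -
    have "continuous_on (expanding n) (\<lambda>t. integral (cbox (inverse (real (Suc n))) (real (Suc n))) (K t))"
      by (rule integral_continuous_on_param)
         (rule continuous_on_subset[OF K], use expanding_subset[of n] in \<open>auto simp: expanding_def\<close>)
    then have "(\<lambda>t. integral (expanding n) (K t)) integrable_on expanding n"
      by (simp add: expanding_def integrable_continuous_interval)
    then show ?thesis unfolding fn_def[abs_def] by (rule integrable_expanding_restrict)
  qed
  have 2: "gn n integrable_on {0<..}" for n
    unfolding gn_def[abs_def] using G by (intro integrable_add integrable_on_mult_left integral_tail_tendsto_0(1)) auto
  have 3: "norm (integral {0<..} (K t) - fn n t) \<le> gn n t" if "t \<in> {0<..}" for n t
    using close[of t n] bnd[of t] tail0[of n] G(2)[of t] that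
    by (auto simp: fn_def gn_def intro: add_increasing)
  have 4: "(\<lambda>n. integral {0<..} (gn n)) \<longlonglongrightarrow> 0"
  proof -
    have "integral {0<..} (gn n) = integral {0<..} G * tail n
        + integral {0<..} (\<lambda>t. if t \<in> expanding n then 0 else G t) * integral {0<..} E" for n
      unfolding gn_def[abs_def]
      by (subst integral_add) (use G in \<open>auto intro!: integrable_on_mult_left integral_tail_tendsto_0(1)\<close>)
    moreover have "(\<lambda>n. integral {0<..} G * tail n
        + integral {0<..} (\<lambda>t. if t \<in> expanding n then 0 else G t) * integral {0<..} E)
        \<longlonglongrightarrow> integral {0<..} G * 0 + 0 * integral {0<..} E"
      by (intro tendsto_intros taillim integral_tail_tendsto_0(2) G)
    ultimately show ?thesis by simp
  qed
  note lim = L1_limit_seq[OF 1 2 3 4]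
  show "(\<lambda>t. integral {0<..} (K t)) integrable_on {0<..}" by (rule lim(1))
  show "(\<lambda>n. integral (expanding n) (\<lambda>t. integral (expanding n) (K t))) \<longlonglongrightarrow> integral {0<..} (\<lambda>t. integral {0<..} (K t))"
    using lim(2) unfolding fn_def[abs_def] by (simp add: integral_expanding_restrict)
qed

text \<open>On compact squares the order may be exchanged by continuity, and both iterated integrals
  are limits of the integrals over the squares \<open>expanding n\<close> x
  \<open>expanding n\<close>.\<close>

lemma fubini_rays:
  fixes K :: "real \<Rightarrow> real \<Rightarrow> 'b::banach"
  assumes K: "continuous_on ({0<..} \<times> {0<..}) (\<lambda>(t, u). K t u)"
    and G: "G integrable_on {0<..}" "\<And>t. t > 0 \<Longrightarrow> 0 \<le> G t" and E: "E integrable_on {0<..}" "\<And>u. u > 0 \<Longrightarrow> 0 \<le> E u"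
    and le: "\<And>t u. t > 0 \<Longrightarrow> u > 0 \<Longrightarrow> norm (K t u) \<le> G t * E u"
  shows "integral {0<..} (\<lambda>t. integral {0<..} (K t)) = integral {0<..} (\<lambda>u. integral {0<..} (\<lambda>t. K t u))"
proof -
  have K': "continuous_on ({0<..} \<times> {0<..}) (\<lambda>(u, t). K t u)"
    using continuous_on_compose2[OF K continuous_on_swap, of "{0<..} \<times> {0<..}"]
    by (force simp: case_prod_beta)
  have le': "norm (K t u) \<le> E u * G t" if "u > 0" "t > 0" for u t using le that by (simp add: mult.commute)
  have "integral (expanding n) (\<lambda>t. integral (expanding n) (K t)) =
      integral (expanding n) (\<lambda>u. integral (expanding n) (\<lambda>t. K t u))" for n
    unfolding expanding_def box_real(2)[symmetric]
    by (rule integral_swap_continuous, rule continuous_on_subset[OF K])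
       (use expanding_subset[of n] in \<open>auto simp: expanding_def cbox_Pair_eq\<close>)
  then show ?thesis
    using LIMSEQ_unique[OF fubini_rays_limit(2)[OF K G E le]] fubini_rays_limit(2)[OF K' E G le'] by simp
qed

text \<open>The origin of the pi in Cauchy's formula, through \<open>rotated_kernel\<close>. With
  \<open>a = 1\<close> it supplies the majorant used for nearly all contour integrals.\<close>

lemma has_integral_arctan_ray:
  assumes "a > 0"
  shows "((\<lambda>t. 1 / (a\<^sup>2 + t\<^sup>2)) has_integral pi / (2 * a)) {0<..}"
proof -
  have d: "((\<lambda>t. 1 / (a\<^sup>2 + t\<^sup>2)) has_integral (arctan (y / a) / a - arctan (0 / a) / a)) {0..y}" if "y \<ge> 0" for y
  proof (rule fundamental_theorem_of_calculus[OF that])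
    fix x assume "x \<in> {0..y}"
    have "((\<lambda>t. arctan (t / a) / a) has_real_derivative 1 / (a\<^sup>2 + x\<^sup>2)) (at x within {0..y})"
    proof -
      have "((\<lambda>t. t / a) has_real_derivative 1 / a) (at x within {0..y})"
        by (intro DERIV_cdivide DERIV_ident)
      from DERIV_cdivide[OF DERIV_chain2[OF DERIV_arctan this], of a]
      have "((\<lambda>t. arctan (t / a) / a) has_real_derivative inverse (1 + (x / a)\<^sup>2) * (1 / a) / a) (at x within {0..y})" .
      also have "inverse (1 + (x / a)\<^sup>2) * (1 / a) / a = 1 / (a * (a * (1 + (x / a)\<^sup>2)))"
        by (simp add: divide_inverse mult_ac)
      also have "a * (a * (1 + (x / a)\<^sup>2)) = a\<^sup>2 + x\<^sup>2"
        using assms by (simp add: field_simps power2_eq_square)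
      finally show ?thesis .
    qed
    then show "((\<lambda>t. arctan (t / a) / a) has_vector_derivative 1 / (a\<^sup>2 + x\<^sup>2)) (at x within {0..y})"
      by (simp add: has_real_derivative_iff_has_vector_derivative)
  qed
  have "((\<lambda>t. 1 / (a\<^sup>2 + t\<^sup>2)) has_integral pi / (2 * a)) {0..}"
  proof (rule has_integral_to_inf)
    have nz: "a\<^sup>2 + x\<^sup>2 \<noteq> 0" for x
      using assms by (simp add: sum_power2_eq_zero_iff)
    show "(\<lambda>t. 1 / (a\<^sup>2 + t\<^sup>2)) integrable_on {0..y}" for y
      by (intro integrable_continuous_interval continuous_intros ballI nz)
    have "filterlim (\<lambda>y. y / a) at_top at_top"
      using assms by real_asymp
    then have "((\<lambda>y. arctan (y / a) / a) \<longlongrightarrow> (pi / 2) / a) at_top"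
      by (intro tendsto_divide tendsto_const filterlim_compose[OF tendsto_arctan_at_top]) (use assms in auto)
    moreover have "eventually (\<lambda>y. arctan (y / a) / a = integral {0..y} (\<lambda>t. 1 / (a\<^sup>2 + t\<^sup>2))) at_top"
      using eventually_ge_at_top[of 0] by eventually_elim (use integral_unique[OF d] in simp)
    ultimately have "((\<lambda>y. integral {0..y} (\<lambda>t. 1 / (a\<^sup>2 + t\<^sup>2))) \<longlongrightarrow> (pi / 2) / a) at_top"
      by (rule Lim_transform_eventually)
    then show "((\<lambda>y. integral {0..y} (\<lambda>t. 1 / (a\<^sup>2 + t\<^sup>2))) \<longlongrightarrow> pi / (2 * a)) at_top"
      by (simp only: divide_divide_eq_left)
  qed auto
  then show ?thesis
    by (subst has_integral_spike_set_eq[where T="{0..}"])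
       (auto intro: negligible_subset[of "{0::real}"])
qed

lemma integrable_cauchy_kernel: "(\<lambda>t. C / (1 + t\<^sup>2)) integrable_on {0<..}" for C :: real
proof -
  have "(\<lambda>t. C * (1 / (1\<^sup>2 + t\<^sup>2))) integrable_on {0<..}"
    using has_integral_arctan_ray[of 1] by (intro integrable_on_mult_right) (auto simp: integrable_on_def)
  then show ?thesis by simp
qed

section \<open>Contour integrals along the boundary of a double sector\<close>

lemma has_vector_derivative_cis: "((\<lambda>x. cis x) has_vector_derivative \<i> * cis x) (at x within S)"
proof -
  have "((\<lambda>x. complex_of_real (cos x) + \<i> * complex_of_real (sin x)) has_vector_derivative
      (complex_of_real (- sin x) + \<i> * complex_of_real (cos x))) (at x within S)"
    by (intro has_vector_derivative_add has_vector_derivative_mult_right has_vector_derivative_of_real)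
       (auto intro!: derivative_eq_intros simp flip: has_real_derivative_iff_has_vector_derivative)
  then show ?thesis
    by (simp add: cis_conv_exp exp_Euler flip: cos_of_real sin_of_real) (simp add: algebra_simps)
qed

lemma abs_sin_le_tan:
  assumes "\<bar>\<psi>\<bar> \<le> \<phi>" "\<phi> < pi / 2" shows "\<bar>sin \<psi>\<bar> \<le> tan \<phi> * cos \<psi>"
proof -
  have *: "sin x \<le> tan \<phi> * cos x" if "0 \<le> x" "x \<le> \<phi>" for x
  proof -
    have "cos x > 0" using that assms by (intro cos_gt_zero_pi) auto
    moreover have "tan x \<le> tan \<phi>" using that assms by (intro tan_mono_le) auto
    ultimately show ?thesis by (simp add: tan_def divide_le_eq)
  qed
  have "0 \<le> \<bar>\<psi>\<bar>" "\<bar>sin \<psi>\<bar> = sin \<bar>\<psi>\<bar>" "cos \<psi> = cos \<bar>\<psi>\<bar>"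
    using assms sin_ge_zero[of "\<bar>\<psi>\<bar>"] by (auto simp: abs_if)
  then show ?thesis using *[of "\<bar>\<psi>\<bar>"] assms by simp
qed

lemma tan_cos_le_sin:
  assumes "0 < \<phi>" "\<phi> < pi / 2" "\<phi> \<le> \<psi>" "\<psi> \<le> pi - \<phi>" shows "tan \<phi> * \<bar>cos \<psi>\<bar> \<le> sin \<psi>"
proof -
  have c: "cos \<phi> > 0" using assms by (intro cos_gt_zero_pi) auto
  have "sin (\<psi> - \<phi>) \<ge> 0" "sin (\<psi> + \<phi>) \<ge> 0" using assms by (auto intro!: sin_ge_zero)
  then have "sin \<phi> * \<bar>cos \<psi>\<bar> \<le> sin \<psi> * cos \<phi>"
    by (auto simp: sin_diff sin_add abs_if mult.commute)
  then show ?thesis using c by (simp add: tan_def field_simps)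
qed

text \<open>Slopes in place of arguments: both components are treated at once and no branch cut
  appears. \<open>inner_sector\<close> and \<open>outer_sector\<close> of the same angle meet
  exactly in the four boundary half-lines, where the contour runs; the origin belongs to
  neither.\<close>

definition inner_sector :: "real \<Rightarrow> complex set" where
  "inner_sector \<phi> = {w. w \<noteq> 0 \<and> \<bar>Im w\<bar> \<le> tan \<phi> * \<bar>Re w\<bar>}"

definition outer_sector :: "real \<Rightarrow> complex set" where
  "outer_sector \<phi> = {w. w \<noteq> 0 \<and> tan \<phi> * \<bar>Re w\<bar> \<le> \<bar>Im w\<bar>}"

lemma inner_sectorI:
  assumes "t > 0" "\<bar>\<psi>\<bar> \<le> \<phi>" "\<phi> < pi / 2"
  shows "of_real t * cis \<psi> \<in> inner_sector \<phi>" "of_real t * - cis \<psi> \<in> inner_sector \<phi>"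
proof -
  have "cos \<psi> \<ge> 0" using assms by (intro cos_ge_zero) auto
  then have "\<bar>t * sin \<psi>\<bar> \<le> tan \<phi> * \<bar>t * cos \<psi>\<bar>"
    using abs_sin_le_tan[OF assms(2,3)] assms(1) by (simp add: abs_mult mult.left_commute mult_left_mono)
  then show "of_real t * cis \<psi> \<in> inner_sector \<phi>" "of_real t * - cis \<psi> \<in> inner_sector \<phi>"
    using assms(1) by (auto simp: inner_sector_def)
qed

lemma outer_sectorI:
  assumes "t > 0" "0 < \<phi>" "\<phi> < pi / 2" "\<phi> \<le> \<bar>\<psi>\<bar>" "\<bar>\<psi>\<bar> \<le> pi - \<phi>"
  shows "of_real t * cis \<psi> \<in> outer_sector \<phi>" "of_real t * - cis \<psi> \<in> outer_sector \<phi>"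
proof -
  have "\<bar>sin \<psi>\<bar> = sin \<bar>\<psi>\<bar>" "cos \<psi> = cos \<bar>\<psi>\<bar>"
    using assms sin_ge_zero[of "\<bar>\<psi>\<bar>"] by (auto simp: abs_if)
  then have "tan \<phi> * \<bar>t * cos \<psi>\<bar> \<le> \<bar>t * sin \<psi>\<bar>"
    using tan_cos_le_sin[OF assms(2,3,4,5)] assms(1) by (simp add: abs_mult mult.left_commute mult_left_mono)
  then show "of_real t * cis \<psi> \<in> outer_sector \<phi>" "of_real t * - cis \<psi> \<in> outer_sector \<phi>"
    using assms(1) by (auto simp: outer_sector_def)
qed

definition dirs :: "real \<Rightarrow> complex set" where
  "dirs \<phi> = {cis \<phi>, cis (-\<phi>), - cis \<phi>, - cis (-\<phi>)}"

text \<open>Orientation: 1 on the half-lines \<open>cis (-\<phi>)\<close> and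
  \<open>- cis (-\<phi>)\<close>, which are run outwards, and -1 on the other two, which are run
  inwards. Each component of the double sector then lies to the left of its boundary.\<close>

definition dir_sgn :: "complex \<Rightarrow> real" where
  "dir_sgn d = - sgn (Re d * Im d)"

lemma finite_dirs [simp]: "finite (dirs \<phi>)" by (simp add: dirs_def)
lemma norm_dirs: "d \<in> dirs \<phi> \<Longrightarrow> norm d = 1" by (auto simp: dirs_def)
lemma norm_ray_dirs: "d \<in> dirs \<phi> \<Longrightarrow> t > 0 \<Longrightarrow> norm (of_real t * d) = t" by (auto simp: norm_dirs norm_mult)

lemma dirs_inner: "d \<in> dirs \<phi> \<Longrightarrow> t > 0 \<Longrightarrow> 0 < \<phi> \<Longrightarrow> \<phi> < pi / 2 \<Longrightarrow> of_real t * d \<in> inner_sector \<phi>"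
  using inner_sectorI[of t \<phi> \<phi>] inner_sectorI[of t "-\<phi>" \<phi>] unfolding dirs_def by (elim insertE emptyE) simp_all

lemma dirs_outer: "d \<in> dirs \<phi> \<Longrightarrow> t > 0 \<Longrightarrow> 0 < \<phi> \<Longrightarrow> \<phi> < pi / 2 \<Longrightarrow> of_real t * d \<in> outer_sector \<phi>"
  using outer_sectorI[of t \<phi> \<phi>] outer_sectorI[of t \<phi> "-\<phi>"] unfolding dirs_def by (elim insertE emptyE) simp_all

lemma tan_mult_mono: "0 < \<phi> \<Longrightarrow> \<phi> \<le> \<phi>' \<Longrightarrow> \<phi>' < pi/2 \<Longrightarrow> tan \<phi> * \<bar>x\<bar> \<le> tan \<phi>' * \<bar>x\<bar>"
  by (intro mult_right_mono tan_mono_le) auto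

lemma inner_sector_mono: "0 < \<phi> \<Longrightarrow> \<phi> \<le> \<phi>' \<Longrightarrow> \<phi>' < pi/2 \<Longrightarrow> inner_sector \<phi> \<subseteq> inner_sector \<phi>'"
  unfolding inner_sector_def using tan_mult_mono[of \<phi> \<phi>'] order_trans by blast

text \<open>One theory of contour integrals for several complex structures: multiplication by
  \<open>\<i>\<close> on the complex numbers and composition with \<open>J0\<close> on operators.
  Right multiplication by \<open>J\<close> on the module is a third instance, used for its
  \<open>cmul\<close>.\<close>

locale complex_structure =
  fixes j :: "'b::banach \<Rightarrow> 'b"
  assumes bounded_linear_j: "bounded_linear j" and j_j [simp]: "j (j v) = - v"
begin

definition cmul :: "complex \<Rightarrow> 'b \<Rightarrow> 'b" where
  "cmul z v = Re z *\<^sub>R v + Im z *\<^sub>R j v"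

lemmas j_simps = linear_add[OF bounded_linear.linear[OF bounded_linear_j]]
  linear_scale[OF bounded_linear.linear[OF bounded_linear_j]]
  linear_neg[OF bounded_linear.linear[OF bounded_linear_j]]

sublocale cm: bounded_bilinear cmul
proof
  from bounded_linear.nonneg_bounded[OF bounded_linear_j] obtain K where K: "K \<ge> 0" "\<And>v. norm (j v) \<le> norm v * K"
    by (auto simp: mult.commute)
  have "norm (cmul z v) \<le> norm z * norm v * (1 + K)" for z v
  proof -
    have "norm (cmul z v) \<le> norm z * norm v + norm z * (norm v * K)"
      unfolding cmul_def using abs_Re_le_cmod[of z] abs_Im_le_cmod[of z] K
      by (intro norm_triangle_le add_mono) (auto intro!: mult_mono)
    then show ?thesis by (simp add: algebra_simps)
  qed
  then show "\<exists>K. \<forall>a b. norm (cmul a b) \<le> norm a * norm b * K" by blast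
qed (auto simp: cmul_def algebra_simps j_simps)

lemma cmul_cmul: "cmul a (cmul b v) = cmul (a * b) v"
  by (simp add: cmul_def j_simps algebra_simps)

lemma cmul_of_real [simp]: "cmul (of_real r) v = r *\<^sub>R v"
  by (simp add: cmul_def)

lemma cmul_one [simp]: "cmul 1 v = v"
  by (simp add: cmul_def)

lemma has_vector_derivative_along:
  assumes "(F has_derivative (\<lambda>h. cmul h D)) (at (p x))" "(p has_vector_derivative p') (at x within S)"
  shows "((\<lambda>x. F (p x)) has_vector_derivative cmul p' D) (at x within S)"
  using has_derivative_compose[OF assms(2)[unfolded has_vector_derivative_def] assms(1)]
  by (simp add: has_vector_derivative_def cm.scaleR_left)

section \<open>Integrals along a half-line\<close>

definition ray :: "complex \<Rightarrow> (complex \<Rightarrow> 'b) \<Rightarrow> 'b" where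
  "ray d F = integral {0<..} (\<lambda>t. cmul d (F (of_real t * d)))"

definition ray_integrable :: "complex \<Rightarrow> (complex \<Rightarrow> 'b) \<Rightarrow> bool" where
  "ray_integrable d F \<longleftrightarrow> continuous_on {0<..} (\<lambda>t. F (of_real t * d)) \<and>
     (\<exists>g. g integrable_on {0<..} \<and> (\<forall>t>0. norm (F (of_real t * d)) \<le> g t))"

lemma ray_integrableI:
  assumes "continuous_on {0<..} (\<lambda>t. F (of_real t * d))" "g integrable_on {0<..}"
    "\<And>t. t > 0 \<Longrightarrow> norm (F (of_real t * d)) \<le> g t"
  shows "ray_integrable d F"
  using assms unfolding ray_integrable_def by blast

lemma ray_integrable_cong:
  "(\<And>t. t > 0 \<Longrightarrow> F (of_real t * d) = G (of_real t * d)) \<Longrightarrow> ray_integrable d F \<longleftrightarrow> ray_integrable d G"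
  unfolding ray_integrable_def by (intro arg_cong2[where f="(\<and>)"] continuous_on_cong ex_cong1) auto

lemma ray_integrable_linear:
  assumes F: "ray_integrable d F" and L: "bounded_linear L" shows "ray_integrable d (\<lambda>w. L (F w))"
proof -
  from F obtain g where c: "continuous_on {0<..} (\<lambda>t. F (of_real t * d))"
    and g: "g integrable_on {0<..}" "\<And>t. t > 0 \<Longrightarrow> norm (F (of_real t * d)) \<le> g t"
    unfolding ray_integrable_def by blast
  from bounded_linear.nonneg_bounded[OF L] obtain K where K: "K \<ge> 0" "\<And>v. norm (L v) \<le> norm v * K"
    by blast
  show ?thesis
  proof (rule ray_integrableI)
    show "continuous_on {0<..} (\<lambda>t. L (F (of_real t * d)))" by (rule bounded_linear.continuous_on[OF L c])
    show "(\<lambda>t. g t * K) integrable_on {0<..}" by (rule integrable_on_mult_left[OF g(1)])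
    show "norm (L (F (of_real t * d))) \<le> g t * K" if "t > 0" for t
      using K(2)[of "F (of_real t * d)"] mult_right_mono[OF g(2)[OF that] K(1)] by linarith
  qed
qed

lemmas ray_integrable_cmul = ray_integrable_linear[OF _ cm.bounded_linear_right]

lemma ray_integrable_add:
  assumes "ray_integrable d F" "ray_integrable d G" shows "ray_integrable d (\<lambda>w. F w + G w)"
proof -
  from assms obtain f g where "continuous_on {0<..} (\<lambda>t. F (of_real t * d))" "continuous_on {0<..} (\<lambda>t. G (of_real t * d))"
    and g: "f integrable_on {0<..}" "g integrable_on {0<..}"
      "\<And>t. t > 0 \<Longrightarrow> norm (F (of_real t * d)) \<le> f t" "\<And>t. t > 0 \<Longrightarrow> norm (G (of_real t * d)) \<le> g t"
    unfolding ray_integrable_def by blast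
  then show ?thesis
    by (intro ray_integrableI[where g="\<lambda>t. f t + g t"] continuous_on_add integrable_add norm_triangle_mono) auto
qed

lemma ray_integrable_integrable: "ray_integrable d F \<Longrightarrow> (\<lambda>t. F (of_real t * d)) integrable_on {0<..}"
  unfolding ray_integrable_def using continuous_dominated_on_ray by blast

lemma ray_limit:
  assumes "ray_integrable d F"
  shows "(\<lambda>n. integral (expanding n) (\<lambda>t. F (of_real t * d))) \<longlonglongrightarrow> integral {0<..} (\<lambda>t. F (of_real t * d))"
proof -
  from assms obtain g where c: "continuous_on {0<..} (\<lambda>t. F (of_real t * d))"
    and g: "g integrable_on {0<..}" "\<And>t. t > 0 \<Longrightarrow> norm (F (of_real t * d)) \<le> g t"
    unfolding ray_integrable_def by blast
  show ?thesis
    by (rule dominated_on_ray(2)[OF integrable_on_expanding[OF ray_integrable_integrable[OF assms]] g])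
qed

text \<open>\<open>L\<close> may map into another space with its own complex structure
  \<open>cmul'\<close>, hence the explicit integral on the left. This is what transfers scalar
  integrals to operators in \<open>contour_cmul_const\<close>.\<close>

lemma ray_linear:
  assumes "ray_integrable d F" "bounded_linear L" "\<And>z v. L (cmul z v) = cmul' z (L v)"
  shows "integral {0<..} (\<lambda>t. cmul' d (L (F (of_real t * d)))) = L (ray d F)"
  using integral_linear[OF ray_integrable_integrable[OF ray_integrable_cmul[OF assms(1)]] assms(2), of d]
  by (simp add: o_def ray_def assms(3))

lemma ray_add:
  assumes "ray_integrable d F" "ray_integrable d G" shows "ray d (\<lambda>w. F w + G w) = ray d F + ray d G"
  using integral_add[OF ray_integrable_integrable[OF ray_integrable_cmul[OF assms(1)]]
       ray_integrable_integrable[OF ray_integrable_cmul[OF assms(2)]], of d d]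
  by (simp add: ray_def cm.add_right)

lemma ray_cong: "(\<And>t. t > 0 \<Longrightarrow> F (of_real t * d) = G (of_real t * d)) \<Longrightarrow> ray d F = ray d G"
  unfolding ray_def by (rule integral_cong) simp

text \<open>Cauchy's theorem for a sector, by differentiating in the angle: the derivative of the
  truncated integral consists of the boundary terms at the two ends of \<open>expanding n\<close>,
  and these are O(1/n). Only the ends enter, so the bound on \<open>F\<close> is demanded for small
  and for large |w| alone, and the region between may contain large values of
  \<open>F\<close>.\<close>

lemma sector_rotate:
  assumes le: "\<alpha> \<le> \<beta>" and S: "\<And>t \<psi>. t > 0 \<Longrightarrow> \<alpha> \<le> \<psi> \<Longrightarrow> \<psi> \<le> \<beta> \<Longrightarrow> of_real t * cis \<psi> \<in> S"
    and der: "\<And>w. w \<in> S \<Longrightarrow> (F has_derivative (\<lambda>h. cmul h (F' w))) (at w)"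
    and cont: "continuous_on S F'"
    and bound: "\<And>w. w \<in> S \<Longrightarrow> norm w \<le> r0 \<or> r1 \<le> norm w \<Longrightarrow> norm (F w) \<le> C / (1 + (norm w)\<^sup>2)"
    and r0: "r0 > 0"
    and int: "ray_integrable (cis \<alpha>) F" "ray_integrable (cis \<beta>) F"
  shows "ray (cis \<alpha>) F = ray (cis \<beta>) F"
proof -
  define I where "I n \<psi> = integral (expanding n) (\<lambda>t. cmul (cis \<psi>) (F (of_real t * cis \<psi>)))" for n \<psi>
  have contF: "continuous_on S F"
    by (rule has_derivative_continuous_on[OF has_derivative_at_withinI[OF der]])
  obtain K where K: "K > 0" "\<And>a b. norm (cmul a b) \<le> norm a * norm b * K"
    using cm.pos_bounded by blast
  \<comment> \<open>The point of the proof: \<open>fx\<close> is the derivative in \<psi> of the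
    integrand and at the same time the derivative in t of \<open>cmul (of_real t * (\<i> * cis
    \<psi>)) (F (of_real t * cis \<psi>))\<close>. Its integral over t is therefore a difference of
    boundary values.\<close>
  define fx where "fx \<psi> t = cmul (cis \<psi>) (cmul (of_real t * (\<i> * cis \<psi>)) (F' (of_real t * cis \<psi>))) +
      cmul (\<i> * cis \<psi>) (F (of_real t * cis \<psi>))" for \<psi> t
  have lim: "(\<lambda>n. I n \<psi>) \<longlonglongrightarrow> ray (cis \<psi>) F" if "ray_integrable (cis \<psi>) F" for \<psi>
  proof -
    show ?thesis
      using ray_limit[OF ray_integrable_cmul[OF that], of "cis \<psi>"] by (simp add: I_def ray_def)
  qed
  have bd: "eventually (\<lambda>n. norm (I n \<beta> - I n \<alpha>) \<le> (2 * K * C * (\<beta> - \<alpha>)) * inverse (real (Suc n))) sequentially"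
  proof -
    have "eventually (\<lambda>n. inverse (real (Suc n)) \<le> r0 \<and> r1 \<le> real (Suc n)) sequentially"
      using order_tendstoD(2)[OF LIMSEQ_inverse_real_of_nat r0]
        filterlim_at_top_dense[THEN iffD1, OF filterlim_real_sequentially, rule_format, of r1]
      by eventually_elim auto
    then show ?thesis
    proof eventually_elim
      case (elim n)
      define a b where "a = inverse (real (Suc n))" and "b = real (Suc n)"
      have ab: "0 < a" "a \<le> b" "a \<le> r0" "r1 \<le> b" "b = inverse a" and b1: "1 \<le> b"
        using elim by (auto simp: a_def b_def field_simps)
      have exp: "expanding n = cbox a b" by (simp add: expanding_def a_def b_def)
      have inS: "of_real t * cis \<psi> \<in> S" if "t \<in> cbox a b" "\<psi> \<in> {\<alpha>..\<beta>}" for t \<psi>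
        using S that ab by auto
      have dF: "((\<lambda>\<psi>. cmul (cis \<psi>) (F (of_real t * cis \<psi>))) has_vector_derivative fx \<psi> t) (at \<psi> within {\<alpha>..\<beta>})"
        if "t \<in> cbox a b" "\<psi> \<in> {\<alpha>..\<beta>}" for t \<psi>
        unfolding fx_def
        by (intro cm.has_vector_derivative has_vector_derivative_cis has_vector_derivative_along[OF der]
              has_vector_derivative_mult_right inS that)
      have dt: "((\<lambda>t. cmul (of_real t * (\<i> * cis \<psi>)) (F (of_real t * cis \<psi>))) has_vector_derivative fx \<psi> t) (at t within {a..b})"
        if "t \<in> cbox a b" "\<psi> \<in> {\<alpha>..\<beta>}" for t \<psi>
      proof -
        have p: "((\<lambda>t. of_real t * c) has_vector_derivative c) (at t within {a..b})" for c :: complex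
        proof -
          have "((\<lambda>t. of_real t) has_vector_derivative complex_of_real 1) (at t within {a..b})"
            by (rule has_vector_derivative_of_real[OF DERIV_ident])
          from has_vector_derivative_mult_left[OF this, of c] show ?thesis by simp
        qed
        have "((\<lambda>t. F (of_real t * cis \<psi>)) has_vector_derivative cmul (cis \<psi>) (F' (of_real t * cis \<psi>))) (at t within {a..b})"
          by (rule has_vector_derivative_along[OF der[OF inS[OF that]] p])
        from cm.has_vector_derivative[OF p this]
        have "((\<lambda>t. cmul (of_real t * (\<i> * cis \<psi>)) (F (of_real t * cis \<psi>))) has_vector_derivative
          cmul (of_real t * (\<i> * cis \<psi>)) (cmul (cis \<psi>) (F' (of_real t * cis \<psi>))) +
          cmul (\<i> * cis \<psi>) (F (of_real t * cis \<psi>))) (at t within {a..b})" .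
        then show ?thesis unfolding fx_def cmul_cmul by (simp add: mult_ac)
      qed
      have cfx: "continuous_on ({\<alpha>..\<beta>} \<times> cbox a b) (\<lambda>(\<psi>, t). fx \<psi> t)"
        unfolding fx_def case_prod_beta cis_conv_exp
        by (intro continuous_intros cm.continuous_on continuous_on_compose2[OF cont] continuous_on_compose2[OF contF])
           (use inS in \<open>auto simp: cis_conv_exp\<close>)
      have I': "(I n has_vector_derivative integral (cbox a b) (fx \<psi>)) (at \<psi> within {\<alpha>..\<beta>})" if "\<psi> \<in> {\<alpha>..\<beta>}" for \<psi>
        unfolding I_def exp
      proof (rule leibniz_rule_vector_derivative[OF dF _ cfx that])
        show "(\<lambda>t. cmul (cis \<psi>) (F (of_real t * cis \<psi>))) integrable_on cbox a b" if "\<psi> \<in> {\<alpha>..\<beta>}" for \<psi>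
          by (intro integrable_continuous continuous_intros cm.continuous_on continuous_on_compose2[OF contF])
             (use inS that in auto)
      qed auto
      have intfx: "integral (cbox a b) (fx \<psi>) = cmul (of_real b * (\<i> * cis \<psi>)) (F (of_real b * cis \<psi>))
          - cmul (of_real a * (\<i> * cis \<psi>)) (F (of_real a * cis \<psi>))" if "\<psi> \<in> {\<alpha>..\<beta>}" for \<psi>
        using fundamental_theorem_of_calculus[OF ab(2) dt[OF _ that]] by (intro integral_unique) simp
      have nfx: "norm (integral (cbox a b) (fx \<psi>)) \<le> 2 * K * C * a" if \<psi>: "\<psi> \<in> {\<alpha>..\<beta>}" for \<psi>
      proof -
        have *: "norm (cmul (of_real t * (\<i> * cis \<psi>)) (F (of_real t * cis \<psi>))) \<le> K * C * a"
          if t: "t \<in> cbox a b" "t \<le> r0 \<or> r1 \<le> t" "t / (1 + t\<^sup>2) \<le> a" for t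
        proof -
          have "t > 0" using t ab by auto
          have *: "norm (F (of_real t * cis \<psi>)) \<le> C / (1 + t\<^sup>2)"
            using bound[OF inS[OF t(1) \<psi>]] t(2) \<open>t > 0\<close> by (simp add: norm_mult)
          then have "C \<ge> 0" by (smt (verit) divide_neg_pos norm_ge_zero zero_le_power2)
          have "norm (cmul (of_real t * (\<i> * cis \<psi>)) (F (of_real t * cis \<psi>))) \<le> t * norm (F (of_real t * cis \<psi>)) * K"
            using K(2)[of "of_real t * (\<i> * cis \<psi>)" "F (of_real t * cis \<psi>)"] \<open>t > 0\<close> by (simp add: norm_mult)
          also have "\<dots> \<le> t * (C / (1 + t\<^sup>2)) * K"
            using * K(1) \<open>t > 0\<close> by (intro mult_right_mono mult_left_mono) auto
          also have "\<dots> = (t / (1 + t\<^sup>2)) * (K * C)" by simp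
          also have "\<dots> \<le> a * (K * C)" using t(3) K(1) \<open>C \<ge> 0\<close> by (intro mult_right_mono) auto
          finally show ?thesis by (simp add: mult_ac)
        qed
        \<comment> \<open>A boundary term at t is at most K C t / (1 + t^2). This is at most K C a
          at both t = a and t = b because b = 1/a.\<close>
        have pos: "1 + x\<^sup>2 > 0" for x :: real by (simp add: add_pos_nonneg)
        have "a \<le> a * (1 + a\<^sup>2)" using ab(1) by (simp add: distrib_left)
        then have "a / (1 + a\<^sup>2) \<le> a" using pos by (simp add: pos_divide_le_eq)
        moreover have "b \<le> a * (1 + b\<^sup>2)" using ab(1) by (simp add: ab(5) field_simps power2_eq_square)
        then have "b / (1 + b\<^sup>2) \<le> a" using pos by (simp add: pos_divide_le_eq)
        ultimately show ?thesis
          unfolding intfx[OF \<psi>] using *[of a] *[of b] ab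
          by (intro order_trans[OF norm_triangle_ineq4]) auto
      qed
      have "((\<lambda>\<psi>. integral (cbox a b) (fx \<psi>)) has_integral I n \<beta> - I n \<alpha>) {\<alpha>..\<beta>}"
        by (rule fundamental_theorem_of_calculus[OF le I'])
      then have "norm (I n \<beta> - I n \<alpha>) \<le> (2 * K * C * a) * measure lborel {\<alpha>..\<beta>}"
        by (intro has_integral_bound_real[where S="{}"]) (use nfx order_trans[OF norm_ge_zero nfx[of \<alpha>]] le in auto)
      then show ?case using le by (simp add: a_def algebra_simps)
    qed
  qed
  have "(\<lambda>n. (2 * K * C * (\<beta> - \<alpha>)) * inverse (real (Suc n))) \<longlonglongrightarrow> (2 * K * C * (\<beta> - \<alpha>)) * 0"
    by (intro tendsto_intros LIMSEQ_inverse_real_of_nat)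
  then have "(\<lambda>n. I n \<beta> - I n \<alpha>) \<longlonglongrightarrow> 0"
    using Lim_null_comparison[OF bd] by simp
  moreover have "(\<lambda>n. I n \<beta> - I n \<alpha>) \<longlonglongrightarrow> ray (cis \<beta>) F - ray (cis \<alpha>) F"
    by (intro tendsto_diff lim int)
  ultimately show ?thesis using LIMSEQ_unique by fastforce
qed

section \<open>Integrals over the boundary of a double sector\<close>

definition contour :: "real \<Rightarrow> (complex \<Rightarrow> 'b) \<Rightarrow> 'b" where
  "contour \<phi> F = (\<Sum>d\<in>dirs \<phi>. dir_sgn d *\<^sub>R ray d F)"

definition contour_integrable :: "real \<Rightarrow> (complex \<Rightarrow> 'b) \<Rightarrow> bool" where
  "contour_integrable \<phi> F \<longleftrightarrow> (\<forall>d\<in>dirs \<phi>. ray_integrable d F)"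

lemma contour_expand:
  assumes "0 < \<phi>" "\<phi> < pi / 2"
  shows "contour \<phi> F = ray (cis (-\<phi>)) F - ray (cis \<phi>) F + (ray (- cis (-\<phi>)) F - ray (- cis \<phi>) F)"
proof -
  have c: "cos \<phi> > 0" using assms by (intro cos_gt_zero_pi) auto
  have s: "sin \<phi> > 0" using assms by (intro sin_gt_zero) auto
  have "cis \<phi> \<notin> {cis (-\<phi>), - cis \<phi>, - cis (-\<phi>)}" "cis (-\<phi>) \<notin> {- cis \<phi>, - cis (-\<phi>)}" "- cis \<phi> \<notin> {- cis (-\<phi>)}"
    using c s by (auto simp: complex_eq_iff)
  then have "contour \<phi> F = dir_sgn (cis \<phi>) *\<^sub>R ray (cis \<phi>) F + (dir_sgn (cis (-\<phi>)) *\<^sub>R ray (cis (-\<phi>)) F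
      + (dir_sgn (- cis \<phi>) *\<^sub>R ray (- cis \<phi>) F + dir_sgn (- cis (-\<phi>)) *\<^sub>R ray (- cis (-\<phi>)) F))"
    unfolding contour_def dirs_def by (simp del: cis_conv_exp)
  moreover have "dir_sgn (cis \<phi>) = -1" "dir_sgn (cis (-\<phi>)) = 1" "dir_sgn (- cis \<phi>) = -1" "dir_sgn (- cis (-\<phi>)) = 1"
    using c s by (simp_all add: dir_sgn_def sgn_mult)
  ultimately show ?thesis by simp
qed

lemma contour_cong:
  assumes "\<And>t d. d \<in> dirs \<phi> \<Longrightarrow> t > 0 \<Longrightarrow> F (of_real t * d) = G (of_real t * d)"
  shows "contour \<phi> F = contour \<phi> G"
  unfolding contour_def using assms by (intro sum.cong refl arg_cong[where f="\<lambda>x. _ *\<^sub>R x"] ray_cong) auto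

lemma contour_add:
  "contour_integrable \<phi> F \<Longrightarrow> contour_integrable \<phi> G \<Longrightarrow> contour \<phi> (\<lambda>w. F w + G w) = contour \<phi> F + contour \<phi> G"
  unfolding contour_def contour_integrable_def by (simp add: ray_add scaleR_add_right sum.distrib)

lemma contour_integrable_add:
  "contour_integrable \<phi> F \<Longrightarrow> contour_integrable \<phi> G \<Longrightarrow> contour_integrable \<phi> (\<lambda>w. F w + G w)"
  unfolding contour_integrable_def by (simp add: ray_integrable_add)

lemma contour_integrable_linear:
  "contour_integrable \<phi> F \<Longrightarrow> bounded_linear L \<Longrightarrow> contour_integrable \<phi> (\<lambda>w. L (F w))"
  unfolding contour_integrable_def by (simp add: ray_integrable_linear)

lemma contour_linear:
  assumes "contour_integrable \<phi> F" "bounded_linear L" "\<And>z v. L (cmul z v) = cmul z (L v)"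
  shows "contour \<phi> (\<lambda>w. L (F w)) = L (contour \<phi> F)"
proof -
  interpret L: bounded_linear L by fact
  have "ray d (\<lambda>w. L (F w)) = L (ray d F)" if "d \<in> dirs \<phi>" for d
    using ray_linear[of d F L cmul] assms that unfolding ray_def contour_integrable_def by blast
  then show ?thesis unfolding contour_def L.sum by (intro sum.cong) (auto simp: L.scale)
qed

lemma contour_integrable_minus: "contour_integrable \<phi> F \<Longrightarrow> contour_integrable \<phi> (\<lambda>w. - F w)"
  by (erule contour_integrable_linear) (simp add: bounded_linear_minus bounded_linear_ident)

lemma contour_minus: "contour \<phi> (\<lambda>w. - F w) = - contour \<phi> F"
  unfolding contour_def ray_def by (simp add: cm.minus_right sum_negf)

lemma contour_integrable_diff:
  "contour_integrable \<phi> F \<Longrightarrow> contour_integrable \<phi> G \<Longrightarrow> contour_integrable \<phi> (\<lambda>w. F w - G w)"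
  using contour_integrable_add[OF _ contour_integrable_minus, of \<phi> F G] by simp

lemma contour_diff:
  "contour_integrable \<phi> F \<Longrightarrow> contour_integrable \<phi> G \<Longrightarrow> contour \<phi> (\<lambda>w. F w - G w) = contour \<phi> F - contour \<phi> G"
  using contour_add[OF _ contour_integrable_minus, of \<phi> F G] by (simp add: contour_minus)

lemma contour_integrableI:
  assumes "continuous_on (inner_sector \<phi> \<inter> outer_sector \<phi>) F" "0 < \<phi>" "\<phi> < pi / 2"
    and "\<And>d. d \<in> dirs \<phi> \<Longrightarrow> g d integrable_on {0<..}"
    and "\<And>t d. t > 0 \<Longrightarrow> d \<in> dirs \<phi> \<Longrightarrow> norm (F (of_real t * d)) \<le> g d t"
  shows "contour_integrable \<phi> F"
  unfolding contour_integrable_def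
proof
  fix d assume d: "d \<in> dirs \<phi>"
  show "ray_integrable d F"
  proof (rule ray_integrableI[OF _ assms(4)[OF d] assms(5)[OF _ d]])
    show "continuous_on {0<..} (\<lambda>t. F (of_real t * d))"
      by (rule continuous_on_compose2[OF assms(1)])
         (use dirs_inner[OF d _ assms(2,3)] dirs_outer[OF d _ assms(2,3)] in \<open>auto intro!: continuous_intros\<close>)
  qed
qed

lemma ray_integrable_cauchy_bound:
  assumes "continuous_on S F" "\<And>t. t > 0 \<Longrightarrow> of_real t * d \<in> S" "norm d = 1"
    and "\<And>w. w \<in> S \<Longrightarrow> norm (F w) \<le> C / (1 + (norm w)\<^sup>2)"
  shows "ray_integrable d F"
proof (rule ray_integrableI[where g="\<lambda>t. C / (1 + t\<^sup>2)"])
  show "continuous_on {0<..} (\<lambda>t. F (of_real t * d))"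
    by (rule continuous_on_compose2[OF assms(1)]) (use assms(2) in \<open>auto intro!: continuous_intros\<close>)
  show "norm (F (of_real t * d)) \<le> C / (1 + t\<^sup>2)" if "t > 0" for t
    using assms(4)[OF assms(2)[OF that]] that assms(3) by (simp add: norm_mult)
qed (rule integrable_cauchy_kernel)

lemma sector_rotate_bounded:
  assumes "\<alpha> \<le> \<beta>" and S: "\<And>t \<psi>. t > 0 \<Longrightarrow> \<alpha> \<le> \<psi> \<Longrightarrow> \<psi> \<le> \<beta> \<Longrightarrow> of_real t * cis \<psi> \<in> S"
    and der: "\<And>w. w \<in> S \<Longrightarrow> (F has_derivative (\<lambda>h. cmul h (F' w))) (at w)"
    and cont: "continuous_on S F'"
    and bound: "\<And>w. w \<in> S \<Longrightarrow> norm (F w) \<le> C / (1 + (norm w)\<^sup>2)"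
  shows "ray (cis \<alpha>) F = ray (cis \<beta>) F"
proof -
  have contF: "continuous_on S F"
    by (rule has_derivative_continuous_on[OF has_derivative_at_withinI[OF der]])
  show ?thesis
    by (rule sector_rotate[OF assms(1) S der cont bound zero_less_one])
       (auto intro!: ray_integrable_cauchy_bound[OF contF _ _ bound] S assms(1))
qed

lemma contour_rotate:
  assumes \<phi>: "0 < \<phi>1" "\<phi>1 \<le> \<phi>2" "\<phi>2 < pi / 2"
    and der: "\<And>w. w \<in> outer_sector \<phi>1 \<inter> inner_sector \<phi>2 \<Longrightarrow> (F has_derivative (\<lambda>h. cmul h (F' w))) (at w)"
    and cont: "continuous_on (outer_sector \<phi>1 \<inter> inner_sector \<phi>2) F'"
    and bound: "\<And>w. w \<in> outer_sector \<phi>1 \<inter> inner_sector \<phi>2 \<Longrightarrow> norm (F w) \<le> C / (1 + (norm w)\<^sup>2)"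
  shows "contour \<phi>1 F = contour \<phi>2 F"
proof -
  have mem: "of_real t * cis \<psi> \<in> outer_sector \<phi>1 \<inter> inner_sector \<phi>2"
    if "t > 0" "\<phi>1 \<le> \<bar>\<psi>\<bar>" "\<bar>\<psi>\<bar> \<le> \<phi>2" for t \<psi>
    using inner_sectorI[of t \<psi> \<phi>2] outer_sectorI[of t \<phi>1 \<psi>] that \<phi> by auto
  have mem': "of_real t * cis \<psi> \<in> outer_sector \<phi>1 \<inter> inner_sector \<phi>2"
    if "t > 0" "\<phi>1 \<le> \<bar>\<psi> - pi\<bar>" "\<bar>\<psi> - pi\<bar> \<le> \<phi>2" for t \<psi>
  proof -
    have "cis \<psi> = - cis (\<psi> - pi)" by (simp add: complex_eq_iff)
    then show ?thesis
      using inner_sectorI(2)[of t "\<psi> - pi" \<phi>2] outer_sectorI(2)[of t \<phi>1 "\<psi> - pi"] that \<phi> by auto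
  qed
  have pi: "- cis \<psi> = cis (pi + \<psi>)" for \<psi> by (simp add: complex_eq_iff)
  note rot = sector_rotate_bounded[OF _ _ der cont bound]
  have "ray (cis \<phi>1) F = ray (cis \<phi>2) F" by (rule rot, use \<phi> in simp, rule mem) (use \<phi> in auto)
  moreover have "ray (cis (-\<phi>2)) F = ray (cis (-\<phi>1)) F" by (rule rot, use \<phi> in simp, rule mem) (use \<phi> in auto)
  moreover have "ray (cis (pi + \<phi>1)) F = ray (cis (pi + \<phi>2)) F" by (rule rot, use \<phi> in simp, rule mem') (use \<phi> in auto)
  moreover have "ray (cis (pi + -\<phi>2)) F = ray (cis (pi + -\<phi>1)) F" by (rule rot, use \<phi> in simp, rule mem') (use \<phi> in auto)
  ultimately show ?thesis
    using \<phi> by (simp add: contour_expand pi)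
qed

text \<open>The two boundary rays of each component are rotated into one another across the real
  axis; they carry opposite signs and cancel.\<close>

lemma contour_inner_eq_0:
  assumes \<phi>: "0 < \<phi>" "\<phi> < pi / 2"
    and der: "\<And>w. w \<in> inner_sector \<phi> \<Longrightarrow> (F has_derivative (\<lambda>h. cmul h (F' w))) (at w)"
    and cont: "continuous_on (inner_sector \<phi>) F'"
    and bound: "\<And>w. w \<in> inner_sector \<phi> \<Longrightarrow> norm (F w) \<le> C / (1 + (norm w)\<^sup>2)"
  shows "contour \<phi> F = 0"
proof -
  have mem': "of_real t * cis \<psi> \<in> inner_sector \<phi>" if "t > 0" "\<bar>\<psi> - pi\<bar> \<le> \<phi>" for t \<psi>
  proof -
    have "cis \<psi> = - cis (\<psi> - pi)" by (simp add: complex_eq_iff)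
    then show ?thesis using inner_sectorI(2)[of t "\<psi> - pi" \<phi>] that \<phi> by auto
  qed
  have pi: "- cis \<psi> = cis (pi + \<psi>)" for \<psi> by (simp add: complex_eq_iff)
  note rot = sector_rotate_bounded[OF _ _ der cont bound]
  have "ray (cis (-\<phi>)) F = ray (cis \<phi>) F" by (rule rot) (use \<phi> in \<open>auto intro!: inner_sectorI\<close>)
  moreover have "ray (cis (pi + -\<phi>)) F = ray (cis (pi + \<phi>)) F" by (rule rot, use \<phi> in simp, rule mem') (use \<phi> in auto)
  ultimately show ?thesis
    using \<phi> by (simp add: contour_expand pi)
qed

text \<open>Here the cancelling rays belong to different components: they are rotated into one
  another across the imaginary axis. Integrability on the rays is a separate hypothesis because the
  bound covers only small and large |w|.\<close>

lemma contour_outer_eq_0: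
  assumes \<phi>: "0 < \<phi>" "\<phi> < pi / 2"
    and der: "\<And>w. w \<in> outer_sector \<phi> \<Longrightarrow> (F has_derivative (\<lambda>h. cmul h (F' w))) (at w)"
    and cont: "continuous_on (outer_sector \<phi>) F'"
    and bound: "\<And>w. w \<in> outer_sector \<phi> \<Longrightarrow> norm w \<le> r0 \<or> r1 \<le> norm w \<Longrightarrow> norm (F w) \<le> C / (1 + (norm w)\<^sup>2)"
    and r0: "r0 > 0" and int: "contour_integrable \<phi> F"
  shows "contour \<phi> F = 0"
proof -
  have pi: "- cis \<psi> = cis (pi + \<psi>)" "- cis \<psi> = cis (\<psi> - pi)" for \<psi> by (simp_all add: complex_eq_iff)
  have i: "ray_integrable (cis \<phi>) F" "ray_integrable (cis (-\<phi>)) F" "ray_integrable (cis (pi + - \<phi>)) F"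
    "ray_integrable (cis (\<phi> - pi)) F"
    using int unfolding pi[symmetric] by (simp_all add: contour_integrable_def dirs_def)
  have rot: "ray (cis \<alpha>) F = ray (cis \<beta>) F"
    if "\<alpha> \<le> \<beta>" "\<And>t \<psi>. t > 0 \<Longrightarrow> \<alpha> \<le> \<psi> \<Longrightarrow> \<psi> \<le> \<beta> \<Longrightarrow> of_real t * cis \<psi> \<in> outer_sector \<phi>"
       "ray_integrable (cis \<alpha>) F" "ray_integrable (cis \<beta>) F" for \<alpha> \<beta>
    by (rule sector_rotate[where S="outer_sector \<phi>" and F'=F' and C=C and ?r0.0=r0 and ?r1.0=r1])
       (use that der cont bound r0 in blast)+
  have "ray (cis \<phi>) F = ray (cis (pi + - \<phi>)) F"
    by (rule rot[OF _ _ i(1,3)], use \<phi> in simp, rule outer_sectorI) (use \<phi> in auto)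
  moreover have "ray (cis (\<phi> - pi)) F = ray (cis (-\<phi>)) F"
    by (rule rot[OF _ _ i(4,2)], use \<phi> in simp, rule outer_sectorI) (use \<phi> in auto)
  ultimately show ?thesis
    unfolding contour_expand[OF \<phi>] pi(2)[of \<phi>] pi(1)[of "-\<phi>"] by simp
qed

lemma ray_uminus: "ray d (\<lambda>w. F (- w)) = - ray (- d) F"
  unfolding ray_def by (simp add: cm.minus_left)

lemma contour_uminus:
  assumes "0 < \<phi>" "\<phi> < pi / 2" shows "contour \<phi> (\<lambda>w. F (- w)) = - contour \<phi> F"
  using assms by (simp add: contour_expand ray_uminus)

end

section \<open>Cauchy's formula in a double sector\<close>

text \<open>Let u = |z - w|, with slopes m1 < m2. Inserting |Re w| <= |Im z| / m2 + u into |Im z| <=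
  m1 |Re w| + u leaves (1 - m1/m2) |Im z| <= (1 + m1) u, and the factor on the left is positive. The
  lower bound is linear in both norms, which makes 1/(z - w) gain decay in either variable.\<close>

lemma sector_dist:
  assumes "0 < \<phi>1" "\<phi>1 < \<phi>2" "\<phi>2 < pi / 2"
  shows "\<exists>c>0. \<forall>z\<in>outer_sector \<phi>2. \<forall>w\<in>inner_sector \<phi>1. c * (norm z + norm w) \<le> norm (z - w)"
proof -
  define m1 m2 where "m1 = tan \<phi>1" and "m2 = tan \<phi>2"
  have m: "0 < m1" "m1 < m2"
    unfolding m1_def m2_def using assms by (auto intro!: tan_gt_zero tan_monotone)
  define K where "K = (1 + 1 / m2) * ((1 + m1) / (1 - m1 / m2))"
  have K: "K > 0" unfolding K_def using m by (auto intro!: mult_pos_pos divide_pos_pos add_pos_pos)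
  have le: "norm z + norm w \<le> (2 * K + 1) * norm (z - w)" if "z \<in> outer_sector \<phi>2" "w \<in> inner_sector \<phi>1" for z w
  proof -
    have z: "m2 * \<bar>Re z\<bar> \<le> \<bar>Im z\<bar>" and w: "\<bar>Im w\<bar> \<le> m1 * \<bar>Re w\<bar>"
      using that by (auto simp: outer_sector_def inner_sector_def m1_def m2_def)
    let ?u = "norm (z - w)"
    have u: "\<bar>Re z - Re w\<bar> \<le> ?u" "\<bar>Im z - Im w\<bar> \<le> ?u"
      using abs_Re_le_cmod[of "z - w"] abs_Im_le_cmod[of "z - w"] by auto
    have "\<bar>Re z\<bar> \<le> \<bar>Im z\<bar> / m2" using z m by (simp add: field_simps)
    have "\<bar>Im z\<bar> \<le> m1 * \<bar>Re w\<bar> + ?u" using u w by linarith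
    also have "\<dots> \<le> m1 * (\<bar>Im z\<bar> / m2 + ?u) + ?u"
      using u \<open>\<bar>Re z\<bar> \<le> \<bar>Im z\<bar> / m2\<close> m by (intro add_right_mono mult_left_mono) auto
    finally have "(1 - m1 / m2) * \<bar>Im z\<bar> \<le> (1 + m1) * ?u" using m by (simp add: algebra_simps)
    then have Im: "\<bar>Im z\<bar> \<le> ((1 + m1) / (1 - m1 / m2)) * ?u"
      using m by (simp add: pos_le_divide_eq mult.commute)
    have "norm z \<le> \<bar>Re z\<bar> + \<bar>Im z\<bar>" by (rule cmod_le)
    also have "\<dots> \<le> (1 + 1 / m2) * \<bar>Im z\<bar>" using \<open>\<bar>Re z\<bar> \<le> \<bar>Im z\<bar> / m2\<close> by (simp add: algebra_simps)
    also have "\<dots> \<le> (1 + 1 / m2) * (((1 + m1) / (1 - m1 / m2)) * ?u)"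
      using Im m by (intro mult_left_mono) auto
    finally have "norm z \<le> K * ?u" unfolding K_def by (simp add: mult.assoc)
    moreover have "norm w \<le> norm z + ?u" by (metis norm_minus_commute norm_triangle_sub)
    ultimately show ?thesis by (simp add: algebra_simps)
  qed
  show ?thesis
  proof (intro exI[of _ "1 / (2 * K + 1)"] conjI ballI)
    show "1 / (2 * K + 1) * (norm z + norm w) \<le> norm (z - w)" if "z \<in> outer_sector \<phi>2" "w \<in> inner_sector \<phi>1" for z w
      using le[OF that] K by (simp add: pos_divide_le_eq mult.commute)
  qed (use K in auto)
qed

lemma sector_nz: "w \<in> inner_sector \<phi> \<Longrightarrow> w \<noteq> 0" "w \<in> outer_sector \<phi> \<Longrightarrow> w \<noteq> 0"
  by (auto simp: inner_sector_def outer_sector_def)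

lemma inner_sector_Re_nz: "w \<in> inner_sector \<phi> \<Longrightarrow> Re w \<noteq> 0"
  by (auto simp: inner_sector_def complex_eq_iff)

lemma inner_sector_uminus: "- w \<in> inner_sector \<phi> \<longleftrightarrow> w \<in> inner_sector \<phi>"
  by (simp add: inner_sector_def)

lemma inner_sector_Re_bound:
  assumes "w \<in> inner_sector \<phi>" shows "norm w \<le> (1 + tan \<phi>) * \<bar>Re w\<bar>"
  using cmod_le[of w] assms by (simp add: inner_sector_def algebra_simps)

section \<open>Majorants of the form C / (1 + t^2)\<close>

lemma inverse_shift_bound:
  fixes t \<rho> :: real
  assumes "t \<ge> 0" "\<rho> > 0"
  shows "1 / (t + \<rho>) \<le> (1 + 1 / \<rho>) * (1 / (1 + t))"
proof -
  have "1 + t \<le> (1 + 1 / \<rho>) * (t + \<rho>)" using assms by (simp add: field_simps)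
  then have "1 \<le> (1 + 1 / \<rho>) * (t + \<rho>) / (1 + t)" using assms by (simp add: pos_le_divide_eq)
  then have "1 / (t + \<rho>) \<le> ((1 + 1 / \<rho>) * (t + \<rho>) / (1 + t)) / (t + \<rho>)"
    using assms by (intro divide_right_mono) auto
  also have "\<dots> = (1 + 1 / \<rho>) * (1 / (1 + t))" using assms by simp
  finally show ?thesis .
qed

lemma cauchy_kernel_bounds:
  fixes t \<rho> :: real
  assumes "t \<ge> 0" "\<rho> > 0"
  shows "1 / (1 + t) * (1 / (t + \<rho>)) \<le> (1 + 1 / \<rho>) / (1 + t\<^sup>2)"
    and "1 / (t + \<rho>) * (1 / (t + \<rho>)) \<le> (1 + 1 / \<rho>)\<^sup>2 / (1 + t\<^sup>2)"
proof -
  note 0 = inverse_shift_bound[OF assms]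
  have 1: "1 / (1 + t) * (1 / (1 + t)) \<le> 1 / (1 + t\<^sup>2)"
  proof -
    have "1 + t\<^sup>2 \<le> (1 + t) * (1 + t)" using assms by (simp add: power2_eq_square algebra_simps)
    then show ?thesis using assms by (simp add: frac_le add_pos_nonneg)
  qed
  have "1 / (1 + t) * (1 / (t + \<rho>)) \<le> 1 / (1 + t) * ((1 + 1 / \<rho>) * (1 / (1 + t)))"
    using 0 assms by (intro mult_left_mono) auto
  also have "\<dots> = (1 + 1 / \<rho>) * (1 / (1 + t) * (1 / (1 + t)))" by simp
  also have "\<dots> \<le> (1 + 1 / \<rho>) * (1 / (1 + t\<^sup>2))" using 1 assms by (intro mult_left_mono) auto
  finally show "1 / (1 + t) * (1 / (t + \<rho>)) \<le> (1 + 1 / \<rho>) / (1 + t\<^sup>2)" by simp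
  have "1 / (t + \<rho>) * (1 / (t + \<rho>)) \<le> ((1 + 1 / \<rho>) * (1 / (1 + t))) * ((1 + 1 / \<rho>) * (1 / (1 + t)))"
    using 0 assms by (intro mult_mono) auto
  also have "\<dots> = (1 + 1 / \<rho>)\<^sup>2 * (1 / (1 + t) * (1 / (1 + t)))" by (simp add: power2_eq_square)
  also have "\<dots> \<le> (1 + 1 / \<rho>)\<^sup>2 * (1 / (1 + t\<^sup>2))" using 1 by (intro mult_left_mono) auto
  finally show "1 / (t + \<rho>) * (1 / (t + \<rho>)) \<le> (1 + 1 / \<rho>)\<^sup>2 / (1 + t\<^sup>2)" by simp
qed

text \<open>The rewrite turns \<open>cmul\<close> into multiplication, so the scalar instances of
  the contour lemmas speak directly about holomorphic functions.\<close>

interpretation sc: complex_structure "(*) \<i>"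
  rewrites sc_cmul: "complex_structure.cmul ((*) \<i>) = (*)"
proof -
  show *: "complex_structure ((*) \<i>)"
    by (rule complex_structure.intro[OF bounded_linear_mult_right]) (simp flip: mult.assoc)
  show "complex_structure.cmul ((*) \<i>) = (*)"
    unfolding complex_structure.cmul_def[OF *] by (intro ext) (simp add: complex_eq_iff)
qed

lemma holomorphic_has_derivative:
  "f holomorphic_on S \<Longrightarrow> open S \<Longrightarrow> w \<in> S \<Longrightarrow> (f has_derivative (\<lambda>h. h * deriv f w)) (at w)"
  using holomorphic_derivI[of f S w] by (simp add: has_field_derivative_def mult.commute[of _ "deriv f w"])

lemma holomorphic_continuous_deriv: "f holomorphic_on S \<Longrightarrow> open S \<Longrightarrow> continuous_on S (deriv f)"
  by (intro holomorphic_on_imp_continuous_on holomorphic_deriv)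

lemma norm_cauchy_quotient:
  fixes g :: complex
  assumes "norm g \<le> C / (1 + norm z)" "c * (norm z + norm w) \<le> norm (z - w)" "c > 0" "w \<noteq> 0"
  shows "norm (g / (z - w)) \<le> (C / c * (1 + 1 / norm w)) / (1 + (norm z)\<^sup>2)"
proof -
  have "0 \<le> C / (1 + norm z)" by (rule order_trans[OF norm_ge_zero assms(1)])
  then have "C \<ge> 0" by (smt (verit) divide_neg_pos norm_ge_zero)
  have pos: "norm z + norm w > 0" using assms(4) by (simp add: add_nonneg_pos)
  have "norm (g / (z - w)) \<le> (C / (1 + norm z)) / (c * (norm z + norm w))"
    unfolding norm_divide using assms pos \<open>C \<ge> 0\<close> by (intro frac_le) auto
  also have "\<dots> = C / c * (1 / (1 + norm z) * (1 / (norm z + norm w)))" by simp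
  also have "\<dots> \<le> C / c * ((1 + 1 / norm w) / (1 + (norm z)\<^sup>2))"
    using \<open>C \<ge> 0\<close> assms by (intro mult_left_mono cauchy_kernel_bounds) auto
  finally show ?thesis by simp
qed

text \<open>The kernel is 1/(z - w) - 1/(z + w): it has the pole of the Cauchy kernel at w but
  decays quadratically, so that each ray has an integral of its own. Rays whose angle lies strictly
  between \<psi> and \<psi> + pi meet neither pole and can all be rotated to the direction
  orthogonal to w, where the integral is an arctangent.\<close>

lemma rotated_kernel:
  assumes w: "w = of_real \<rho> * cis \<psi>" "\<rho> > 0" and \<alpha>: "\<psi> < \<alpha>" "\<alpha> < \<psi> + pi"
    and int: "sc.ray_integrable (cis \<alpha>) (\<lambda>z. 2 * w / ((z + w) * (z - w)))"
  shows "sc.ray (cis \<alpha>) (\<lambda>z. 2 * w / ((z + w) * (z - w))) = - (\<i> * pi)"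
proof -
  define q where "q z = 2 * w / ((z + w) * (z - w))" for z
  define S where "S = {z. z + w \<noteq> 0 \<and> z - w \<noteq> 0}"
  have "open S" unfolding S_def by (intro open_Collect_conj open_Collect_neq continuous_intros)
  have q: "q holomorphic_on S" unfolding q_def[abs_def] by (intro holomorphic_intros) (auto simp: S_def)
  have nw: "norm w = \<rho>" using w by (simp add: norm_mult)
  \<comment> \<open>At a right angle to w the denominator becomes
    \<open>- (cis \<psi> * cis \<psi>) * (\<rho>^2 + t^2)\<close>, a constant times a positive
    function.\<close>
  have \<beta>: "q (of_real t * cis (\<psi> + pi / 2)) = (- 2 * \<i> * \<rho> * inverse (cis (\<psi> + pi / 2))) * (1 / (\<rho>\<^sup>2 + t\<^sup>2))" if "t > 0" for t
  proof -
    have c: "cis (\<psi> + pi / 2) = \<i> * cis \<psi>" by (simp add: complex_eq_iff cos_add sin_add)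
    have "(of_real t * (\<i> * cis \<psi>) + w) * (of_real t * (\<i> * cis \<psi>) - w) = - (cis \<psi> * cis \<psi>) * of_real (\<rho>\<^sup>2 + t\<^sup>2)"
      unfolding w by (simp add: algebra_simps power2_eq_square)
    moreover have "\<rho>\<^sup>2 + t\<^sup>2 \<noteq> 0" using w that by (simp add: sum_power2_eq_zero_iff)
    then have "complex_of_real (\<rho>\<^sup>2 + t\<^sup>2) \<noteq> 0" unfolding of_real_eq_0_iff .
    moreover have "2 * (of_real \<rho> * e) / (- (e * e) * X) = (- 2 * \<i> * of_real \<rho> * inverse (\<i> * e)) * (1 / X)"
      if "e \<noteq> 0" "X \<noteq> 0" for e X :: complex using that by (simp add: field_simps)
    ultimately have "q (of_real t * cis (\<psi> + pi / 2)) = (- 2 * \<i> * \<rho> * inverse (\<i> * cis \<psi>)) * (1 / of_real (\<rho>\<^sup>2 + t\<^sup>2))"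
      unfolding q_def c by (simp only: w(1)[symmetric]) (simp only: w(1) cis_neq_zero not_False_eq_True)
    then show ?thesis unfolding c by simp
  qed
  have int\<beta>: "sc.ray_integrable (cis (\<psi> + pi / 2)) q"
  proof (rule sc.ray_integrableI)
    show "continuous_on {0<..} (\<lambda>t. q (of_real t * cis (\<psi> + pi / 2)))"
      using w(2) by (subst continuous_on_cong[OF refl \<beta>])
        (auto intro!: continuous_intros simp: sum_power2_eq_zero_iff simp flip: of_real_power of_real_add)
    show "(\<lambda>t. 2 * \<rho> * (1 / (\<rho>\<^sup>2 + t\<^sup>2))) integrable_on {0<..}"
      using has_integral_arctan_ray[OF w(2)] by (intro integrable_on_mult_right) (auto simp: integrable_on_def)
    show "norm (q (of_real t * cis (\<psi> + pi / 2))) \<le> 2 * \<rho> * (1 / (\<rho>\<^sup>2 + t\<^sup>2))" if "t > 0" for t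
      unfolding \<beta>[OF that] using w(2) by (simp add: norm_mult norm_divide norm_inverse flip: of_real_power of_real_add)
  qed
  have mem: "of_real t * cis \<eta> \<in> S" if t: "t > 0" and \<eta>: "\<psi> < \<eta>" "\<eta> < \<psi> + pi" for t \<eta>
  proof -
    have "Im (of_real t * cis \<eta> * cnj w) = t * \<rho> * sin (\<eta> - \<psi>)"
      unfolding w by (simp add: sin_diff algebra_simps)
    moreover have "sin (\<eta> - \<psi>) > 0" using \<eta> by (intro sin_gt_zero) auto
    ultimately have "Im (of_real t * cis \<eta> * cnj w) \<noteq> 0" using t w by auto
    moreover have "Im (w * cnj w) = 0" "Im (- w * cnj w) = 0" by (simp_all add: algebra_simps)
    ultimately show ?thesis unfolding S_def by (metis (mono_tags, lifting) add_eq_0_iff2 eq_iff_diff_eq_0 mem_Collect_eq)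
  qed
  \<comment> \<open>After squaring, a factor 2 between |z| and \<rho> becomes a factor 4, so |z^2 -
    w^2| is at least half of |z|^2 + \<rho>^2. In the constant, 5 / \<rho> times \<rho>^2 covers 4 *
    \<rho>, and 5 * \<rho> times |z|^2 covers the other term.\<close>
  have bound: "norm (q z) \<le> (5 / \<rho> + 5 * \<rho>) / (1 + (norm z)\<^sup>2)" if z: "z \<in> S" "norm z \<le> \<rho> / 2 \<or> 2 * \<rho> \<le> norm z" for z
  proof -
    let ?t = "norm z"
    have "norm ((z + w) * (z - w)) = norm (z\<^sup>2 - w\<^sup>2)" by (simp add: algebra_simps power2_eq_square)
    also have "\<dots> \<ge> \<bar>?t\<^sup>2 - \<rho>\<^sup>2\<bar>" using norm_triangle_ineq3[of "z\<^sup>2" "w\<^sup>2"] by (simp add: norm_power nw)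
    finally have 1: "\<bar>?t\<^sup>2 - \<rho>\<^sup>2\<bar> \<le> norm ((z + w) * (z - w))" .
    have aux: "(a + b) / 2 \<le> \<bar>a - b\<bar>" if "a \<le> b / 4" "0 \<le> a" for a b :: real
      using that by (simp add: abs_real_def)
    have "(?t\<^sup>2 + \<rho>\<^sup>2) / 2 \<le> \<bar>?t\<^sup>2 - \<rho>\<^sup>2\<bar>"
    proof (cases "?t \<le> \<rho> / 2")
      case True
      then have "?t\<^sup>2 \<le> (\<rho> / 2)\<^sup>2" by (intro power_mono) auto
      then have "?t\<^sup>2 \<le> \<rho>\<^sup>2 / 4" by (simp add: power_divide)
      then show ?thesis by (intro aux) auto
    next
      case False
      then have "(2 * \<rho>)\<^sup>2 \<le> ?t\<^sup>2" using z(2) w(2) by (intro power_mono) auto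
      then have "4 * \<rho>\<^sup>2 \<le> ?t\<^sup>2" by (simp add: power_mult_distrib)
      then have "(\<rho>\<^sup>2 + ?t\<^sup>2) / 2 \<le> \<bar>\<rho>\<^sup>2 - ?t\<^sup>2\<bar>" by (intro aux) auto
      then show ?thesis by (simp only: abs_minus_commute add.commute)
    qed
    then have 2: "(?t\<^sup>2 + \<rho>\<^sup>2) / 2 \<le> norm ((z + w) * (z - w))" using 1 by (rule order_trans)
    have pos: "?t\<^sup>2 + \<rho>\<^sup>2 > 0" using w by (simp add: add_nonneg_pos)
    have "norm (2 * w) = 2 * \<rho>" by (simp add: norm_mult nw)
    then have "norm (q z) \<le> (2 * \<rho>) / ((?t\<^sup>2 + \<rho>\<^sup>2) / 2)"
      unfolding q_def norm_divide using 2 pos w(2) by (intro frac_le) simp_all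
    also have "\<dots> \<le> (5 / \<rho> + 5 * \<rho>) / (1 + ?t\<^sup>2)"
    proof -
      have "4 * \<rho> * (1 + ?t\<^sup>2) \<le> (5 / \<rho> + 5 * \<rho>) * (?t\<^sup>2 + \<rho>\<^sup>2)"
      proof -
        have "(5 / \<rho> + 5 * \<rho>) * (?t\<^sup>2 + \<rho>\<^sup>2) = 5 * ?t\<^sup>2 / \<rho> + 5 * (\<rho> * ?t\<^sup>2) + 5 * \<rho> + 5 * \<rho> ^ 3"
          using w(2) by (simp add: field_simps power2_eq_square power3_eq_cube)
        moreover have "4 * \<rho> * (1 + ?t\<^sup>2) = 4 * \<rho> + 4 * (\<rho> * ?t\<^sup>2)" by (simp add: algebra_simps)
        moreover have "0 \<le> 5 * ?t\<^sup>2 / \<rho>" "0 \<le> \<rho> * ?t\<^sup>2" "0 \<le> \<rho> ^ 3" using w(2) by auto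
        ultimately show ?thesis using w(2) by linarith
      qed
      then have "4 * \<rho> / (?t\<^sup>2 + \<rho>\<^sup>2) \<le> (5 / \<rho> + 5 * \<rho>) / (1 + ?t\<^sup>2)"
        using pos by (simp add: pos_divide_le_eq pos_le_divide_eq add_pos_nonneg)
      then show ?thesis by simp
    qed
    finally show ?thesis .
  qed
  have rot: "sc.ray (cis a) q = sc.ray (cis b) q" if "a \<le> b" "\<psi> < a" "b < \<psi> + pi"
      "sc.ray_integrable (cis a) q" "sc.ray_integrable (cis b) q" for a b
  proof (rule sc.sector_rotate[where S=S and F'="deriv q" and C="5 / \<rho> + 5 * \<rho>" and ?r0.0="\<rho>/2" and ?r1.0="2 * \<rho>"])
    show "of_real t * cis \<eta> \<in> S" if "t > 0" "a \<le> \<eta>" "\<eta> \<le> b" for t \<eta>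
      using mem that \<open>\<psi> < a\<close> \<open>b < \<psi> + pi\<close> by auto
    show "(q has_derivative (\<lambda>h. h * deriv q z)) (at z)" if "z \<in> S" for z
      by (rule holomorphic_has_derivative[OF q \<open>open S\<close> that])
    show "continuous_on S (deriv q)" by (rule holomorphic_continuous_deriv[OF q \<open>open S\<close>])
  qed (use that bound w(2) in auto)
  have "sc.ray (cis \<alpha>) q = sc.ray (cis (\<psi> + pi / 2)) q"
  proof (cases "\<alpha> \<le> \<psi> + pi / 2")
    case True
    then show ?thesis by (rule rot) (use \<alpha> int int\<beta> in \<open>simp_all add: q_def[abs_def]\<close>)
  next
    case False
    then have "\<psi> + pi / 2 \<le> \<alpha>" by simp
    then show ?thesis by (rule rot[symmetric]) (use \<alpha> int int\<beta> in \<open>simp_all add: q_def[abs_def]\<close>)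
  qed
  also have "\<dots> = integral {0<..} (\<lambda>t. (- 2 * \<i> * \<rho>) * of_real (1 / (\<rho>\<^sup>2 + t\<^sup>2)))"
    unfolding sc.ray_def
  proof (rule integral_cong)
    fix t :: real assume "t \<in> {0<..}"
    moreover have "e * ((- 2 * \<i> * of_real \<rho> * inverse e) * X) = (- 2 * \<i> * of_real \<rho>) * X" if "e \<noteq> 0" for e X :: complex
      using that by simp
    ultimately show "cis (\<psi> + pi / 2) * q (of_real t * cis (\<psi> + pi / 2)) = (- 2 * \<i> * \<rho>) * of_real (1 / (\<rho>\<^sup>2 + t\<^sup>2))"
      by (simp only: \<beta> greaterThan_iff cis_neq_zero not_False_eq_True of_real_1 of_real_divide)
  qed
  also have "\<dots> = (- 2 * \<i> * \<rho>) * of_real (pi / (2 * \<rho>))"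
    by (intro integral_unique has_integral_mult_right has_integral_of_real has_integral_arctan_ray w)
  also have "\<dots> = (- 2 * \<i>) * of_real (\<rho> * (pi / (2 * \<rho>)))" by (simp only: of_real_mult mult.assoc)
  also have "\<rho> * (pi / (2 * \<rho>)) = pi / 2" using w(2) by simp
  also have "(- 2 * \<i>) * of_real (pi / 2) = - (\<i> * of_real pi)" by simp
  finally show ?thesis unfolding q_def[abs_def] .
qed

text \<open>Subtracting \<open>g w\<close> times the kernel \<open>q\<close> of
  \<open>rotated_kernel\<close> removes the pole of \<open>g z / (z - w)\<close> and keeps quadratic
  decay. The remainder \<open>H\<close> rotates through the right component without contribution, so
  the value comes from the two rays of \<open>q\<close>, which give - i pi and i pi. In the left
  component the quotient has no pole, and its two rays cancel.\<close>

lemma cauchy_formula_right: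
  assumes \<phi>: "0 < \<phi>'" "\<phi>' < \<phi>" "\<phi> < pi / 2" and S: "open S" "inner_sector \<phi> \<subseteq> S" and g: "g holomorphic_on S"
    and bound: "\<And>z. z \<in> inner_sector \<phi> \<Longrightarrow> norm (g z) \<le> C / (1 + norm z)"
    and w: "w \<in> inner_sector \<phi>'" "Re w > 0"
  shows "sc.contour \<phi> (\<lambda>z. g z / (z - w)) = 2 * pi * \<i> * g w"
proof -
  have \<phi>0: "0 < \<phi>" using \<phi> by simp
  obtain c where c: "c > 0" "\<And>z w. z \<in> outer_sector \<phi> \<Longrightarrow> w \<in> inner_sector \<phi>' \<Longrightarrow> c * (norm z + norm w) \<le> norm (z - w)"
    using sector_dist[OF \<phi>] by blast
  have w0: "w \<noteq> 0" using w by auto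
  have w': "w \<in> inner_sector \<phi>" using w inner_sector_mono[of \<phi>' \<phi>] \<phi> by auto
  have tan: "tan \<phi> > 0" using \<phi> by (intro tan_gt_zero) auto
  \<comment> \<open>In the right component |z| is at most (1 + tan \<phi>) Re z, so \<open>z\<close>
    and \<open>w\<close> cannot nearly cancel in z + w.\<close>
  define c1 where "c1 = 1 / (1 + tan \<phi>)"
  have c1: "c1 > 0" using tan by (simp add: c1_def)
  have opp: "c1 * (norm z + norm w) \<le> norm (z + w)" if "z \<in> inner_sector \<phi>" "Re z > 0" for z
  proof -
    have "norm z + norm w \<le> (1 + tan \<phi>) * Re (z + w)"
      using inner_sector_Re_bound[OF that(1)] inner_sector_Re_bound[OF w'] that w by (simp add: algebra_simps)
    also have "\<dots> \<le> (1 + tan \<phi>) * norm (z + w)" using tan complex_Re_le_cmod[of "z + w"] by (intro mult_left_mono) (simp_all del: plus_complex.sel)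
    finally show ?thesis using tan by (simp add: c1_def pos_divide_le_eq mult.commute)
  qed
  have C: "C \<ge> 0" using order_trans[OF norm_ge_zero bound[OF w']] by (smt (verit) divide_neg_pos norm_ge_zero)
  define F where "F z = g z / (z - w)" for z
  define q where "q z = 2 * w / ((z + w) * (z - w))" for z
  have qden: "norm (q z) \<le> (2 * norm w / (c1 * c) * (1 + 1 / norm w)\<^sup>2) / (1 + (norm z)\<^sup>2)"
    if "z \<in> outer_sector \<phi>" "z \<in> inner_sector \<phi>" "Re z > 0" for z
  proof -
    have pos: "norm z + norm w > 0" using w0 by (simp add: add_nonneg_pos)
    have "norm (q z) \<le> (2 * norm w) / ((c1 * (norm z + norm w)) * (c * (norm z + norm w)))"
      unfolding q_def norm_divide norm_mult using opp[OF that(2,3)] c(2)[OF that(1) w(1)] c1 c(1) pos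
      by (intro frac_le mult_mono) (auto intro!: mult_pos_pos)
    also have "\<dots> = 2 * norm w / (c1 * c) * (1 / (norm z + norm w) * (1 / (norm z + norm w)))" by simp
    also have "\<dots> \<le> 2 * norm w / (c1 * c) * ((1 + 1 / norm w)\<^sup>2 / (1 + (norm z)\<^sup>2))"
      using c c1 w0 by (intro mult_left_mono cauchy_kernel_bounds) auto
    finally show ?thesis by simp
  qed
  have Fden: "norm (F z) \<le> (C / c * (1 + 1 / norm w)) / (1 + (norm z)\<^sup>2)"
    if "z \<in> outer_sector \<phi>" "z \<in> inner_sector \<phi>" for z
    unfolding F_def by (rule norm_cauchy_quotient[OF bound[OF that(2)] c(2)[OF that(1) w(1)] c(1) w0])
  have outer_ne: "z \<noteq> w" if "z \<in> outer_sector \<phi>" for z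
    using c(2)[OF that w(1)] c(1) w0 by (smt (verit, best) mult_pos_pos norm_ge_zero norm_zero right_minus_eq zero_less_norm_iff)
  define R where "R = outer_sector \<phi> \<inter> inner_sector \<phi> \<inter> {z. Re z > 0}"
  have opp_ne: "z + w \<noteq> 0" if "Re z > 0" for z using that w(2) by (metis add_pos_pos less_irrefl plus_complex.sel(1) zero_complex.sel(1))
  have contF: "continuous_on R F" unfolding F_def
    by (intro continuous_intros continuous_on_subset[OF holomorphic_on_imp_continuous_on[OF g]]) (use S outer_ne in \<open>auto simp: R_def\<close>)
  have contq: "continuous_on R q" unfolding q_def
    by (intro continuous_intros) (use outer_ne opp_ne in \<open>auto simp: R_def\<close>)
  have cosp: "cos \<phi> > 0" using \<phi> by (intro cos_gt_zero_pi) auto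
  have dR: "of_real t * cis \<phi> \<in> R" "of_real t * cis (-\<phi>) \<in> R" if "t > 0" for t
    using dirs_inner[of _ \<phi> t] dirs_outer[of _ \<phi> t] that \<phi> cosp by (auto simp: R_def dirs_def)
  have L: "bounded_linear (\<lambda>x. - (g w * x))" by (intro bounded_linear_minus bounded_linear_mult_right)
  have FR: "norm (F z) \<le> (C / c * (1 + 1 / norm w)) / (1 + (norm z)\<^sup>2)" if "z \<in> R" for z
    using Fden that by (auto simp: R_def)
  have qR: "norm (q z) \<le> (2 * norm w / (c1 * c) * (1 + 1 / norm w)\<^sup>2) / (1 + (norm z)\<^sup>2)" if "z \<in> R" for z
    using qden that by (auto simp: R_def)
  have intF: "sc.ray_integrable (cis \<phi>) F" "sc.ray_integrable (cis (-\<phi>)) F"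
    using sc.ray_integrable_cauchy_bound[OF contF dR(1) norm_cis FR]
      sc.ray_integrable_cauchy_bound[OF contF dR(2) norm_cis FR] by blast+
  have intq: "sc.ray_integrable (cis \<phi>) q" "sc.ray_integrable (cis (-\<phi>)) q"
    using sc.ray_integrable_cauchy_bound[OF contq dR(1) norm_cis qR]
      sc.ray_integrable_cauchy_bound[OF contq dR(2) norm_cis qR] by blast+
  \<comment> \<open>The factor 2w/(z + w) equals 1 at z = w, so \<open>k\<close> vanishes there and
    \<open>k z / (z - w)\<close> extends holomorphically. A constant factor would do that too, but
    would leave only decay of order 1/|z|.\<close>
  define k where "k z = g z - g w * (2 * w / (z + w))" for z
  define H where "H z = (if z = w then deriv k w else (k z - k w) / (z - w))" for z
  define U where "U = S \<inter> {z. Re z > 0}"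
  have U: "open U" unfolding U_def using S by (auto intro: open_halfspace_Re_gt)
  have wU: "w \<in> U" using w w' S by (auto simp: U_def)
  have kU: "k holomorphic_on U" unfolding k_def[abs_def]
    by (intro holomorphic_intros holomorphic_on_subset[OF g]) (use opp_ne in \<open>auto simp: U_def\<close>)
  have HU: "H holomorphic_on U" unfolding H_def[abs_def]
    by (rule pole_lemma[OF kU]) (use wU U in \<open>simp add: interior_open\<close>)
  have k0: "k w = 0" using w0 by (simp add: k_def)
  have Heq: "H z = F z + - (g w * q z)" if "z \<noteq> w" for z
    using that k0 by (simp add: H_def F_def q_def k_def diff_divide_distrib)
  have dRU: "R \<subseteq> U" using S by (auto simp: R_def U_def)
  have intH: "sc.ray_integrable (cis \<phi>) (\<lambda>z. F z + - (g w * q z))" "sc.ray_integrable (cis (-\<phi>)) (\<lambda>z. F z + - (g w * q z))"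
    by (rule sc.ray_integrable_add[OF intF(1) sc.ray_integrable_linear[OF intq(1) L]])
       (rule sc.ray_integrable_add[OF intF(2) sc.ray_integrable_linear[OF intq(2) L]])
  have HF: "H (of_real t * d) = F (of_real t * d) + - (g w * q (of_real t * d))" if "t > 0" "d = cis \<phi> \<or> d = cis (-\<phi>)" for t d
    using Heq outer_ne dR[OF that(1)] that(2) by (auto simp: R_def)
  have cosp': "cos \<eta> > 0" if "\<bar>\<eta>\<bar> \<le> \<phi>" for \<eta> using \<phi> that by (intro cos_gt_zero_pi) auto
  define M0 where "M0 = C + 2 * norm (g w) * norm w / c1 * (1 + 1 / norm w)"
  define M where "M = M0 * 3 * (1 + 1 / norm w)"
  have Hrot: "sc.ray (cis (-\<phi>)) H = sc.ray (cis \<phi>) H"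
  proof (rule sc.sector_rotate[where S="inner_sector \<phi> \<inter> {z. Re z > 0}" and F'="deriv H" and C=M
      and ?r0.0="norm w/2" and ?r1.0="2 * norm w"])
    show "of_real t * cis \<eta> \<in> inner_sector \<phi> \<inter> {z. Re z > 0}" if "t > 0" "- \<phi> \<le> \<eta>" "\<eta> \<le> \<phi>" for t \<eta>
      using inner_sectorI[of t \<eta> \<phi>] that \<phi> cosp'[of \<eta>] by auto
    show "(H has_derivative (\<lambda>h. h * deriv H z)) (at z)" if "z \<in> inner_sector \<phi> \<inter> {z. Re z > 0}" for z
      by (rule holomorphic_has_derivative[OF HU U]) (use that S in \<open>auto simp: U_def\<close>)
    show "continuous_on (inner_sector \<phi> \<inter> {z. Re z > 0}) (deriv H)"
      by (rule continuous_on_subset[OF holomorphic_continuous_deriv[OF HU U]]) (use S in \<open>auto simp: U_def\<close>)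
    show "norm w / 2 > 0" using w0 by simp
    show "sc.ray_integrable (cis (- \<phi>)) H" by (rule iffD2[OF sc.ray_integrable_cong intH(2)]) (use HF in blast)
    show "sc.ray_integrable (cis \<phi>) H" by (rule iffD2[OF sc.ray_integrable_cong intH(1)]) (use HF in blast)
    show "norm (H z) \<le> M / (1 + (norm z)\<^sup>2)"
      if z: "z \<in> inner_sector \<phi> \<inter> {z. Re z > 0}" and far: "norm z \<le> norm w / 2 \<or> 2 * norm w \<le> norm z" for z
    proof -
      have "z \<noteq> w" using far w0 by auto
      \<comment> \<open>If one norm is at least twice the other, their difference is at least a
        third of their sum.\<close>
      have aux: "(a + b) / 3 \<le> x" if "\<bar>a - b\<bar> \<le> x" "a \<le> b / 2 \<or> 2 * b \<le> a" "0 \<le> a" "0 \<le> b" for a b x :: real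
        using that by (auto simp: abs_real_def split: if_splits)
      have 3: "(norm z + norm w) / 3 \<le> norm (z - w)"
        by (rule aux[OF norm_triangle_ineq3]) (use far in auto)
      have pos: "norm z + norm w > 0" using w0 by (simp add: add_nonneg_pos)
      have "norm (k z) \<le> norm (g z) + norm (g w * (2 * w / (z + w)))" unfolding k_def by (rule norm_triangle_ineq4)
      also have "\<dots> \<le> C / (1 + norm z) + norm (g w) * ((2 * norm w) / (c1 * (norm z + norm w)))"
        unfolding norm_mult norm_divide using bound opp z c1 pos
        by (intro add_mono mult_mono frac_le) (auto intro!: divide_nonneg_nonneg)
      also have "\<dots> = C / (1 + norm z) + (2 * norm (g w) * norm w / c1) * (1 / (norm z + norm w))" by simp
      also have "\<dots> \<le> C / (1 + norm z) + (2 * norm (g w) * norm w / c1) * ((1 + 1 / norm w) * (1 / (1 + norm z)))"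
        using c1 w0 by (intro add_left_mono mult_left_mono inverse_shift_bound) auto
      finally have "norm (k z) \<le> C / (1 + norm z) + (2 * norm (g w) * norm w / c1) * ((1 + 1 / norm w) * (1 / (1 + norm z)))" .
      also have "C / x + a * (b * (1 / x)) = (C + a * b) * (1 / x)" for a b x :: real
        by (simp add: add_divide_distrib)
      finally have kb: "norm (k z) \<le> M0 * (1 / (1 + norm z))" unfolding M0_def .
      have M0: "M0 \<ge> 0" unfolding M0_def using C c1 by auto
      have "norm (H z) = norm (k z) / norm (z - w)" using \<open>z \<noteq> w\<close> by (simp add: H_def k0 norm_divide)
      also have "\<dots> \<le> (M0 * (1 / (1 + norm z))) / ((norm z + norm w) / 3)"
        using kb 3 pos M0 by (intro frac_le) auto
      also have "\<dots> = (M0 * 3) * (1 / (1 + norm z) * (1 / (norm z + norm w)))" by simp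
      also have "\<dots> \<le> (M0 * 3) * ((1 + 1 / norm w) / (1 + (norm z)\<^sup>2))"
        using M0 w0 by (intro mult_left_mono cauchy_kernel_bounds) auto
      finally show ?thesis unfolding M_def by (simp add: mult.assoc)
    qed
  qed (use \<phi> in auto)
  have split: "sc.ray d H = sc.ray d F - g w * sc.ray d q" if d: "d = cis \<phi> \<or> d = cis (-\<phi>)" for d
  proof -
    have "sc.ray d H = sc.ray d (\<lambda>z. F z + - (g w * q z))" by (rule sc.ray_cong) (use HF d in blast)
    also have "\<dots> = sc.ray d F + sc.ray d (\<lambda>z. - (g w * q z))"
      using intF intq d sc.ray_integrable_linear[OF _ L] by (intro sc.ray_add) blast+
    also have "sc.ray d (\<lambda>z. - (g w * q z)) = - (g w * sc.ray d q)"
      using sc.ray_linear[OF _ L, of d q "(*)"] intq d unfolding sc.ray_def by (auto simp: mult_ac)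
    finally show ?thesis by simp
  qed
  obtain \<psi> where \<psi>: "w = of_real (norm w) * cis \<psi>" "-pi < \<psi>" "\<psi> \<le> pi"
    using cis_Arg[OF w0] Arg_bounded[of w] rcis_cmod_Arg[of w] by (metis rcis_def)
  have Re: "norm w * cos \<psi> > 0" and Im: "\<bar>norm w * sin \<psi>\<bar> \<le> tan \<phi>' * \<bar>norm w * cos \<psi>\<bar>"
    using w arg_cong[OF \<psi>(1), of Re] arg_cong[OF \<psi>(1), of Im] by (simp_all add: inner_sector_def)
  have cos\<psi>: "cos \<psi> > 0" using Re w0 by (simp add: zero_less_mult_iff)
  have \<psi>2: "\<bar>\<psi>\<bar> < pi / 2"
  proof (rule ccontr)
    assume "\<not> ?thesis"
    then have "cos \<bar>\<psi>\<bar> \<le> cos (pi / 2)" using \<psi> by (intro cos_monotone_0_pi_le) auto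
    then show False using cos\<psi> by simp
  qed
  have \<psi>\<phi>: "\<bar>\<psi>\<bar> < \<phi>"
  proof (rule ccontr)
    assume "\<not> ?thesis"
    then have "tan \<phi>' < tan \<bar>\<psi>\<bar>" using \<phi> \<psi>2 by (intro tan_monotone) auto
    moreover have "tan \<bar>\<psi>\<bar> * cos \<psi> = sin \<bar>\<psi>\<bar>" using cos\<psi> by (simp add: tan_def abs_if)
    moreover have "sin \<bar>\<psi>\<bar> \<le> \<bar>sin \<psi>\<bar>" by (simp add: abs_if)
    moreover have "norm w * \<bar>sin \<psi>\<bar> \<le> norm w * (tan \<phi>' * cos \<psi>)"
      using Im cos\<psi> by (simp add: abs_mult mult.left_commute)
    then have "\<bar>sin \<psi>\<bar> \<le> tan \<phi>' * cos \<psi>" using w0 by simp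
    ultimately show False using cos\<psi> by (smt (verit) mult_strict_right_mono)
  qed
  have "sc.ray (cis \<phi>) q = - (\<i> * pi)"
    unfolding q_def[abs_def] by (rule rotated_kernel[OF \<psi>(1)]) (use \<psi>\<phi> \<phi> w0 intq in \<open>auto simp: q_def[abs_def]\<close>)
  moreover have "sc.ray (cis (-\<phi>)) q = \<i> * pi"
  proof -
    \<comment> \<open>For the lower ray the lemma is used with -w, whose argument is \<psi> - pi:
      the angle -\<phi> lies between \<psi> - pi and \<psi>. Changing w into -w reverses the sign of
      the kernel.\<close>
    have eq: "(\<lambda>z. 2 * - w / ((z + - w) * (z - - w))) = (\<lambda>z. - q z)"
      by (intro ext) (simp add: q_def mult.commute)
    have "sc.ray (cis (-\<phi>)) (\<lambda>z. 2 * - w / ((z + - w) * (z - - w))) = - (\<i> * pi)"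
    proof (rule rotated_kernel)
      have "cis (\<psi> - pi) = - cis \<psi>" by (simp add: complex_eq_iff)
      then show "- w = of_real (norm w) * cis (\<psi> - pi)" using \<psi>(1) by simp
      show "sc.ray_integrable (cis (- \<phi>)) (\<lambda>z. 2 * - w / ((z + - w) * (z - - w)))"
        unfolding eq by (rule sc.ray_integrable_linear[OF intq(2) bounded_linear_minus[OF bounded_linear_ident]])
    qed (use w0 \<psi>\<phi> \<phi> in auto)
    then show ?thesis unfolding eq sc.ray_def by simp
  qed
  ultimately have "sc.ray (cis (-\<phi>)) F - sc.ray (cis \<phi>) F = 2 * pi * \<i> * g w"
    using Hrot split[of "cis \<phi>"] split[of "cis (-\<phi>)"] by (simp add: algebra_simps)
  moreover have "sc.ray (cis (pi - \<phi>)) F = sc.ray (cis (pi + \<phi>)) F"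
  proof -
    define L where "L = S \<inter> {z. Re z < 0}"
    have L: "open L" unfolding L_def using S by (auto intro: open_halfspace_Re_lt)
    have FL: "F holomorphic_on L" unfolding F_def[abs_def]
      by (intro holomorphic_intros holomorphic_on_subset[OF g]) (use w in \<open>auto simp: L_def\<close>)
    show ?thesis
    proof (rule sc.sector_rotate_bounded[where S="inner_sector \<phi> \<inter> {z. Re z < 0}" and F'="deriv F"])
      show "of_real t * cis \<eta> \<in> inner_sector \<phi> \<inter> {z. Re z < 0}" if "t > 0" "pi - \<phi> \<le> \<eta>" "\<eta> \<le> pi + \<phi>" for t \<eta>
      proof -
        have "cis \<eta> = - cis (\<eta> - pi)" by (simp add: complex_eq_iff)
        then show ?thesis using inner_sectorI(2)[of t "\<eta> - pi" \<phi>] that \<phi> cosp'[of "\<eta> - pi"] by (auto intro!: mult_pos_neg)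
      qed
      show "(F has_derivative (\<lambda>h. h * deriv F z)) (at z)" if "z \<in> inner_sector \<phi> \<inter> {z. Re z < 0}" for z
        by (rule holomorphic_has_derivative[OF FL L]) (use that S in \<open>auto simp: L_def\<close>)
      show "continuous_on (inner_sector \<phi> \<inter> {z. Re z < 0}) (deriv F)"
        by (rule continuous_on_subset[OF holomorphic_continuous_deriv[OF FL L]]) (use S in \<open>auto simp: L_def\<close>)
      show "norm (F z) \<le> (C / c1 * (1 + 1 / norm w)) / (1 + (norm z)\<^sup>2)" if "z \<in> inner_sector \<phi> \<inter> {z. Re z < 0}" for z
      proof -
        have "c1 * (norm z + norm w) \<le> norm (z - w)"
          using opp[of "- z"] that by (simp add: inner_sector_uminus norm_minus_commute)
        then show ?thesis unfolding F_def using that by (intro norm_cauchy_quotient bound c1 w0) auto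
      qed
    qed (use \<phi> in auto)
  qed
  moreover have "cis (pi - \<phi>) = - cis (-\<phi>)" "cis (pi + \<phi>) = - cis \<phi>" by (simp_all add: complex_eq_iff)
  ultimately show ?thesis
    using \<phi> by (simp add: sc.contour_expand F_def[abs_def])
qed

text \<open>The substitution z -> -z exchanges the components and changes the sign of the contour
  integral; the second sign comes from the denominator.\<close>

lemma cauchy_formula:
  assumes \<phi>: "0 < \<phi>'" "\<phi>' < \<phi>" "\<phi> < pi / 2" and S: "open S" "inner_sector \<phi> \<subseteq> S" and g: "g holomorphic_on S"
    and bound: "\<And>z. z \<in> inner_sector \<phi> \<Longrightarrow> norm (g z) \<le> C / (1 + norm z)"
    and w: "w \<in> inner_sector \<phi>'"
  shows "sc.contour \<phi> (\<lambda>z. g z / (z - w)) = 2 * pi * \<i> * g w"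
proof (cases "Re w > 0")
  case True
  then show ?thesis using cauchy_formula_right[OF assms] by blast
next
  case False
  then have "Re (- w) > 0" using inner_sector_Re_nz[OF w] by auto
  let ?g = "\<lambda>z. g (- z)"
  have "sc.contour \<phi> (\<lambda>z. ?g z / (z - - w)) = 2 * pi * \<i> * ?g (- w)"
  proof (rule cauchy_formula_right[OF \<phi>, where S="uminus ` S" and C=C])
    show "open (uminus ` S)" using S(1) by (rule open_negations)
    show "inner_sector \<phi> \<subseteq> uminus ` S"
      using S(2) inner_sector_uminus[of _ \<phi>] by (metis (no_types, lifting) image_eqI minus_minus subsetD subsetI)
    show "(\<lambda>z. g (- z)) holomorphic_on uminus ` S"
      using g by (intro holomorphic_on_compose_gen[of uminus _ g S, unfolded o_def] holomorphic_intros) auto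
  qed (use bound[of "- _"] inner_sector_uminus w \<open>Re (- w) > 0\<close> in auto)
  moreover have "sc.contour \<phi> (\<lambda>z. ?g z / (z - - w)) = - sc.contour \<phi> (\<lambda>z. g z / (- z + w))"
    using sc.contour_uminus[of \<phi> "\<lambda>z. g z / (- z + w)"] \<phi> by simp
  moreover have "(\<lambda>z. g z / (- z + w)) = (\<lambda>z. - (g z / (z - w)))"
    by (intro ext) (metis minus_diff_eq minus_divide_right uminus_add_conv_diff)
  ultimately show ?thesis by (simp add: sc.contour_minus)
qed

section \<open>Resolvent families of bisectorial type\<close>

context complex_structure
begin

section \<open>Interchange of two contour integrals\<close>

lemma ray_swap:
  assumes K: "continuous_on ({0<..} \<times> {0<..}) (\<lambda>(t, u). K (of_real t * d) (of_real u * d'))"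
    and G: "G integrable_on {0<..}" "\<And>t. t > 0 \<Longrightarrow> 0 \<le> G t" and E: "E integrable_on {0<..}" "\<And>u. u > 0 \<Longrightarrow> 0 \<le> E u"
    and le: "\<And>t u. t > 0 \<Longrightarrow> u > 0 \<Longrightarrow> norm (K (of_real t * d) (of_real u * d')) \<le> G t * E u"
  shows "(\<lambda>t. cmul d (ray d' (K (of_real t * d)))) integrable_on {0<..}"
    and "ray d (\<lambda>z. ray d' (K z)) = ray d' (\<lambda>w. ray d (\<lambda>z. K z w))"
proof -
  obtain B where B: "B > 0" "\<And>a b. norm (cmul a b) \<le> norm a * norm b * B"
    using cm.pos_bounded by blast
  define L where "L t u = cmul (d * d') (K (of_real t * d) (of_real u * d'))" for t u
  have cL: "continuous_on ({0<..} \<times> {0<..}) (\<lambda>(t, u). L t u)"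
    unfolding L_def case_prod_beta using K[unfolded case_prod_beta] by (intro cm.continuous_on continuous_on_const)
  have leL: "norm (L t u) \<le> (norm (d * d') * B * G t) * E u" if "t > 0" "u > 0" for t u
  proof -
    have "norm (L t u) \<le> norm (d * d') * norm (K (of_real t * d) (of_real u * d')) * B"
      unfolding L_def by (rule B)
    also have "\<dots> \<le> norm (d * d') * (G t * E u) * B"
      using le[OF that] B by (intro mult_right_mono mult_left_mono) auto
    finally show ?thesis by (simp add: mult_ac)
  qed
  have G': "(\<lambda>t. norm (d * d') * B * G t) integrable_on {0<..}" using G by (intro integrable_on_mult_right)
  have G'0: "0 \<le> norm (d * d') * B * G t" if "t > 0" for t using G(2)[OF that] B by auto
  have inner1: "cmul d (ray d' (K (of_real t * d))) = integral {0<..} (L t)" if t: "t > 0" for t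
  proof -
    have "ray_integrable d' (K (of_real t * d))"
    proof (rule ray_integrableI)
      show "continuous_on {0<..} (\<lambda>u. K (of_real t * d) (of_real u * d'))"
        by (rule continuous_on_compose2[OF K, of "{0<..}" "\<lambda>u. (t, u)", unfolded case_prod_conv])
           (use t in \<open>auto intro!: continuous_intros\<close>)
      show "(\<lambda>u. G t * E u) integrable_on {0<..}" using E by (intro integrable_on_mult_right)
    qed (use le t in auto)
    from ray_integrable_integrable[OF ray_integrable_cmul[OF this, of "d'"]]
    have "(\<lambda>u. cmul d' (K (of_real t * d) (of_real u * d'))) integrable_on {0<..}" .
    from integral_linear[OF this cm.bounded_linear_right, of d]
    show ?thesis by (simp add: o_def ray_def L_def[abs_def] cmul_cmul)
  qed
  have inner2: "cmul d' (ray d (\<lambda>z. K z (of_real u * d'))) = integral {0<..} (\<lambda>t. L t u)" if u: "u > 0" for u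
  proof -
    have "ray_integrable d (\<lambda>z. K z (of_real u * d'))"
    proof (rule ray_integrableI)
      show "continuous_on {0<..} (\<lambda>t. K (of_real t * d) (of_real u * d'))"
        by (rule continuous_on_compose2[OF K, of "{0<..}" "\<lambda>t. (t, u)", unfolded case_prod_conv])
           (use u in \<open>auto intro!: continuous_intros\<close>)
      show "(\<lambda>t. G t * E u) integrable_on {0<..}" using G by (intro integrable_on_mult_left)
    qed (use le u in auto)
    from ray_integrable_integrable[OF ray_integrable_cmul[OF this, of d]]
    have "(\<lambda>t. cmul d (K (of_real t * d) (of_real u * d'))) integrable_on {0<..}" .
    from integral_linear[OF this cm.bounded_linear_right, of d']
    show ?thesis by (simp add: o_def ray_def L_def[abs_def] cmul_cmul mult.commute)
  qed
  show "(\<lambda>t. cmul d (ray d' (K (of_real t * d)))) integrable_on {0<..}"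
    by (rule integrable_eq[OF fubini_rays_limit(1)[OF cL G' G'0 E leL]]) (use inner1 in auto)
  have "ray d (\<lambda>z. ray d' (K z)) = integral {0<..} (\<lambda>t. integral {0<..} (L t))"
    unfolding ray_def[of d] by (rule integral_cong) (use inner1 in auto)
  also have "\<dots> = integral {0<..} (\<lambda>u. integral {0<..} (\<lambda>t. L t u))"
    by (rule fubini_rays[OF cL G' G'0 E leL])
  also have "\<dots> = ray d' (\<lambda>w. ray d (\<lambda>z. K z w))"
    unfolding ray_def[of d'] by (rule integral_cong) (use inner2 in auto)
  finally show "ray d (\<lambda>z. ray d' (K z)) = ray d' (\<lambda>w. ray d (\<lambda>z. K z w))" .
qed

lemma contour_of_contour:
  assumes "\<And>d d'. d \<in> dirs \<phi>2 \<Longrightarrow> d' \<in> dirs \<phi>1 \<Longrightarrow> (\<lambda>t. cmul d (ray d' (K (of_real t * d)))) integrable_on {0<..}"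
  shows "contour \<phi>2 (\<lambda>z. contour \<phi>1 (K z)) =
     (\<Sum>d\<in>dirs \<phi>2. \<Sum>d'\<in>dirs \<phi>1. (dir_sgn d * dir_sgn d') *\<^sub>R ray d (\<lambda>z. ray d' (K z)))"
proof -
  have "ray d (\<lambda>z. contour \<phi>1 (K z)) = (\<Sum>d'\<in>dirs \<phi>1. dir_sgn d' *\<^sub>R ray d (\<lambda>z. ray d' (K z)))"
    if "d \<in> dirs \<phi>2" for d
    unfolding ray_def[of d] contour_def cm.sum_right cm.scaleR_right using assms[OF that]
    by (subst integral_sum) (auto intro!: integrable_cmul)
  then show ?thesis unfolding contour_def[of \<phi>2] by (simp add: scaleR_sum_right)
qed

lemma contour_swap:
  assumes K: "\<And>d d'. d \<in> dirs \<phi>2 \<Longrightarrow> d' \<in> dirs \<phi>1 \<Longrightarrow>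
      continuous_on ({0<..} \<times> {0<..}) (\<lambda>(t, u). K (of_real t * d) (of_real u * d'))"
    and G: "G integrable_on {0<..}" "\<And>t. t > 0 \<Longrightarrow> 0 \<le> G t" and E: "E integrable_on {0<..}" "\<And>u. u > 0 \<Longrightarrow> 0 \<le> E u"
    and le: "\<And>t u d d'. t > 0 \<Longrightarrow> u > 0 \<Longrightarrow> d \<in> dirs \<phi>2 \<Longrightarrow> d' \<in> dirs \<phi>1 \<Longrightarrow>
      norm (K (of_real t * d) (of_real u * d')) \<le> G t * E u"
  shows "contour \<phi>2 (\<lambda>z. contour \<phi>1 (K z)) = contour \<phi>1 (\<lambda>w. contour \<phi>2 (\<lambda>z. K z w))"
proof -
  have K': "continuous_on ({0<..} \<times> {0<..}) (\<lambda>(u, t). K (of_real t * d) (of_real u * d'))"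
    if "d \<in> dirs \<phi>2" "d' \<in> dirs \<phi>1" for d d'
    using continuous_on_compose2[OF K[OF that] continuous_on_swap, of "{0<..} \<times> {0<..}"]
    by (force simp: case_prod_beta)
  have le': "norm (K (of_real t * d) (of_real u * d')) \<le> E u * G t"
    if "u > 0" "t > 0" "d \<in> dirs \<phi>2" "d' \<in> dirs \<phi>1" for t u d d'
    using le[OF that(2,1,3,4)] by (simp add: mult.commute)
  have 1: "contour \<phi>2 (\<lambda>z. contour \<phi>1 (K z)) =
     (\<Sum>d\<in>dirs \<phi>2. \<Sum>d'\<in>dirs \<phi>1. (dir_sgn d * dir_sgn d') *\<^sub>R ray d (\<lambda>z. ray d' (K z)))"
    by (rule contour_of_contour) (rule ray_swap(1)[OF K G E le])
  have 2: "contour \<phi>1 (\<lambda>w. contour \<phi>2 (\<lambda>z. K z w)) =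
     (\<Sum>d'\<in>dirs \<phi>1. \<Sum>d\<in>dirs \<phi>2. (dir_sgn d' * dir_sgn d) *\<^sub>R ray d' (\<lambda>w. ray d (\<lambda>z. K z w)))"
    by (rule contour_of_contour) (rule ray_swap(1)[OF K' E G le'])
  show ?thesis unfolding 1 2
    by (subst sum.swap) (intro sum.cong refl arg_cong2[where f="(*\<^sub>R)"] ray_swap(2)[OF K G E le] mult.commute)
qed

lemma contour_cmul_const:
  assumes "sc.contour_integrable \<phi> k"
  shows "contour \<phi> (\<lambda>w. cmul (k w) X) = cmul (sc.contour \<phi> k) X"
    and "contour_integrable \<phi> (\<lambda>w. cmul (k w) X)"
proof -
  have bl: "bounded_linear (\<lambda>z. cmul z X)" by (rule cm.bounded_linear_left)
  have "ray d (\<lambda>w. cmul (k w) X) = cmul (sc.ray d k) X" if "d \<in> dirs \<phi>" for d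
    using sc.ray_linear[of d k "\<lambda>z. cmul z X" cmul, OF _ bl] assms that
    unfolding ray_def sc.contour_integrable_def by (simp add: cmul_cmul)
  then show "contour \<phi> (\<lambda>w. cmul (k w) X) = cmul (sc.contour \<phi> k) X"
    unfolding contour_def sc.contour_def by (simp add: cm.sum_left cm.scaleR_left)
  show "contour_integrable \<phi> (\<lambda>w. cmul (k w) X)"
    unfolding contour_integrable_def
  proof
    fix d assume "d \<in> dirs \<phi>"
    then have "sc.ray_integrable d k" using assms by (simp add: sc.contour_integrable_def)
    then obtain g where c: "continuous_on {0<..} (\<lambda>t. k (of_real t * d))"
      and g: "g integrable_on {0<..}" "\<And>t. t > 0 \<Longrightarrow> norm (k (of_real t * d)) \<le> g t"
      unfolding sc.ray_integrable_def by blast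
    obtain B where B: "B > 0" "\<And>a b. norm (cmul a b) \<le> norm a * norm b * B"
      using cm.pos_bounded by blast
    show "ray_integrable d (\<lambda>w. cmul (k w) X)"
    proof (rule ray_integrableI)
      show "continuous_on {0<..} (\<lambda>t. cmul (k (of_real t * d)) X)" by (rule bounded_linear.continuous_on[OF bl c])
      show "(\<lambda>t. g t * (norm X * B)) integrable_on {0<..}" using g(1) by (rule integrable_on_mult_left)
      show "norm (cmul (k (of_real t * d)) X) \<le> g t * (norm X * B)" if "t > 0" for t
        using B(2)[of "k (of_real t * d)" X] mult_right_mono[OF g(2)[OF that], of "norm X * B"] B(1)
        by (simp add: mult.assoc)
    qed
  qed
qed

end

section \<open>Function classes on the open double sector\<close>

definition bisector :: "real \<Rightarrow> complex set" where
  "bisector \<theta> = {w. \<bar>Im w\<bar> < tan \<theta> * \<bar>Re w\<bar>}"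

lemma open_bisector: "open (bisector \<theta>)"
  unfolding bisector_def by (intro open_Collect_less continuous_intros)

lemma bisector_nz: "w \<in> bisector \<theta> \<Longrightarrow> w \<noteq> 0" by (auto simp: bisector_def)

lemma inner_subset_bisector:
  assumes "0 < \<phi>" "\<phi> < \<theta>" "\<theta> < pi / 2" shows "inner_sector \<phi> \<subseteq> bisector \<theta>"
proof
  fix w assume w: "w \<in> inner_sector \<phi>"
  have "tan \<phi> < tan \<theta>" using assms by (intro tan_monotone) auto
  then have "tan \<phi> * \<bar>Re w\<bar> < tan \<theta> * \<bar>Re w\<bar>"
    using inner_sector_Re_nz[OF w] by (intro mult_strict_right_mono) auto
  then show "w \<in> bisector \<theta>" using w by (auto simp: inner_sector_def bisector_def)
qed

lemma bisector_subset_inner: "bisector \<theta> \<subseteq> inner_sector \<theta>"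
  by (auto simp: bisector_def inner_sector_def)

lemma bisector_scale: "t > 0 \<Longrightarrow> of_real t * w \<in> bisector \<theta> \<longleftrightarrow> w \<in> bisector \<theta>"
  by (simp add: bisector_def abs_mult mult.left_commute)

lemma bisector_scaleI: "w \<in> bisector \<theta> \<Longrightarrow> t > 0 \<Longrightarrow> of_real t * w \<in> bisector \<theta>"
  by (simp only: bisector_scale)

lemma dirs_bisector: "0 < \<phi> \<Longrightarrow> \<phi> < \<theta> \<Longrightarrow> \<theta> < pi / 2 \<Longrightarrow> d \<in> dirs \<phi> \<Longrightarrow> d \<in> bisector \<theta>"
  using dirs_inner[of d \<phi> 1] inner_subset_bisector[of \<phi> \<theta>] by auto

text \<open>
  On \<open>sector_decay\<close> all the contour integrals are dominated by the Cauchy kernel \<open>1 / (1 + t\<^sup>2)\<close>.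
\<close>

definition sector_null :: "real \<Rightarrow> (complex \<Rightarrow> complex) set" where
  "sector_null \<theta> = {h. h holomorphic_on bisector \<theta> \<and> bounded (h ` bisector \<theta>) \<and>
     (\<forall>d\<in>bisector \<theta>. norm d = 1 \<longrightarrow> (\<lambda>t. norm (h (of_real t * d)) / t) integrable_on {0<..})}"

definition sector_decay :: "real \<Rightarrow> (complex \<Rightarrow> complex) set" where
  "sector_decay \<theta> = {h. h holomorphic_on bisector \<theta> \<and>
     (\<exists>C. \<forall>z\<in>bisector \<theta>. norm (h z) \<le> C * (norm z / (1 + (norm z)\<^sup>2)))}"

text \<open>Everything the scalar calculus needs about an operator, on an arbitrary real Banach
  space: the complex structure \<open>J0\<close> and a resolvent off the closed double sector. The
  factor z - w of the resolvent identity is split into real and imaginary part because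
  \<open>cmul\<close> becomes available only through the sublocale below.\<close>

locale resolvent_family =
  fixes J0 :: "'v::banach \<Rightarrow>\<^sub>L 'v" and R :: "complex \<Rightarrow> 'v \<Rightarrow>\<^sub>L 'v" and \<omega> \<theta> :: real
  assumes J0: "J0 o\<^sub>L J0 = - id_blinfun" and angles: "0 < \<omega>" "\<omega> < \<theta>" "\<theta> < pi / 2"
    and R_J0: "\<And>w. tan \<omega> * \<bar>Re w\<bar> < \<bar>Im w\<bar> \<Longrightarrow> R w o\<^sub>L J0 = J0 o\<^sub>L R w"
    and resolvent_eq: "\<And>w z. tan \<omega> * \<bar>Re w\<bar> < \<bar>Im w\<bar> \<Longrightarrow> tan \<omega> * \<bar>Re z\<bar> < \<bar>Im z\<bar> \<Longrightarrow>
       R w - R z = Re (z - w) *\<^sub>R (R w o\<^sub>L R z) + Im (z - w) *\<^sub>R (J0 o\<^sub>L (R w o\<^sub>L R z))"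
    and R_bound: "\<And>\<phi>. \<omega> < \<phi> \<Longrightarrow> \<phi> < pi / 2 \<Longrightarrow> \<exists>C\<ge>0. \<forall>w\<in>outer_sector \<phi>. norm (R w) \<le> C / norm w"
begin

sublocale complex_structure "\<lambda>X :: 'v \<Rightarrow>\<^sub>L 'v. J0 o\<^sub>L X"
proof
  show "\<exists>K. \<forall>X. norm (J0 o\<^sub>L X) \<le> norm X * K"
    by (intro exI[of _ "norm J0"]) (metis mult.commute norm_blinfun_compose)
  have "blinfun_apply J0 (blinfun_apply J0 v) = - v" for v
    using arg_cong[OF J0, of "\<lambda>Y. blinfun_apply Y v"] by (simp add: blinfun.bilinear_simps)
  then show "J0 o\<^sub>L (J0 o\<^sub>L X) = - X" for X
    by (intro blinfun_eqI) (simp add: blinfun.bilinear_simps)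
qed (rule blinfun_eqI, simp add: blinfun.bilinear_simps)+

definition \<Omega> where "\<Omega> = {w. tan \<omega> * \<bar>Re w\<bar> < \<bar>Im w\<bar>}"

lemma open_\<Omega>: "open \<Omega>"
  unfolding \<Omega>_def by (intro open_Collect_less continuous_intros)

lemma outer_subset_\<Omega>:
  assumes "\<omega> < \<phi>" "\<phi> < pi / 2" shows "outer_sector \<phi> \<subseteq> \<Omega>"
proof
  fix w assume w: "w \<in> outer_sector \<phi>"
  have "tan \<omega> < tan \<phi>" using assms angles by (intro tan_monotone) auto
  show "w \<in> \<Omega>"
  proof (cases "Re w = 0")
    case True
    then show ?thesis using w by (auto simp: outer_sector_def \<Omega>_def complex_eq_iff)
  next
    case False
    then have "tan \<omega> * \<bar>Re w\<bar> < tan \<phi> * \<bar>Re w\<bar>" using \<open>tan \<omega> < tan \<phi>\<close> by (intro mult_strict_right_mono) auto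
    then show ?thesis using w by (auto simp: outer_sector_def \<Omega>_def)
  qed
qed

lemma cmul_compose: "cmul z X o\<^sub>L Y = cmul z (X o\<^sub>L Y)"
  by (rule blinfun_eqI) (simp add: cmul_def blinfun.bilinear_simps)

lemma compose_cmul: "X o\<^sub>L J0 = J0 o\<^sub>L X \<Longrightarrow> X o\<^sub>L cmul z Y = cmul z (X o\<^sub>L Y)"
proof (rule blinfun_eqI)
  fix v assume "X o\<^sub>L J0 = J0 o\<^sub>L X"
  then have "blinfun_apply X (blinfun_apply J0 (blinfun_apply Y v)) = blinfun_apply J0 (blinfun_apply X (blinfun_apply Y v))"
    by (metis blinfun_apply_blinfun_compose)
  then show "blinfun_apply (X o\<^sub>L cmul z Y) v = blinfun_apply (cmul z (X o\<^sub>L Y)) v"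
    by (simp add: cmul_def blinfun.bilinear_simps)
qed

lemma R_diff: "w \<in> \<Omega> \<Longrightarrow> z \<in> \<Omega> \<Longrightarrow> R w - R z = cmul (z - w) (R w o\<^sub>L R z)"
  using resolvent_eq by (simp add: \<Omega>_def cmul_def)

lemma R_R: "w \<in> \<Omega> \<Longrightarrow> z \<in> \<Omega> \<Longrightarrow> w \<noteq> z \<Longrightarrow> R w o\<^sub>L R z = cmul (1 / (z - w)) (R w - R z)"
  by (simp add: R_diff cmul_cmul)

end

section \<open>The functional calculus of a resolvent family\<close>

text \<open>The weight 1/t is what the resolvent bound C/|w| contributes on a ray. Only the boundary
  half-lines are constrained, which suffices for the linear theory at a fixed angle and admits
  quotients such as h w / (z - w).\<close>

definition ray_admissible :: "real \<Rightarrow> (complex \<Rightarrow> complex) \<Rightarrow> bool" where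
  "ray_admissible \<phi> h \<longleftrightarrow> continuous_on (inner_sector \<phi> \<inter> outer_sector \<phi>) h \<and>
     (\<forall>d\<in>dirs \<phi>. (\<lambda>t. norm (h (of_real t * d)) / t) integrable_on {0<..})"

lemma sector_null_continuous: "h \<in> sector_null \<theta> \<Longrightarrow> continuous_on (bisector \<theta>) h"
  unfolding sector_null_def by (auto intro: holomorphic_on_imp_continuous_on)

lemma sector_null_admissible:
  assumes "h \<in> sector_null \<theta>" "0 < \<phi>" "\<phi> < \<theta>" "\<theta> < pi / 2" shows "ray_admissible \<phi> h"
  unfolding ray_admissible_def
proof (intro conjI ballI)
  show "continuous_on (inner_sector \<phi> \<inter> outer_sector \<phi>) h"
    by (rule continuous_on_subset[OF sector_null_continuous[OF assms(1)]])
       (use inner_subset_bisector[OF assms(2-4)] in auto)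
  show "(\<lambda>t. norm (h (of_real t * d)) / t) integrable_on {0<..}" if "d \<in> dirs \<phi>" for d
    using assms(1) dirs_bisector[OF assms(2-4) that] norm_dirs[OF that] by (auto simp: sector_null_def)
qed

lemma continuous_on_bisector_ray:
  assumes "continuous_on (bisector \<theta>) h" "d \<in> bisector \<theta>"
  shows "continuous_on {0<..} (\<lambda>t. h (of_real t * d))"
  by (rule continuous_on_compose2[OF assms(1)]) (use bisector_scaleI[OF assms(2)] in \<open>auto intro!: continuous_intros\<close>)

lemma sector_decay_null: assumes "h \<in> sector_decay \<theta>" shows "h \<in> sector_null \<theta>"
proof -
  from assms obtain C where hol: "h holomorphic_on bisector \<theta>"
    and C: "\<And>z. z \<in> bisector \<theta> \<Longrightarrow> norm (h z) \<le> C * (norm z / (1 + (norm z)\<^sup>2))"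
    unfolding sector_decay_def by blast
  have cont: "continuous_on (bisector \<theta>) h" using hol by (rule holomorphic_on_imp_continuous_on)
  have pos: "1 + t\<^sup>2 > 0" for t :: real by (simp add: add_pos_nonneg)
  have "norm (h z) \<le> \<bar>C\<bar>" if "z \<in> bisector \<theta>" for z
  proof -
    have "norm z / (1 + (norm z)\<^sup>2) \<le> 1"
      using sum_squares_bound[of "norm z" 1] zero_le_power2[of "norm z"] pos[of "norm z"]
      by (simp add: pos_divide_le_eq)
    moreover have "norm z / (1 + (norm z)\<^sup>2) \<ge> 0" using pos by simp
    ultimately have "C * (norm z / (1 + (norm z)\<^sup>2)) \<le> \<bar>C\<bar> * 1" by (intro mult_mono) auto
    then show ?thesis using C[OF that] by simp
  qed
  then have "bounded (h ` bisector \<theta>)" unfolding bounded_iff by auto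
  moreover have "(\<lambda>t. norm (h (of_real t * d)) / t) integrable_on {0<..}" if d: "d \<in> bisector \<theta>" "norm d = 1" for d
  proof (rule continuous_dominated_on_ray[OF _ integrable_cauchy_kernel[of C]])
    show "continuous_on {0<..} (\<lambda>t. norm (h (of_real t * d)) / t)"
      by (intro continuous_intros continuous_on_bisector_ray[OF cont d(1)]) auto
    show "norm (norm (h (of_real t * d)) / t) \<le> C / (1 + t\<^sup>2)" if "t > 0" for t
      using C[OF bisector_scaleI[OF d(1) that]] that d(2) pos[of t] by (simp add: norm_mult field_simps)
  qed
  ultimately show ?thesis using hol by (auto simp: sector_null_def)
qed

context resolvent_family
begin

text \<open>The resolvent identity supplies its own local bound: near w the difference
  \<open>R z - R w\<close> is at most half of \<open>R z\<close> in norm, hence |R z| <= 2 |R w|,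
  and inserting this again gives a Lipschitz estimate.\<close>

lemma continuous_on_R: "continuous_on \<Omega> R"
proof (clarsimp simp: continuous_on_eq_continuous_at[OF open_\<Omega>])
  fix w assume w: "w \<in> \<Omega>"
  obtain B where B: "B > 0" "\<And>a b. norm (cmul a b) \<le> norm a * norm b * B"
    using cm.pos_bounded by blast
  have le: "norm (R z - R w) \<le> norm (z - w) * (2 * B * (norm (R w))\<^sup>2)"
    if z: "z \<in> \<Omega>" and close: "norm (z - w) * (B * norm (R w)) \<le> 1 / 2" for z
  proof -
    have "norm (R z - R w) \<le> norm (w - z) * norm (R z o\<^sub>L R w) * B"
      unfolding R_diff[OF z w] by (rule B)
    also have "\<dots> \<le> norm (w - z) * (norm (R z) * norm (R w)) * B"
      using B by (intro mult_right_mono mult_left_mono norm_blinfun_compose) auto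
    finally have 1: "norm (R z - R w) \<le> (norm (z - w) * (B * norm (R w))) * norm (R z)"
      by (simp add: norm_minus_commute mult_ac)
    also have "\<dots> \<le> 1 / 2 * norm (R z)" using close by (intro mult_right_mono) auto
    finally have "norm (R z) \<le> 2 * norm (R w)"
      using norm_triangle_ineq2[of "R z" "R w"] by simp
    then have "(norm (z - w) * (B * norm (R w))) * norm (R z) \<le> (norm (z - w) * (B * norm (R w))) * (2 * norm (R w))"
      using B by (intro mult_left_mono) auto
    then show ?thesis using 1 by (simp add: power2_eq_square mult_ac)
  qed
  have lim0: "((\<lambda>z. norm (z - w) * c) \<longlongrightarrow> 0) (at w)" for c :: real
    by (rule tendsto_eq_intros refl | simp)+
  have "eventually (\<lambda>z. norm (z - w) * (B * norm (R w)) < 1 / 2) (at w)"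
    by (rule order_tendstoD(2)[OF lim0]) simp
  moreover have "eventually (\<lambda>z. z \<in> \<Omega>) (at w)" using open_\<Omega> w by (rule eventually_at_in_open')
  ultimately have "eventually (\<lambda>z. norm (R z - R w) \<le> norm (z - w) * (2 * B * (norm (R w))\<^sup>2)) (at w)"
    by eventually_elim (use le in auto)
  then have "((\<lambda>z. R z - R w) \<longlongrightarrow> 0) (at w)"
    by (rule Lim_null_comparison[OF _ lim0])
  then show "isCont R w" unfolding isCont_def by (rule LIM_zero_cancel)
qed

lemma R_has_derivative:
  assumes w: "w \<in> \<Omega>" shows "(R has_derivative (\<lambda>h. cmul h (- (R w o\<^sub>L R w)))) (at w)"
  unfolding has_derivative_iff_norm
proof (intro conjI)
  show "bounded_linear (\<lambda>h. cmul h (- (R w o\<^sub>L R w)))" by (rule cm.bounded_linear_left)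
  obtain B where B: "B > 0" "\<And>a b. norm (cmul a b) \<le> norm a * norm b * B"
    using cm.pos_bounded by blast
  have ev: "eventually (\<lambda>z. z \<in> \<Omega>) (at w)" using open_\<Omega> w by (rule eventually_at_in_open')
  have le: "norm (norm (R z - R w - cmul (z - w) (- (R w o\<^sub>L R w))) / norm (z - w)) \<le> norm (R w) * norm (R w - R z) * B"
    if z: "z \<in> \<Omega>" for z
  proof (cases "z = w")
    case False
    have "R z - R w = - cmul (z - w) (R w o\<^sub>L R z)" using R_diff[OF w z] by (metis minus_diff_eq)
    then have "R z - R w - cmul (z - w) (- (R w o\<^sub>L R w)) = cmul (z - w) (R w o\<^sub>L (R w - R z))"
      by (simp add: cm.minus_right cm.diff_right[symmetric] bounded_bilinear.diff_right[OF bounded_bilinear_blinfun_compose])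
    then have "norm (R z - R w - cmul (z - w) (- (R w o\<^sub>L R w))) \<le> norm (z - w) * norm (R w o\<^sub>L (R w - R z)) * B"
      using B by simp
    also have "\<dots> \<le> norm (z - w) * (norm (R w) * norm (R w - R z)) * B"
      using B by (intro mult_right_mono mult_left_mono norm_blinfun_compose) auto
    finally show ?thesis using False by (simp add: pos_divide_le_eq mult_ac)
  qed (use B in auto)
  have "isCont R w" using continuous_on_R w by (simp add: continuous_on_eq_continuous_at[OF open_\<Omega>])
  then have "(R \<longlongrightarrow> R w) (at w)" by (simp add: isCont_def)
  then have "((\<lambda>z. norm (R w) * norm (R w - R z) * B) \<longlongrightarrow> norm (R w) * norm (R w - R w) * B) (at w)"
    by (intro tendsto_intros)
  then have lim0: "((\<lambda>z. norm (R w) * norm (R w - R z) * B) \<longlongrightarrow> 0) (at w)" by simp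
  show "((\<lambda>z. norm (R z - R w - cmul (z - w) (- (R w o\<^sub>L R w))) / norm (z - w)) \<longlongrightarrow> 0) (at w)"
    by (rule Lim_null_comparison[OF eventually_mono[OF ev le] lim0])
qed

lemma hR_has_derivative:
  assumes "h holomorphic_on S" "open S" "w \<in> S" "w \<in> \<Omega>"
  shows "((\<lambda>w. cmul (h w) (R w)) has_derivative
     (\<lambda>k. cmul k (cmul (h w) (- (R w o\<^sub>L R w)) + cmul (deriv h w) (R w)))) (at w)"
  using cm.FDERIV[OF holomorphic_has_derivative[OF assms(1,2,3)] R_has_derivative[OF assms(4)]]
  by (simp add: cmul_cmul cm.add_right mult.commute)

lemma continuous_hR':
  assumes "h holomorphic_on S" "open S" "T \<subseteq> S" "T \<subseteq> \<Omega>"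
  shows "continuous_on T (\<lambda>w. cmul (h w) (- (R w o\<^sub>L R w)) + cmul (deriv h w) (R w))"
  using holomorphic_on_imp_continuous_on[OF assms(1)] holomorphic_continuous_deriv[OF assms(1,2)] continuous_on_R
  by (intro continuous_intros cm.continuous_on bounded_bilinear.continuous_on[OF bounded_bilinear_blinfun_compose])
     (use assms(3,4) in \<open>blast intro: continuous_on_subset\<close>)+

section \<open>The Riesz-Dunford integral at a fixed angle\<close>

lemma contour_integrable_R:
  assumes \<phi>: "\<omega> < \<phi>" "\<phi> < pi / 2" and h: "ray_admissible \<phi> h"
  shows "contour_integrable \<phi> (\<lambda>w. cmul (h w) (R w))"
proof -
  obtain C where C: "C \<ge> 0" "\<And>w. w \<in> outer_sector \<phi> \<Longrightarrow> norm (R w) \<le> C / norm w" using R_bound[OF \<phi>] by blast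
  obtain B where B: "B > 0" "\<And>a b. norm (cmul a b) \<le> norm a * norm b * B"
    using cm.pos_bounded by blast
  have \<phi>0: "0 < \<phi>" using \<phi> angles by simp
  show ?thesis
  proof (rule contour_integrableI[where g="\<lambda>d t. norm (h (of_real t * d)) / t * (C * B)"])
    show "continuous_on (inner_sector \<phi> \<inter> outer_sector \<phi>) (\<lambda>w. cmul (h w) (R w))"
      using h continuous_on_subset[OF continuous_on_R, of "inner_sector \<phi> \<inter> outer_sector \<phi>"] outer_subset_\<Omega>[OF \<phi>]
      by (intro cm.continuous_on) (auto simp: ray_admissible_def)
    show "(\<lambda>t. norm (h (of_real t * d)) / t * (C * B)) integrable_on {0<..}" if "d \<in> dirs \<phi>" for d
      using h that by (intro integrable_on_mult_left) (auto simp: ray_admissible_def)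
    show "norm (cmul (h (of_real t * d)) (R (of_real t * d))) \<le> norm (h (of_real t * d)) / t * (C * B)"
      if "t > 0" "d \<in> dirs \<phi>" for t d
    proof -
      have "norm (R (of_real t * d)) \<le> C / t"
        using C(2)[OF dirs_outer[OF that(2,1) \<phi>0 \<phi>(2)]] norm_ray_dirs[OF that(2,1)] by simp
      then have "norm (h (of_real t * d)) * norm (R (of_real t * d)) * B \<le> norm (h (of_real t * d)) * (C / t) * B"
        using B by (intro mult_right_mono mult_left_mono) auto
      then show ?thesis using B(2)[of "h (of_real t * d)" "R (of_real t * d)"] by (simp add: mult_ac)
    qed
  qed (use \<phi> \<phi>0 in auto)
qed

definition Phi :: "real \<Rightarrow> (complex \<Rightarrow> complex) \<Rightarrow> 'v \<Rightarrow>\<^sub>L 'v" where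
  "Phi \<phi> h = cmul (1 / (2 * pi * \<i>)) (contour \<phi> (\<lambda>w. cmul (h w) (R w)))"

lemma Phi_cong:
  assumes "\<And>t d. d \<in> dirs \<phi> \<Longrightarrow> t > 0 \<Longrightarrow> h (of_real t * d) = k (of_real t * d)"
  shows "Phi \<phi> h = Phi \<phi> k"
  unfolding Phi_def using contour_cong[of \<phi> "\<lambda>w. cmul (h w) (R w)" "\<lambda>w. cmul (k w) (R w)"] assms by simp

lemma Phi_add:
  assumes "\<omega> < \<phi>" "\<phi> < pi / 2" "ray_admissible \<phi> h" "ray_admissible \<phi> k"
  shows "Phi \<phi> (\<lambda>w. h w + k w) = Phi \<phi> h + Phi \<phi> k"
  unfolding Phi_def cm.add_left
  using contour_add[OF contour_integrable_R[OF assms(1-3)] contour_integrable_R[OF assms(1,2,4)]]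
  by (simp add: cm.add_right)

lemma Phi_cmul:
  assumes "\<omega> < \<phi>" "\<phi> < pi / 2" "ray_admissible \<phi> h"
  shows "Phi \<phi> (\<lambda>w. c * h w) = cmul c (Phi \<phi> h)"
proof -
  have "contour \<phi> (\<lambda>w. cmul c (cmul (h w) (R w))) = cmul c (contour \<phi> (\<lambda>w. cmul (h w) (R w)))"
    by (rule contour_linear[OF contour_integrable_R[OF assms] cm.bounded_linear_right])
       (simp add: cmul_cmul mult.commute)
  then show ?thesis unfolding Phi_def by (simp add: cmul_cmul mult.commute)
qed

lemma bounded_linear_compose_right: "bounded_linear (\<lambda>Y. X o\<^sub>L Y)"
  by (rule bounded_bilinear.bounded_linear_right[OF bounded_bilinear_blinfun_compose])

lemma bounded_linear_compose_left: "bounded_linear (\<lambda>Y. Y o\<^sub>L X)"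
  by (rule bounded_bilinear.bounded_linear_left[OF bounded_bilinear_blinfun_compose])

text \<open>A left factor must commute with \<open>J0\<close> in order to pass the complex scalars.
  A right factor passes them always, since the complex structure itself acts by composition from the
  left.\<close>

lemma Phi_compose_left:
  assumes "\<omega> < \<phi>" "\<phi> < pi / 2" "ray_admissible \<phi> h" and X: "X o\<^sub>L J0 = J0 o\<^sub>L X"
  shows "X o\<^sub>L Phi \<phi> h = cmul (1 / (2 * pi * \<i>)) (contour \<phi> (\<lambda>w. cmul (h w) (X o\<^sub>L R w)))"
  using contour_linear[OF contour_integrable_R[OF assms(1-3)] bounded_linear_compose_right compose_cmul[OF X]]
  unfolding Phi_def compose_cmul[OF X] by simp

lemma Phi_compose_right:
  assumes "\<omega> < \<phi>" "\<phi> < pi / 2" "ray_admissible \<phi> h"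
  shows "Phi \<phi> h o\<^sub>L X = cmul (1 / (2 * pi * \<i>)) (contour \<phi> (\<lambda>w. cmul (h w) (R w o\<^sub>L X)))"
  using contour_linear[OF contour_integrable_R[OF assms(1-3)] bounded_linear_compose_left cmul_compose, of X]
  unfolding Phi_def cmul_compose by simp

lemma R_commute_J0: "w \<in> \<Omega> \<Longrightarrow> R w o\<^sub>L J0 = J0 o\<^sub>L R w"
  using R_J0 by (simp add: \<Omega>_def)

lemma dirs_\<Omega>: "\<omega> < \<phi> \<Longrightarrow> \<phi> < pi / 2 \<Longrightarrow> d \<in> dirs \<phi> \<Longrightarrow> t > 0 \<Longrightarrow> of_real t * d \<in> \<Omega>"
  using dirs_outer[of d \<phi> t] outer_subset_\<Omega>[of \<phi>] angles by auto

lemma Phi_commute_J0: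
  assumes "\<omega> < \<phi>" "\<phi> < pi / 2" "ray_admissible \<phi> h"
  shows "Phi \<phi> h o\<^sub>L J0 = J0 o\<^sub>L Phi \<phi> h"
  unfolding Phi_compose_right[OF assms] Phi_compose_left[OF assms refl]
  by (intro arg_cong[where f="cmul _"] contour_cong arg_cong[where f="cmul _"])
     (use R_commute_J0 dirs_\<Omega>[OF assms(1,2)] in auto)

text \<open>For decaying \<open>h\<close> the factor |w| / (1 + |w|^2) absorbs the 1/|w| of the
  resolvent and leaves a Cauchy kernel uniformly in the angle. For a general null function no such
  uniform bound is at hand.\<close>

lemma Phi_rotate:
  assumes \<phi>: "\<omega> < \<phi>1" "\<phi>1 \<le> \<phi>2" "\<phi>2 < \<theta>" and h: "h \<in> sector_decay \<theta>"
  shows "Phi \<phi>1 h = Phi \<phi>2 h"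
proof -
  from h obtain Ch where hol: "h holomorphic_on bisector \<theta>"
    and Ch: "\<And>z. z \<in> bisector \<theta> \<Longrightarrow> norm (h z) \<le> Ch * (norm z / (1 + (norm z)\<^sup>2))"
    unfolding sector_decay_def by blast
  have \<phi>': "\<phi>1 < pi / 2" "\<phi>2 < pi / 2" "0 < \<phi>1" "0 < \<phi>2" using \<phi> angles by auto
  obtain C where C: "C \<ge> 0" "\<And>w. w \<in> outer_sector \<phi>1 \<Longrightarrow> norm (R w) \<le> C / norm w" using R_bound[OF \<phi>(1) \<phi>'(1)] by blast
  obtain B where B: "B > 0" "\<And>a b. norm (cmul a b) \<le> norm a * norm b * B"
    using cm.pos_bounded by blast
  have sub: "outer_sector \<phi>1 \<inter> inner_sector \<phi>2 \<subseteq> bisector \<theta>" "outer_sector \<phi>1 \<inter> inner_sector \<phi>2 \<subseteq> \<Omega>"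
    using inner_subset_bisector[OF \<phi>'(4) \<phi>(3) angles(3)] outer_subset_\<Omega>[OF \<phi>(1) \<phi>'(1)] by auto
  have "contour \<phi>1 (\<lambda>w. cmul (h w) (R w)) = contour \<phi>2 (\<lambda>w. cmul (h w) (R w))"
  proof (rule contour_rotate[OF \<phi>'(3) \<phi>(2) \<phi>'(2), where C="Ch * C * B"])
    show "((\<lambda>w. cmul (h w) (R w)) has_derivative
     (\<lambda>k. cmul k (cmul (h w) (- (R w o\<^sub>L R w)) + cmul (deriv h w) (R w)))) (at w)"
      if "w \<in> outer_sector \<phi>1 \<inter> inner_sector \<phi>2" for w
      by (rule hR_has_derivative[OF hol open_bisector]) (use sub that in auto)
    show "continuous_on (outer_sector \<phi>1 \<inter> inner_sector \<phi>2)
      (\<lambda>w. cmul (h w) (- (R w o\<^sub>L R w)) + cmul (deriv h w) (R w))"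
      by (rule continuous_hR'[OF hol open_bisector sub])
    show "norm (cmul (h w) (R w)) \<le> Ch * C * B / (1 + (norm w)\<^sup>2)" if w: "w \<in> outer_sector \<phi>1 \<inter> inner_sector \<phi>2" for w
    proof -
      have nz: "w \<noteq> 0" using w sector_nz by auto
      have h: "norm (h w) \<le> Ch * (norm w / (1 + (norm w)\<^sup>2))" using Ch sub w by blast
      have "norm (cmul (h w) (R w)) \<le> norm (h w) * norm (R w) * B" by (rule B)
      also have "\<dots> \<le> (Ch * (norm w / (1 + (norm w)\<^sup>2))) * (C / norm w) * B"
        using B(1) h C w order_trans[OF norm_ge_zero h] by (intro mult_right_mono mult_mono) auto
      also have "\<dots> = Ch * C * B / (1 + (norm w)\<^sup>2)" using nz by simp
      finally show ?thesis .
    qed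
  qed
  then show ?thesis unfolding Phi_def by simp
qed

end

lemma sector_decay_bound:
  assumes "norm g \<le> C * (norm z / (1 + (norm z)\<^sup>2))" shows "norm g \<le> (2 * \<bar>C\<bar>) / (1 + norm (z::complex))"
proof -
  define t where "t = norm z"
  have t0: "t \<ge> 0" by (simp add: t_def)
  have pos: "1 + t\<^sup>2 > 0" by (simp add: add_pos_nonneg)
  have "2 * t \<le> 1 + t\<^sup>2" using sum_squares_bound[of t 1] by simp
  moreover have aux: "a + s \<le> 2 * (1 + s)" if "2 * a \<le> 1 + s" "0 \<le> s" for a s :: real using that by simp
  ultimately have "t + t\<^sup>2 \<le> 2 * (1 + t\<^sup>2)" by (intro aux) auto
  then have "t * (1 + t) \<le> 2 * (1 + t\<^sup>2)" by (simp add: distrib_left power2_eq_square)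
  then have "(t * (1 + t)) / ((1 + t\<^sup>2) * (1 + t)) \<le> (2 * (1 + t\<^sup>2)) / ((1 + t\<^sup>2) * (1 + t))"
    using pos t0 by (intro divide_right_mono) auto
  moreover have "(t * (1 + t)) / ((1 + t\<^sup>2) * (1 + t)) = t / (1 + t\<^sup>2)"
    by (rule mult_divide_mult_cancel_right) (use t0 in simp)
  moreover have "(2 * (1 + t\<^sup>2)) / ((1 + t\<^sup>2) * (1 + t)) = 2 / (1 + t)"
    unfolding mult.commute[of 2 "1 + t\<^sup>2"] by (rule mult_divide_mult_cancel_left) (use pos in simp)
  ultimately have le: "t / (1 + t\<^sup>2) \<le> 2 / (1 + t)" by (simp only:)
  have "C * (t / (1 + t\<^sup>2)) \<le> \<bar>C\<bar> * (t / (1 + t\<^sup>2))"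
    by (rule mult_right_mono) (use pos t0 in auto)
  with assms have "norm g \<le> \<bar>C\<bar> * (t / (1 + t\<^sup>2))" unfolding t_def by (rule order_trans)
  also have "\<dots> \<le> \<bar>C\<bar> * (2 / (1 + t))" using le by (intro mult_left_mono) auto
  also have "\<dots> = (2 * \<bar>C\<bar>) / (1 + t)" by (simp only: times_divide_eq_right mult.commute)
  finally show ?thesis unfolding t_def .
qed

section \<open>Stability of the function classes and approximation by decaying functions\<close>

lemma ray_admissible_mult_bounded:
  assumes h: "ray_admissible \<phi> h" and \<phi>: "0 < \<phi>" "\<phi> < pi / 2"
    and k: "continuous_on (inner_sector \<phi> \<inter> outer_sector \<phi>) k"
    and M: "\<And>w. w \<in> inner_sector \<phi> \<inter> outer_sector \<phi> \<Longrightarrow> norm (k w) \<le> M"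
  shows "ray_admissible \<phi> (\<lambda>w. k w * h w)"
  unfolding ray_admissible_def
proof (intro conjI ballI)
  show c: "continuous_on (inner_sector \<phi> \<inter> outer_sector \<phi>) (\<lambda>w. k w * h w)"
    using h k by (intro continuous_intros) (auto simp: ray_admissible_def)
  fix d assume d: "d \<in> dirs \<phi>"
  have mem: "of_real t * d \<in> inner_sector \<phi> \<inter> outer_sector \<phi>" if "t > 0" for t
    using dirs_inner[OF d that \<phi>] dirs_outer[OF d that \<phi>] by blast
  show "(\<lambda>t. norm (k (of_real t * d) * h (of_real t * d)) / t) integrable_on {0<..}"
  proof (rule continuous_dominated_on_ray)
    show "continuous_on {0<..} (\<lambda>t. norm (k (of_real t * d) * h (of_real t * d)) / t)"
      by (intro continuous_on_divide continuous_on_norm continuous_on_compose2[OF c])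
         (use mem in \<open>auto intro!: continuous_intros\<close>)
    show "(\<lambda>t. M * (norm (h (of_real t * d)) / t)) integrable_on {0<..}"
      using h d by (intro integrable_on_mult_right) (auto simp: ray_admissible_def)
    show "norm (norm (k (of_real t * d) * h (of_real t * d)) / t) \<le> M * (norm (h (of_real t * d)) / t)" if "t > 0" for t
    proof -
      have "norm (k (of_real t * d)) * norm (h (of_real t * d)) / t \<le> M * norm (h (of_real t * d)) / t"
        using M[OF mem[OF that]] that by (intro divide_right_mono mult_right_mono) auto
      then show ?thesis using that by (simp add: norm_mult)
    qed
  qed
qed

lemma sector_null_mult_bounded:
  assumes h: "h \<in> sector_null \<theta>" and k: "k holomorphic_on bisector \<theta>" "bounded (k ` bisector \<theta>)"
  shows "(\<lambda>w. k w * h w) \<in> sector_null \<theta>"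
proof -
  obtain M where M: "\<And>w. w \<in> bisector \<theta> \<Longrightarrow> norm (k w) \<le> M" using k(2) unfolding bounded_iff by auto
  obtain N where N: "\<And>w. w \<in> bisector \<theta> \<Longrightarrow> norm (h w) \<le> N"
    using h unfolding sector_null_def bounded_iff by auto
  have hol: "(\<lambda>w. k w * h w) holomorphic_on bisector \<theta>"
    using h k by (intro holomorphic_intros) (auto simp: sector_null_def)
  have "bounded ((\<lambda>w. k w * h w) ` bisector \<theta>)"
    unfolding bounded_iff
  proof (intro exI[of _ "M * N"] ballI)
    fix y assume "y \<in> (\<lambda>w. k w * h w) ` bisector \<theta>"
    then obtain w where w: "w \<in> bisector \<theta>" "y = k w * h w" by auto
    have "norm (k w) * norm (h w) \<le> M * N"
      using M[OF w(1)] N[OF w(1)] order_trans[OF norm_ge_zero M[OF w(1)]] by (intro mult_mono) auto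
    then show "norm y \<le> M * N" by (simp add: w norm_mult)
  qed
  moreover have "(\<lambda>t. norm (k (of_real t * d) * h (of_real t * d)) / t) integrable_on {0<..}"
    if d: "d \<in> bisector \<theta>" "norm d = 1" for d
  proof (rule continuous_dominated_on_ray)
    show "continuous_on {0<..} (\<lambda>t. norm (k (of_real t * d) * h (of_real t * d)) / t)"
      using continuous_on_bisector_ray[OF holomorphic_on_imp_continuous_on[OF hol] d(1)]
      by (intro continuous_on_divide continuous_on_norm) auto
    show "(\<lambda>t. M * (norm (h (of_real t * d)) / t)) integrable_on {0<..}"
      using h d by (intro integrable_on_mult_right) (auto simp: sector_null_def)
    show "norm (norm (k (of_real t * d) * h (of_real t * d)) / t) \<le> M * (norm (h (of_real t * d)) / t)" if "t > 0" for t
    proof -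
      have "norm (k (of_real t * d)) * norm (h (of_real t * d)) / t \<le> M * norm (h (of_real t * d)) / t"
        using M[OF bisector_scaleI[OF d(1) that]] that by (intro divide_right_mono mult_right_mono) auto
      then show ?thesis using that by (simp add: norm_mult)
    qed
  qed
  ultimately show ?thesis using hol by (auto simp: sector_null_def)
qed

lemma sector_null_add:
  assumes "h \<in> sector_null \<theta>" "k \<in> sector_null \<theta>" shows "(\<lambda>w. h w + k w) \<in> sector_null \<theta>"
proof -
  have hol: "(\<lambda>w. h w + k w) holomorphic_on bisector \<theta>"
    using assms by (intro holomorphic_intros) (auto simp: sector_null_def)
  have bd: "bounded ((\<lambda>w. h w + k w) ` bisector \<theta>)"
    using assms bounded_plus_comp[of h "bisector \<theta>" k] by (auto simp: sector_null_def)
  have "(\<lambda>t. norm (h (of_real t * d) + k (of_real t * d)) / t) integrable_on {0<..}"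
    if d: "d \<in> bisector \<theta>" "norm d = 1" for d
  proof (rule continuous_dominated_on_ray)
    show "continuous_on {0<..} (\<lambda>t. norm (h (of_real t * d) + k (of_real t * d)) / t)"
      using continuous_on_bisector_ray[OF holomorphic_on_imp_continuous_on[OF hol] d(1)]
      by (intro continuous_on_divide continuous_on_norm) auto
    show "(\<lambda>t. norm (h (of_real t * d)) / t + norm (k (of_real t * d)) / t) integrable_on {0<..}"
      using assms d by (intro integrable_add) (auto simp: sector_null_def)
    show "norm (norm (h (of_real t * d) + k (of_real t * d)) / t) \<le> norm (h (of_real t * d)) / t + norm (k (of_real t * d)) / t"
      if "t > 0" for t
      using that norm_triangle_ineq[of "h (of_real t * d)" "k (of_real t * d)"]
      by (simp add: add_divide_distrib[symmetric] divide_right_mono)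
  qed
  then show ?thesis using hol bd by (auto simp: sector_null_def)
qed

text \<open>1 + w^2 = (i - w)(-i - w), and i and -i lie in the outer sector of every angle, so the
  bound is the product of two instances of \<open>sector_dist\<close>.\<close>

lemma one_plus_square_bound:
  assumes "0 < \<theta>" "\<theta> < pi / 2"
  shows "\<exists>c>0. \<forall>w\<in>inner_sector \<theta>. c * (1 + norm w)\<^sup>2 \<le> norm (1 + w\<^sup>2)"
proof -
  obtain \<phi> where \<phi>: "\<theta> < \<phi>" "\<phi> < pi / 2" using assms dense by blast
  then obtain c where c: "c > 0" "\<And>z w. z \<in> outer_sector \<phi> \<Longrightarrow> w \<in> inner_sector \<theta> \<Longrightarrow> c * (norm z + norm w) \<le> norm (z - w)"
    using sector_dist[OF assms(1) \<phi>] by blast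
  have "c\<^sup>2 * (1 + norm w)\<^sup>2 \<le> norm (1 + w\<^sup>2)" if w: "w \<in> inner_sector \<theta>" for w
  proof -
    have "c * (1 + norm w) \<le> norm (\<i> - w)" "c * (1 + norm w) \<le> norm (- \<i> - w)"
      using c(2)[of \<i> w] c(2)[of "-\<i>" w] w by (simp_all add: outer_sector_def)
    then have "(c * (1 + norm w)) * (c * (1 + norm w)) \<le> norm (\<i> - w) * norm (- \<i> - w)"
      using c(1) by (intro mult_mono) auto
    also have "\<dots> = norm (1 + w\<^sup>2)"
      unfolding norm_mult[symmetric] by (simp add: algebra_simps power2_eq_square)
    finally show ?thesis by (simp add: power2_eq_square mult_ac)
  qed
  then show ?thesis using c(1) by (intro exI[of _ "c\<^sup>2"]) auto
qed

lemma one_plus_square_nz: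
  assumes "0 < \<theta>" "\<theta> < pi / 2" "w \<in> inner_sector \<theta>" shows "1 + w\<^sup>2 \<noteq> 0"
proof
  assume "1 + w\<^sup>2 = 0"
  moreover obtain c where "c > 0" "c * (1 + norm w)\<^sup>2 \<le> norm (1 + w\<^sup>2)"
    using one_plus_square_bound[OF assms(1,2)] assms(3) by blast
  ultimately show False by (auto simp: mult_le_0_iff add_nonneg_eq_0_iff)
qed

text \<open>With x = 1/(n + 1), the factor 1/(1 + (x w)^2) cuts off at infinity and 1/(1 + (x/w)^2)
  at the origin. Both arguments stay in the double sector, which is invariant under scaling and
  inversion, so neither denominator vanishes and the bound is uniform in \<open>n\<close>.\<close>

definition reg :: "nat \<Rightarrow> complex \<Rightarrow> complex" where
  "reg n w = 1 / ((1 + (of_real (inverse (real (Suc n))) * w)\<^sup>2) * (1 + (of_real (inverse (real (Suc n))) * inverse w)\<^sup>2))"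

lemma inner_sector_scale: "t > 0 \<Longrightarrow> w \<in> inner_sector \<theta> \<Longrightarrow> of_real t * w \<in> inner_sector \<theta>"
  by (auto simp: inner_sector_def abs_mult mult.left_commute)

lemma inner_sector_inverse: "w \<in> inner_sector \<theta> \<Longrightarrow> inverse w \<in> inner_sector \<theta>"
proof -
  assume w: "w \<in> inner_sector \<theta>"
  let ?n = "(Re w)\<^sup>2 + (Im w)\<^sup>2"
  have n: "?n > 0" using sector_nz(1)[OF w] by (simp add: sum_power2_gt_zero_iff complex_eq_iff)
  have "\<bar>Im w\<bar> / ?n \<le> tan \<theta> * \<bar>Re w\<bar> / ?n" using w n by (intro divide_right_mono) (auto simp: inner_sector_def)
  then show ?thesis using w n by (simp add: inner_sector_def abs_divide)
qed

lemma reg_bounds: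
  assumes "0 < \<theta>" "\<theta> < pi / 2"
  obtains M where "\<And>n w. w \<in> bisector \<theta> \<Longrightarrow> norm (reg n w) \<le> M"
    and "\<And>n w. w \<in> bisector \<theta> \<Longrightarrow> norm (reg n w) \<le> M * real (Suc n) ^ 3 * (norm w / (1 + (norm w)\<^sup>2))"
proof -
  obtain c where c: "c > 0" "\<And>w. w \<in> inner_sector \<theta> \<Longrightarrow> c * (1 + norm w)\<^sup>2 \<le> norm (1 + w\<^sup>2)"
    using one_plus_square_bound[OF assms] by blast
  have main: "norm (reg n w) \<le> 1 / ((c * (1 + x * t)\<^sup>2) * (c * (1 + x / t)\<^sup>2))"
    if w: "w \<in> bisector \<theta>" and x: "x = inverse (real (Suc n))" and t: "t = norm w" for n w x t
  proof -
    have x0: "x > 0" by (simp add: x)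
    have t0: "t > 0" using bisector_nz[OF w] by (simp add: t)
    have w': "w \<in> inner_sector \<theta>" using w bisector_subset_inner by auto
    have 1: "c * (1 + x * t)\<^sup>2 \<le> norm (1 + (of_real x * w)\<^sup>2)"
      using c(2)[OF inner_sector_scale[OF x0 w']] x0 by (simp add: norm_mult t)
    have 2: "c * (1 + x / t)\<^sup>2 \<le> norm (1 + (of_real x * inverse w)\<^sup>2)"
      using c(2)[OF inner_sector_scale[OF x0 inner_sector_inverse[OF w']]] x0
      by (simp add: norm_mult norm_inverse t divide_inverse)
    have "0 < c * (1 + x * t)\<^sup>2" "0 < c * (1 + x / t)\<^sup>2"
      using c(1) x0 t0 by (auto intro!: mult_pos_pos zero_less_power add_pos_pos)
    then show ?thesis unfolding reg_def norm_divide norm_mult x[symmetric] norm_one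
      by (intro frac_le[OF _ _ mult_pos_pos mult_mono[OF 1 2]]) auto
  qed
  show thesis
  proof (rule that[of "1 / c\<^sup>2"])
    fix n and w :: complex assume w: "w \<in> bisector \<theta>"
    define x t where "x = inverse (real (Suc n))" and "t = norm w"
    have x0: "x > 0" "x \<le> 1" by (auto simp: x_def field_simps)
    have t0: "t > 0" using bisector_nz[OF w] by (simp add: t_def)
    note m = main[OF w x_def t_def]
    have P: "0 < (c * (1 + x * t)\<^sup>2) * (c * (1 + x / t)\<^sup>2)"
      using c(1) x0 t0 by (auto intro!: mult_pos_pos zero_less_power add_pos_pos)
    have "c * c \<le> (c * (1 + x * t)\<^sup>2) * (c * (1 + x / t)\<^sup>2)"
      using c(1) x0 t0 by (intro mult_mono) (auto intro!: one_le_power)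
    then have "1 / ((c * (1 + x * t)\<^sup>2) * (c * (1 + x / t)\<^sup>2)) \<le> 1 / (c * c)"
      using c(1) P by (intro divide_left_mono mult_pos_pos[OF P]) auto
    then show "norm (reg n w) \<le> 1 / c\<^sup>2" using m by (simp add: power2_eq_square)
    have pos: "1 + t\<^sup>2 > 0" by (simp add: add_pos_nonneg)
    \<comment> \<open>One factor contributes x^2 (1 + t^2), the other x/t. Their product x^3 (1 +
      t^2) / t explains both the cube of n + 1 and the decay t / (1 + t^2).\<close>
    have "x\<^sup>2 * (1 + t\<^sup>2) \<le> (1 + x * t)\<^sup>2"
    proof -
      have "x\<^sup>2 \<le> 1" using x0 by (simp add: power_le_one)
      moreover have "(1 + x * t)\<^sup>2 = 1 + 2 * (x * t) + x\<^sup>2 * t\<^sup>2" by (simp add: power2_eq_square algebra_simps)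
      moreover have "0 \<le> x * t" using x0 t0 by simp
      ultimately show ?thesis by (simp add: algebra_simps)
    qed
    moreover have "x / t \<le> (1 + x / t)\<^sup>2"
    proof -
      have "0 \<le> x / t" using x0 t0 by simp
      then show ?thesis using self_le_power[of "1 + x / t" 2] by simp
    qed
    ultimately have "(c * (x\<^sup>2 * (1 + t\<^sup>2))) * (c * (x / t)) \<le> (c * (1 + x * t)\<^sup>2) * (c * (1 + x / t)\<^sup>2)"
      using c(1) x0 t0 pos by (intro mult_mono) auto
    then have "1 / ((c * (1 + x * t)\<^sup>2) * (c * (1 + x / t)\<^sup>2)) \<le> 1 / ((c * (x\<^sup>2 * (1 + t\<^sup>2))) * (c * (x / t)))"
    proof (rule divide_left_mono[OF _ zero_le_one mult_pos_pos[OF P]])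
      show "0 < (c * (x\<^sup>2 * (1 + t\<^sup>2))) * (c * (x / t))"
        using c(1) x0 t0 pos by (intro mult_pos_pos divide_pos_pos zero_less_power)
    qed
    also have "\<dots> = 1 / c\<^sup>2 * (1 / x) ^ 3 * (t / (1 + t\<^sup>2))"
      using c(1) x0 t0 by (simp add: power2_eq_square power3_eq_cube)
    also have "1 / x = real (Suc n)" by (simp add: x_def divide_inverse del: of_nat_Suc)
    finally have "1 / ((c * (1 + x * t)\<^sup>2) * (c * (1 + x / t)\<^sup>2)) \<le> 1 / c\<^sup>2 * real (Suc n) ^ 3 * (t / (1 + t\<^sup>2))" .
    from order_trans[OF m this]
    show "norm (reg n w) \<le> 1 / c\<^sup>2 * real (Suc n) ^ 3 * (norm w / (1 + (norm w)\<^sup>2))" unfolding t_def .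
  qed
qed

lemma reg_holomorphic:
  assumes "0 < \<theta>" "\<theta> < pi / 2" shows "reg n holomorphic_on bisector \<theta>"
proof -
  have x0: "inverse (real (Suc n)) > 0" by simp
  have "(1 + (of_real (inverse (real (Suc n))) * w)\<^sup>2) * (1 + (of_real (inverse (real (Suc n))) * inverse w)\<^sup>2) \<noteq> 0"
    if "w \<in> bisector \<theta>" for w
  proof -
    have w': "w \<in> inner_sector \<theta>" using that bisector_subset_inner by auto
    show ?thesis
      using one_plus_square_nz[OF assms inner_sector_scale[OF x0 w']]
        one_plus_square_nz[OF assms inner_sector_scale[OF x0 inner_sector_inverse[OF w']]] by simp
  qed
  then show ?thesis unfolding reg_def[abs_def]
    by (intro holomorphic_intros) (auto simp: bisector_nz simp del: of_real_inverse)
qed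

lemma reg_decay:
  assumes "0 < \<theta>" "\<theta> < pi / 2" "h \<in> sector_null \<theta>" shows "(\<lambda>w. reg n w * h w) \<in> sector_decay \<theta>"
proof -
  obtain M where M: "\<And>n w. w \<in> bisector \<theta> \<Longrightarrow> norm (reg n w) \<le> M * real (Suc n) ^ 3 * (norm w / (1 + (norm w)\<^sup>2))"
    using reg_bounds[OF assms(1,2)] by metis
  obtain N where N: "\<And>w. w \<in> bisector \<theta> \<Longrightarrow> norm (h w) \<le> N"
    using assms(3) unfolding sector_null_def bounded_iff by auto
  have "norm (reg n w * h w) \<le> (M * real (Suc n) ^ 3 * N) * (norm w / (1 + (norm w)\<^sup>2))" if w: "w \<in> bisector \<theta>" for w
  proof -
    have "norm (reg n w) * norm (h w) \<le> (M * real (Suc n) ^ 3 * (norm w / (1 + (norm w)\<^sup>2))) * N"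
      using M[OF w, of n] N[OF w] order_trans[OF norm_ge_zero M[OF w, of n]] by (intro mult_mono) auto
    then show ?thesis by (simp add: norm_mult mult_ac)
  qed
  moreover have "(\<lambda>w. reg n w * h w) holomorphic_on bisector \<theta>"
    using assms(3) reg_holomorphic[OF assms(1,2)] by (intro holomorphic_intros) (auto simp: sector_null_def)
  ultimately show ?thesis unfolding sector_decay_def by blast
qed

lemma reg_tendsto: "(\<lambda>n. reg n w) \<longlonglongrightarrow> 1"
proof -
  have x: "(\<lambda>n. complex_of_real (inverse (real (Suc n)))) \<longlonglongrightarrow> 0"
    using tendsto_of_real[OF LIMSEQ_inverse_real_of_nat, where 'a=complex] by simp
  have "(\<lambda>n. reg n w) \<longlonglongrightarrow> 1 / ((1 + (0 * w)\<^sup>2) * (1 + (0 * inverse w)\<^sup>2))"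
    unfolding reg_def by (intro tendsto_intros x) auto
  then show ?thesis by simp
qed

context resolvent_family
begin

text \<open>\<open>K\<close> does not depend on \<open>h\<close>: \<open>Phi \<phi>\<close> is
  continuous for the weighted L1 norms on the four boundary half-lines. This reduces limits of
  operators to limits of real integrals.\<close>

lemma Phi_norm_bound:
  assumes \<phi>: "\<omega> < \<phi>" "\<phi> < pi / 2"
  shows "\<exists>K. \<forall>h. ray_admissible \<phi> h \<longrightarrow>
     norm (Phi \<phi> h) \<le> K * (\<Sum>d\<in>dirs \<phi>. integral {0<..} (\<lambda>t. norm (h (of_real t * d)) / t))"
proof -
  obtain C where C: "C \<ge> 0" "\<And>w. w \<in> outer_sector \<phi> \<Longrightarrow> norm (R w) \<le> C / norm w" using R_bound[OF \<phi>] by blast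
  obtain B where B: "B > 0" "\<And>a b. norm (cmul a b) \<le> norm a * norm b * B"
    using cm.pos_bounded by blast
  have \<phi>0: "0 < \<phi>" using \<phi> angles by simp
  have "norm (Phi \<phi> h) \<le> (norm (1 / (2 * pi * \<i>)) * B * (C * B\<^sup>2)) * (\<Sum>d\<in>dirs \<phi>. integral {0<..} (\<lambda>t. norm (h (of_real t * d)) / t))"
    if h: "ray_admissible \<phi> h" for h
  proof -
    have ray: "norm (ray d (\<lambda>w. cmul (h w) (R w))) \<le> C * B\<^sup>2 * integral {0<..} (\<lambda>t. norm (h (of_real t * d)) / t)"
      if d: "d \<in> dirs \<phi>" for d
    proof -
      have i: "ray_integrable d (\<lambda>w. cmul (h w) (R w))"
        using contour_integrable_R[OF \<phi> h] d by (simp add: contour_integrable_def)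
      have g: "(\<lambda>t. C * B\<^sup>2 * (norm (h (of_real t * d)) / t)) integrable_on {0<..}"
        using h d by (intro integrable_on_mult_right) (auto simp: ray_admissible_def)
      have "norm (ray d (\<lambda>w. cmul (h w) (R w))) \<le> integral {0<..} (\<lambda>t. C * B\<^sup>2 * (norm (h (of_real t * d)) / t))"
        unfolding ray_def
      proof (rule integral_norm_bound_integral[OF ray_integrable_integrable[OF ray_integrable_cmul[OF i]] g])
        fix t :: real assume "t \<in> {0<..}"
        then have t: "t > 0" by simp
        have "norm (R (of_real t * d)) \<le> C / t"
          using C(2)[OF dirs_outer[OF d t \<phi>0 \<phi>(2)]] norm_ray_dirs[OF d t] by simp
        then have "norm (h (of_real t * d)) * norm (R (of_real t * d)) * B \<le> norm (h (of_real t * d)) * (C / t) * B"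
          using B by (intro mult_right_mono mult_left_mono) auto
        with B(2) have "norm (cmul (h (of_real t * d)) (R (of_real t * d))) \<le> norm (h (of_real t * d)) * (C / t) * B"
          by (rule order_trans)
        then have "norm d * norm (cmul (h (of_real t * d)) (R (of_real t * d))) * B \<le> 1 * (norm (h (of_real t * d)) * (C / t) * B) * B"
          using B norm_dirs[OF d] by (intro mult_right_mono) auto
        with B(2) have "norm (cmul d (cmul (h (of_real t * d)) (R (of_real t * d)))) \<le> 1 * (norm (h (of_real t * d)) * (C / t) * B) * B"
          by (rule order_trans)
        then show "norm (cmul d (cmul (h (of_real t * d)) (R (of_real t * d)))) \<le> C * B\<^sup>2 * (norm (h (of_real t * d)) / t)"
          by (simp add: power2_eq_square mult_ac)
      qed
      then show ?thesis by (simp only: integral_mult_right)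
    qed
    have "norm (contour \<phi> (\<lambda>w. cmul (h w) (R w))) \<le> (\<Sum>d\<in>dirs \<phi>. C * B\<^sup>2 * integral {0<..} (\<lambda>t. norm (h (of_real t * d)) / t))"
      unfolding contour_def
    proof (rule sum_norm_le)
      fix d assume d: "d \<in> dirs \<phi>"
      have "norm (dir_sgn d *\<^sub>R ray d (\<lambda>w. cmul (h w) (R w))) \<le> 1 * norm (ray d (\<lambda>w. cmul (h w) (R w)))"
        unfolding norm_scaleR by (intro mult_right_mono) (auto simp: dir_sgn_def sgn_real_def)
      then show "norm (dir_sgn d *\<^sub>R ray d (\<lambda>w. cmul (h w) (R w))) \<le> C * B\<^sup>2 * integral {0<..} (\<lambda>t. norm (h (of_real t * d)) / t)"
        using ray[OF d] by simp
    qed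
    then have "norm (1 / (2 * pi * \<i>)) * norm (contour \<phi> (\<lambda>w. cmul (h w) (R w))) * B \<le>
       norm (1 / (2 * pi * \<i>)) * (C * B\<^sup>2 * (\<Sum>d\<in>dirs \<phi>. integral {0<..} (\<lambda>t. norm (h (of_real t * d)) / t))) * B"
      using B by (intro mult_right_mono mult_left_mono) (auto simp: sum_distrib_left)
    with B(2) show ?thesis unfolding Phi_def by (rule order_trans[THEN order_trans]) (simp add: mult_ac)
  qed
  then show ?thesis by blast
qed

text \<open>Dominated convergence is applied to the real integrals of |(k n - 1) h| / t, with
  majorant (M + 1) |h| / t; \<open>Phi_norm_bound\<close> carries the result to the
  operators.\<close>

lemma Phi_limit:
  assumes \<phi>: "\<omega> < \<phi>" "\<phi> < pi / 2" and h: "ray_admissible \<phi> h"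
    and k: "\<And>n. continuous_on (inner_sector \<phi> \<inter> outer_sector \<phi>) (k n)"
    and M: "\<And>n w. w \<in> inner_sector \<phi> \<inter> outer_sector \<phi> \<Longrightarrow> norm (k n w) \<le> M"
    and lim: "\<And>w. w \<in> inner_sector \<phi> \<inter> outer_sector \<phi> \<Longrightarrow> (\<lambda>n. k n w) \<longlonglongrightarrow> 1"
  shows "(\<lambda>n. Phi \<phi> (\<lambda>w. k n w * h w)) \<longlonglongrightarrow> Phi \<phi> h"
proof -
  have \<phi>0: "0 < \<phi>" using \<phi> angles by simp
  obtain K where K: "\<And>h. ray_admissible \<phi> h \<Longrightarrow>
     norm (Phi \<phi> h) \<le> K * (\<Sum>d\<in>dirs \<phi>. integral {0<..} (\<lambda>t. norm (h (of_real t * d)) / t))"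
    using Phi_norm_bound[OF \<phi>] by blast
  have M1: "norm (k n w - 1) \<le> M + 1" if "w \<in> inner_sector \<phi> \<inter> outer_sector \<phi>" for n w
    using norm_triangle_ineq4[of "k n w" 1] M[OF that, of n] by simp
  have adm: "ray_admissible \<phi> (\<lambda>w. (k n w - 1) * h w)" for n
    by (rule ray_admissible_mult_bounded[OF h \<phi>0 \<phi>(2) _ M1]) (intro continuous_intros k)
  have eq: "Phi \<phi> (\<lambda>w. k n w * h w) - Phi \<phi> h = Phi \<phi> (\<lambda>w. (k n w - 1) * h w)" for n
    using Phi_add[OF \<phi> adm[of n] h] by (simp add: algebra_simps)
  have "(\<lambda>n. integral {0<..} (\<lambda>t. norm ((k n (of_real t * d) - 1) * h (of_real t * d)) / t)) \<longlonglongrightarrow> integral {0<..} (\<lambda>t::real. 0::real)"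
    if d: "d \<in> dirs \<phi>" for d
  proof (rule dominated_convergence(2)[where h="\<lambda>t. (M + 1) * (norm (h (of_real t * d)) / t)"])
    show "(\<lambda>t. norm ((k n (of_real t * d) - 1) * h (of_real t * d)) / t) integrable_on {0<..}" for n
      using adm[of n] d by (simp add: ray_admissible_def)
    show "(\<lambda>t. (M + 1) * (norm (h (of_real t * d)) / t)) integrable_on {0<..}"
      using h d by (intro integrable_on_mult_right) (auto simp: ray_admissible_def)
    fix t :: real assume "t \<in> {0<..}"
    then have t: "t > 0" by simp
    have mem: "of_real t * d \<in> inner_sector \<phi> \<inter> outer_sector \<phi>"
      using dirs_inner[OF d t \<phi>0 \<phi>(2)] dirs_outer[OF d t \<phi>0 \<phi>(2)] by blast
    show "norm (norm ((k n (of_real t * d) - 1) * h (of_real t * d)) / t) \<le> (M + 1) * (norm (h (of_real t * d)) / t)" for n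
    proof -
      have "norm (k n (of_real t * d) - 1) * norm (h (of_real t * d)) / t \<le> (M + 1) * norm (h (of_real t * d)) / t"
        using M1[OF mem, of n] t by (intro divide_right_mono mult_right_mono) auto
      then show ?thesis using t by (simp add: norm_mult)
    qed
    have "(\<lambda>n. norm ((k n (of_real t * d) - 1) * h (of_real t * d)) / t) \<longlonglongrightarrow> norm ((1 - 1) * h (of_real t * d)) / t"
      using t by (intro tendsto_intros lim[OF mem]) auto
    then show "(\<lambda>n. norm ((k n (of_real t * d) - 1) * h (of_real t * d)) / t) \<longlonglongrightarrow> 0" by simp
  qed
  then have "(\<lambda>n. K * (\<Sum>d\<in>dirs \<phi>. integral {0<..} (\<lambda>t. norm ((k n (of_real t * d) - 1) * h (of_real t * d)) / t)))
     \<longlonglongrightarrow> K * (\<Sum>d\<in>dirs \<phi>. 0)"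
    by (intro tendsto_intros) auto
  then have lim0: "(\<lambda>n. K * (\<Sum>d\<in>dirs \<phi>. integral {0<..} (\<lambda>t. norm ((k n (of_real t * d) - 1) * h (of_real t * d)) / t)))
     \<longlonglongrightarrow> 0" by simp
  have "(\<lambda>n. Phi \<phi> (\<lambda>w. k n w * h w) - Phi \<phi> h) \<longlonglongrightarrow> 0"
    by (rule Lim_null_comparison[OF always_eventually lim0]) (use K[OF adm] eq in simp)
  then show ?thesis by (rule LIM_zero_cancel)
qed

end

lemma sector_decayE:
  assumes "h \<in> sector_decay \<theta>"
  obtains C where "C \<ge> 0" "\<And>z. z \<in> bisector \<theta> \<Longrightarrow> norm (h z) \<le> C * (norm z / (1 + (norm z)\<^sup>2))"
    "h holomorphic_on bisector \<theta>"
proof -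
  from assms obtain C where hol: "h holomorphic_on bisector \<theta>"
    and C: "\<And>z. z \<in> bisector \<theta> \<Longrightarrow> norm (h z) \<le> C * (norm z / (1 + (norm z)\<^sup>2))"
    unfolding sector_decay_def by blast
  have "norm (h z) \<le> \<bar>C\<bar> * (norm z / (1 + (norm z)\<^sup>2))" if "z \<in> bisector \<theta>" for z
    by (rule order_trans[OF C[OF that] mult_right_mono[OF abs_ge_self]]) simp
  then show thesis using hol by (intro that[of "\<bar>C\<bar>"]) auto
qed

context resolvent_family
begin

section \<open>Multiplicativity of the scalar calculus\<close>

lemma outer_inner_disjoint:
  assumes "0 < \<phi>" "\<phi> < \<phi>'" "\<phi>' < pi / 2" "z \<in> outer_sector \<phi>'" "w \<in> inner_sector \<phi>" shows "z \<noteq> w"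
proof
  assume eq: "z = w"
  obtain c where c: "c > 0" "c * (norm z + norm w) \<le> norm (z - w)"
    using sector_dist[OF assms(1-3)] assms(4,5) by blast
  have "norm z + norm w > 0" using sector_nz(1)[OF assms(5)] by (simp add: add_nonneg_pos)
  from mult_pos_pos[OF c(1) this] c(2) have "norm (z - w) > 0" by (rule less_le_trans)
  then show False using eq by simp
qed

lemma admissible_resolvent_quotient:
  assumes h: "ray_admissible \<phi> h" and \<phi>: "0 < \<phi>" "\<phi> < \<phi>'" "\<phi>' < pi / 2" and z: "z \<in> outer_sector \<phi>'"
  shows "ray_admissible \<phi> (\<lambda>w. h w / (z - w))"
proof -
  obtain c where c: "c > 0" "\<And>z w. z \<in> outer_sector \<phi>' \<Longrightarrow> w \<in> inner_sector \<phi> \<Longrightarrow> c * (norm z + norm w) \<le> norm (z - w)"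
    using sector_dist[OF \<phi>] by blast
  have z0: "norm z > 0" using sector_nz(2)[OF z] by simp
  have "ray_admissible \<phi> (\<lambda>w. 1 / (z - w) * h w)"
  proof (rule ray_admissible_mult_bounded[OF h \<phi>(1)])
    show "continuous_on (inner_sector \<phi> \<inter> outer_sector \<phi>) (\<lambda>w. 1 / (z - w))"
      using outer_inner_disjoint[OF \<phi> z] by (intro continuous_intros) auto
    show "norm (1 / (z - w)) \<le> 1 / (c * norm z)" if w: "w \<in> inner_sector \<phi> \<inter> outer_sector \<phi>" for w
    proof -
      have "c * norm z \<le> c * (norm z + norm w)" using c(1) by (intro mult_left_mono) auto
      also have "\<dots> \<le> norm (z - w)" using c(2) z w by blast
      finally have "c * norm z \<le> norm (z - w)" .
      then show ?thesis unfolding norm_divide norm_one using mult_pos_pos[OF c(1) z0] by (intro frac_le) auto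
    qed
  qed (use \<phi> in auto)
  then show ?thesis by simp
qed

text \<open>The resolvent identity splits \<open>R w o\<^sub>L R z\<close> into (R w - R z) / (z -
  w). The term with \<open>R z\<close> has the scalar factor e w / (z - w), which is holomorphic in
  the inner sector because z lies outside it, so its contour integral vanishes.\<close>

lemma Phi_resolvent_decay:
  assumes e: "e \<in> sector_decay \<theta>" and \<phi>: "\<omega> < \<phi>" "\<phi> < \<theta>" "\<phi> < \<phi>'" "\<phi>' < pi / 2" and z: "z \<in> outer_sector \<phi>'"
  shows "Phi \<phi> e o\<^sub>L R z = Phi \<phi> (\<lambda>w. e w / (z - w))"
proof -
  have \<phi>0: "0 < \<phi>" "\<phi> < pi / 2" using \<phi> angles by auto
  obtain C where C: "C \<ge> 0" "\<And>z. z \<in> bisector \<theta> \<Longrightarrow> norm (e z) \<le> C * (norm z / (1 + (norm z)\<^sup>2))"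
    and hol: "e holomorphic_on bisector \<theta>" using sector_decayE[OF e] by blast
  have adm: "ray_admissible \<phi> e" using sector_null_admissible[OF sector_decay_null[OF e] \<phi>0(1) \<phi>(2) angles(3)] .
  have adm': "ray_admissible \<phi> (\<lambda>w. e w / (z - w))"
    by (rule admissible_resolvent_quotient[OF adm \<phi>0(1) \<phi>(3,4) z])
  obtain c where c: "c > 0" "\<And>z w. z \<in> outer_sector \<phi>' \<Longrightarrow> w \<in> inner_sector \<phi> \<Longrightarrow> c * (norm z + norm w) \<le> norm (z - w)"
    using sector_dist[OF \<phi>0(1) \<phi>(3,4)] by blast
  have z0: "z \<noteq> 0" using sector_nz(2)[OF z] .
  have z\<Omega>: "z \<in> \<Omega>" using outer_subset_\<Omega>[of \<phi>'] z \<phi> by auto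
  note ne = outer_inner_disjoint[OF \<phi>0(1) \<phi>(3,4) z]
  have sub: "inner_sector \<phi> \<subseteq> bisector \<theta>" by (rule inner_subset_bisector[OF \<phi>0(1) \<phi>(2) angles(3)])
  define F where "F w = e w / (z - w)" for w
  have op: "open (bisector \<theta> - {z})" using open_bisector by (simp add: open_delete)
  have F: "F holomorphic_on bisector \<theta> - {z}" unfolding F_def[abs_def]
    by (intro holomorphic_intros holomorphic_on_subset[OF hol]) auto
  have sub': "inner_sector \<phi> \<subseteq> bisector \<theta> - {z}" using sub ne by blast
  have bound: "norm (F w) \<le> (2 * \<bar>C\<bar> / c * (1 + 1 / norm z)) / (1 + (norm w)\<^sup>2)" if w: "w \<in> inner_sector \<phi>" for w
  proof -
    have 1: "norm (e w) \<le> (2 * \<bar>C\<bar>) / (1 + norm w)" using C(2) sub w by (intro sector_decay_bound) blast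
    have 2: "c * (norm w + norm z) \<le> norm (w - z)"
      using c(2)[OF z w] by (simp only: norm_minus_commute add.commute)
    have "norm (F w) = norm (e w / (w - z))" unfolding F_def norm_divide by (simp only: norm_minus_commute)
    then show ?thesis using norm_cauchy_quotient[OF 1 2 c(1) z0] by simp
  qed
  have zero: "sc.contour \<phi> F = 0"
  proof (rule sc.contour_inner_eq_0[OF \<phi>0])
    show "(F has_derivative (\<lambda>h. h * deriv F w)) (at w)" if "w \<in> inner_sector \<phi>" for w
      using holomorphic_has_derivative[OF F op] sub' that by blast
    show "continuous_on (inner_sector \<phi>) (deriv F)"
      by (rule continuous_on_subset[OF holomorphic_continuous_deriv[OF F op] sub'])
  qed (rule bound)
  have int: "sc.contour_integrable \<phi> F"
    unfolding sc.contour_integrable_def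
  proof
    fix d assume d: "d \<in> dirs \<phi>"
    show "sc.ray_integrable d F"
      by (rule sc.ray_integrable_cauchy_bound[OF _ dirs_inner[OF d _ \<phi>0] norm_dirs[OF d] bound])
         (rule continuous_on_subset[OF holomorphic_on_imp_continuous_on[OF F] sub'])
  qed
  have "contour \<phi> (\<lambda>w. cmul (e w) (R w o\<^sub>L R z)) = contour \<phi> (\<lambda>w. cmul (F w) (R w) - cmul (F w) (R z))"
  proof (rule contour_cong)
    fix t d assume d: "d \<in> dirs \<phi>" "t > (0::real)"
    have "of_real t * d \<in> inner_sector \<phi>" by (rule dirs_inner[OF d \<phi>0])
    then have "of_real t * d \<noteq> z" using ne by blast
    then show "cmul (e (of_real t * d)) (R (of_real t * d) o\<^sub>L R z) =
        cmul (F (of_real t * d)) (R (of_real t * d)) - cmul (F (of_real t * d)) (R z)"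
      unfolding R_R[OF dirs_\<Omega>[OF \<phi>(1) \<phi>0(2) d] z\<Omega> \<open>of_real t * d \<noteq> z\<close>] cmul_cmul F_def
      by (simp add: cm.diff_right)
  qed
  also have "\<dots> = contour \<phi> (\<lambda>w. cmul (F w) (R w)) - contour \<phi> (\<lambda>w. cmul (F w) (R z))"
    using contour_integrable_R[OF \<phi>(1) \<phi>0(2) adm'] contour_cmul_const(2)[OF int]
    by (intro contour_diff) (simp_all add: F_def[abs_def])
  also have "\<dots> = contour \<phi> (\<lambda>w. cmul (F w) (R w))"
    by (simp add: contour_cmul_const(1)[OF int] zero cm.zero_left)
  finally show ?thesis
    unfolding Phi_compose_right[OF \<phi>(1) \<phi>0(2) adm] unfolding Phi_def F_def by simp
qed

lemma decay_product_bound: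
  fixes t u :: real
  assumes "t > 0" "u > 0"
  shows "t / (1 + t\<^sup>2) * (u / (1 + u\<^sup>2)) / (t + u) / u \<le> 1 / (1 + t\<^sup>2) * (1 / (1 + u\<^sup>2))"
proof -
  have "t / (t + u) \<le> 1" using assms by simp
  then have "(t / (t + u)) * (1 / (1 + t\<^sup>2) * (1 / (1 + u\<^sup>2))) \<le> 1 * (1 / (1 + t\<^sup>2) * (1 / (1 + u\<^sup>2)))"
    by (rule mult_right_mono) simp
  moreover have "t / (1 + t\<^sup>2) * (u / (1 + u\<^sup>2)) / (t + u) / u = (t / (t + u)) * (1 / (1 + t\<^sup>2) * (1 / (1 + u\<^sup>2)))"
    using assms by simp
  ultimately show ?thesis by simp
qed

text \<open>The second factor is moved to a larger angle \<open>\<phi>2\<close> so that the two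
  contours keep apart. After \<open>Phi_resolvent_decay\<close> and an exchange of the integrals,
  the inner integral over the wider contour is Cauchy's formula for \<open>g\<close> at a point w of
  the narrower one.\<close>

lemma Phi_mult_decay:
  assumes e: "e \<in> sector_decay \<theta>" and g: "g \<in> sector_decay \<theta>" and \<phi>: "\<omega> < \<phi>" "\<phi> < \<theta>"
  shows "Phi \<phi> e o\<^sub>L Phi \<phi> g = Phi \<phi> (\<lambda>w. e w * g w)"
proof -
  obtain \<phi>2 where \<phi>2: "\<phi> < \<phi>2" "\<phi>2 < \<theta>" using \<phi> dense by blast
  have \<phi>0: "0 < \<phi>" "\<phi> < pi / 2" "0 < \<phi>2" "\<phi>2 < pi / 2" "\<omega> < \<phi>2" using \<phi> \<phi>2 angles by auto
  obtain Ce where Ce: "Ce \<ge> 0" "\<And>z. z \<in> bisector \<theta> \<Longrightarrow> norm (e z) \<le> Ce * (norm z / (1 + (norm z)\<^sup>2))"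
    and hole: "e holomorphic_on bisector \<theta>" using sector_decayE[OF e] by blast
  obtain Cg where Cg: "Cg \<ge> 0" "\<And>z. z \<in> bisector \<theta> \<Longrightarrow> norm (g z) \<le> Cg * (norm z / (1 + (norm z)\<^sup>2))"
    and holg: "g holomorphic_on bisector \<theta>" using sector_decayE[OF g] by blast
  have adme: "ray_admissible \<phi> e" using sector_null_admissible[OF sector_decay_null[OF e] \<phi>0(1) \<phi>(2) angles(3)] .
  have admg: "ray_admissible \<phi>2 g" using sector_null_admissible[OF sector_decay_null[OF g] \<phi>0(3) \<phi>2(2) angles(3)] .
  obtain c where c: "c > 0" "\<And>z w. z \<in> outer_sector \<phi>2 \<Longrightarrow> w \<in> inner_sector \<phi> \<Longrightarrow> c * (norm z + norm w) \<le> norm (z - w)"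
    using sector_dist[OF \<phi>0(1) \<phi>2(1) \<phi>0(4)] by blast
  obtain C where C: "C \<ge> 0" "\<And>w. w \<in> outer_sector \<phi> \<Longrightarrow> norm (R w) \<le> C / norm w" using R_bound[OF \<phi>(1) \<phi>0(2)] by blast
  obtain B where B: "B > 0" "\<And>a b. norm (cmul a b) \<le> norm a * norm b * B"
    using cm.pos_bounded by blast
  define k where "k = 1 / (2 * pi * \<i>)"
  define K where "K z w = cmul (k * (g z * (e w / (z - w)))) (R w)" for z w
  have inner: "cmul (g z) (Phi \<phi> e o\<^sub>L R z) = contour \<phi> (K z)" if z: "z \<in> outer_sector \<phi>2" for z
  proof -
    have adm: "ray_admissible \<phi> (\<lambda>w. e w / (z - w))"
      by (rule admissible_resolvent_quotient[OF adme \<phi>0(1) \<phi>2(1) \<phi>0(4) z])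
    have "cmul (g z) (Phi \<phi> e o\<^sub>L R z) = cmul (k * g z) (contour \<phi> (\<lambda>w. cmul (e w / (z - w)) (R w)))"
      unfolding Phi_resolvent_decay[OF e \<phi> \<phi>2(1) \<phi>0(4) z] unfolding Phi_def cmul_cmul k_def by (simp add: mult.commute)
    also have "\<dots> = contour \<phi> (\<lambda>w. cmul (k * g z) (cmul (e w / (z - w)) (R w)))"
      by (rule contour_linear[OF contour_integrable_R[OF \<phi>(1) \<phi>0(2) adm] cm.bounded_linear_right, symmetric])
         (simp add: cmul_cmul mult.commute)
    finally show ?thesis unfolding K_def cmul_cmul by (simp add: mult.assoc)
  qed
  have mem2: "of_real t * d \<in> outer_sector \<phi>2" "of_real t * d \<in> bisector \<theta>" if "d \<in> dirs \<phi>2" "t > 0" for t d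
    using dirs_outer[OF that \<phi>0(3,4)] dirs_inner[OF that \<phi>0(3,4)] inner_subset_bisector[OF \<phi>0(3) \<phi>2(2) angles(3)] by auto
  have mem1: "of_real u * d' \<in> inner_sector \<phi>" "of_real u * d' \<in> outer_sector \<phi>" "of_real u * d' \<in> bisector \<theta>" "of_real u * d' \<in> \<Omega>"
    if "d' \<in> dirs \<phi>" "u > 0" for u d'
    using dirs_outer[OF that \<phi>0(1,2)] dirs_inner[OF that \<phi>0(1,2)] inner_subset_bisector[OF \<phi>0(1) \<phi>(2) angles(3)]
      dirs_\<Omega>[OF \<phi>(1) \<phi>0(2) that] by auto
  note ne = outer_inner_disjoint[OF \<phi>0(1) \<phi>2(1) \<phi>0(4)]
  have "Phi \<phi> e o\<^sub>L Phi \<phi> g = Phi \<phi> e o\<^sub>L Phi \<phi>2 g"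
    using Phi_rotate[OF \<phi>(1) less_imp_le[OF \<phi>2(1)] \<phi>2(2) g] by simp
  also have "\<dots> = cmul k (contour \<phi>2 (\<lambda>z. cmul (g z) (Phi \<phi> e o\<^sub>L R z)))"
    unfolding k_def by (rule Phi_compose_left[OF \<phi>0(5,4) admg Phi_commute_J0[OF \<phi>(1) \<phi>0(2) adme]])
  also have "contour \<phi>2 (\<lambda>z. cmul (g z) (Phi \<phi> e o\<^sub>L R z)) = contour \<phi>2 (\<lambda>z. contour \<phi> (K z))"
    by (rule contour_cong) (use inner mem2 in blast)
  also have "\<dots> = contour \<phi> (\<lambda>w. contour \<phi>2 (\<lambda>z. K z w))"
  \<comment> \<open>Fubini needs a majorant that is a product in t and u. The factor 1/(z - w) costs
    1/(t + u), and t/(t + u) <= 1 together with the decay of \<open>e\<close> and \<open>g\<close>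
    leaves two separate Cauchy kernels.\<close>
  proof (rule contour_swap[where G="\<lambda>t. (norm k * Cg * Ce * C * B / c) / (1 + t\<^sup>2)" and E="\<lambda>u. 1 / (1 + u\<^sup>2)"])
    show "continuous_on ({0<..} \<times> {0<..}) (\<lambda>(t, u). K (of_real t * d) (of_real u * d'))"
      if d: "d \<in> dirs \<phi>2" "d' \<in> dirs \<phi>" for d d'
      unfolding K_def case_prod_beta
      by (intro cm.continuous_on continuous_intros
           continuous_on_compose2[OF holomorphic_on_imp_continuous_on[OF hole], where f="\<lambda>x. of_real (snd x) * d'"]
           continuous_on_compose2[OF holomorphic_on_imp_continuous_on[OF holg], where f="\<lambda>x. of_real (fst x) * d"]
           continuous_on_compose2[OF continuous_on_R, where f="\<lambda>x. of_real (snd x) * d'"])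
         (use mem2[OF d(1)] mem1[OF d(2)] ne in \<open>fastforce+\<close>)
    show "norm (K (of_real t * d) (of_real u * d')) \<le> (norm k * Cg * Ce * C * B / c) / (1 + t\<^sup>2) * (1 / (1 + u\<^sup>2))"
      if tu: "t > 0" "u > 0" and d: "d \<in> dirs \<phi>2" "d' \<in> dirs \<phi>" for t u d d'
    proof -
      let ?z = "of_real t * d" and ?w = "of_real u * d'"
      have n: "norm ?z = t" "norm ?w = u" using norm_ray_dirs d tu by blast+
      have g: "norm (g ?z) \<le> Cg * (t / (1 + t\<^sup>2))" using Cg(2)[OF mem2(2)[OF d(1) tu(1)]] unfolding n .
      have e: "norm (e ?w) \<le> Ce * (u / (1 + u\<^sup>2))" using Ce(2)[OF mem1(3)[OF d(2) tu(2)]] unfolding n .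
      have dist: "c * (t + u) \<le> norm (?z - ?w)" using c(2)[OF mem2(1)[OF d(1) tu(1)] mem1(1)[OF d(2) tu(2)]] unfolding n .
      have r: "norm (R ?w) \<le> C / u" using C(2)[OF mem1(2)[OF d(2) tu(2)]] unfolding n .
      have q: "norm (e ?w) / norm (?z - ?w) \<le> (Ce * (u / (1 + u\<^sup>2))) / (c * (t + u))"
        using e dist c(1) tu Ce(1) by (intro frac_le mult_pos_pos) auto
      have "norm (K ?z ?w) \<le> norm (k * (g ?z * (e ?w / (?z - ?w)))) * norm (R ?w) * B" unfolding K_def by (rule B)
      also have "\<dots> = norm k * (norm (g ?z) * (norm (e ?w) / norm (?z - ?w))) * norm (R ?w) * B"
        by (simp only: norm_mult norm_divide)
      also have "\<dots> \<le> norm k * ((Cg * (t / (1 + t\<^sup>2))) * ((Ce * (u / (1 + u\<^sup>2))) / (c * (t + u)))) * (C / u) * B"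
        using g q r B(1) tu Cg(1) Ce(1) c(1) C(1)
        by (intro mult_right_mono mult_mono mult_left_mono) (auto intro!: mult_nonneg_nonneg divide_nonneg_nonneg)
      also have "\<dots> = (norm k * Cg * Ce * C * B / c) * (t / (1 + t\<^sup>2) * (u / (1 + u\<^sup>2)) / (t + u) / u)"
      proof -
        have "x * ((Cg * a) * ((Ce * b) / (c * s))) * (C / u) * B = (x * Cg * Ce * C * B / c) * (a * b / s / u)" for x a b s :: real
          by (simp only: divide_inverse inverse_mult_distrib mult_ac)
        then show ?thesis .
      qed
      also have "\<dots> \<le> (norm k * Cg * Ce * C * B / c) * (1 / (1 + t\<^sup>2) * (1 / (1 + u\<^sup>2)))"
        using Cg(1) Ce(1) C(1) B(1) c(1) by (intro mult_left_mono decay_product_bound tu) auto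
      finally show ?thesis by simp
    qed
  qed (rule integrable_cauchy_kernel, use Cg(1) Ce(1) C(1) B(1) c(1) in simp, rule integrable_cauchy_kernel, simp)
  also have "\<dots> = contour \<phi> (\<lambda>w. cmul (e w * g w) (R w))"
  proof (rule contour_cong)
    fix u d' assume d': "d' \<in> dirs \<phi>" "u > (0::real)"
    let ?w = "of_real u * d'"
    define F where "F z = g z / (z - ?w)" for z
    have w: "?w \<in> inner_sector \<phi>" by (rule mem1(1)[OF d'])
    have sub: "inner_sector \<phi>2 \<subseteq> bisector \<theta>" by (rule inner_subset_bisector[OF \<phi>0(3) \<phi>2(2) angles(3)])
    have gb: "norm (g z) \<le> (2 * \<bar>Cg\<bar>) / (1 + norm z)" if "z \<in> inner_sector \<phi>2" for z
      using Cg(2) sub that by (intro sector_decay_bound) blast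
    have val: "sc.contour \<phi>2 F = 2 * pi * \<i> * g ?w"
      unfolding F_def by (rule cauchy_formula[OF \<phi>0(1) \<phi>2(1) \<phi>0(4) open_bisector sub holg gb w])
    have w0: "?w \<noteq> 0" using sector_nz(1)[OF w] .
    have int: "sc.contour_integrable \<phi>2 F"
      unfolding sc.contour_integrable_def
    proof
      fix d assume d: "d \<in> dirs \<phi>2"
      show "sc.ray_integrable d F"
      proof (rule sc.ray_integrable_cauchy_bound[where S="inner_sector \<phi>2 \<inter> outer_sector \<phi>2"])
        show "continuous_on (inner_sector \<phi>2 \<inter> outer_sector \<phi>2) F"
          unfolding F_def using ne w sub
          by (intro continuous_intros continuous_on_subset[OF holomorphic_on_imp_continuous_on[OF holg]]) auto
        show "of_real t * d \<in> inner_sector \<phi>2 \<inter> outer_sector \<phi>2" if "t > 0" for t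
          using dirs_inner[OF d that \<phi>0(3,4)] dirs_outer[OF d that \<phi>0(3,4)] by blast
        show "norm (F z) \<le> (2 * \<bar>Cg\<bar> / c * (1 + 1 / norm ?w)) / (1 + (norm z)\<^sup>2)"
          if z: "z \<in> inner_sector \<phi>2 \<inter> outer_sector \<phi>2" for z
          unfolding F_def using z by (intro norm_cauchy_quotient gb c w w0) auto
      qed (rule norm_dirs[OF d])
    qed
    have "contour \<phi>2 (\<lambda>z. K z ?w) = contour \<phi>2 (\<lambda>z. cmul (F z) (cmul (k * e ?w) (R ?w)))"
      unfolding K_def F_def cmul_cmul by (simp add: mult_ac)
    also have "\<dots> = cmul (2 * pi * \<i> * g ?w) (cmul (k * e ?w) (R ?w))"
      unfolding contour_cmul_const(1)[OF int] val ..
    also have "\<dots> = cmul ((2 * pi * \<i> * k) * (e ?w * g ?w)) (R ?w)"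
      unfolding cmul_cmul by (simp only: mult_ac)
    also have "2 * pi * \<i> * k = 1" by (simp add: k_def)
    also have "1 * (e ?w * g ?w) = e ?w * g ?w" by simp
    finally show "contour \<phi>2 (\<lambda>z. K z ?w) = cmul (e ?w * g ?w) (R ?w)" .
  qed
  finally show ?thesis unfolding Phi_def k_def .
qed

lemma reg_properties:
  assumes "0 < \<phi>" "\<phi> < \<theta>"
  obtains M where "\<And>n. continuous_on (inner_sector \<phi> \<inter> outer_sector \<phi>) (reg n)"
    "\<And>n w. w \<in> inner_sector \<phi> \<inter> outer_sector \<phi> \<Longrightarrow> norm (reg n w) \<le> M"
proof -
  have \<theta>: "0 < \<theta>" using angles by simp
  have sub: "inner_sector \<phi> \<inter> outer_sector \<phi> \<subseteq> bisector \<theta>" using inner_subset_bisector[OF assms angles(3)] by auto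
  obtain M where M: "\<And>n w. w \<in> bisector \<theta> \<Longrightarrow> norm (reg n w) \<le> M" using reg_bounds[OF \<theta> angles(3)] by metis
  show thesis
    by (rule that[of M])
       (use continuous_on_subset[OF holomorphic_on_imp_continuous_on[OF reg_holomorphic[OF \<theta> angles(3)]] sub] M sub in auto)
qed

lemma Phi_reg_limit:
  assumes \<phi>: "\<omega> < \<phi>" "\<phi> < \<theta>" and h: "ray_admissible \<phi> h"
  shows "(\<lambda>n. Phi \<phi> (\<lambda>w. reg n w * h w)) \<longlonglongrightarrow> Phi \<phi> h"
    and "(\<lambda>n. Phi \<phi> (\<lambda>w. (reg n w)\<^sup>2 * h w)) \<longlonglongrightarrow> Phi \<phi> h"
proof -
  have \<phi>0: "0 < \<phi>" "\<phi> < pi / 2" using \<phi> angles by auto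
  obtain M where M: "\<And>n. continuous_on (inner_sector \<phi> \<inter> outer_sector \<phi>) (reg n)"
    "\<And>n w. w \<in> inner_sector \<phi> \<inter> outer_sector \<phi> \<Longrightarrow> norm (reg n w) \<le> M"
    using reg_properties[OF \<phi>0(1) \<phi>(2)] by blast
  show "(\<lambda>n. Phi \<phi> (\<lambda>w. reg n w * h w)) \<longlonglongrightarrow> Phi \<phi> h"
    by (rule Phi_limit[OF \<phi>(1) \<phi>0(2) h M(1,2) reg_tendsto])
  have "(\<lambda>n. (reg n w)\<^sup>2) \<longlonglongrightarrow> 1" for w using tendsto_power[OF reg_tendsto, of w 2] by simp
  then show "(\<lambda>n. Phi \<phi> (\<lambda>w. (reg n w)\<^sup>2 * h w)) \<longlonglongrightarrow> Phi \<phi> h"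
    by (intro Phi_limit[OF \<phi>(1) \<phi>0(2) h, where M="M\<^sup>2"] continuous_intros M)
       (auto simp: norm_power intro!: power_mono M(2))
qed

text \<open>Both factors are multiplied by \<open>reg n\<close>, which brings them into the decaying
  class. The product then carries \<open>(reg n)^2\<close>, whence the second limit in
  \<open>Phi_reg_limit\<close>.\<close>

lemma Phi_mult:
  assumes e: "e \<in> sector_null \<theta>" and g: "g \<in> sector_null \<theta>" and \<phi>: "\<omega> < \<phi>" "\<phi> < \<theta>"
  shows "Phi \<phi> e o\<^sub>L Phi \<phi> g = Phi \<phi> (\<lambda>w. e w * g w)"
proof -
  have \<theta>: "0 < \<theta>" and \<phi>0: "0 < \<phi>" using angles \<phi> by auto
  have eg: "(\<lambda>w. e w * g w) \<in> sector_null \<theta>"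
    using sector_null_mult_bounded[OF g] e by (auto simp: sector_null_def)
  note adm = sector_null_admissible[OF _ \<phi>0 \<phi>(2) angles(3)]
  have "(\<lambda>n. Phi \<phi> (\<lambda>w. reg n w * e w) o\<^sub>L Phi \<phi> (\<lambda>w. reg n w * g w)) \<longlonglongrightarrow> (Phi \<phi> e o\<^sub>L Phi \<phi> g)"
    by (intro bounded_bilinear.tendsto[OF bounded_bilinear_blinfun_compose] Phi_reg_limit \<phi> adm e g)
  moreover have "Phi \<phi> (\<lambda>w. reg n w * e w) o\<^sub>L Phi \<phi> (\<lambda>w. reg n w * g w) = Phi \<phi> (\<lambda>w. (reg n w)\<^sup>2 * (e w * g w))" for n
    unfolding Phi_mult_decay[OF reg_decay[OF \<theta> angles(3) e] reg_decay[OF \<theta> angles(3) g] \<phi>]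
    by (simp add: power2_eq_square mult_ac)
  ultimately have "(\<lambda>n. Phi \<phi> (\<lambda>w. (reg n w)\<^sup>2 * (e w * g w))) \<longlonglongrightarrow> (Phi \<phi> e o\<^sub>L Phi \<phi> g)" by simp
  then show ?thesis using Phi_reg_limit(2)[OF \<phi> adm[OF eg]] LIMSEQ_unique by blast
qed

lemma Phi_resolvent:
  assumes e: "e \<in> sector_null \<theta>" and \<phi>: "\<omega> < \<phi>" "\<phi> < \<theta>" "\<phi> < \<phi>'" "\<phi>' < pi / 2" and z: "z \<in> outer_sector \<phi>'"
  shows "Phi \<phi> e o\<^sub>L R z = Phi \<phi> (\<lambda>w. e w / (z - w))"
proof -
  have \<theta>: "0 < \<theta>" and \<phi>0: "0 < \<phi>" using angles \<phi> by auto
  note adm = sector_null_admissible[OF e \<phi>0 \<phi>(2) angles(3)]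
  have "(\<lambda>n. Phi \<phi> (\<lambda>w. reg n w * e w) o\<^sub>L R z) \<longlonglongrightarrow> (Phi \<phi> e o\<^sub>L R z)"
    by (intro bounded_bilinear.tendsto[OF bounded_bilinear_blinfun_compose] Phi_reg_limit \<phi> adm tendsto_const)
  moreover have "Phi \<phi> (\<lambda>w. reg n w * e w) o\<^sub>L R z = Phi \<phi> (\<lambda>w. reg n w * (e w / (z - w)))" for n
    unfolding Phi_resolvent_decay[OF reg_decay[OF \<theta> angles(3) e] \<phi> z] by simp
  ultimately have "(\<lambda>n. Phi \<phi> (\<lambda>w. reg n w * (e w / (z - w)))) \<longlonglongrightarrow> (Phi \<phi> e o\<^sub>L R z)" by (simp only:)
  from LIMSEQ_unique[OF this Phi_reg_limit(1)[OF \<phi>(1,2) admissible_resolvent_quotient[OF adm \<phi>0 \<phi>(3,4) z]]]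
  show ?thesis .
qed

lemma R_commute: "w \<in> \<Omega> \<Longrightarrow> z \<in> \<Omega> \<Longrightarrow> R w o\<^sub>L R z = R z o\<^sub>L R w"
proof (cases "w = z")
  case False
  assume wz: "w \<in> \<Omega>" "z \<in> \<Omega>"
  have "1 / (w - z) = - (1 / (z - w))" using False by (simp add: divide_simps)
  then show ?thesis
    unfolding R_R[OF wz False] R_R[OF wz(2,1) False[symmetric]] by (simp add: cm.minus_left cm.diff_right)
qed simp

lemma Phi_commute_R:
  assumes \<phi>: "\<omega> < \<phi>" "\<phi> < pi / 2" and h: "ray_admissible \<phi> h" and z: "z \<in> \<Omega>"
  shows "R z o\<^sub>L Phi \<phi> h = Phi \<phi> h o\<^sub>L R z"
  unfolding Phi_compose_right[OF assms(1-3)] Phi_compose_left[OF assms(1-3) R_commute_J0[OF z]]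
  by (intro arg_cong[where f="cmul _"] contour_cong arg_cong[where f="cmul _"])
     (use R_commute[OF z] dirs_\<Omega>[OF \<phi>] in auto)

end

section \<open>The regularizing function and its operator\<close>

text \<open>\<open>fB\<close> tends to 1 at the origin and therefore lies outside
  \<open>sector_null\<close>; \<open>fA\<close> vanishes at both ends, so \<open>Phi\<close> can be
  evaluated at it. The function z itself enters the calculus only through \<open>fA\<close>.\<close>

definition fA :: "complex \<Rightarrow> complex" where "fA w = w / (1 + w\<^sup>2)"
definition fB :: "complex \<Rightarrow> complex" where "fB w = 1 / (1 + w\<^sup>2)"

lemma fAB_bounds:
  assumes "0 < \<theta>" "\<theta> < pi / 2"
  obtains M where "M \<ge> 0" "\<And>w. w \<in> inner_sector \<theta> \<Longrightarrow> norm (fB w) \<le> M / (1 + (norm w)\<^sup>2)"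
    "\<And>w. w \<in> inner_sector \<theta> \<Longrightarrow> norm (fA w) \<le> M * (norm w / (1 + (norm w)\<^sup>2))"
proof -
  obtain c where c: "c > 0" "\<And>w. w \<in> inner_sector \<theta> \<Longrightarrow> c * (1 + norm w)\<^sup>2 \<le> norm (1 + w\<^sup>2)"
    using one_plus_square_bound[OF assms] by blast
  have fB: "norm (fB w) \<le> (1 / c) / (1 + (norm w)\<^sup>2)" if w: "w \<in> inner_sector \<theta>" for w
  proof -
    have pos: "0 < c * (1 + (norm w)\<^sup>2)" using c(1) by (intro mult_pos_pos) (auto simp: add_pos_nonneg)
    have "1 + (norm w)\<^sup>2 \<le> (1 + norm w)\<^sup>2" by (simp add: power2_sum)
    then have "c * (1 + (norm w)\<^sup>2) \<le> norm (1 + w\<^sup>2)"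
      using c(1) by (intro order_trans[OF mult_left_mono c(2)[OF w]]) auto
    then have "norm (fB w) \<le> 1 / (c * (1 + (norm w)\<^sup>2))"
      unfolding fB_def norm_divide norm_one using pos by (intro frac_le) auto
    then show ?thesis by simp
  qed
  show thesis
  proof (rule that[of "1 / c", OF _ fB])
    show "norm (fA w) \<le> 1 / c * (norm w / (1 + (norm w)\<^sup>2))" if w: "w \<in> inner_sector \<theta>" for w
    proof -
      have "norm (fA w) = norm w * norm (fB w)" by (simp add: fA_def fB_def norm_divide)
      also have "\<dots> \<le> norm w * ((1 / c) / (1 + (norm w)\<^sup>2))" using fB[OF w] by (intro mult_left_mono) auto
      finally show ?thesis by (simp add: mult.commute)
    qed
  qed (use c(1) in auto)
qed

lemma holomorphic_fAB:
  assumes "0 < \<theta>" "\<theta> < pi / 2" shows "fA holomorphic_on bisector \<theta>" "fB holomorphic_on bisector \<theta>"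
  unfolding fA_def[abs_def] fB_def[abs_def]
  using one_plus_square_nz[OF assms] bisector_subset_inner by (auto intro!: holomorphic_intros)

lemma fA_decay: assumes "0 < \<theta>" "\<theta> < pi / 2" shows "fA \<in> sector_decay \<theta>"
proof -
  obtain M where "\<And>w. w \<in> inner_sector \<theta> \<Longrightarrow> norm (fA w) \<le> M * (norm w / (1 + (norm w)\<^sup>2))"
    using fAB_bounds[OF assms] by metis
  then show ?thesis
    using holomorphic_fAB(1)[OF assms] bisector_subset_inner unfolding sector_decay_def by blast
qed

lemma bounded_fB: assumes "0 < \<theta>" "\<theta> < pi / 2" shows "bounded (fB ` bisector \<theta>)"
proof -
  obtain M where M: "M \<ge> 0" "\<And>w. w \<in> inner_sector \<theta> \<Longrightarrow> norm (fB w) \<le> M / (1 + (norm w)\<^sup>2)"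
    using fAB_bounds[OF assms] by metis
  have "norm (fB w) \<le> M" if "w \<in> bisector \<theta>" for w
  proof -
    have "M / (1 + (norm w)\<^sup>2) \<le> M / 1" using M(1) by (intro divide_left_mono) (auto simp: add_pos_nonneg)
    then show ?thesis using M(2)[of w] that bisector_subset_inner by (metis div_by_1 order_trans subsetD)
  qed
  then show ?thesis unfolding bounded_iff by auto
qed

text \<open>This makes the span of 1, \<open>fB\<close> and the null functions closed under
  multiplication: the square of \<open>fB\<close> is \<open>fB\<close> up to a null function.
  \<open>Bop_square\<close> is the matching identity of operators.\<close>

lemma fB_square: "1 + w\<^sup>2 \<noteq> 0 \<Longrightarrow> fB w * fB w = fB w - fA w * fA w"
  unfolding fA_def fB_def by (simp add: divide_simps) (simp add: algebra_simps power2_eq_square)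

lemma fAB_cnj: "fA (cnj w) = cnj (fA w)" "fB (cnj w) = cnj (fB w)"
  by (simp_all add: fA_def fB_def)

lemma i_outer: "\<i> \<in> outer_sector \<phi>" "- \<i> \<in> outer_sector \<phi>"
  by (simp_all add: outer_sector_def)

lemma one_inner: "0 < \<phi> \<Longrightarrow> \<phi> < pi / 2 \<Longrightarrow> 1 \<in> inner_sector \<phi>" "0 < \<phi> \<Longrightarrow> \<phi> < pi / 2 \<Longrightarrow> - 1 \<in> inner_sector \<phi>"
  using tan_gt_zero[of \<phi>] by (auto simp: inner_sector_def)

lemma far_from_unit_circle:
  fixes w :: complex
  assumes "norm w \<le> 1 / 2 \<or> 2 \<le> norm w"
  shows "(1 + (norm w)\<^sup>2) / 2 \<le> norm (1 + w\<^sup>2)" "(1 + (norm w)\<^sup>2) / 2 \<le> norm (w\<^sup>2 - 1)"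
proof -
  have *: "(1 + (norm w)\<^sup>2) / 2 \<le> \<bar>(norm w)\<^sup>2 - 1\<bar>"
  proof (cases "norm w \<le> 1 / 2")
    case True
    then have "(norm w)\<^sup>2 \<le> (1 / 2)\<^sup>2" by (intro power_mono) auto
    then show ?thesis by (simp add: power2_eq_square)
  next
    case False
    then have "2\<^sup>2 \<le> (norm w)\<^sup>2" using assms by (intro power_mono) auto
    then show ?thesis by simp
  qed
  have "\<bar>norm (w\<^sup>2) - norm (- 1 :: complex)\<bar> \<le> norm (w\<^sup>2 - - 1)" by (rule norm_triangle_ineq3)
  then show "(1 + (norm w)\<^sup>2) / 2 \<le> norm (1 + w\<^sup>2)" using * by (simp add: norm_power add.commute)
  have "\<bar>norm (w\<^sup>2) - norm (1 :: complex)\<bar> \<le> norm (w\<^sup>2 - 1)" by (rule norm_triangle_ineq3)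
  then show "(1 + (norm w)\<^sup>2) / 2 \<le> norm (w\<^sup>2 - 1)" using * by (simp add: norm_power)
qed

context resolvent_family
begin

text \<open>These are \<open>(1 + T\<^sup>2)\<^sup>-\<^sup>1\<close> and \<open>T (1 + T\<^sup>2)\<^sup>-\<^sup>1\<close> when \<open>R\<close> is the resolvent of \<open>T\<close>.\<close>

definition Bop where "Bop = cmul (\<i> / 2) (R \<i> - R (- \<i>))"
definition Aop where "Aop = cmul (- 1 / 2) (R \<i> + R (- \<i>))"

lemma i_\<Omega>: "\<i> \<in> \<Omega>" "- \<i> \<in> \<Omega>" by (simp_all add: \<Omega>_def)

text \<open>The identity fA z / (w - z) = fA w / (w - z) + fA w * fA z - fB w * fB z with z replaced
  by the operator. It holds because \<open>R w\<close> meets \<open>R \<i>\<close> and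
  \<open>R (- \<i>)\<close> through the resolvent identity, which produces the partial fractions at
  the two poles.\<close>

lemma R_Aop:
  assumes w: "w \<in> \<Omega>" "1 + w\<^sup>2 \<noteq> 0"
  shows "R w o\<^sub>L Aop = cmul (fA w) (R w) + cmul (fA w) Aop - cmul (fB w) Bop"
proof -
  have ne: "w \<noteq> \<i>" "w \<noteq> - \<i>" using w(2) by auto
  have nz: "\<i> - w \<noteq> 0" "- \<i> - w \<noteq> 0" using ne by (auto simp: minus_equation_iff)
  have f: "1 + w\<^sup>2 = - ((\<i> - w) * (\<i> + w))" by (simp add: algebra_simps power2_eq_square)
  have nz': "\<i> + w \<noteq> 0" using nz(2) by (metis add_uminus_conv_diff minus_add_distrib neg_equal_0_iff_equal)
  define D where "D = 1 + w\<^sup>2"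
  define x y where "x = 1 / (\<i> - w)" and "y = 1 / (- \<i> - w)"
  have D0: "D \<noteq> 0" using w(2) by (simp add: D_def)
  have inv: "x = - ((\<i> + w) / D)" "y = - ((w - \<i>) / D)"
    unfolding D_def x_def y_def f using nz nz' by (simp_all add: divide_simps) (simp_all add: algebra_simps)
  have AB: "fA w = w / D" "fB w = 1 / D" by (simp_all add: fA_def fB_def D_def)
  have 1: "R w o\<^sub>L Aop = cmul (- 1 / 2) (cmul x (R w - R \<i>) + cmul y (R w - R (- \<i>)))"
    unfolding x_def y_def Aop_def compose_cmul[OF R_commute_J0[OF w(1)]] bounded_bilinear.add_right[OF bounded_bilinear_blinfun_compose]
      R_R[OF w(1) i_\<Omega>(1) ne(1)] R_R[OF w(1) i_\<Omega>(2) ne(2)] ..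
  have 2: "R w o\<^sub>L Aop = cmul (- 1 / 2 * x + - 1 / 2 * y) (R w) - cmul (- 1 / 2 * x) (R \<i>) - cmul (- 1 / 2 * y) (R (- \<i>))"
    unfolding 1 by (simp only: cm.add_right cm.diff_right cm.add_left cmul_cmul) (simp only: algebra_simps)
  have 3: "cmul (fA w) (R w) + cmul (fA w) Aop - cmul (fB w) Bop = cmul (fA w) (R w)
      + cmul (fA w * (- 1 / 2) - fB w * (\<i> / 2)) (R \<i>) + cmul (fA w * (- 1 / 2) + fB w * (\<i> / 2)) (R (- \<i>))"
    unfolding Aop_def Bop_def
    by (simp only: cm.add_right cm.diff_right cm.add_left cm.diff_left cmul_cmul) (simp only: algebra_simps)
  have "- 1 / 2 * x + - 1 / 2 * y = fA w"
    "fA w * (- 1 / 2) - fB w * (\<i> / 2) = - (- 1 / 2 * x)"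
    "fA w * (- 1 / 2) + fB w * (\<i> / 2) = - (- 1 / 2 * y)"
    unfolding inv AB using D0 by (simp_all add: field_simps)
  then show ?thesis unfolding 2 3 by (simp only: cm.minus_left) simp
qed

text \<open>By the resolvent identity \<open>R \<i> o\<^sub>L R (- \<i>)\<close> equals
  \<open>Bop\<close> itself. In both squares this mixed product \<open>S\<close> appears with
  coefficient 1/2, while the pure squares of the two resolvents have opposite signs and drop out of
  the sum.\<close>

lemma Bop_square: "Bop o\<^sub>L Bop = Bop - (Aop o\<^sub>L Aop)"
proof -
  have J: "R \<i> o\<^sub>L J0 = J0 o\<^sub>L R \<i>" "R (- \<i>) o\<^sub>L J0 = J0 o\<^sub>L R (- \<i>)" by (rule R_commute_J0[OF i_\<Omega>(1)], rule R_commute_J0[OF i_\<Omega>(2)])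
  have pm: "R \<i> o\<^sub>L R (- \<i>) = cmul (\<i> / 2) (R \<i> - R (- \<i>))"
    by (subst R_R[OF i_\<Omega>]) (simp_all add: divide_simps complex_eq_iff)
  have mp: "R (- \<i>) o\<^sub>L R \<i> = R \<i> o\<^sub>L R (- \<i>)" by (rule R_commute[OF i_\<Omega>(2,1)])
  note simps = cmul_compose compose_cmul[OF J(1)] compose_cmul[OF J(2)] cm.add_right cm.diff_right cmul_cmul
    bounded_bilinear.add_right[OF bounded_bilinear_blinfun_compose] bounded_bilinear.add_left[OF bounded_bilinear_blinfun_compose]
    bounded_bilinear.diff_right[OF bounded_bilinear_blinfun_compose] bounded_bilinear.diff_left[OF bounded_bilinear_blinfun_compose]
  define P Q S where "P = R \<i> o\<^sub>L R \<i>" and "Q = R (- \<i>) o\<^sub>L R (- \<i>)" and "S = R \<i> o\<^sub>L R (- \<i>)"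
  have "Bop o\<^sub>L Bop = cmul (- 1 / 4) P + cmul (- 1 / 4) Q + cmul (1 / 2) S"
    unfolding Bop_def simps mp P_def[symmetric] Q_def[symmetric] S_def[symmetric]
    by (simp add: cm.add_left[symmetric] cm.minus_left[symmetric] algebra_simps)
      (simp add: cmul_def scaleR_add_left[symmetric])
  moreover have "Aop o\<^sub>L Aop = cmul (1 / 4) P + cmul (1 / 4) Q + cmul (1 / 2) S"
    unfolding Aop_def simps mp P_def[symmetric] Q_def[symmetric] S_def[symmetric]
    by (simp add: algebra_simps) (simp add: cmul_def scaleR_add_left[symmetric])
  moreover have "Bop = S" unfolding S_def pm Bop_def ..
  moreover have "(1 / 2) *\<^sub>R S = S - (1 / 2) *\<^sub>R S" using scaleR_left_diff_distrib[of 1 "1/2" S] by simp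
  ultimately show ?thesis by (simp add: cmul_def)
qed

text \<open>The poles i and -i of \<open>fA\<close> lie in the outer sector, so its integrand cannot
  be pulled through there. \<open>R w o\<^sub>L Aop\<close> can, but decays only like 1/|w|.
  Subtracting \<open>u w\<close> times \<open>Aop\<close> repairs the decay and places the new poles
  1 and -1 in the inner sector. The outer rotation gives 0 for the difference \<open>F\<close>, and
  Cauchy's formula at 1 and -1 supplies the value.\<close>

lemma Phi_fA:
  assumes \<phi>: "\<omega> < \<phi>" "\<phi> < \<theta>" shows "Phi \<phi> fA = Aop"
proof -
  have \<theta>: "0 < \<theta>" and \<phi>0: "0 < \<phi>" "\<phi> < pi / 2" "0 < \<phi> / 2" "\<phi> / 2 < \<phi>" "\<phi> / 2 < pi / 2" using angles \<phi> by auto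
  have sub: "inner_sector \<phi> \<subseteq> bisector \<theta>" by (rule inner_subset_bisector[OF \<phi>0(1) \<phi>(2) angles(3)])
  obtain M where M: "M \<ge> 0" "\<And>w. w \<in> inner_sector \<phi> \<Longrightarrow> norm (fB w) \<le> M / (1 + (norm w)\<^sup>2)"
    "\<And>w. w \<in> inner_sector \<phi> \<Longrightarrow> norm (fA w) \<le> M * (norm w / (1 + (norm w)\<^sup>2))"
    using fAB_bounds[OF \<phi>0(1,2)] by metis
  have hol: "fA holomorphic_on bisector \<theta>" "fB holomorphic_on bisector \<theta>" using holomorphic_fAB[OF \<theta> angles(3)] by auto
  have adm: "ray_admissible \<phi> fA"
    by (rule sector_null_admissible[OF sector_decay_null[OF fA_decay[OF \<theta> angles(3)]] \<phi>0(1) \<phi>(2) angles(3)])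
  \<comment> \<open>At infinity \<open>u\<close> agrees with \<open>fA\<close> up to order 1/|w|^3,
    but its poles are 1 and -1 instead of i and -i.\<close>
  define u where "u w = w / (w\<^sup>2 - 1)" for w :: complex
  define F where "F w = (R w o\<^sub>L Aop) - cmul (u w) Aop" for w
  define F1 where "F1 w = fB w / (w - 1)" for w
  define F2 where "F2 w = fB w / (w - - 1)" for w
  obtain c where c: "c > 0" "\<And>z w. z \<in> outer_sector \<phi> \<Longrightarrow> w \<in> inner_sector (\<phi>/2) \<Longrightarrow> c * (norm z + norm w) \<le> norm (z - w)"
    using sector_dist[OF \<phi>0(3,4,2)] by blast
  have pm1: "1 \<in> inner_sector (\<phi>/2)" "- 1 \<in> inner_sector (\<phi>/2)" using one_inner \<phi>0 by auto
  have ne: "z \<noteq> 1" "z \<noteq> - 1" if "z \<in> outer_sector \<phi>" for z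
    using outer_inner_disjoint[OF \<phi>0(3,4,2) that] pm1 by auto
  have fB1: "norm (fB z) \<le> (2 * M) / (1 + norm z)" if "z \<in> inner_sector \<phi>" for z
  proof -
    have "M / (1 + (norm z)\<^sup>2) \<le> (2 * M) / (1 + norm z)"
    proof -
      have "2 * norm z \<le> 1 + (norm z)\<^sup>2" using sum_squares_bound[of "norm z" 1] by simp
      moreover have aux: "1 + a \<le> 2 * (1 + s)" if "2 * a \<le> 1 + s" "0 \<le> s" for a s :: real using that by simp
      ultimately have "1 + norm z \<le> 2 * (1 + (norm z)\<^sup>2)" by (intro aux) auto
      from mult_left_mono[OF this M(1)] have "M * (1 + norm z) \<le> 2 * M * (1 + (norm z)\<^sup>2)" by (simp only: mult_ac)
      then show ?thesis by (simp add: pos_divide_le_eq add_pos_nonneg pos_le_divide_eq)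
    qed
    then show ?thesis using M(2)[OF that] by linarith
  qed
  have val: "sc.contour \<phi> F1 = 2 * pi * \<i> * fB 1" "sc.contour \<phi> F2 = 2 * pi * \<i> * fB (- 1)"
    unfolding F1_def F2_def using cauchy_formula[OF \<phi>0(3,4,2) open_bisector sub hol(2) fB1] pm1 by blast+
  have intF: "sc.contour_integrable \<phi> F1" "sc.contour_integrable \<phi> F2"
  proof -
    have "sc.contour_integrable \<phi> (\<lambda>z. fB z / (z - p))" if p: "p \<in> inner_sector (\<phi>/2)" for p
      unfolding sc.contour_integrable_def
    proof
      fix d assume d: "d \<in> dirs \<phi>"
      show "sc.ray_integrable d (\<lambda>z. fB z / (z - p))"
      proof (rule sc.ray_integrable_cauchy_bound[where S="inner_sector \<phi> \<inter> outer_sector \<phi>"])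
        show "continuous_on (inner_sector \<phi> \<inter> outer_sector \<phi>) (\<lambda>z. fB z / (z - p))"
          using outer_inner_disjoint[OF \<phi>0(3,4,2) _ p] sub
          by (intro continuous_intros continuous_on_subset[OF holomorphic_on_imp_continuous_on[OF hol(2)]]) auto
        show "of_real t * d \<in> inner_sector \<phi> \<inter> outer_sector \<phi>" if "t > 0" for t
          using dirs_inner[OF d that \<phi>0(1,2)] dirs_outer[OF d that \<phi>0(1,2)] by blast
        show "norm (fB z / (z - p)) \<le> (2 * M / c * (1 + 1 / norm p)) / (1 + (norm z)\<^sup>2)"
          if z: "z \<in> inner_sector \<phi> \<inter> outer_sector \<phi>" for z
          using z by (intro norm_cauchy_quotient fB1 c p sector_nz(1)[OF p]) auto
      qed (rule norm_dirs[OF d])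
    qed
    then show "sc.contour_integrable \<phi> F1" "sc.contour_integrable \<phi> F2"
      unfolding F1_def F2_def using pm1 by blast+
  qed
  have intB: "sc.contour_integrable \<phi> fB"
    unfolding sc.contour_integrable_def
  proof
    fix d assume d: "d \<in> dirs \<phi>"
    show "sc.ray_integrable d fB"
      by (rule sc.ray_integrable_cauchy_bound[OF continuous_on_subset[OF holomorphic_on_imp_continuous_on[OF hol(2)] sub]
            dirs_inner[OF d _ \<phi>0(1,2)] norm_dirs[OF d] M(2)])
  qed
  have zeroB: "sc.contour \<phi> fB = 0"
  proof (rule sc.contour_inner_eq_0[OF \<phi>0(1,2)])
    show "(fB has_derivative (\<lambda>h. h * deriv fB w)) (at w)" if "w \<in> inner_sector \<phi>" for w
      using holomorphic_has_derivative[OF hol(2) open_bisector] sub that by blast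
    show "continuous_on (inner_sector \<phi>) (deriv fB)"
      by (rule continuous_on_subset[OF holomorphic_continuous_deriv[OF hol(2) open_bisector] sub])
  qed (use M(2) in blast)
  have uF: "u w - fA w = F1 w + F2 w" if "1 + w\<^sup>2 \<noteq> 0" "w \<noteq> 1" "w \<noteq> - 1" for w
  proof -
    have nz: "w - 1 \<noteq> 0" "w + 1 \<noteq> 0" using that by (auto simp: eq_neg_iff_add_eq_0)
    have f: "w\<^sup>2 - 1 = (w - 1) * (w + 1)" by (simp add: algebra_simps power2_eq_square)
    have "fB w / (w - 1) + fB w / (w + 1) = 2 * w / ((1 + w\<^sup>2) * (w\<^sup>2 - 1))"
      unfolding fB_def f using nz that(1) by (simp add: divide_simps)
    moreover have "w\<^sup>2 - 1 \<noteq> 0" using nz f by auto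
    then have "u w - fA w = 2 * w / ((1 + w\<^sup>2) * (w\<^sup>2 - 1))"
      unfolding u_def fA_def using that(1) by (simp add: divide_simps) (simp add: algebra_simps)
    ultimately show ?thesis by (simp add: F1_def F2_def)
  qed
  have Feq: "F w = cmul (fA w) (R w) - cmul (F1 w + F2 w) Aop - cmul (fB w) Bop"
    if "w \<in> \<Omega>" "1 + w\<^sup>2 \<noteq> 0" "w \<noteq> 1" "w \<noteq> - 1" for w
    unfolding F_def R_Aop[OF that(1,2)] uF[OF that(2-4), symmetric] by (simp add: cm.diff_left algebra_simps)
  have sumint: "sc.contour_integrable \<phi> (\<lambda>w. F1 w + F2 w)" by (rule sc.contour_integrable_add[OF intF])
  note ints = contour_integrable_R[OF \<phi>(1) \<phi>0(2) adm] contour_cmul_const(2)[OF sumint, of Aop] contour_cmul_const(2)[OF intB, of Bop]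
  have raycond: "of_real t * d \<in> \<Omega>" "1 + (of_real t * d)\<^sup>2 \<noteq> 0" "of_real t * d \<noteq> 1" "of_real t * d \<noteq> - 1"
    if "d \<in> dirs \<phi>" "t > 0" for t d
    using dirs_\<Omega>[OF \<phi>(1) \<phi>0(2) that] one_plus_square_nz[OF \<phi>0(1,2) dirs_inner[OF that \<phi>0(1,2)]]
      ne[OF dirs_outer[OF that \<phi>0(1,2)]] by auto
  have sum: "contour \<phi> F = contour \<phi> (\<lambda>w. cmul (fA w) (R w)) - cmul (2 * pi * \<i>) Aop"
  proof -
    have "contour \<phi> F = contour \<phi> (\<lambda>w. (cmul (fA w) (R w) - cmul (F1 w + F2 w) Aop) - cmul (fB w) Bop)"
      by (rule contour_cong) (use Feq raycond in blast)
    also have "\<dots> = contour \<phi> (\<lambda>w. cmul (fA w) (R w)) - cmul (sc.contour \<phi> (\<lambda>w. F1 w + F2 w)) Aop - cmul (sc.contour \<phi> fB) Bop"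
      by (simp only: contour_diff[OF contour_integrable_diff[OF ints(1,2)] ints(3)] contour_diff[OF ints(1,2)]
          contour_cmul_const(1)[OF sumint] contour_cmul_const(1)[OF intB])
    \<comment> \<open>The values \<open>fB 1 = fB (- 1) = 1 / 2\<close> of the two Cauchy integrals
      add up to 1.\<close>
    also have "sc.contour \<phi> (\<lambda>w. F1 w + F2 w) = 2 * pi * \<i>"
    proof -
      have half: "X * (1 / 2) + X * (1 / 2) = X" for X :: complex by simp
      have "fB 1 = 1 / 2" "fB (- 1) = 1 / 2" by (simp_all add: fB_def)
      then show ?thesis unfolding sc.contour_add[OF intF] val by (simp only: half)
    qed
    finally show ?thesis by (simp add: zeroB cm.zero_left)
  qed
  have "contour \<phi> F = 0"
  proof -
    obtain C where C: "C \<ge> 0" "\<And>w. w \<in> outer_sector \<phi> \<Longrightarrow> norm (R w) \<le> C / norm w" using R_bound[OF \<phi>(1) \<phi>0(2)] by blast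
    obtain B where B: "B > 0" "\<And>a b. norm (cmul a b) \<le> norm a * norm b * B"
      using cm.pos_bounded by blast
    define V where "V = {w::complex. w \<noteq> 1 \<and> w \<noteq> - 1}"
    have V: "open V" unfolding V_def by (intro open_Collect_conj open_Collect_neq continuous_intros)
    have u: "u holomorphic_on V" unfolding u_def[abs_def] V_def
      by (intro holomorphic_intros) (auto simp: power2_eq_1_iff)
    have subV: "outer_sector \<phi> \<subseteq> V" using ne by (auto simp: V_def)
    have sub\<Omega>: "outer_sector \<phi> \<subseteq> \<Omega>" by (rule outer_subset_\<Omega>[OF \<phi>(1) \<phi>0(2)])
    have intFF: "contour_integrable \<phi> F"
    proof -
      have i: "contour_integrable \<phi> (\<lambda>w. (cmul (fA w) (R w) - cmul (F1 w + F2 w) Aop) - cmul (fB w) Bop)"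
        by (rule contour_integrable_diff[OF contour_integrable_diff[OF ints(1,2)] ints(3)])
      have "ray_integrable d F" if d: "d \<in> dirs \<phi>" for d
        by (rule iffD2[OF ray_integrable_cong i[unfolded contour_integrable_def, rule_format, OF d]])
           (use Feq raycond d in blast)
      then show ?thesis by (simp add: contour_integrable_def)
    qed
    show ?thesis
    proof (rule contour_outer_eq_0[OF \<phi>0(1,2), where F'="\<lambda>w. ((- (R w o\<^sub>L R w)) o\<^sub>L Aop) - cmul (deriv u w) Aop"
        and ?r0.0="1/2" and ?r1.0=2 and C="(2 * C + 8 * norm Aop + 2 * norm Bop) * B"])
      show "(F has_derivative (\<lambda>h. cmul h (((- (R w o\<^sub>L R w)) o\<^sub>L Aop) - cmul (deriv u w) Aop))) (at w)"
        if w: "w \<in> outer_sector \<phi>" for w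
      proof -
        have "w \<in> \<Omega>" "w \<in> V" using w sub\<Omega> subV by auto
        have "(F has_derivative (\<lambda>h. (cmul h (- (R w o\<^sub>L R w)) o\<^sub>L Aop) - cmul (h * deriv u w) Aop)) (at w)"
          unfolding F_def[abs_def]
          by (intro has_derivative_diff bounded_linear.has_derivative[OF bounded_linear_compose_left R_has_derivative[OF \<open>w \<in> \<Omega>\<close>]]
               bounded_linear.has_derivative[OF cm.bounded_linear_left holomorphic_has_derivative[OF u V \<open>w \<in> V\<close>]])
        then show ?thesis by (simp only: cmul_compose cm.diff_right cmul_cmul)
      qed
      show "continuous_on (outer_sector \<phi>) (\<lambda>w. ((- (R w o\<^sub>L R w)) o\<^sub>L Aop) - cmul (deriv u w) Aop)"
        using continuous_on_subset[OF continuous_on_R sub\<Omega>] continuous_on_subset[OF holomorphic_continuous_deriv[OF u V] subV]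
        by (intro continuous_intros cm.continuous_on bounded_bilinear.continuous_on[OF bounded_bilinear_blinfun_compose])
      \<comment> \<open>The estimate uses the formula \<open>Feq\<close>, whose single terms blow up
        at i and -i although \<open>F\<close> does not. Excluding 1/2 < |w| < 2 stays clear of these
        points.\<close>
      show "norm (F w) \<le> ((2 * C + 8 * norm Aop + 2 * norm Bop) * B) / (1 + (norm w)\<^sup>2)"
        if w: "w \<in> outer_sector \<phi>" and far: "norm w \<le> 1 / 2 \<or> 2 \<le> norm w" for w
      proof -
        define t where "t = norm w"
        have t0: "t > 0" using sector_nz(2)[OF w] by (simp add: t_def)
        have pos: "1 + t\<^sup>2 > 0" by (simp add: add_pos_nonneg)
        have 1: "(1 + t\<^sup>2) / 2 \<le> norm (1 + w\<^sup>2)" "(1 + t\<^sup>2) / 2 \<le> norm (w\<^sup>2 - 1)"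
          using far_from_unit_circle[OF far] by (simp_all add: t_def)
        have nz: "1 + w\<^sup>2 \<noteq> 0" "w\<^sup>2 - 1 \<noteq> 0" using 1 pos by (metis half_gt_zero norm_zero not_le)+
        have a: "norm (fA w) \<le> t / ((1 + t\<^sup>2) / 2)"
          unfolding fA_def norm_divide t_def[symmetric] using 1(1) pos t0 by (intro frac_le) auto
        have b: "norm (fB w) \<le> 1 / ((1 + t\<^sup>2) / 2)"
          unfolding fB_def norm_divide norm_one using 1(1) pos by (intro frac_le) auto
        have "u w - fA w = 2 * w / ((1 + w\<^sup>2) * (w\<^sup>2 - 1))"
          unfolding u_def fA_def using nz by (simp add: divide_simps) (simp add: algebra_simps)
        then have "norm (F1 w + F2 w) = 2 * t / (norm (1 + w\<^sup>2) * norm (w\<^sup>2 - 1))"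
          unfolding uF[OF nz(1) ne[OF w], symmetric] by (simp add: norm_divide norm_mult t_def)
        also have "\<dots> \<le> (1 + t\<^sup>2) / (((1 + t\<^sup>2) / 2) * ((1 + t\<^sup>2) / 2))"
          using 1 pos sum_squares_bound[of t 1] by (intro frac_le mult_mono mult_pos_pos) auto
        also have "\<dots> = 4 / (1 + t\<^sup>2)"
        proof -
          have aux: "x / ((x / 2) * (x / 2)) = 4 / x" if "x \<noteq> 0" for x :: real using that by (simp add: field_simps)
          show ?thesis by (rule aux) (use pos in simp)
        qed
        finally have f: "norm (F1 w + F2 w) \<le> 4 / (1 + t\<^sup>2)" .
        have r: "norm (R w) \<le> C / t" using C(2)[OF w] by (simp add: t_def)
        have "norm (F w) \<le> norm (cmul (fA w) (R w)) + norm (cmul (F1 w + F2 w) Aop) + norm (cmul (fB w) Bop)"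
          unfolding Feq[OF subsetD[OF sub\<Omega> w] nz(1) ne[OF w]]
          by (intro norm_triangle_le_diff add_mono order_refl)
        also have "\<dots> \<le> norm (fA w) * norm (R w) * B + norm (F1 w + F2 w) * norm Aop * B + norm (fB w) * norm Bop * B"
          by (intro add_mono B)
        also have "\<dots> \<le> (t / ((1 + t\<^sup>2) / 2)) * (C / t) * B + (4 / (1 + t\<^sup>2)) * norm Aop * B + (1 / ((1 + t\<^sup>2) / 2)) * norm Bop * B"
          using a b f r B(1) t0 pos by (intro add_mono mult_right_mono mult_mono) auto
        also have "\<dots> = ((2 * C + 4 * norm Aop + 2 * norm Bop) * B) / (1 + t\<^sup>2)"
        proof -
          have aux: "(t / (X / 2)) * (C / t) * B + (4 / X) * a * B + (1 / (X / 2)) * b * B = ((2 * C + 4 * a + 2 * b) * B) / X"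
            if "X \<noteq> 0" for X a b :: real using that t0 by (simp add: field_simps)
          show ?thesis by (rule aux) (use pos in simp)
        qed
        also have "\<dots> \<le> ((2 * C + 8 * norm Aop + 2 * norm Bop) * B) / (1 + t\<^sup>2)"
          using pos B(1) by (intro divide_right_mono mult_right_mono) auto
        finally show ?thesis unfolding t_def .
      qed
    qed (use intFF in auto)
  qed
  then have "contour \<phi> (\<lambda>w. cmul (fA w) (R w)) = cmul (2 * pi * \<i>) Aop" using sum by simp
  then show ?thesis unfolding Phi_def by (simp add: cmul_cmul)
qed

text \<open>\<open>fB\<close> is not a null function, so \<open>Phi_mult\<close> does not cover this
  product. The partial fractions of \<open>fB\<close> at i and -i reduce it to
  \<open>Phi_resolvent\<close> at these two points.\<close>

lemma Phi_Bop:
  assumes h: "h \<in> sector_null \<theta>" and \<phi>: "\<omega> < \<phi>" "\<phi> < \<theta>"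
  shows "Phi \<phi> h o\<^sub>L Bop = Phi \<phi> (\<lambda>w. fB w * h w)" "Bop o\<^sub>L Phi \<phi> h = Phi \<phi> (\<lambda>w. fB w * h w)"
proof -
  have \<theta>: "0 < \<theta>" and \<phi>0: "0 < \<phi>" "\<phi> < pi / 2" using angles \<phi> by auto
  obtain \<phi>' where \<phi>': "\<phi> < \<phi>'" "\<phi>' < pi / 2" using \<phi>0 dense by blast
  note adm = sector_null_admissible[OF h \<phi>0(1) \<phi>(2) angles(3)]
  have a1: "ray_admissible \<phi> (\<lambda>w. h w / (\<i> - w))" "ray_admissible \<phi> (\<lambda>w. h w / (- \<i> - w))"
    by (rule admissible_resolvent_quotient[OF adm \<phi>0(1) \<phi>' i_outer(1)], rule admissible_resolvent_quotient[OF adm \<phi>0(1) \<phi>' i_outer(2)])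
  have "Phi \<phi> h o\<^sub>L Bop = cmul (\<i> / 2) (Phi \<phi> (\<lambda>w. h w / (\<i> - w)) - Phi \<phi> (\<lambda>w. h w / (- \<i> - w)))"
    unfolding Bop_def compose_cmul[OF Phi_commute_J0[OF \<phi>(1) \<phi>0(2) adm]]
      bounded_bilinear.diff_right[OF bounded_bilinear_blinfun_compose]
      Phi_resolvent[OF h \<phi> \<phi>' i_outer(1)] Phi_resolvent[OF h \<phi> \<phi>' i_outer(2)] ..
  also have "\<dots> = cmul (\<i> / 2) (Phi \<phi> (\<lambda>w. h w / (\<i> - w))) + cmul (- \<i> / 2) (Phi \<phi> (\<lambda>w. h w / (- \<i> - w)))"
    by (simp add: cm.diff_right cm.minus_left)
  also have "\<dots> = Phi \<phi> (\<lambda>w. \<i> / 2 * (h w / (\<i> - w)) + - \<i> / 2 * (h w / (- \<i> - w)))"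
  proof -
    have "ray_admissible \<phi> (\<lambda>w. c * (h w / (\<i> - w)))" "ray_admissible \<phi> (\<lambda>w. c * (h w / (- \<i> - w)))" for c
      using ray_admissible_mult_bounded[OF a1(1) \<phi>0, of "\<lambda>_. c" "norm c"]
        ray_admissible_mult_bounded[OF a1(2) \<phi>0, of "\<lambda>_. c" "norm c"] by auto
    then show ?thesis
      by (subst Phi_add[OF \<phi>(1) \<phi>0(2)]) (simp_all only: Phi_cmul[OF \<phi>(1) \<phi>0(2) a1(1)] Phi_cmul[OF \<phi>(1) \<phi>0(2) a1(2)])
  qed
  also have "\<dots> = Phi \<phi> (\<lambda>w. fB w * h w)"
  proof (rule Phi_cong)
    fix t d assume d: "d \<in> dirs \<phi>" "t > (0::real)"
    let ?w = "of_real t * d"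
    have nz: "1 + ?w\<^sup>2 \<noteq> 0" by (rule one_plus_square_nz[OF \<phi>0 dirs_inner[OF d \<phi>0]])
    have id: "\<i> / 2 * (h / (\<i> - w)) + - \<i> / 2 * (h / (- \<i> - w)) = fB w * h" if "1 + w\<^sup>2 \<noteq> 0" for w h
    proof -
      have f: "1 + w\<^sup>2 = (\<i> - w) * (- \<i> - w)" by (simp add: algebra_simps power2_eq_square)
      then have "\<i> - w \<noteq> 0" "- \<i> - w \<noteq> 0" using that by auto
      then show ?thesis unfolding fB_def f by (simp add: divide_simps) (simp add: algebra_simps)
    qed
    show "\<i> / 2 * (h ?w / (\<i> - ?w)) + - \<i> / 2 * (h ?w / (- \<i> - ?w)) = fB ?w * h ?w"
      by (rule id[OF nz])
  qed
  finally show 1: "Phi \<phi> h o\<^sub>L Bop = Phi \<phi> (\<lambda>w. fB w * h w)" .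
  have "Bop o\<^sub>L Phi \<phi> h = Phi \<phi> h o\<^sub>L Bop"
    unfolding Bop_def compose_cmul[OF Phi_commute_J0[OF \<phi>(1) \<phi>0(2) adm]] cmul_compose
      bounded_bilinear.diff_right[OF bounded_bilinear_blinfun_compose] bounded_bilinear.diff_left[OF bounded_bilinear_blinfun_compose]
      Phi_commute_R[OF \<phi>(1) \<phi>0(2) adm i_\<Omega>(1)] Phi_commute_R[OF \<phi>(1) \<phi>0(2) adm i_\<Omega>(2)] ..
  then show "Bop o\<^sub>L Phi \<phi> h = Phi \<phi> (\<lambda>w. fB w * h w)" using 1 by simp
qed

end

section \<open>The extended functional calculus\<close>

text \<open>The integral of 1/t from p to q depends only on the ratio q/p and is unbounded in it, so
  a null function cannot stay away from zero on intervals of arbitrarily large ratio.\<close>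

lemma sector_null_lower_bound:
  assumes h: "h \<in> sector_null \<theta>" and \<theta>: "0 < \<theta>" "\<theta> < pi / 2"
    and pq: "0 < p" "p \<le> q" and low: "\<And>t. p \<le> t \<Longrightarrow> t \<le> q \<Longrightarrow> \<epsilon> \<le> norm (h (of_real t))"
  shows "\<epsilon> * ln (q / p) \<le> integral {0<..} (\<lambda>t. norm (h (of_real t)) / t)"
proof -
  have 1: "1 \<in> bisector \<theta>" using \<theta> tan_gt_zero[of \<theta>] by (simp add: bisector_def)
  then have "\<forall>d\<in>bisector \<theta>. norm d = 1 \<longrightarrow> (\<lambda>t. norm (h (of_real t * d)) / t) integrable_on {0<..}"
    using h by (simp add: sector_null_def)
  from bspec[OF this 1] have i: "(\<lambda>t. norm (h (of_real t)) / t) integrable_on {0<..}" by simp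
  have "((\<lambda>t. \<epsilon> / t) has_integral \<epsilon> * ln q - \<epsilon> * ln p) {p..q}"
  proof (rule fundamental_theorem_of_calculus[OF pq(2)])
    fix x assume "x \<in> {p..q}"
    then have "x > 0" using pq by auto
    then have "((\<lambda>t. \<epsilon> * ln t) has_real_derivative \<epsilon> * (1 / x)) (at x within {p..q})"
      by (intro DERIV_cmult has_field_derivative_at_within[OF DERIV_ln_divide])
    then show "((\<lambda>t. \<epsilon> * ln t) has_vector_derivative \<epsilon> / x) (at x within {p..q})"
      by (simp add: has_real_derivative_iff_has_vector_derivative)
  qed
  moreover have "\<epsilon> * ln q - \<epsilon> * ln p = \<epsilon> * ln (q / p)" using pq by (simp add: ln_div right_diff_distrib)
  ultimately have e: "((\<lambda>t. \<epsilon> / t) has_integral \<epsilon> * ln (q / p)) {p..q}" by simp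
  have sub: "{p..q} \<subseteq> {0<..}" using pq by auto
  have i': "(\<lambda>t. norm (h (of_real t)) / t) integrable_on {p..q}"
    using integrable_on_subcbox[OF i, of p q] sub by simp
  have "\<epsilon> * ln (q / p) \<le> integral {p..q} (\<lambda>t. norm (h (of_real t)) / t)"
    by (rule has_integral_le[OF e integrable_integral[OF i']]) (use low pq in \<open>auto intro!: divide_right_mono\<close>)
  also have "\<dots> \<le> integral {0<..} (\<lambda>t. norm (h (of_real t)) / t)"
    by (rule integral_subset_le[OF sub i' i]) auto
  finally show ?thesis .
qed

text \<open>If L were nonzero, |h| would stay above |L|/2 near the end in question, hence on
  intervals of every prescribed ratio, against the lower bound. Null functions need not have limits
  at either end; the claim is that no other limit is possible.\<close>

lemma sector_null_limits:
  assumes h: "h \<in> sector_null \<theta>" and \<theta>: "0 < \<theta>" "\<theta> < pi / 2"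
  shows "((\<lambda>t. h (of_real t)) \<longlongrightarrow> L) at_top \<Longrightarrow> L = 0"
    and "((\<lambda>t. h (of_real t)) \<longlongrightarrow> L) (at_right 0) \<Longrightarrow> L = 0"
proof -
  define I where "I = integral {0<..} (\<lambda>t. norm (h (of_real t)) / t)"
  have contra: False if "\<epsilon> > 0" "\<And>r. r > 1 \<Longrightarrow> \<exists>p q. 0 < p \<and> p \<le> q \<and> q / p = r \<and> (\<forall>t. p \<le> t \<and> t \<le> q \<longrightarrow> \<epsilon> \<le> norm (h (of_real t)))" for \<epsilon>
  proof -
    \<comment> \<open>Chosen so that \<epsilon> times ln r equals |I| + 1, which exceeds the
      integral.\<close>
    define r where "r = exp ((\<bar>I\<bar> + 1) / \<epsilon>)"
    have "r > 1" unfolding r_def using that(1) by (auto intro!: divide_pos_pos)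
    from that(2)[OF this] obtain p q where pq: "0 < p" "p \<le> q" "q / p = r" "\<And>t. p \<le> t \<Longrightarrow> t \<le> q \<Longrightarrow> \<epsilon> \<le> norm (h (of_real t))"
      by blast
    have "\<epsilon> * ln r \<le> I"
      using sector_null_lower_bound[OF h \<theta> pq(1,2,4)] unfolding pq(3) I_def by blast
    moreover have "\<epsilon> * ln r = \<bar>I\<bar> + 1" unfolding r_def using that(1) by simp
    ultimately show False by simp
  qed
  have ev: "eventually (\<lambda>t. norm L / 2 \<le> norm (h (of_real t))) F" if "((\<lambda>t. h (of_real t)) \<longlongrightarrow> L) F" "L \<noteq> 0" for F
  proof -
    have "eventually (\<lambda>t. norm L / 2 < norm (h (of_real t))) F"
      by (rule order_tendstoD(1)[OF tendsto_norm[OF that(1)]]) (use that(2) in simp)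
    then show ?thesis by eventually_elim simp
  qed
  show "L = 0" if "((\<lambda>t. h (of_real t)) \<longlongrightarrow> L) at_top"
  proof (rule ccontr)
    assume "L \<noteq> 0"
    from ev[OF that this] obtain M where M: "\<And>t. t \<ge> M \<Longrightarrow> norm L / 2 \<le> norm (h (of_real t))"
      unfolding eventually_at_top_linorder by blast
    show False
    proof (rule contra)
      show "norm L / 2 > 0" using \<open>L \<noteq> 0\<close> by simp
      fix r :: real assume "r > 1"
      then show "\<exists>p q. 0 < p \<and> p \<le> q \<and> q / p = r \<and> (\<forall>t. p \<le> t \<and> t \<le> q \<longrightarrow> norm L / 2 \<le> norm (h (of_real t)))"
        by (intro exI[of _ "max M 1"] exI[of _ "max M 1 * r"]) (use M in \<open>auto simp: max_def\<close>)
    qed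
  qed
  show "L = 0" if "((\<lambda>t. h (of_real t)) \<longlongrightarrow> L) (at_right 0)"
  proof (rule ccontr)
    assume "L \<noteq> 0"
    from ev[OF that this] obtain b where b: "b > 0" "\<And>t. t > 0 \<Longrightarrow> t < b \<Longrightarrow> norm L / 2 \<le> norm (h (of_real t))"
      unfolding eventually_at_right_field by blast
    show False
    proof (rule contra)
      show "norm L / 2 > 0" using \<open>L \<noteq> 0\<close> by simp
      fix r :: real assume r: "r > 1"
      have "norm L / 2 \<le> norm (h (of_real t))" if "b / 2 / r \<le> t" "t \<le> b / 2" for t
      proof -
        have "0 < b / 2 / r" using b r by simp
        then show ?thesis using b(2)[of t] that b(1) by linarith
      qed
      moreover have "b / 2 / r \<le> b / 2" using b r by (simp add: pos_divide_le_eq)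
      ultimately show "\<exists>p q. 0 < p \<and> p \<le> q \<and> q / p = r \<and> (\<forall>t. p \<le> t \<and> t \<le> q \<longrightarrow> norm L / 2 \<le> norm (h (of_real t)))"
        using b r by (intro exI[of _ "b / 2 / r"] exI[of _ "b / 2"]) auto
    qed
  qed
qed

lemma sector_null_scale: "h \<in> sector_null \<theta> \<Longrightarrow> (\<lambda>w. c * h w) \<in> sector_null \<theta>"
  by (rule sector_null_mult_bounded) (auto simp: bounded_iff)

lemma sector_null_mult: "h \<in> sector_null \<theta> \<Longrightarrow> k \<in> sector_null \<theta> \<Longrightarrow> (\<lambda>w. k w * h w) \<in> sector_null \<theta>"
  by (rule sector_null_mult_bounded) (auto simp: sector_null_def)

text \<open>Along the positive real axis \<open>fB\<close> tends to 0 at infinity and to 1 at the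
  origin. The difference of the two null functions has limits there, which must be 0: the limit at
  infinity yields c = c', and then the limit at 0 yields d = d'.\<close>

lemma sector_bounded_components_unique:
  fixes c c' d d' :: real
  assumes \<theta>: "0 < \<theta>" "\<theta> < pi / 2" and h: "h \<in> sector_null \<theta>" "h' \<in> sector_null \<theta>"
    and eq: "\<And>w. w \<in> bisector \<theta> \<Longrightarrow> of_real c + of_real d * fB w + h w = of_real c' + of_real d' * fB w + h' w"
  shows "c = c'" "d = d'" "\<And>w. w \<in> bisector \<theta> \<Longrightarrow> h w = h' w"
proof -
  define k where "k w = h w + -1 * h' w" for w
  have k: "k \<in> sector_null \<theta>" unfolding k_def[abs_def] using h by (intro sector_null_add sector_null_scale)
  have mem: "of_real t \<in> bisector \<theta>" if "t > 0" for t :: real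
    using bisector_scaleI[of 1 \<theta> t] that tan_gt_zero[of \<theta>] \<theta> by (simp add: bisector_def)
  have kt: "k (of_real t) = of_real ((c' - c) + (d' - d) * (1 / (1 + t\<^sup>2)))" if "t > 0" for t
    using eq[OF mem[OF that]] by (simp add: k_def fB_def algebra_simps diff_divide_distrib)
  have "((\<lambda>t. k (of_real t)) \<longlongrightarrow> of_real ((c' - c) + (d' - d) * 0)) at_top"
  proof (rule Lim_transform_eventually)
    have "((\<lambda>t::real. 1 / (1 + t\<^sup>2)) \<longlongrightarrow> 0) at_top" by real_asymp
    then show "((\<lambda>t. complex_of_real ((c' - c) + (d' - d) * (1 / (1 + t\<^sup>2)))) \<longlongrightarrow> of_real ((c' - c) + (d' - d) * 0)) at_top"
      by (intro tendsto_intros)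
    show "eventually (\<lambda>t. complex_of_real ((c' - c) + (d' - d) * (1 / (1 + t\<^sup>2))) = k (of_real t)) at_top"
      using eventually_gt_at_top[of 0] by eventually_elim (simp only: kt)
  qed
  from sector_null_limits(1)[OF k \<theta> this] show c: "c = c'" by (simp flip: of_real_diff)
  have "((\<lambda>t. k (of_real t)) \<longlongrightarrow> of_real ((c' - c) + (d' - d) * (1 / (1 + 0\<^sup>2)))) (at_right 0)"
  proof (rule Lim_transform_eventually)
    show "((\<lambda>t. complex_of_real ((c' - c) + (d' - d) * (1 / (1 + t\<^sup>2)))) \<longlongrightarrow> of_real ((c' - c) + (d' - d) * (1 / (1 + 0\<^sup>2)))) (at_right 0)"
      by (intro tendsto_intros) simp
    show "eventually (\<lambda>t. complex_of_real ((c' - c) + (d' - d) * (1 / (1 + t\<^sup>2))) = k (of_real t)) (at_right 0)"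
      using eventually_at_right_less[of 0] by eventually_elim (simp only: kt)
  qed
  from sector_null_limits(2)[OF k \<theta> this] show d: "d = d'" using c by (simp flip: of_real_diff)
  show "h w = h' w" if "w \<in> bisector \<theta>" for w using eq[OF that] c d by simp
qed

text \<open>The parity of the slice components, even \<open>f0\<close> and odd \<open>f1\<close>,
  expressed for the function with real part \<open>f0\<close> and imaginary part
  \<open>f1\<close>.\<close>

definition sector_symmetric :: "real \<Rightarrow> (complex \<Rightarrow> complex) \<Rightarrow> bool" where
  "sector_symmetric \<theta> h \<longleftrightarrow> (\<forall>z\<in>bisector \<theta>. h (cnj z) = cnj (h z))"

context resolvent_family
begin

text \<open>A relation between functions and operators, so that the components c, d, h need not be
  chosen; \<open>calc_unique\<close> makes it single valued. Real constants and symmetry are exactly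
  what the coordinates of a Clifford-valued slice function provide.\<close>

definition calc :: "real \<Rightarrow> (complex \<Rightarrow> complex) \<Rightarrow> ('v \<Rightarrow>\<^sub>L 'v) \<Rightarrow> bool" where
  "calc \<phi> k X \<longleftrightarrow> (\<exists>c d h. h \<in> sector_null \<theta> \<and> sector_symmetric \<theta> h \<and>
     (\<forall>w\<in>bisector \<theta>. k w = of_real c + of_real d * fB w + h w) \<and>
     X = c *\<^sub>R id_blinfun + d *\<^sub>R Bop + Phi \<phi> h)"

lemma \<theta>_bounds: "0 < \<theta>" "\<theta> < pi / 2" using angles by auto

context
  fixes \<phi> assumes \<phi>: "\<omega> < \<phi>" "\<phi> < \<theta>"
begin

section \<open>The commutative algebra of constants, \<open>fB\<close> and null functions\<close>

lemma \<phi>_bounds: "0 < \<phi>" "\<phi> < pi / 2" using angles \<phi> by auto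

lemma adm_null: "h \<in> sector_null \<theta> \<Longrightarrow> ray_admissible \<phi> h"
  by (rule sector_null_admissible[OF _ \<phi>_bounds(1) \<phi>(2) angles(3)])

lemma Phi_eqI: "(\<And>w. w \<in> bisector \<theta> \<Longrightarrow> h w = k w) \<Longrightarrow> Phi \<phi> h = Phi \<phi> k"
  by (rule Phi_cong) (use bisector_scaleI[OF dirs_bisector[OF \<phi>_bounds(1) \<phi>(2) angles(3)]] in blast)

lemma Phi_scaleR: "h \<in> sector_null \<theta> \<Longrightarrow> Phi \<phi> (\<lambda>w. of_real c * h w) = c *\<^sub>R Phi \<phi> h"
  using Phi_cmul[OF \<phi>(1) \<phi>_bounds(2) adm_null, of h "of_real c"] by simp

lemma Phi_plus: "h \<in> sector_null \<theta> \<Longrightarrow> k \<in> sector_null \<theta> \<Longrightarrow> Phi \<phi> (\<lambda>w. h w + k w) = Phi \<phi> h + Phi \<phi> k"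
  by (rule Phi_add[OF \<phi>(1) \<phi>_bounds(2)]) (auto intro: adm_null)

lemma calc_unique:
  assumes "calc \<phi> k X" "calc \<phi> k' X'" "\<And>w. w \<in> bisector \<theta> \<Longrightarrow> k w = k' w" shows "X = X'"
proof -
  from assms obtain c d h c' d' h' where h: "h \<in> sector_null \<theta>" "h' \<in> sector_null \<theta>"
    and k: "\<And>w. w \<in> bisector \<theta> \<Longrightarrow> k w = of_real c + of_real d * fB w + h w"
      "\<And>w. w \<in> bisector \<theta> \<Longrightarrow> k' w = of_real c' + of_real d' * fB w + h' w"
    and X: "X = c *\<^sub>R id_blinfun + d *\<^sub>R Bop + Phi \<phi> h" "X' = c' *\<^sub>R id_blinfun + d' *\<^sub>R Bop + Phi \<phi> h'"
    unfolding calc_def by blast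
  have "of_real c + of_real d * fB w + h w = of_real c' + of_real d' * fB w + h' w" if "w \<in> bisector \<theta>" for w
    using k[OF that] assms(3)[OF that] by simp
  note eq = this
  have "c = c'" by (rule sector_bounded_components_unique(1)[OF \<theta>_bounds h eq])
  moreover have "d = d'" by (rule sector_bounded_components_unique(2)[OF \<theta>_bounds h eq])
  moreover have "Phi \<phi> h = Phi \<phi> h'"
    by (rule Phi_eqI, rule sector_bounded_components_unique(3)[OF \<theta>_bounds h eq])
  ultimately show ?thesis unfolding X by simp
qed

lemma calc_cong:
  "calc \<phi> k X \<Longrightarrow> (\<And>w. w \<in> bisector \<theta> \<Longrightarrow> k w = k' w) \<Longrightarrow> calc \<phi> k' X"
  unfolding calc_def by (elim exE, intro exI) auto

lemma calcI:
  "h \<in> sector_null \<theta> \<Longrightarrow> sector_symmetric \<theta> h \<Longrightarrow> calc \<phi> (\<lambda>w. of_real c + of_real d * fB w + h w) (c *\<^sub>R id_blinfun + d *\<^sub>R Bop + Phi \<phi> h)"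
  unfolding calc_def by blast

lemma null_zero: "(\<lambda>_. 0) \<in> sector_null \<theta>" "Phi \<phi> (\<lambda>_. 0) = 0"
proof -
  show *: "(\<lambda>_. 0) \<in> sector_null \<theta>" by (auto simp: sector_null_def bounded_iff intro!: integrable_0)
  show "Phi \<phi> (\<lambda>_. 0) = 0" using Phi_scaleR[OF *, of 0] by simp
qed

lemma calc_const: "calc \<phi> (\<lambda>_. of_real c) (c *\<^sub>R id_blinfun)"
  using calcI[of "\<lambda>_. 0" c 0] null_zero by (simp add: sector_symmetric_def)

lemma calc_fB: "calc \<phi> fB Bop"
  using calcI[of "\<lambda>_. 0" 0 1] null_zero by (simp add: sector_symmetric_def)

lemma calc_fA: "calc \<phi> fA Aop"
  using calcI[of fA 0 0] sector_decay_null[OF fA_decay[OF \<theta>_bounds]] Phi_fA[OF \<phi>]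
  by (simp add: sector_symmetric_def fAB_cnj)

lemma calc_add:
  assumes "calc \<phi> k X" "calc \<phi> k' X'" shows "calc \<phi> (\<lambda>w. k w + k' w) (X + X')"
proof -
  from assms obtain c d h c' d' h' where h: "h \<in> sector_null \<theta>" "h' \<in> sector_null \<theta>"
    and s: "sector_symmetric \<theta> h" "sector_symmetric \<theta> h'"
    and k: "\<And>w. w \<in> bisector \<theta> \<Longrightarrow> k w = of_real c + of_real d * fB w + h w"
      "\<And>w. w \<in> bisector \<theta> \<Longrightarrow> k' w = of_real c' + of_real d' * fB w + h' w"
    and X: "X = c *\<^sub>R id_blinfun + d *\<^sub>R Bop + Phi \<phi> h" "X' = c' *\<^sub>R id_blinfun + d' *\<^sub>R Bop + Phi \<phi> h'"
    unfolding calc_def by blast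
  show ?thesis
    unfolding calc_def
  proof (intro exI conjI ballI)
    show "(\<lambda>w. h w + h' w) \<in> sector_null \<theta>" using h by (rule sector_null_add)
    show "sector_symmetric \<theta> (\<lambda>w. h w + h' w)" using s by (simp add: sector_symmetric_def)
    show "X + X' = (c + c') *\<^sub>R id_blinfun + (d + d') *\<^sub>R Bop + Phi \<phi> (\<lambda>w. h w + h' w)"
      unfolding X Phi_plus[OF h] by (simp add: scaleR_add_left)
  qed (simp add: k algebra_simps)
qed

text \<open>Of the nine products of components only that of the two multiples of \<open>fB\<close>
  is neither of a given type nor null by boundedness: there d d' fB^2 becomes d d' fB - d d' fA^2.
  On the operator side \<open>Bop_square\<close> splits in the same way, and
  \<open>Phi_mult\<close>, \<open>Phi_Bop\<close> and \<open>Phi_fA\<close> evaluate the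
  rest.\<close>

lemma calc_mult:
  assumes "calc \<phi> k X" "calc \<phi> k' X'" shows "calc \<phi> (\<lambda>w. k w * k' w) (X o\<^sub>L X')"
proof -
  from assms obtain c d h c' d' h' where h: "h \<in> sector_null \<theta>" "h' \<in> sector_null \<theta>"
    and s: "sector_symmetric \<theta> h" "sector_symmetric \<theta> h'"
    and k: "\<And>w. w \<in> bisector \<theta> \<Longrightarrow> k w = of_real c + of_real d * fB w + h w"
      "\<And>w. w \<in> bisector \<theta> \<Longrightarrow> k' w = of_real c' + of_real d' * fB w + h' w"
    and X: "X = c *\<^sub>R id_blinfun + d *\<^sub>R Bop + Phi \<phi> h" "X' = c' *\<^sub>R id_blinfun + d' *\<^sub>R Bop + Phi \<phi> h'"
    unfolding calc_def by blast
  have fA: "fA \<in> sector_null \<theta>" by (rule sector_decay_null[OF fA_decay[OF \<theta>_bounds]])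
  define a where "a w = of_real (- (d * d')) * (fA w * fA w)" for w
  define a1 where "a1 w = of_real c * h' w" for w
  define a2 where "a2 w = of_real c' * h w" for w
  define a3 where "a3 w = of_real d * (fB w * h' w)" for w
  define a4 where "a4 w = of_real d' * (fB w * h w)" for w
  define a5 where "a5 w = h w * h' w" for w
  have AA: "(\<lambda>w. fA w * fA w) \<in> sector_null \<theta>" by (rule sector_null_mult[OF fA fA])
  have fBh: "(\<lambda>w. fB w * h w) \<in> sector_null \<theta>" "(\<lambda>w. fB w * h' w) \<in> sector_null \<theta>"
    using sector_null_mult_bounded[OF _ holomorphic_fAB(2)[OF \<theta>_bounds] bounded_fB[OF \<theta>_bounds]] h by blast+
  have n: "a \<in> sector_null \<theta>" "a1 \<in> sector_null \<theta>" "a2 \<in> sector_null \<theta>" "a3 \<in> sector_null \<theta>" "a4 \<in> sector_null \<theta>" "a5 \<in> sector_null \<theta>"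
    unfolding a_def[abs_def] a1_def[abs_def] a2_def[abs_def] a3_def[abs_def] a4_def[abs_def] a5_def[abs_def]
    using sector_null_scale AA h fBh sector_null_mult[OF h(2,1)] by blast+
  have v: "Phi \<phi> a = (- (d * d')) *\<^sub>R (Aop o\<^sub>L Aop)" "Phi \<phi> a1 = c *\<^sub>R Phi \<phi> h'" "Phi \<phi> a2 = c' *\<^sub>R Phi \<phi> h"
    "Phi \<phi> a3 = d *\<^sub>R (Bop o\<^sub>L Phi \<phi> h')" "Phi \<phi> a4 = d' *\<^sub>R (Phi \<phi> h o\<^sub>L Bop)" "Phi \<phi> a5 = Phi \<phi> h o\<^sub>L Phi \<phi> h'"
    unfolding a_def[abs_def] a1_def[abs_def] a2_def[abs_def] a3_def[abs_def] a4_def[abs_def] a5_def[abs_def]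
      Phi_scaleR[OF AA] Phi_scaleR[OF h(1)] Phi_scaleR[OF h(2)] Phi_scaleR[OF fBh(1)] Phi_scaleR[OF fBh(2)]
      Phi_mult[OF h \<phi>] Phi_Bop(1)[OF h(1) \<phi>] Phi_Bop(2)[OF h(2) \<phi>] Phi_mult[OF fA fA \<phi>, symmetric] Phi_fA[OF \<phi>]
    by simp_all
  show ?thesis
    unfolding calc_def
  proof (intro exI conjI ballI)
    show null: "(\<lambda>w. a w + (a1 w + (a2 w + (a3 w + (a4 w + a5 w))))) \<in> sector_null \<theta>"
      using n by (intro sector_null_add)
    have "fB (cnj z) = cnj (fB z)" "fA (cnj z) = cnj (fA z)" for z by (rule fAB_cnj)+
    then show "sector_symmetric \<theta> (\<lambda>w. a w + (a1 w + (a2 w + (a3 w + (a4 w + a5 w)))))"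
      using s by (simp add: sector_symmetric_def a_def a1_def a2_def a3_def a4_def a5_def)
    show "k w * k' w = of_real (c * c') + of_real (c * d' + d * c' + d * d') * fB w + (a w + (a1 w + (a2 w + (a3 w + (a4 w + a5 w)))))"
      if w: "w \<in> bisector \<theta>" for w
    proof -
      have "1 + w\<^sup>2 \<noteq> 0" using one_plus_square_nz[OF \<theta>_bounds] w bisector_subset_inner by blast
      then have A: "fA w * fA w = fB w - fB w * fB w" using fB_square[of w] by simp
      show ?thesis
        unfolding k[OF w] a_def A a1_def a2_def a3_def a4_def a5_def by (simp add: algebra_simps)
    qed
    have A: "Aop o\<^sub>L Aop = Bop - (Bop o\<^sub>L Bop)" using Bop_square by simp
    have id: "id_blinfun o\<^sub>L Y = Y" "Y o\<^sub>L id_blinfun = Y" for Y :: "'v \<Rightarrow>\<^sub>L 'v"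
      by (rule blinfun_eqI, simp)+
    have bil: "(c *\<^sub>R U) o\<^sub>L V = c *\<^sub>R (U o\<^sub>L V)" "U o\<^sub>L (c *\<^sub>R V) = c *\<^sub>R (U o\<^sub>L V)"
      "(U + W) o\<^sub>L V = (U o\<^sub>L V) + (W o\<^sub>L V)" "U o\<^sub>L (V + W) = (U o\<^sub>L V) + (U o\<^sub>L W)" for U V W :: "'v \<Rightarrow>\<^sub>L 'v" and c
      by (rule blinfun_eqI, simp add: blinfun.bilinear_simps)+
    have e: "Phi \<phi> (\<lambda>w. a w + (a1 w + (a2 w + (a3 w + (a4 w + a5 w))))) = Phi \<phi> a + (Phi \<phi> a1 + (Phi \<phi> a2 + (Phi \<phi> a3 + (Phi \<phi> a4 + Phi \<phi> a5))))"
      using n by (simp add: Phi_plus sector_null_add)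
    show "X o\<^sub>L X' = (c * c') *\<^sub>R id_blinfun + (c * d' + d * c' + d * d') *\<^sub>R Bop + Phi \<phi> (\<lambda>w. a w + (a1 w + (a2 w + (a3 w + (a4 w + a5 w)))))"
      unfolding e v A X bil id by (simp add: algebra_simps scaleR_add_left)
  qed
qed

lemma calc_commute:
  assumes "calc \<phi> k X" "calc \<phi> k' X'" shows "X o\<^sub>L X' = X' o\<^sub>L X"
  by (rule calc_unique[OF calc_mult[OF assms] calc_mult[OF assms(2,1)]]) (simp add: mult.commute)

end

end

section \<open>The closed graph theorem and Clifford modules\<close>

text \<open>By Baire, some set where |f| <= n is dense in a ball. Hence each x in a ball around 0 is
  a sum of elements \<open>u k\<close> whose images decrease geometrically; the images then sum up,
  and closedness identifies the sum with \<open>f x\<close>.\<close>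

theorem closed_graph:
  fixes f :: "'a::banach \<Rightarrow> 'b::banach"
  assumes "linear f" and closed: "closed {(x, y). y = f x}"
  shows "bounded_linear f"
proof -
  interpret linear f by fact
  define S where "S n = {x. norm (f x) \<le> real n}" for n :: nat
  have "(\<Union>n. closure (S n)) = UNIV"
  proof -
    have "\<exists>n. x \<in> closure (S n)" for x
    proof -
      obtain n where "norm (f x) \<le> real n" using real_arch_simple by blast
      then have "x \<in> S n" by (simp add: S_def)
      then show ?thesis using closure_subset by blast
    qed
    then show ?thesis by auto
  qed
  have "\<exists>n. interior (closure (S n)) \<noteq> {}"
  proof (rule ccontr)
    assume "\<not> ?thesis"
    then have "interior (closure (S n)) = {}" for n by simp
    then have int: "interior X = {}" "closed X" if "X \<in> range (\<lambda>n. closure (S n))" for X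
      using that by blast+
    have "Met_TC.mtopology interior_of \<Union> (range (\<lambda>n. closure (S n))) = {}"
    proof (rule Met_TC.metric_Baire_category_alt)
      show "Met_TC.mcomplete TYPE('a)" by (simp add: complete_UNIV)
      show "countable (range (\<lambda>n. closure (S n)))" by simp
      show "closedin Met_TC.mtopology X \<and> Met_TC.mtopology interior_of X = {}"
        if "X \<in> range (\<lambda>n. closure (S n))" for X
        using int[OF that] by simp
    qed
    then show False using \<open>(\<Union>n. closure (S n)) = UNIV\<close> by simp
  qed
  then obtain n x0 r where r: "r > 0" "ball x0 r \<subseteq> closure (S n)"
    by (metis all_not_in_conv mem_interior)
  \<comment> \<open>A difference of two elements of \<open>S n\<close> has an image of norm at most
    2n; the summand 1 makes \<open>N\<close> positive.\<close>
  define N where "N = 2 * real n + 1"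
  have N: "N > 0" by (simp add: N_def)
  have dense: "\<exists>u. norm (f u) \<le> N * e \<and> norm (x - u) < r * e / 2" if x: "norm x < r * e" and e: "e > 0" for x e
  proof -
    define y where "y = (1 / e) *\<^sub>R x"
    have ny: "norm y < r" using x e by (simp add: y_def pos_divide_less_eq)
    \<comment> \<open>The ball is centred at \<open>x0\<close>; subtracting an approximant of
      \<open>x0\<close> from one of \<open>x0 + y\<close> recentres it at 0.\<close>
    have "x0 \<in> closure (S n)" "x0 + y \<in> closure (S n)" using r ny by (auto simp: subset_iff dist_norm)
    moreover have "r / 4 > 0" using r by simp
    ultimately obtain a b where ab: "a \<in> S n" "dist a x0 < r / 4" "b \<in> S n" "dist b (x0 + y) < r / 4"
      unfolding closure_approachable by blast
    have "norm (f (b - a)) \<le> norm (f b) + norm (f a)" unfolding diff by (rule norm_triangle_ineq4)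
    then have 1: "norm (f (b - a)) \<le> N" using ab by (simp add: S_def N_def)
    have "norm (y - (b - a)) = norm ((a - x0) - (b - (x0 + y)))" by (simp add: algebra_simps)
    also have "\<dots> \<le> norm (a - x0) + norm (b - (x0 + y))" by (rule norm_triangle_ineq4)
    also have "\<dots> < r / 2" using ab by (simp add: dist_norm)
    finally have 2: "norm (y - (b - a)) < r / 2" .
    have xe: "x = e *\<^sub>R y" using e by (simp add: y_def)
    have "norm (f (e *\<^sub>R (b - a))) \<le> N * e" unfolding scale norm_scaleR using 1 e by (simp add: mult.commute)
    moreover have "norm (x - e *\<^sub>R (b - a)) < r * e / 2"
      unfolding xe scaleR_diff_right[symmetric] norm_scaleR using 2 e by (simp add: mult.commute)
    ultimately show ?thesis by blast
  qed
  have bound: "norm (f x) \<le> 2 * N" if x: "norm x < r" for x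
  proof -
    define step where "step k y = (SOME u. norm (f u) \<le> N * (1/2)^k \<and> norm (y - u) < r * (1/2)^k / 2)" for k :: nat and y
    define rem where "rem = rec_nat x (\<lambda>k y. y - step k y)"
    have rem: "rem 0 = x" "rem (Suc k) = rem k - step k (rem k)" for k by (simp_all add: rem_def)
    have st: "norm (f (step k y)) \<le> N * (1/2)^k \<and> norm (y - step k y) < r * (1/2)^k / 2" if "norm y < r * (1/2)^k" for k y
      unfolding step_def by (rule someI_ex, rule dense[OF that]) simp
    have nr: "norm (rem k) < r * (1/2)^k" for k
    proof (induction k)
      case (Suc k)
      show ?case using st[OF Suc] by (simp add: rem)
    qed (simp add: rem x)
    define u where "u k = step k (rem k)" for k
    have nf: "norm (f (u k)) \<le> N * (1/2)^k" for k using st[OF nr] by (simp add: u_def)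
    have sums: "(\<Sum>i<k. u i) = x - rem k" for k by (induction k) (simp_all add: rem u_def)
    have geo: "(\<lambda>k. N * (1/2)^k) sums (N * (1 / (1 - 1/2)))" by (intro sums_mult geometric_sums) simp
    have sf: "summable (\<lambda>k. norm (f (u k)))" by (rule summable_comparison_test'[OF sums_summable[OF geo]]) (use nf in simp)
    have "rem \<longlonglongrightarrow> 0"
    proof (rule Lim_null_comparison)
      show "eventually (\<lambda>k. norm (rem k) \<le> r * (1/2)^k) sequentially" using nr by (simp add: less_imp_le)
      show "(\<lambda>k. r * (1/2)^k) \<longlonglongrightarrow> 0" by (intro tendsto_mult_right_zero LIMSEQ_power_zero) simp
    qed
    then have l1: "(\<lambda>k. \<Sum>i<k. u i) \<longlonglongrightarrow> x" unfolding sums by (auto intro: tendsto_eq_intros)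
    have l2: "(\<lambda>k. f (\<Sum>i<k. u i)) \<longlonglongrightarrow> (\<Sum>k. f (u k))"
      unfolding sum by (rule summable_LIMSEQ[OF summable_norm_cancel[OF sf]])
    have "(x, \<Sum>k. f (u k)) \<in> {(x, y). y = f x}"
      by (rule closed_sequentially[OF closed _ tendsto_Pair[OF l1 l2]]) auto
    then have "f x = (\<Sum>k. f (u k))" by simp
    also have "norm \<dots> \<le> (\<Sum>k. norm (f (u k)))" by (rule summable_norm[OF sf])
    also have "\<dots> \<le> (\<Sum>k. N * (1/2)^k)" by (rule suminf_le[OF nf sf sums_summable[OF geo]])
    also have "\<dots> = 2 * N" using sums_unique[OF geo] by simp
    finally show ?thesis .
  qed
  show ?thesis
  proof (rule bounded_linear_intro[where K="4 * N / r"])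
    show "norm (f x) \<le> norm x * (4 * N / r)" for x
    proof (cases "x = 0")
      case False
      define c where "c = r / (2 * norm x)"
      have c: "c > 0" using r False by (simp add: c_def)
      have "norm (c *\<^sub>R x) < r" using r False by (simp add: c_def)
      from bound[OF this] have "c * norm (f x) \<le> 2 * N" using c by (simp add: scale)
      then have "norm (f x) \<le> 2 * N / c" using c by (simp add: pos_le_divide_eq mult.commute)
      then show ?thesis using r False by (simp add: c_def mult_ac)
    qed simp
  qed (simp_all add: add scale)
qed

section \<open>Clifford multiplication and imaginary units\<close>

lemma bounded_linear_axis: "bounded_linear (axis i :: 'v::real_normed_vector \<Rightarrow> 'v ^ 'm::finite)"
proof (rule bounded_linear_intro[where K=1])
  have "norm (axis i x :: 'v ^ 'm) \<le> (\<Sum>k\<in>UNIV. norm ((axis i x :: 'v ^ 'm) $ k))" for x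
    unfolding norm_vec_def by (rule L2_set_le_sum) simp
  then show "norm (axis i x :: 'v ^ 'm) \<le> norm x * 1" for x
    by (simp add: axis_def if_distrib cong: if_cong)
qed (simp_all add: axis_def vec_eq_iff)

lemma bounded_linear_lmul: "bounded_linear (\<lambda>v. a \<cdot> v)"
  unfolding lmul_def
  by (intro bounded_linear_sum bounded_linear_compose[OF bounded_linear_axis]
      bounded_linear_compose[OF bounded_linear_scaleR_right] bounded_linear_vec_nth)

lemma bounded_linear_rmul: "bounded_linear (\<lambda>v. v \<cdot>\<^sub>r a)"
  unfolding rmul_def
  by (intro bounded_linear_sum bounded_linear_compose[OF bounded_linear_axis]
      bounded_linear_compose[OF bounded_linear_scaleR_right] bounded_linear_vec_nth)

lemma bounded_linear_lmul_left: "bounded_linear (\<lambda>a. a \<cdot> v)"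
  unfolding lmul_def
  by (intro bounded_linear_sum bounded_linear_compose[OF bounded_linear_axis]
      bounded_linear_compose[OF bounded_linear_scaleR_left] bounded_linear_compose[OF bounded_linear_mult_left] bounded_linear_vec_nth)

lemma bounded_linear_rmul_right: "bounded_linear (\<lambda>a. v \<cdot>\<^sub>r a)"
  unfolding rmul_def
  by (intro bounded_linear_sum bounded_linear_compose[OF bounded_linear_axis]
      bounded_linear_compose[OF bounded_linear_scaleR_left] bounded_linear_compose[OF bounded_linear_mult_right] bounded_linear_vec_nth)

lemma rmul_axis:
  fixes x :: "'v::real_normed_vector" and c :: real
  shows "axis A x \<cdot>\<^sub>r axis B c = axis (sym_diff A B) ((cl_sgn A B * c) *\<^sub>R x)"
proof -
  have "axis A x \<cdot>\<^sub>r axis B c = (\<Sum>A'\<in>UNIV. \<Sum>B'\<in>UNIV. if A' = A then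
      (if B' = B then axis (sym_diff A B) ((cl_sgn A B * c) *\<^sub>R x) else 0) else 0)"
    unfolding rmul_def
  proof (intro sum.cong refl)
    fix A' B' :: "'a set"
    have ax: "axis i (0::'v) = (0 :: 'v ^ 'a set)" for i by (simp add: axis_def vec_eq_iff)
    show "axis (sym_diff A' B') ((cl_sgn A' B' * axis B c $ B') *\<^sub>R axis A x $ A') =
      (if A' = A then if B' = B then axis (sym_diff A B) ((cl_sgn A B * c) *\<^sub>R x) else 0 else 0)"
      by (cases "A' = A"; cases "B' = B") (simp_all add: axis_def[of A x] axis_def[of B c] ax)
  qed
  also have "\<dots> = axis (sym_diff A B) ((cl_sgn A B * c) *\<^sub>R x)"
    by (subst sum.swap) (simp add: sum.delta)
  finally show ?thesis .
qed

lemma rmul_assoc: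
  fixes v :: "('v::real_normed_vector, 'n::{finite,linorder}) clmodule"
  shows "(v \<cdot>\<^sub>r a) \<cdot>\<^sub>r b = v \<cdot>\<^sub>r (a \<cdot> b)"
proof -
  have *: "(axis A x \<cdot>\<^sub>r axis B c) \<cdot>\<^sub>r axis C d = axis A x \<cdot>\<^sub>r (axis B c \<cdot> axis C d)"
    for A B C :: "'n set" and x :: 'v and c d :: real
  proof -
    have "sym_diff (sym_diff A B) C = sym_diff A (sym_diff B C)" by blast
    then show ?thesis by (simp add: rmul_axis lmul_axis cl_sgn_sym_diff mult_ac)
  qed
  note lin = bounded_linear.linear[OF bounded_linear_rmul] bounded_linear.linear[OF bounded_linear_rmul_right]
  have "((\<Sum>A\<in>UNIV. axis A (v $ A)) \<cdot>\<^sub>r (\<Sum>B\<in>UNIV. axis B (a $ B))) \<cdot>\<^sub>r (\<Sum>C\<in>UNIV. axis C (b $ C))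
      = (\<Sum>A\<in>UNIV. axis A (v $ A)) \<cdot>\<^sub>r ((\<Sum>B\<in>UNIV. axis B (a $ B)) \<cdot> (\<Sum>C\<in>UNIV. axis C (b $ C)))"
    by (simp add: lmul_sum_left lmul_sum_right linear_sum[OF lin(1)] linear_sum[OF lin(2)] *)
  then show ?thesis by (simp flip: axis_expansion)
qed

lemma rmul_cl_real: "v \<cdot>\<^sub>r cl_real x = x *\<^sub>R v"
proof -
  note lin = bounded_linear.linear[OF bounded_linear_rmul]
  have "axis A c \<cdot>\<^sub>r axis {} x = x *\<^sub>R axis A c" for A :: "'b set" and c :: 'a
    by (simp add: rmul_axis cl_sgn_def) (simp add: axis_def vec_eq_iff)
  then have "(\<Sum>A\<in>UNIV. axis A (v $ A)) \<cdot>\<^sub>r axis {} x = x *\<^sub>R (\<Sum>A\<in>UNIV. axis A (v $ A))"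
    by (simp add: linear_sum[OF lin] scaleR_sum_right)
  then show ?thesis by (simp add: cl_real_def flip: axis_expansion)
qed

lemma lmul_scaleR_left: "(c *\<^sub>R a) \<cdot> v = c *\<^sub>R (a \<cdot> v)"
  by (rule linear_scale[OF bounded_linear.linear[OF bounded_linear_lmul_left]])

lemma lmul_scaleR_right: "a \<cdot> (c *\<^sub>R v) = c *\<^sub>R (a \<cdot> v)"
  by (rule linear_scale[OF bounded_linear.linear[OF bounded_linear_lmul]])

lemma lmul_minus: "(- a) \<cdot> v = - (a \<cdot> v)" "a \<cdot> (- v) = - (a \<cdot> v)"
  by (rule linear_neg[OF bounded_linear.linear[OF bounded_linear_lmul_left]])
     (rule linear_neg[OF bounded_linear.linear[OF bounded_linear_lmul]])

lemma clifford_norm_square: "(norm (s :: 'n::{finite,linorder} clifford))\<^sup>2 = (\<Sum>A\<in>UNIV. (s $ A)\<^sup>2)"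
  by (simp add: norm_vec_def L2_set_def sum_nonneg)

lemma imag_unit_nth: "J \<in> imag_units \<Longrightarrow> J $ {} = 0" by (simp add: imag_units_def)

lemma imag_unit_expansion:
  assumes "J \<in> imag_units" shows "J = (\<Sum>i\<in>UNIV. J $ {i} *\<^sub>R cl_gen i)"
proof (subst vec_eq_iff, rule allI)
  fix A :: "'a set"
  have eq: "(\<Sum>i\<in>UNIV. J $ {i} *\<^sub>R cl_gen i) $ A = (\<Sum>i\<in>UNIV. J $ {i} * (if A = {i} then 1 else 0))"
    by (simp add: cl_gen_def axis_def)
  consider "A = {}" | i where "A = {i}" | "card A \<ge> 2"
    by (metis One_nat_def card_1_singletonE card_eq_0_iff finite less_2_cases not_less)
  then show "J $ A = (\<Sum>i\<in>UNIV. J $ {i} *\<^sub>R cl_gen i) $ A"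
  proof cases
    case 1
    then show ?thesis unfolding eq using imag_unit_nth[OF assms] by simp
  next
    case (2 i)
    have "(\<Sum>k\<in>UNIV. J $ {k} * (if A = {k} then 1 else 0)) = (\<Sum>k\<in>UNIV. if k = i then J $ {i} else 0)"
      by (rule sum.cong) (auto simp: 2)
    then show ?thesis unfolding eq using 2 by simp
  next
    case 3
    then have "A \<noteq> {i}" for i by auto
    then show ?thesis unfolding eq using assms 3 by (simp add: imag_units_def paravectors_def)
  qed
qed

text \<open>Adding the double sum for J J to the one with the generators exchanged cancels all mixed
  terms by anticommutation and leaves -2 times the sum of the squared coordinates, which is the norm
  of J squared.\<close>

lemma imag_unit_square: assumes "J \<in> imag_units" shows "J \<cdot> J = cl_real (- 1)"
proof -
  let ?c = "\<lambda>i. J $ {i}"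
  have JJ: "J \<cdot> J = (\<Sum>i\<in>UNIV. \<Sum>k\<in>UNIV. (?c i * ?c k) *\<^sub>R (cl_gen i \<cdot> cl_gen k))"
  proof -
    have "J \<cdot> J = (\<Sum>i\<in>UNIV. ?c i *\<^sub>R cl_gen i) \<cdot> (\<Sum>k\<in>UNIV. ?c k *\<^sub>R cl_gen k)"
      using imag_unit_expansion[OF assms] by metis
    also have "\<dots> = (\<Sum>i\<in>UNIV. \<Sum>k\<in>UNIV. (?c i *\<^sub>R cl_gen i) \<cdot> (?c k *\<^sub>R cl_gen k))"
      unfolding lmul_sum_left[OF finite] lmul_sum_right[OF finite] by (rule sum.swap)
    finally show ?thesis unfolding lmul_scaleR_left lmul_scaleR_right scaleR_scaleR by (simp only: mult.commute)
  qed
  have JJ': "J \<cdot> J = (\<Sum>i\<in>UNIV. \<Sum>k\<in>UNIV. (?c i * ?c k) *\<^sub>R (cl_gen k \<cdot> cl_gen i))"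
    unfolding JJ by (subst sum.swap) (simp add: mult.commute)
  have pair: "(?c i * ?c k) *\<^sub>R (cl_gen i \<cdot> cl_gen k) + (?c i * ?c k) *\<^sub>R (cl_gen k \<cdot> cl_gen i) =
      (if k = i then (2 * (?c i)\<^sup>2) *\<^sub>R cl_real (- 1) else 0)" for i k
    by (auto simp: cl_gen_square cl_gen_anticommute[of i k] power2_eq_square scaleR_left_distrib[symmetric])
  have "2 *\<^sub>R (J \<cdot> J) = J \<cdot> J + J \<cdot> J" by (simp add: scaleR_2)
  also have "\<dots> = (\<Sum>i\<in>UNIV. \<Sum>k\<in>UNIV. (?c i * ?c k) *\<^sub>R (cl_gen i \<cdot> cl_gen k) + (?c i * ?c k) *\<^sub>R (cl_gen k \<cdot> cl_gen i))"
    by (subst JJ, subst JJ') (simp add: sum.distrib)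
  also have "\<dots> = (\<Sum>i\<in>UNIV. (2 * (?c i)\<^sup>2) *\<^sub>R cl_real (- 1))"
    unfolding pair by simp
  also have "\<dots> = (2 * (\<Sum>i\<in>UNIV. (?c i)\<^sup>2)) *\<^sub>R cl_real (- 1)"
    by (simp add: scaleR_sum_left sum_distrib_left)
  also have "(\<Sum>i\<in>UNIV. (?c i)\<^sup>2) = 1"
  proof -
    have "1 = (\<Sum>A\<in>UNIV. (J $ A)\<^sup>2)" using clifford_norm_square[of J] assms by (simp add: imag_units_def)
    also have "\<dots> = (\<Sum>A\<in>range (\<lambda>i. {i}). (J $ A)\<^sup>2)"
    proof (rule sum.mono_neutral_right)
      show "\<forall>A\<in>UNIV - range (\<lambda>i. {i}). (J $ A)\<^sup>2 = 0"
      proof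
        fix A assume A: "A \<in> UNIV - range (\<lambda>i::'a. {i})"
        then have "A = {} \<or> card A \<ge> 2"
          by (metis DiffD2 One_nat_def card_1_singletonE card_eq_0_iff finite less_2_cases not_less rangeI)
        then show "(J $ A)\<^sup>2 = 0" using assms by (auto simp: imag_units_def paravectors_def)
      qed
    qed auto
    also have "\<dots> = (\<Sum>i\<in>UNIV. (?c i)\<^sup>2)" by (subst sum.reindex) (auto simp: inj_on_def)
    finally show ?thesis by simp
  qed
  finally show ?thesis by simp
qed

lemma imag_units_nonempty: "\<exists>J. J \<in> (imag_units :: 'n::{finite,linorder} clifford set)"
proof -
  have "cl_gen (undefined :: 'n) \<in> imag_units"
  proof -
    have "(norm (cl_gen (undefined :: 'n)))\<^sup>2 = 1"
      unfolding clifford_norm_square cl_gen_def axis_def by (simp add: if_distrib[of "\<lambda>x. x\<^sup>2"] cong: if_cong)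
    then have "norm (cl_gen (undefined :: 'n)) = 1" by (simp add: power2_eq_1_iff) (smt (verit) norm_ge_zero)
    then show ?thesis by (auto simp: imag_units_def paravectors_def cl_gen_def axis_def)
  qed
  then show ?thesis by blast
qed

lemma scal_slice_pt: "J \<in> imag_units \<Longrightarrow> scal (slice_pt J x y) = x"
  by (simp add: slice_pt_def cl_real_def axis_def imag_unit_nth)

lemma norm_slice_pt: assumes "J \<in> imag_units" shows "(norm (slice_pt J x y))\<^sup>2 = x\<^sup>2 + y\<^sup>2"
proof -
  have "(norm (slice_pt J x y))\<^sup>2 = (\<Sum>A\<in>UNIV. (if A = {} then x\<^sup>2 else 0) + y\<^sup>2 * (J $ A)\<^sup>2)"
    unfolding clifford_norm_square slice_pt_def cl_real_def axis_def
    by (rule sum.cong) (auto simp: imag_unit_nth[OF assms] power_mult_distrib)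
  also have "\<dots> = x\<^sup>2 + y\<^sup>2 * (norm J)\<^sup>2"
    by (simp add: sum.distrib clifford_norm_square sum_distrib_left)
  finally show ?thesis using assms by (simp add: imag_units_def)
qed

lemma slice_pt_paravector: "J \<in> imag_units \<Longrightarrow> slice_pt J x y \<in> paravectors"
  by (auto simp: slice_pt_def cl_real_def axis_def imag_units_def paravectors_def)

lemma cnj_slice_pt: "J \<in> imag_units \<Longrightarrow> cl_cnj (slice_pt J x y) = slice_pt J x (- y)"
  by (simp add: vec_eq_iff cl_cnj_def slice_pt_def cl_real_def axis_def imag_unit_nth)

lemma slice_pt_lmul: "slice_pt J x y \<cdot> v = x *\<^sub>R v + y *\<^sub>R (J \<cdot> v)"
  by (simp add: slice_pt_def lmul_add_left cl_real_lmul lmul_scaleR_left)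

lemma cl_op_apply: "blinfun_apply (cl_op a) v = a \<cdot> v"
  unfolding cl_op_def by (rule bounded_linear_Blinfun_apply[OF bounded_linear_lmul, THEN fun_cong])

section \<open>Sectors of paravectors as axially symmetric copies of the complex double
  sector\<close>

lemma I_angles_sin_cos:
  assumes "\<phi> \<in> I_angles \<theta>" "0 < \<theta>" "\<theta> < pi / 2" shows "\<bar>sin \<phi>\<bar> < tan \<theta> * \<bar>cos \<phi>\<bar>"
proof -
  have *: "\<bar>sin x\<bar> < tan \<theta> * \<bar>cos x\<bar>" if x: "\<bar>x\<bar> < \<theta>" for x
  proof -
    have c: "cos x > 0" using x assms by (intro cos_gt_zero_pi) auto
    have "\<bar>sin x\<bar> \<le> tan \<bar>x\<bar> * cos x" using abs_sin_le_tan[of x "\<bar>x\<bar>"] x assms by simp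
    also have "\<dots> < tan \<theta> * cos x" using c x assms by (intro mult_strict_right_mono tan_monotone) auto
    finally show ?thesis using c by simp
  qed
  show ?thesis
  proof (cases "\<phi> \<in> {-\<theta><..<\<theta>}")
    case True
    then have "\<bar>\<phi>\<bar> < \<theta>" by auto
    then show ?thesis by (rule *)
  next
    case False
    then have "\<bar>\<phi> - pi\<bar> < \<theta>" using assms by (auto simp: I_angles_def)
    from *[OF this] show ?thesis by (simp add: sin_diff cos_diff)
  qed
qed

text \<open>The slope description uses only the scalar part and the norm of the vector part, without
  J or an angle. It therefore passes to the closure, which is what the hypothesis on the S-spectrum
  requires.\<close>

lemma D_sector_scal_vec:
  assumes s: "s \<in> D_sector \<theta>" and \<theta>: "0 < \<theta>" "\<theta> < pi / 2"
  shows "norm (s - cl_real (scal s)) < tan \<theta> * \<bar>scal s\<bar>"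
proof -
  from s obtain r I \<phi> where s: "s = r *\<^sub>R cl_cis I \<phi>" "r > 0" "I \<in> imag_units" "\<phi> \<in> I_angles \<theta>"
    by (auto simp: D_sector_def)
  have sc: "scal s = r * cos \<phi>" using scal_slice_pt[OF s(3)] by (simp add: s(1) cl_cis_def)
  have "s - cl_real (scal s) = (r * sin \<phi>) *\<^sub>R I"
    unfolding sc by (simp add: s(1) cl_cis_def slice_pt_def vec_eq_iff cl_real_def axis_def algebra_simps)
  then have "norm (s - cl_real (scal s)) = r * \<bar>sin \<phi>\<bar>" using s by (simp add: imag_units_def abs_mult)
  also have "\<dots> < r * (tan \<theta> * \<bar>cos \<phi>\<bar>)" using I_angles_sin_cos[OF s(4) \<theta>] s(2) by simp
  finally show ?thesis unfolding sc using s(2) by (simp add: abs_mult mult_ac)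
qed

lemma closure_D_sector_scal_vec:
  assumes s: "s \<in> closure (D_sector \<theta>)" and \<theta>: "0 < \<theta>" "\<theta> < pi / 2"
  shows "norm (s - cl_real (scal s)) \<le> tan \<theta> * \<bar>scal s\<bar>"
proof -
  have bl: "bounded_linear (\<lambda>x. cl_real x :: 'a clifford)" unfolding cl_real_def by (rule bounded_linear_axis)
  have "closed {s :: 'a clifford. norm (s - cl_real (scal s)) \<le> tan \<theta> * \<bar>scal s\<bar>}"
    by (intro closed_Collect_le continuous_intros bounded_linear.continuous_on[OF bl] )
  moreover have "D_sector \<theta> \<subseteq> {s :: 'a clifford. norm (s - cl_real (scal s)) \<le> tan \<theta> * \<bar>scal s\<bar>}"
    using D_sector_scal_vec[OF _ \<theta>] by (auto intro: less_imp_le)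
  ultimately show ?thesis using closure_minimal s by blast
qed

lemma slice_pt_vec_norm: "J \<in> imag_units \<Longrightarrow> norm (slice_pt J x y - cl_real (scal (slice_pt J x y))) = \<bar>y\<bar>"
  by (simp add: scal_slice_pt) (simp add: slice_pt_def imag_units_def)

lemma bisector_polar:
  assumes z: "z \<in> bisector \<theta>" and \<theta>: "0 < \<theta>" "\<theta> < pi / 2"
  obtains r \<phi> where "r > 0" "\<phi> \<in> I_angles \<theta>" "z = of_real r * cis \<phi>"
proof -
  define x y where "x = Re z" "y = Im z"
  have x: "x \<noteq> 0" and b: "\<bar>y\<bar> < tan \<theta> * \<bar>x\<bar>" using z by (auto simp: bisector_def x_y_def)
  define u where "u = y / x"
  have "\<bar>u\<bar> < tan \<theta>" using b x by (simp add: u_def abs_divide pos_divide_less_eq)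
  then have "arctan \<bar>u\<bar> < arctan (tan \<theta>)" by (simp add: arctan_less_iff)
  then have a: "\<bar>arctan u\<bar> < \<theta>" using \<theta> by (simp add: arctan_tan abs_if arctan_minus split: if_splits)
  define \<phi> where "\<phi> = (if x > 0 then arctan u else pi + arctan u)"
  define r where "r = \<bar>x\<bar> * sqrt (1 + u\<^sup>2)"
  have sq: "sqrt (1 + u\<^sup>2) > 0" by (simp add: add_pos_nonneg)
  have r: "r > 0" using x sq by (simp add: r_def)
  have "r * cos \<phi> = x" "r * sin \<phi> = y"
    using sq x by (auto simp: \<phi>_def r_def cos_arctan sin_arctan cos_add sin_add u_def[symmetric] abs_if) (simp_all add: u_def)
  then have "z = of_real r * cis \<phi>" by (simp add: complex_eq_iff x_y_def)
  moreover have "\<phi> \<in> I_angles \<theta>" using a by (auto simp: \<phi>_def I_angles_def abs_less_iff)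
  ultimately show ?thesis using that r by blast
qed

lemma slice_pt_polar: "slice_pt J (Re (of_real r * cis \<phi>)) (Im (of_real r * cis \<phi>)) = r *\<^sub>R cl_cis J \<phi>"
  by (simp add: cl_cis_def slice_pt_def vec_eq_iff cl_real_def axis_def algebra_simps)

lemma slice_pt_D_sector:
  assumes J: "J \<in> imag_units" and \<theta>: "0 < \<theta>" "\<theta> < pi / 2"
  shows "slice_pt J x y \<in> D_sector \<theta> \<longleftrightarrow> Complex x y \<in> bisector \<theta>"
proof
  assume "slice_pt J x y \<in> D_sector \<theta>"
  from D_sector_scal_vec[OF this \<theta>] show "Complex x y \<in> bisector \<theta>"
    unfolding slice_pt_vec_norm[OF J] by (simp add: scal_slice_pt[OF J] bisector_def)
next
  assume "Complex x y \<in> bisector \<theta>"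
  then obtain r \<phi> where "r > 0" "\<phi> \<in> I_angles \<theta>" and z: "Complex x y = of_real r * cis \<phi>"
    using bisector_polar \<theta> by blast
  moreover have "slice_pt J x y = r *\<^sub>R cl_cis J \<phi>" unfolding slice_pt_polar[symmetric] z[symmetric] by simp
  ultimately show "slice_pt J x y \<in> D_sector \<theta>" unfolding D_sector_def using J by blast
qed

lemma imag_unit_lmul_lmul: "J \<in> imag_units \<Longrightarrow> J \<cdot> J \<cdot> v = - v"
  by (simp add: imag_unit_square cl_real_lmul flip: lmul_assoc)

lemma lmul_one: "v \<cdot> cl_real 1 = v" for v :: "'n::{finite,linorder} clifford"
  using rmul_cl_real[of v 1] by (simp add: rmul_eq_lmul)

lemma slice_pt_mult:
  assumes "J \<in> imag_units"
  shows "slice_pt J (Re w) (Im w) \<cdot> slice_pt J (Re z) (Im z) = slice_pt J (Re (w * z)) (Im (w * z))"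
proof -
  have "slice_pt J (Re w) (Im w) \<cdot> slice_pt J (Re z) (Im z) \<cdot> cl_real 1 = slice_pt J (Re (w * z)) (Im (w * z)) \<cdot> cl_real 1"
    by (simp add: slice_pt_lmul lmul_add_right lmul_scaleR_right imag_unit_lmul_lmul[OF assms] algebra_simps del: lmul_one)
  then show ?thesis by (simp add: lmul_one)
qed

section \<open>The resolvent of a bisectorial operator\<close>

lemma op_pow_2: "op_pow T 2 u = Some v \<longleftrightarrow> (\<exists>x. T u = Some x \<and> T x = Some v)"
  by (simp add: numeral_2_eq_2 map_comp_Some_iff)

lemma Q_op_Some:
  "Q_op s T u = Some v \<longleftrightarrow> (\<exists>x y. T u = Some x \<and> T x = Some y \<and> v = y - (2 * scal s) *\<^sub>R x + (norm s)\<^sup>2 *\<^sub>R u)"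
proof (cases "\<exists>y. op_pow T 2 u = Some y")
  case True
  then obtain x y where xy: "op_pow T 2 u = Some y" "T u = Some x" "T x = Some y" using op_pow_2 by metis
  then have "u \<in> dom (op_pow T 2)" by blast
  then show ?thesis unfolding Q_op_def using xy by auto
next
  case False
  then have "u \<notin> dom (op_pow T 2)" by blast
  then show ?thesis unfolding Q_op_def using False op_pow_2[of T u] by auto
qed

lemma op_inv_inj:
  assumes "inj_on S (dom S)" "S u = Some v" shows "op_inv S v = Some u"
proof -
  have "v \<in> ran S" using assms(2) by (auto simp: ran_def)
  moreover have "(THE u. S u = Some v) = u"
    by (rule the_equality) (use assms in \<open>auto simp: inj_on_def dom_def\<close>)
  ultimately show ?thesis by (simp add: op_inv_def)
qed

lemma op_inv_Some:
  assumes "inj_on S (dom S)" shows "op_inv S v = Some u \<longleftrightarrow> S u = Some v"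
proof
  assume a: "op_inv S v = Some u"
  then obtain u' where "S u' = Some v" by (auto simp: op_inv_def ran_def split: if_splits)
  with op_inv_inj[OF assms this] a show "S u = Some v" by simp
qed (rule op_inv_inj[OF assms])

locale bisectorial_operator =
  fixes T :: "('v::banach, 'n::{finite,linorder}) clmodule \<rightharpoonup> ('v, 'n) clmodule"
    and J :: "'n clifford" and \<omega> \<theta> :: real
  assumes T: "T \<in> closed_ops" "bisectorial \<omega> T" and angles: "0 < \<omega>" "\<omega> < \<theta>" "\<theta> < pi / 2"
    and J: "J \<in> imag_units"
begin

lemma T_add: "\<And>v w v' w'. T v = Some v' \<Longrightarrow> T w = Some w' \<Longrightarrow> T (v + w) = Some (v' + w')"
  and T_rmul: "\<And>v v' a. T v = Some v' \<Longrightarrow> T (v \<cdot>\<^sub>r a) = Some (v' \<cdot>\<^sub>r a)"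
  using T(1) by (simp_all add: closed_ops_def right_linear_def)

lemma T_scaleR: "T v = Some v' \<Longrightarrow> T (c *\<^sub>R v) = Some (c *\<^sub>R v')"
  using T_rmul[of v v' "cl_real c"] by (simp add: rmul_cl_real)

lemma T_diff: "T v = Some v' \<Longrightarrow> T w = Some w' \<Longrightarrow> T (v - w) = Some (v' - w')"
  using T_add[of v v' "(-1) *\<^sub>R w" "(-1) *\<^sub>R w'"] T_scaleR[of w w' "-1"] by simp

lemma rmul_J_J: "v \<cdot>\<^sub>r J \<cdot>\<^sub>r J = - v"
  by (simp add: rmul_assoc imag_unit_square[OF J] rmul_cl_real)

sublocale vc: complex_structure "\<lambda>v :: ('v, 'n) clmodule. v \<cdot>\<^sub>r J"
  by (rule complex_structure.intro[OF bounded_linear_rmul rmul_J_J])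

lemma T_cmul: "T v = Some v' \<Longrightarrow> T (vc.cmul z v) = Some (vc.cmul z v')"
  unfolding vc.cmul_def by (intro T_add T_scaleR T_rmul)

definition pt where "pt w = slice_pt J (Re w) (Im w)"

lemma scal_pt: "scal (pt w) = Re w" and norm_pt: "norm (pt w) = norm w"
  using norm_slice_pt[OF J, of "Re w" "Im w"]
  by (simp_all add: pt_def scal_slice_pt[OF J] flip: cmod_power2)

definition \<Delta> where "\<Delta> = {w. tan \<omega> * \<bar>Re w\<bar> < \<bar>Im w\<bar>}"

lemma cnj_\<Delta>: "w \<in> \<Delta> \<Longrightarrow> cnj w \<in> \<Delta>" by (simp add: \<Delta>_def)

lemma pt_resolvent: assumes "w \<in> \<Delta>" shows "pt w \<in> S_resolvent_set T"
proof (rule ccontr)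
  assume "\<not> ?thesis"
  then have "pt w \<in> S_spectrum T" using slice_pt_paravector[OF J] by (simp add: S_spectrum_def pt_def)
  then have "pt w \<in> closure (D_sector \<omega>)" using T(2) by (auto simp: bisectorial_def)
  from closure_D_sector_scal_vec[OF this] show False
    using assms angles slice_pt_vec_norm[OF J, of "Re w" "Im w"] by (simp add: pt_def \<Delta>_def scal_slice_pt[OF J])
qed

text \<open>Total functions for the inverse of \<open>Q_op\<close> and for \<open>T\<close> after
  it. They carry meaning for w in \<open>\<Delta>\<close>, where the values under \<open>the\<close>
  exist by \<open>op_inv_Q\<close> and \<open>T_Qi\<close>.\<close>

definition Qi where "Qi w v = the (op_inv (Q_op (pt w) T) v)"
definition TQi where "TQi w v = the (T (Qi w v))"

lemma op_inv_Q: assumes "w \<in> \<Delta>" shows "op_inv (Q_op (pt w) T) v = Some (Qi w v)"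
proof -
  have "dom (op_inv (Q_op (pt w) T)) = UNIV"
    using pt_resolvent[OF assms] by (simp add: S_resolvent_set_def bounded_ops_def)
  then have "op_inv (Q_op (pt w) T) v \<noteq> None" by blast
  then show ?thesis by (auto simp: Qi_def)
qed

lemma Q_op_iff: assumes "w \<in> \<Delta>" shows "Q_op (pt w) T u = Some v \<longleftrightarrow> u = Qi w v"
  using op_inv_Some[of "Q_op (pt w) T" v u] pt_resolvent[OF assms] unfolding op_inv_Q[OF assms]
  by (auto simp: S_resolvent_set_def)

lemma T_Qi: "w \<in> \<Delta> \<Longrightarrow> T (Qi w v) = Some (TQi w v)"
  and T_TQi: "w \<in> \<Delta> \<Longrightarrow> T (TQi w v) = Some (v + (2 * Re w) *\<^sub>R TQi w v - (norm w)\<^sup>2 *\<^sub>R Qi w v)"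
proof -
  assume w: "w \<in> \<Delta>"
  have "Q_op (pt w) T (Qi w v) = Some v" by (simp add: Q_op_iff[OF w])
  then obtain x y where xy: "T (Qi w v) = Some x" "T x = Some y" "v = y - (2 * Re w) *\<^sub>R x + (norm w)\<^sup>2 *\<^sub>R Qi w v"
    unfolding Q_op_Some scal_pt norm_pt by blast
  then have x: "x = TQi w v" by (simp add: TQi_def)
  show "T (Qi w v) = Some (TQi w v)" using xy x by simp
  have "y = v + (2 * Re w) *\<^sub>R x - (norm w)\<^sup>2 *\<^sub>R Qi w v" using xy(3) by (simp add: algebra_simps)
  then show "T (TQi w v) = Some (v + (2 * Re w) *\<^sub>R TQi w v - (norm w)\<^sup>2 *\<^sub>R Qi w v)" using xy(2) x by simp
qed

lemma Qi_eqI: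
  assumes "w \<in> \<Delta>" "T u = Some x" "T x = Some y" "v = y - (2 * Re w) *\<^sub>R x + (norm w)\<^sup>2 *\<^sub>R u"
  shows "Qi w v = u" "TQi w v = x"
proof -
  have "Q_op (pt w) T u = Some v" unfolding Q_op_Some scal_pt norm_pt using assms by blast
  then show "Qi w v = u" by (simp add: Q_op_iff[OF assms(1)])
  then show "TQi w v = x" using assms(2) by (simp add: TQi_def)
qed

lemma bounded_linear_Qi: assumes "w \<in> \<Delta>" shows "bounded_linear (Qi w)"
proof -
  have "bounded_linear (\<lambda>v. the (op_inv (Q_op (pt w) T) v))"
    using pt_resolvent[OF assms] by (simp add: S_resolvent_set_def bounded_ops_def)
  then show ?thesis by (simp add: Qi_def[abs_def])
qed

text \<open>\<open>TQi w\<close> is defined everywhere, and its graph is the preimage of the closed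
  graph of \<open>T\<close> under the continuous map (v, u) -> (Qi w v, u).\<close>

lemma bounded_linear_TQi: assumes w: "w \<in> \<Delta>" shows "bounded_linear (TQi w)"
proof (rule closed_graph)
  interpret Q: bounded_linear "Qi w" by (rule bounded_linear_Qi[OF w])
  show "linear (TQi w)"
  proof (rule linearI)
    show "TQi w (v + u) = TQi w v + TQi w u" for v u
      using T_add[OF T_Qi[OF w] T_Qi[OF w], of v u] T_Qi[OF w, of "v + u"] by (simp add: Q.add)
    show "TQi w (c *\<^sub>R v) = c *\<^sub>R TQi w v" for v c
      using T_scaleR[OF T_Qi[OF w], of c v] T_Qi[OF w, of "c *\<^sub>R v"] by (simp add: Q.scaleR)
  qed
  have "{(v, u). u = TQi w v} = (\<lambda>(v, u). (Qi w v, u)) -` {(v, u). T v = Some u}"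
    using T_Qi[OF w] by auto
  moreover have "closed \<dots>"
    by (rule closed_vimage)
       (use T(1) in \<open>auto simp: closed_ops_def case_prod_beta intro!: continuous_intros Q.continuous_on\<close>)
  ultimately show "closed {(v, u). u = TQi w v}" by simp
qed

lemma Qi_rmul: assumes w: "w \<in> \<Delta>" shows "Qi w (v \<cdot>\<^sub>r a) = Qi w v \<cdot>\<^sub>r a" "TQi w (v \<cdot>\<^sub>r a) = TQi w v \<cdot>\<^sub>r a"
proof -
  interpret r: bounded_linear "\<lambda>v. v \<cdot>\<^sub>r a" by (rule bounded_linear_rmul)
  note * = Qi_eqI[OF w T_rmul[OF T_Qi[OF w]] T_rmul[OF T_TQi[OF w]], of _ v a]
  show "Qi w (v \<cdot>\<^sub>r a) = Qi w v \<cdot>\<^sub>r a" by (rule *(1)) (simp add: r.add r.diff r.scaleR)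
  show "TQi w (v \<cdot>\<^sub>r a) = TQi w v \<cdot>\<^sub>r a" by (rule *(2)) (simp add: r.add r.diff r.scaleR)
qed

text \<open>\<open>TQi w u\<close> solves the second order equation for \<open>T u\<close>: by
  \<open>T_TQi\<close> its image under \<open>T\<close> is a combination of \<open>u\<close>,
  \<open>TQi w u\<close> and \<open>Qi w u\<close>, and all three lie in the domain of
  \<open>T\<close> when \<open>u\<close> does.\<close>

lemma Qi_T: assumes w: "w \<in> \<Delta>" and u: "T u = Some u'"
  shows "Qi w u' = TQi w u" "TQi w u' = u + (2 * Re w) *\<^sub>R TQi w u - (norm w)\<^sup>2 *\<^sub>R Qi w u"
proof -
  note a = T_diff[OF T_add[OF u T_scaleR[OF T_TQi[OF w, of u]]] T_scaleR[OF T_Qi[OF w]], of "2 * Re w" "(norm w)\<^sup>2" u]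
  note * = Qi_eqI[OF w T_TQi[OF w, of u] a]
  show "Qi w u' = TQi w u" by (rule *(1)) (simp add: algebra_simps)
  show "TQi w u' = u + (2 * Re w) *\<^sub>R TQi w u - (norm w)\<^sup>2 *\<^sub>R Qi w u" by (rule *(2)) (simp add: algebra_simps)
qed

lemma Qi_cmul: assumes w: "w \<in> \<Delta>" shows "Qi w (vc.cmul z v) = vc.cmul z (Qi w v)" "TQi w (vc.cmul z v) = vc.cmul z (TQi w v)"
proof -
  interpret Q: bounded_linear "Qi w" by (rule bounded_linear_Qi[OF w])
  interpret TQ: bounded_linear "TQi w" by (rule bounded_linear_TQi[OF w])
  show "Qi w (vc.cmul z v) = vc.cmul z (Qi w v)" "TQi w (vc.cmul z v) = vc.cmul z (TQi w v)"
    by (simp_all add: vc.cmul_def Q.add Q.scaleR TQ.add TQ.scaleR Qi_rmul[OF w])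
qed

section \<open>The complex resolvent and its bound\<close>

definition J0 :: "('v, 'n) clmodule \<Rightarrow>\<^sub>L ('v, 'n) clmodule" where "J0 = Blinfun (\<lambda>v. v \<cdot>\<^sub>r J)"

text \<open>
  The resolvent \<open>(w - T)\<^sup>-\<^sup>1\<close> of \<open>T\<close> in the complex structure \<open>v \<mapsto> v J\<close>; unlike in the left S-resolvent,
  the conjugate of \<open>w\<close> acts from the right, and therefore commutes with \<open>T\<close>.
\<close>

definition R :: "complex \<Rightarrow> ('v, 'n) clmodule \<Rightarrow>\<^sub>L ('v, 'n) clmodule" where
  "R w = Blinfun (\<lambda>v. vc.cmul (cnj w) (Qi w v) - TQi w v)"

lemma J0_apply: "blinfun_apply J0 v = v \<cdot>\<^sub>r J"
  unfolding J0_def by (simp add: bounded_linear_Blinfun_apply bounded_linear_rmul)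

lemma R_apply: assumes "w \<in> \<Delta>" shows "blinfun_apply (R w) v = vc.cmul (cnj w) (Qi w v) - TQi w v"
proof -
  have "bounded_linear (\<lambda>v. vc.cmul (cnj w) (Qi w v) - TQi w v)"
    by (intro bounded_linear_sub bounded_linear_compose[OF vc.cm.bounded_linear_right] bounded_linear_Qi bounded_linear_TQi assms)
  then show ?thesis unfolding R_def by (simp add: bounded_linear_Blinfun_apply)
qed

lemma cmul_2Re: "(2 * Re w) *\<^sub>R v = vc.cmul w v + vc.cmul (cnj w) v"
  by (simp add: vc.cmul_def algebra_simps scaleR_2[symmetric])

lemma cmul_cmod: "(norm w)\<^sup>2 *\<^sub>R v = vc.cmul w (vc.cmul (cnj w) v)" "(norm w)\<^sup>2 *\<^sub>R v = vc.cmul (cnj w) (vc.cmul w v)"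
proof -
  have "w * cnj w = of_real ((norm w)\<^sup>2)" by (rule complex_norm_square[symmetric])
  then show "(norm w)\<^sup>2 *\<^sub>R v = vc.cmul w (vc.cmul (cnj w) v)" "(norm w)\<^sup>2 *\<^sub>R v = vc.cmul (cnj w) (vc.cmul w v)"
    by (simp_all only: vc.cmul_cmul mult.commute[of "cnj w"] vc.cmul_of_real)
qed

text \<open>With scalars acting from the right, the second order operator factors as (T - w)(T - cnj
  w), because 2 Re w and |w|^2 are the sum and the product of w and its conjugate.
  \<open>R w\<close> is the conjugate factor divided by the product, up to sign.\<close>

lemma T_R: assumes w: "w \<in> \<Delta>" shows "T (blinfun_apply (R w) v) = Some (vc.cmul w (blinfun_apply (R w) v) - v)"
proof -
  have "T (blinfun_apply (R w) v) = Some (vc.cmul (cnj w) (TQi w v) - (v + (2 * Re w) *\<^sub>R TQi w v - (norm w)\<^sup>2 *\<^sub>R Qi w v))"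
    unfolding R_apply[OF w] by (rule T_diff[OF T_cmul[OF T_Qi[OF w]] T_TQi[OF w]])
  also have "vc.cmul (cnj w) (TQi w v) - (v + (2 * Re w) *\<^sub>R TQi w v - (norm w)\<^sup>2 *\<^sub>R Qi w v)
      = vc.cmul w (blinfun_apply (R w) v) - v"
    unfolding R_apply[OF w] cmul_2Re cmul_cmod(1) vc.cm.diff_right by simp
  finally show ?thesis .
qed

lemma R_T: assumes w: "w \<in> \<Delta>" and u: "T u = Some u'" shows "blinfun_apply (R w) (vc.cmul w u - u') = u"
proof -
  interpret Q: bounded_linear "Qi w" by (rule bounded_linear_Qi[OF w])
  interpret TQ: bounded_linear "TQi w" by (rule bounded_linear_TQi[OF w])
  show ?thesis
    unfolding R_apply[OF w] Q.diff TQ.diff Qi_cmul[OF w] Qi_T[OF w u] cmul_2Re cmul_cmod(2) vc.cm.diff_right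
    by simp
qed

lemma R_rmul: assumes w: "w \<in> \<Delta>" shows "blinfun_apply (R w) (v \<cdot>\<^sub>r J) = blinfun_apply (R w) v \<cdot>\<^sub>r J"
proof -
  interpret r: bounded_linear "\<lambda>v :: ('v, 'n) clmodule. v \<cdot>\<^sub>r J" by (rule bounded_linear_rmul)
  have j: "vc.cmul z (v \<cdot>\<^sub>r J) = vc.cmul z v \<cdot>\<^sub>r J" for z v
    unfolding vc.cmul_def r.add r.scaleR ..
  show ?thesis unfolding R_apply[OF w] Qi_rmul[OF w] j r.diff ..
qed

lemma SL_resolvent_apply: assumes w: "w \<in> \<Delta>"
  shows "blinfun_apply (SL_resolvent (pt w) T) v = Re w *\<^sub>R Qi w v - Im w *\<^sub>R Qi w (J \<cdot> v) - TQi w v"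
proof -
  interpret Q: bounded_linear "Qi w" by (rule bounded_linear_Qi[OF w])
  let ?S = "op_diff (op_inv (Q_op (pt w) T) \<circ>\<^sub>m of_blinfun (cl_op (cl_cnj (pt w)))) (T \<circ>\<^sub>m op_inv (Q_op (pt w) T))"
  have cnj: "cl_cnj (pt w) = slice_pt J (Re w) (- Im w)" by (simp add: pt_def cnj_slice_pt[OF J])
  have S: "the (?S v) = Qi w (slice_pt J (Re w) (- Im w) \<cdot> v) - TQi w v" for v
  proof -
    have "(op_inv (Q_op (pt w) T) \<circ>\<^sub>m of_blinfun (cl_op (cl_cnj (pt w)))) v = Some (Qi w (slice_pt J (Re w) (- Im w) \<cdot> v))"
      by (simp add: map_comp_def of_blinfun_def op_inv_Q[OF w] cl_op_apply cnj)
    moreover have "(T \<circ>\<^sub>m op_inv (Q_op (pt w) T)) v = Some (TQi w v)"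
      by (simp add: map_comp_def op_inv_Q[OF w] T_Qi[OF w])
    ultimately show ?thesis by (simp add: op_diff_def dom_def)
  qed
  have "bounded_linear (\<lambda>v. Qi w (slice_pt J (Re w) (- Im w) \<cdot> v) - TQi w v)"
    by (intro bounded_linear_sub bounded_linear_compose[OF bounded_linear_Qi[OF w]] bounded_linear_lmul bounded_linear_TQi w)
  then have "blinfun_apply (SL_resolvent (pt w) T) v = Qi w (slice_pt J (Re w) (- Im w) \<cdot> v) - TQi w v"
    unfolding SL_resolvent_def to_blinfun_def S by (simp add: bounded_linear_Blinfun_apply)
  then show ?thesis by (simp add: slice_pt_lmul Q.add Q.scaleR Q.diff)
qed

lemma Qi_cnj: "Qi (cnj w) = Qi w" "TQi (cnj w) = TQi w"
proof -
  have "Q_op (pt (cnj w)) T = Q_op (pt w) T" unfolding Q_op_def scal_pt norm_pt by (simp cong: if_cong)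
  then show "Qi (cnj w) = Qi w" by (simp add: Qi_def[abs_def])
  then show "TQi (cnj w) = TQi w" by (simp add: TQi_def[abs_def])
qed

lemma SL_bound:
  assumes \<phi>: "\<omega> < \<phi>" "\<phi> < pi / 2"
  shows "\<exists>C\<ge>0. \<forall>w\<in>outer_sector \<phi>. norm (SL_resolvent (pt w) T) \<le> C / norm w"
proof -
  have \<phi>0: "0 < \<phi>" using \<phi> angles by simp
  obtain C where C: "C \<ge> 0" "\<And>s. s \<in> paravectors - (D_sector \<phi> \<union> {0}) \<Longrightarrow> norm (SL_resolvent s T) \<le> C / norm s"
    using T(2) \<phi> unfolding bisectorial_def by blast
  have "norm (SL_resolvent (pt w) T) \<le> C / norm w" if w: "w \<in> outer_sector \<phi>" for w
  proof -
    have "pt w \<notin> D_sector \<phi>"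
      using slice_pt_D_sector[OF J \<phi>0 \<phi>(2)] w by (simp add: pt_def bisector_def outer_sector_def)
    moreover have "pt w \<noteq> 0" using norm_pt[of w] w by (auto simp: outer_sector_def)
    ultimately have "pt w \<in> paravectors - (D_sector \<phi> \<union> {0})" using slice_pt_paravector[OF J] by (simp add: pt_def)
    from C(2)[OF this] show ?thesis by (simp add: norm_pt)
  qed
  with C(1) show ?thesis by blast
qed

text \<open>The hypothesis bounds the left S-resolvent, in which J acts from the left. Its values at
  w and at the conjugate differ by 2 Im w times \<open>Qi w (J \<cdot> v)\<close>, which bounds |Im
  w| |Qi w v| after replacing v by J v. In the outer sector |Re w| is at most a multiple of |Im w|,
  and then \<open>TQi\<close> is bounded from the formula for the S-resolvent.\<close>

lemma R_bound:
  assumes \<phi>: "\<omega> < \<phi>" "\<phi> < pi / 2"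
  shows "\<exists>C\<ge>0. \<forall>w\<in>outer_sector \<phi>. norm (R w) \<le> C / norm w"
proof -
  have \<phi>0: "0 < \<phi>" using \<phi> angles by simp
  have tp: "tan \<phi> > 0" using \<phi>0 \<phi> by (intro tan_gt_zero) auto
  obtain C where C: "C \<ge> 0" "\<And>w. w \<in> outer_sector \<phi> \<Longrightarrow> norm (SL_resolvent (pt w) T) \<le> C / norm w"
    using SL_bound[OF \<phi>] by blast
  define M where "M = norm (cl_op J :: ('v, 'n) clmodule \<Rightarrow>\<^sub>L ('v, 'n) clmodule)"
  have M: "norm (J \<cdot> v) \<le> M * norm v" "M \<ge> 0" for v :: "('v, 'n) clmodule"
    using norm_blinfun[of "cl_op J :: ('v, 'n) clmodule \<Rightarrow>\<^sub>L ('v, 'n) clmodule" v] by (simp_all add: M_def cl_op_apply)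
  have JJ: "J \<cdot> (J \<cdot> v) = - v" for v :: "('v, 'n) clmodule"
    by (simp add: imag_unit_square[OF J] cl_real_lmul flip: lmul_assoc)
  obtain K where K: "K > 0" "\<And>z v. norm (vc.cmul z v) \<le> norm z * norm v * K"
    using vc.cm.pos_bounded by blast
  define D where "D = 1 / tan \<phi>"
  have D: "D > 0" using tp by (simp add: D_def)
  \<comment> \<open>The first summand is the share of \<open>vc.cmul (cnj w) (Qi w v)\<close>, the
    others are that of \<open>TQi w v\<close>. \<open>D\<close> bounds |Re w| / |Im w|, and
    \<open>M\<close> is the norm of left multiplication by \<open>J\<close>.\<close>
  define B where "B = (K * (D + 1) * M + D * M + 2) * C"
  have B: "B \<ge> 0" unfolding B_def using K D M C by (intro mult_nonneg_nonneg add_nonneg_nonneg) auto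
  have "norm (R w) \<le> B / norm w" if out: "w \<in> outer_sector \<phi>" for w
  proof -
    have y: "tan \<phi> * \<bar>Re w\<bar> \<le> \<bar>Im w\<bar>" "Im w \<noteq> 0" using out tp by (auto simp: outer_sector_def complex_eq_iff mult_le_0_iff)
    have "tan \<omega> < tan \<phi>" using \<phi> angles by (intro tan_monotone) auto
    have w: "w \<in> \<Delta>"
    proof (cases "Re w = 0")
      case True
      then show ?thesis using y by (simp add: \<Delta>_def)
    next
      case False
      then have "tan \<omega> * \<bar>Re w\<bar> < tan \<phi> * \<bar>Re w\<bar>" using \<open>tan \<omega> < tan \<phi>\<close> by simp
      also note y(1)
      finally show ?thesis by (simp add: \<Delta>_def)
    qed
    have w': "cnj w \<in> \<Delta>" using w by (rule cnj_\<Delta>)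
    have w0: "norm w > 0" using y by auto
    define c where "c = C / norm w"
    have sl: "norm (blinfun_apply (SL_resolvent (pt z) T) v) \<le> c * norm v" if "\<bar>Re z\<bar> = \<bar>Re w\<bar>" "\<bar>Im z\<bar> = \<bar>Im w\<bar>" for z v
    proof -
      have nz: "norm z = norm w" unfolding cmod_def using that by (metis power2_abs)
      have "z \<noteq> 0" using nz w0 by auto
      then have "z \<in> outer_sector \<phi>" using y(1) that by (simp add: outer_sector_def)
      from C(2)[OF this] have "norm (SL_resolvent (pt z) T) \<le> c" by (simp add: nz c_def)
      then have "norm (SL_resolvent (pt z) T) * norm v \<le> c * norm v" by (rule mult_right_mono) simp
      with norm_blinfun show ?thesis by (rule order_trans)
    qed
    interpret Q: bounded_linear "Qi w" by (rule bounded_linear_Qi[OF w])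
    have qJ: "\<bar>Im w\<bar> * norm (Qi w (J \<cdot> v)) \<le> c * norm v" for v
    proof -
      have "2 * (\<bar>Im w\<bar> * norm (Qi w (J \<cdot> v))) = norm ((2 * Im w) *\<^sub>R Qi w (J \<cdot> v))" by (simp add: abs_mult)
      also have "(2 * Im w) *\<^sub>R Qi w (J \<cdot> v) = blinfun_apply (SL_resolvent (pt (cnj w)) T) v - blinfun_apply (SL_resolvent (pt w) T) v"
        unfolding SL_resolvent_apply[OF w] SL_resolvent_apply[OF w'] Qi_cnj by (simp add: algebra_simps scaleR_2[symmetric])
      also have "norm \<dots> \<le> norm (blinfun_apply (SL_resolvent (pt (cnj w)) T) v) + norm (blinfun_apply (SL_resolvent (pt w) T) v)"
        by (rule norm_triangle_ineq4)
      also have "\<dots> \<le> c * norm v + c * norm v" by (intro add_mono sl) simp_all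
      finally show ?thesis by simp
    qed
    have c0: "c \<ge> 0" using C w0 by (simp add: c_def)
    have q: "\<bar>Im w\<bar> * norm (Qi w v) \<le> c * M * norm v" for v
    proof -
      have "Qi w v = - Qi w (J \<cdot> (J \<cdot> v))" by (simp add: JJ Q.neg)
      then have "\<bar>Im w\<bar> * norm (Qi w v) \<le> c * norm (J \<cdot> v)" using qJ[of "J \<cdot> v"] by simp
      also have "\<dots> \<le> c * (M * norm v)" by (rule mult_left_mono[OF M(1) c0])
      finally show ?thesis by (simp add: mult.assoc)
    qed
    have x: "\<bar>Re w\<bar> \<le> D * \<bar>Im w\<bar>" using y(1) tp by (simp add: D_def pos_le_divide_eq mult.commute)
    have "norm (blinfun_apply (R w) v) \<le> (B / norm w) * norm v" for v
    proof -
      have xq: "\<bar>Re w\<bar> * norm (Qi w v) \<le> D * (c * M * norm v)"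
      proof -
        have "\<bar>Re w\<bar> * norm (Qi w v) \<le> D * \<bar>Im w\<bar> * norm (Qi w v)" by (rule mult_right_mono[OF x]) simp
        also have "\<dots> \<le> D * (c * M * norm v)" unfolding mult.assoc[of D] using q[of v] D by (intro mult_left_mono) (auto simp: mult.assoc)
        finally show ?thesis .
      qed
      have 1: "norm (vc.cmul (cnj w) (Qi w v)) \<le> (D * (c * M * norm v) + c * M * norm v) * K"
      proof -
        have "norm (vc.cmul (cnj w) (Qi w v)) \<le> norm w * norm (Qi w v) * K" using K(2)[of "cnj w"] by simp
        also have "\<dots> \<le> (\<bar>Re w\<bar> * norm (Qi w v) + \<bar>Im w\<bar> * norm (Qi w v)) * K"
          unfolding distrib_right[symmetric] by (intro mult_right_mono cmod_le) (use K in auto)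
        also have "\<dots> \<le> (D * (c * M * norm v) + c * M * norm v) * K"
          by (intro mult_right_mono add_mono xq q) (use K in auto)
        finally show ?thesis .
      qed
      have "TQi w v = (Re w *\<^sub>R Qi w v - Im w *\<^sub>R Qi w (J \<cdot> v)) - blinfun_apply (SL_resolvent (pt w) T) v"
        unfolding SL_resolvent_apply[OF w] by simp
      also have "norm \<dots> \<le> norm (Re w *\<^sub>R Qi w v) + norm (Im w *\<^sub>R Qi w (J \<cdot> v)) + norm (blinfun_apply (SL_resolvent (pt w) T) v)"
        by (rule order_trans[OF norm_triangle_ineq4 add_right_mono[OF norm_triangle_ineq4]])
      also have "\<dots> \<le> D * (c * M * norm v) + c * norm v + c * norm v"
        unfolding norm_scaleR by (intro add_mono xq qJ sl) simp_all
      finally have 2: "norm (TQi w v) \<le> D * (c * M * norm v) + c * norm v + c * norm v" .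
      have "norm (blinfun_apply (R w) v) \<le> norm (vc.cmul (cnj w) (Qi w v)) + norm (TQi w v)"
        unfolding R_apply[OF w] by (rule norm_triangle_ineq4)
      also have "\<dots> \<le> (D * (c * M * norm v) + c * M * norm v) * K + (D * (c * M * norm v) + c * norm v + c * norm v)"
        by (rule add_mono[OF 1 2])
      also have "\<dots> = (B / norm w) * norm v" by (simp add: B_def c_def algebra_simps add_divide_distrib)
      finally show ?thesis .
    qed
    moreover have "B / norm w \<ge> 0" using B w0 by simp
    ultimately show ?thesis by (intro norm_blinfun_bound)
  qed
  with B show ?thesis by blast
qed

lemma resolvent_family: "resolvent_family J0 R \<omega> \<theta>"
proof
  show "J0 o\<^sub>L J0 = - id_blinfun" by (rule blinfun_eqI) (simp add: J0_apply rmul_J_J blinfun.minus_left)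
  fix w assume "tan \<omega> * \<bar>Re w\<bar> < \<bar>Im w\<bar>"
  then have w: "w \<in> \<Delta>" by (simp add: \<Delta>_def)
  show "R w o\<^sub>L J0 = J0 o\<^sub>L R w" by (rule blinfun_eqI) (simp add: J0_apply R_rmul[OF w])
  fix z assume "tan \<omega> * \<bar>Re z\<bar> < \<bar>Im z\<bar>"
  then have z: "z \<in> \<Delta>" by (simp add: \<Delta>_def)
  show "R w - R z = Re (z - w) *\<^sub>R (R w o\<^sub>L R z) + Im (z - w) *\<^sub>R (J0 o\<^sub>L (R w o\<^sub>L R z))"
  proof (rule blinfun_eqI)
    fix v
    let ?y = "blinfun_apply (R z) v"
    have c: "blinfun_apply (R w) (vc.cmul u x) = vc.cmul u (blinfun_apply (R w) x)" for u x
      unfolding vc.cmul_def by (simp add: blinfun.add_right blinfun.scaleR_right R_rmul[OF w])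
    \<comment> \<open>\<open>R w\<close> undoes w - T on the vector \<open>R z v\<close>, and (w -
      T) R z v = v - (z - w) R z v.\<close>
    have "?y = blinfun_apply (R w) (vc.cmul w ?y - (vc.cmul z ?y - v))"
      by (rule R_T[OF w T_R[OF z], symmetric])
    also have "\<dots> = blinfun_apply (R w) v - vc.cmul (z - w) (blinfun_apply (R w) ?y)"
      unfolding blinfun.diff_right c vc.cm.diff_left by simp
    finally show "blinfun_apply (R w - R z) v = blinfun_apply (Re (z - w) *\<^sub>R (R w o\<^sub>L R z) + Im (z - w) *\<^sub>R (J0 o\<^sub>L (R w o\<^sub>L R z))) v"
      unfolding vc.cmul_def by (simp add: blinfun.diff_left blinfun.add_left blinfun.scaleR_left J0_apply algebra_simps)
  qed
qed (use angles R_bound in auto)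

end

sublocale bisectorial_operator \<subseteq> resolvent_family J0 R \<omega> \<theta>
  by (rule resolvent_family)

section \<open>The slice Cauchy integral\<close>

lemma has_integral_reflect_real_set:
  fixes f :: "real \<Rightarrow> 'b::banach"
  assumes "(f has_integral I) S" shows "((\<lambda>t. f (- t)) has_integral I) (uminus ` S)"
proof -
  have eq: "(\<lambda>t. if t \<in> uminus ` S then f (- t) else 0) = (\<lambda>t. if - t \<in> S then f (- t) else 0)"
    by (intro ext if_cong refl) (metis imageE imageI minus_minus)
  show ?thesis
  proof (subst has_integral_alt', unfold eq, intro conjI allI impI)
    fix a b :: real
    have "(\<lambda>t. if t \<in> S then f t else 0) integrable_on cbox (- b) (- a)"
      using assms unfolding has_integral_alt' by blast
    from integrable_reflect[THEN iffD2, OF this]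
    show "(\<lambda>t. if - t \<in> S then f (- t) else 0) integrable_on cbox a b" by simp
  next
    fix e :: real assume "e > 0"
    then obtain B where B: "B > 0" "\<And>a b. ball 0 B \<subseteq> cbox a b \<Longrightarrow> norm (integral (cbox a b) (\<lambda>t. if t \<in> S then f t else 0) - I) < e"
      using assms unfolding has_integral_alt' by blast
    show "\<exists>B>0. \<forall>a b. ball 0 B \<subseteq> cbox a b \<longrightarrow> norm (integral (cbox a b) (\<lambda>t. if - t \<in> S then f (- t) else 0) - I) < e"
    proof (intro exI[of _ B] conjI allI impI B(1))
      fix a b :: real assume ab: "ball 0 B \<subseteq> cbox a b"
      have "ball 0 B \<subseteq> cbox (- b) (- a)"
      proof
        fix x :: real assume "x \<in> ball 0 B"
        then have "- x \<in> ball 0 B" by simp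
        then have "- x \<in> cbox a b" using ab by blast
        then show "x \<in> cbox (- b) (- a)" by auto
      qed
      from B(2)[OF this] show "norm (integral (cbox a b) (\<lambda>t. if - t \<in> S then f (- t) else 0) - I) < e"
        using integral_reflect[of "- a" "- b" "\<lambda>t. if t \<in> S then f t else 0"] by simp
    qed
  qed
qed

context bisectorial_operator
begin

lemma pt_lmul: "pt w \<cdot> v = Re w *\<^sub>R v + Im w *\<^sub>R (J \<cdot> v)"
  by (simp add: pt_def slice_pt_lmul)

lemma pt_mult: "pt w \<cdot> pt z = pt (w * z)"
  unfolding pt_def by (rule slice_pt_mult[OF J])

lemma pt_lmul_lmul: "pt w \<cdot> (pt z \<cdot> v) = pt (w * z) \<cdot> v"
  by (simp add: pt_mult flip: lmul_assoc)

lemma cl_op_pt: "cl_op (pt a) = Re a *\<^sub>R id_blinfun + Im a *\<^sub>R (cl_op J :: ('v, 'n) clmodule \<Rightarrow>\<^sub>L ('v, 'n) clmodule)"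
  by (rule blinfun_eqI) (simp add: cl_op_apply pt_lmul blinfun.add_left blinfun.scaleR_left)

lemma bounded_linear_cl_op_pt: "bounded_linear (\<lambda>a. cl_op (pt a) :: ('v, 'n) clmodule \<Rightarrow>\<^sub>L ('v, 'n) clmodule)"
  unfolding cl_op_pt
  by (intro bounded_linear_add bounded_linear_compose[OF bounded_linear_scaleR_left] bounded_linear_Re bounded_linear_Im)

lemma \<Delta>_Im: assumes "w \<in> \<Delta>" shows "Im w \<noteq> 0"
proof -
  have "0 \<le> tan \<omega> * \<bar>Re w\<bar>" using angles tan_gt_zero[of \<omega>] by simp
  then show ?thesis using assms by (auto simp: \<Delta>_def)
qed

lemma lmul_diff_right: "a \<cdot> (v - w) = a \<cdot> v - a \<cdot> w" for v :: "('u::real_normed_vector, 'n) clmodule"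
  by (rule linear_diff[OF bounded_linear.linear[OF bounded_linear_lmul]])

text \<open>\<open>Qi\<close> is recovered from the resolvent at conjugate points, because R w - R
  (cnj w) is Qi w times cnj w - w. Together with \<open>TQi_R\<close> this transfers continuity from
  \<open>R\<close> to the S-resolvent.\<close>

lemma Qi_R: assumes w: "w \<in> \<Delta>"
  shows "Qi w v = (1 / (2 * Im w)) *\<^sub>R blinfun_apply (J0 o\<^sub>L (R w - R (cnj w))) v"
proof -
  interpret r: bounded_linear "\<lambda>v :: ('v, 'n) clmodule. v \<cdot>\<^sub>r J" by (rule bounded_linear_rmul)
  have y: "Im w \<noteq> 0" by (rule \<Delta>_Im[OF w])
  have "blinfun_apply (J0 o\<^sub>L (R w - R (cnj w))) v = (2 * Im w) *\<^sub>R Qi w v"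
    by (simp add: J0_apply blinfun.diff_left R_apply[OF w] R_apply[OF cnj_\<Delta>[OF w]] Qi_cnj vc.cmul_def r.add r.diff r.scaleR r.neg rmul_J_J)
       (simp add: scaleR_2[symmetric])
  then show ?thesis using y by simp
qed

lemma TQi_R: assumes w: "w \<in> \<Delta>"
  shows "TQi w v = Re w *\<^sub>R Qi w v - (1 / 2) *\<^sub>R blinfun_apply (R w + R (cnj w)) v"
proof -
  have "blinfun_apply (R w + R (cnj w)) v = 2 *\<^sub>R (Re w *\<^sub>R Qi w v - TQi w v)"
    unfolding blinfun.add_left R_apply[OF w] R_apply[OF cnj_\<Delta>[OF w]] Qi_cnj vc.cmul_def
    by (simp only: scaleR_2) (simp add: algebra_simps)
  then show ?thesis by simp
qed

lemma \<Delta>_\<Omega>: "\<Omega> = \<Delta>" by (simp add: \<Omega>_def \<Delta>_def)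

lemma continuous_on_SL: "continuous_on \<Omega> (\<lambda>w. SL_resolvent (pt w) T)"
proof -
  define QB where "QB w = (1 / (2 * Im w)) *\<^sub>R (J0 o\<^sub>L (R w - R (cnj w)))" for w
  have eq: "SL_resolvent (pt w) T = (Re w *\<^sub>R QB w - Im w *\<^sub>R (QB w o\<^sub>L cl_op J)) - (Re w *\<^sub>R QB w - (1 / 2) *\<^sub>R (R w + R (cnj w)))"
    if "w \<in> \<Omega>" for w
  proof (rule blinfun_eqI)
    fix v
    have w: "w \<in> \<Delta>" using that \<Delta>_\<Omega> by simp
    have "blinfun_apply (QB w) v = Qi w v" for v unfolding Qi_R[OF w] QB_def blinfun.scaleR_left ..
    then show "blinfun_apply (SL_resolvent (pt w) T) v = blinfun_apply ((Re w *\<^sub>R QB w - Im w *\<^sub>R (QB w o\<^sub>L cl_op J)) - (Re w *\<^sub>R QB w - (1 / 2) *\<^sub>R (R w + R (cnj w)))) v"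
      unfolding SL_resolvent_apply[OF w] TQi_R[OF w] by (simp add: blinfun.diff_left blinfun.add_left blinfun.scaleR_left cl_op_apply)
  qed
  have Rc: "continuous_on \<Omega> (\<lambda>w. R (cnj w))"
    by (rule continuous_on_compose2[OF continuous_on_R]) (use cnj_\<Delta> \<Delta>_\<Omega> in \<open>auto intro!: continuous_intros\<close>)
  have "w \<in> \<Omega> \<Longrightarrow> Im w \<noteq> 0" for w using \<Delta>_Im \<Delta>_\<Omega> by simp
  then have QB: "continuous_on \<Omega> QB" unfolding QB_def
    by (intro continuous_intros bounded_bilinear.continuous_on[OF bounded_bilinear_blinfun_compose] continuous_on_R Rc) auto
  show ?thesis
    by (rule continuous_on_eq[OF _ eq[symmetric]])
       (intro continuous_intros bounded_bilinear.continuous_on[OF bounded_bilinear_blinfun_compose] continuous_on_R Rc QB, assumption)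
qed

text \<open>
  The left multiplications by \<open>a\<close> and its conjugate combine to real factors, so that after summation over
  conjugate points they may be replaced by multiplications from the right.
\<close>

lemma SL_pair: assumes w: "w \<in> \<Omega>"
  shows "(SL_resolvent (pt w) T o\<^sub>L cl_op (pt a)) + (SL_resolvent (pt (cnj w)) T o\<^sub>L cl_op (pt (cnj a)))
    = cmul a (R w) + cmul (cnj a) (R (cnj w))"
proof (rule blinfun_eqI)
  fix v
  interpret r: bounded_linear "\<lambda>v :: ('v, 'n) clmodule. v \<cdot>\<^sub>r J" by (rule bounded_linear_rmul)
  have w: "w \<in> \<Delta>" using w \<Delta>_\<Omega> by simp
  interpret Q: bounded_linear "Qi w" by (rule bounded_linear_Qi[OF w])
  interpret TQ: bounded_linear "TQi w" by (rule bounded_linear_TQi[OF w])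
  have "blinfun_apply ((SL_resolvent (pt w) T o\<^sub>L cl_op (pt a)) + (SL_resolvent (pt (cnj w)) T o\<^sub>L cl_op (pt (cnj a)))) v
    = (2 * (Re w * Re a + Im w * Im a)) *\<^sub>R Qi w v - (2 * Re a) *\<^sub>R TQi w v"
    by (simp add: blinfun.add_left cl_op_apply SL_resolvent_apply[OF w] SL_resolvent_apply[OF cnj_\<Delta>[OF w]] Qi_cnj pt_lmul
        lmul_add_right lmul_diff_right lmul_scaleR_right lmul_minus Q.add Q.scaleR Q.diff Q.neg TQ.add TQ.scaleR TQ.diff TQ.neg imag_unit_lmul_lmul[OF J])
       (simp only: mult_2 scaleR_left_distrib, simp add: algebra_simps)
  moreover have "blinfun_apply (cmul a (R w) + cmul (cnj a) (R (cnj w))) v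
    = (2 * (Re w * Re a + Im w * Im a)) *\<^sub>R Qi w v - (2 * Re a) *\<^sub>R TQi w v"
    by (simp add: cmul_def blinfun.add_left blinfun.diff_left blinfun.scaleR_left J0_apply R_apply[OF w] R_apply[OF cnj_\<Delta>[OF w]] Qi_cnj
        vc.cmul_def r.add r.diff r.scaleR r.neg rmul_J_J)
       (simp only: mult_2 scaleR_left_distrib, simp add: algebra_simps)
  ultimately show "blinfun_apply ((SL_resolvent (pt w) T o\<^sub>L cl_op (pt a)) + (SL_resolvent (pt (cnj w)) T o\<^sub>L cl_op (pt (cnj a)))) v
    = blinfun_apply (cmul a (R w) + cmul (cnj a) (R (cnj w))) v" by simp
qed

text \<open>The factor - \<i> * d is the velocity d of the outgoing half-line divided by J, with -
  \<i> in the role of 1/J.\<close>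

definition SL_ray :: "complex \<Rightarrow> (complex \<Rightarrow> complex) \<Rightarrow> real \<Rightarrow> ('v, 'n) clmodule \<Rightarrow>\<^sub>L ('v, 'n) clmodule" where
  "SL_ray d h t = (SL_resolvent (pt (of_real t * d)) T o\<^sub>L cl_op (pt (- \<i> * d * h (of_real t * d))))"

context
  fixes \<phi> assumes \<phi>: "\<omega> < \<phi>" "\<phi> < \<theta>"
begin

lemma SL_ray_integrable:
  assumes h: "h \<in> sector_null \<theta>" and d: "d \<in> dirs \<phi>"
  shows "SL_ray d h integrable_on {0<..}"
proof -
  have \<phi>': "0 < \<phi>" "\<phi> < pi / 2" using \<phi> angles by auto
  obtain C where C: "C \<ge> 0" "\<And>w. w \<in> outer_sector \<phi> \<Longrightarrow> norm (SL_resolvent (pt w) T) \<le> C / norm w"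
    using SL_bound[OF \<phi>(1) \<phi>'(2)] by blast
  obtain K where K: "K > 0" "\<And>a. norm (cl_op (pt a) :: ('v, 'n) clmodule \<Rightarrow>\<^sub>L ('v, 'n) clmodule) \<le> norm a * K"
    using bounded_linear.pos_bounded[OF bounded_linear_cl_op_pt] by blast
  have dB: "d \<in> bisector \<theta>" by (rule dirs_bisector[OF \<phi>'(1) \<phi>(2) angles(3) d])
  have out: "of_real t * d \<in> outer_sector \<phi>" if "t > 0" for t by (rule dirs_outer[OF d that \<phi>'])
  show ?thesis
  proof (rule continuous_dominated_on_ray[where g="\<lambda>t. norm (h (of_real t * d)) / t * (C * K)"])
    have "continuous_on {0<..} (\<lambda>t. SL_resolvent (pt (of_real t * d)) T)"
      by (rule continuous_on_compose2[OF continuous_on_SL])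
         (use out outer_subset_\<Omega>[OF \<phi>(1) \<phi>'(2)] in \<open>auto intro!: continuous_intros\<close>)
    moreover have "continuous_on {0<..} (\<lambda>t. h (of_real t * d))"
      by (rule continuous_on_bisector_ray[OF sector_null_continuous[OF h] dB])
    ultimately show "continuous_on {0<..} (SL_ray d h)"
      unfolding SL_ray_def
      by (intro bounded_bilinear.continuous_on[OF bounded_bilinear_blinfun_compose]
          bounded_linear.continuous_on[OF bounded_linear_cl_op_pt] continuous_intros)
    show "(\<lambda>t. norm (h (of_real t * d)) / t * (C * K)) integrable_on {0<..}"
      using h dB norm_dirs[OF d] by (intro integrable_on_mult_left) (auto simp: sector_null_def)
    fix t :: real assume t: "t > 0"
    have 1: "norm (SL_resolvent (pt (of_real t * d)) T) \<le> C / t"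
      using C(2)[OF out[OF t]] norm_ray_dirs[OF d t] by simp
    have 2: "norm (cl_op (pt (- \<i> * d * h (of_real t * d))) :: ('v, 'n) clmodule \<Rightarrow>\<^sub>L ('v, 'n) clmodule) \<le> norm (h (of_real t * d)) * K"
      using K(2)[of "- \<i> * d * h (of_real t * d)"] norm_dirs[OF d] by (simp add: norm_mult)
    have "norm (SL_ray d h t) \<le> norm (SL_resolvent (pt (of_real t * d)) T) * norm (cl_op (pt (- \<i> * d * h (of_real t * d))) :: ('v, 'n) clmodule \<Rightarrow>\<^sub>L ('v, 'n) clmodule)"
      unfolding SL_ray_def by (rule norm_blinfun_compose)
    also have "\<dots> \<le> (C / t) * (norm (h (of_real t * d)) * K)" by (rule mult_mono[OF 1 2]) (use C t in auto)
    finally show "norm (SL_ray d h t) \<le> norm (h (of_real t * d)) / t * (C * K)" by (simp add: mult_ac)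
  qed
qed

text \<open>Conjugation turns - \<i> into \<i>. The minus sign of the inward ray compensates this,
  so by the symmetry of \<open>h\<close> the coefficients at w and at its conjugate are conjugate to
  each other, as \<open>SL_pair\<close> demands. The pairing takes place under the integral, for
  each t.\<close>

lemma SL_ray_pair:
  assumes h: "h \<in> sector_null \<theta>" "sector_symmetric \<theta> h" and d: "d \<in> dirs \<phi>" "cnj d \<in> dirs \<phi>"
  shows "integral {0<..} (SL_ray d h) - integral {0<..} (SL_ray (cnj d) h) =
    cmul (- \<i>) (ray d (\<lambda>w. cmul (h w) (R w)) - ray (cnj d) (\<lambda>w. cmul (h w) (R w)))"
proof -
  have \<phi>': "0 < \<phi>" "\<phi> < pi / 2" using \<phi> angles by auto
  have dB: "d \<in> bisector \<theta>" by (rule dirs_bisector[OF \<phi>'(1) \<phi>(2) angles(3) d(1)])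
  have adm: "ray_admissible \<phi> h" by (rule sector_null_admissible[OF h(1) \<phi>'(1) \<phi>(2) angles(3)])
  have ri: "(\<lambda>t. cmul e (cmul (h (of_real t * e)) (R (of_real t * e)))) integrable_on {0<..}" if "e \<in> dirs \<phi>" for e
  proof -
    have "ray_integrable e (\<lambda>w. cmul (h w) (R w))"
      using contour_integrable_R[OF \<phi>(1) \<phi>'(2) adm] that by (simp add: contour_integrable_def)
    from integrable_linear[OF ray_integrable_integrable[OF this] cm.bounded_linear_right[of e]]
    show ?thesis unfolding o_def .
  qed
  have eq: "SL_ray d h t - SL_ray (cnj d) h t =
      cmul (- \<i>) (cmul d (cmul (h (of_real t * d)) (R (of_real t * d))) - cmul (cnj d) (cmul (h (of_real t * cnj d)) (R (of_real t * cnj d))))"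
    if t: "t > 0" for t
  proof -
    define w where "w = of_real t * d"
    have w': "of_real t * cnj d = cnj w" by (simp add: w_def)
    have w: "w \<in> \<Omega>" using dirs_outer[OF d(1) t \<phi>'] outer_subset_\<Omega>[OF \<phi>(1) \<phi>'(2)] by (auto simp: w_def)
    have hc: "h (cnj w) = cnj (h w)" using h(2) bisector_scaleI[OF dB t] by (auto simp: sector_symmetric_def w_def)
    define a where "a = - \<i> * d * h w"
    have neg: "cl_op (pt (- cnj a)) = - (cl_op (pt (cnj a)) :: ('v, 'n) clmodule \<Rightarrow>\<^sub>L ('v, 'n) clmodule)"
      using linear_neg[OF bounded_linear.linear[OF bounded_linear_cl_op_pt]] .
    have ca: "- \<i> * cnj d * h (cnj w) = - cnj a" by (simp add: a_def hc)
    have "SL_ray d h t - SL_ray (cnj d) h t = (SL_resolvent (pt w) T o\<^sub>L cl_op (pt a)) + (SL_resolvent (pt (cnj w)) T o\<^sub>L cl_op (pt (cnj a)))"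
      unfolding SL_ray_def w' w_def[symmetric] ca neg a_def[symmetric]
        bounded_bilinear.minus_right[OF bounded_bilinear_blinfun_compose] by simp
    also have "\<dots> = cmul a (R w) + cmul (cnj a) (R (cnj w))" by (rule SL_pair[OF w])
    also have "cmul (cnj a) (R (cnj w)) = - cmul (- \<i> * cnj d * h (cnj w)) (R (cnj w))" unfolding ca cm.minus_left by simp
    also have "cmul a (R w) + \<dots> = cmul (- \<i>) (cmul d (cmul (h w) (R w)) - cmul (cnj d) (cmul (h (cnj w)) (R (cnj w))))"
      unfolding a_def cm.diff_right cmul_cmul by (simp add: mult.assoc)
    finally show ?thesis unfolding w' w_def[symmetric] .
  qed
  have "integral {0<..} (SL_ray d h) - integral {0<..} (SL_ray (cnj d) h) = integral {0<..} (\<lambda>t. SL_ray d h t - SL_ray (cnj d) h t)"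
    by (rule integral_diff[symmetric]) (rule SL_ray_integrable[OF h(1)] d)+
  also have "\<dots> = integral {0<..} (\<lambda>t. cmul (- \<i>) (cmul d (cmul (h (of_real t * d)) (R (of_real t * d))) - cmul (cnj d) (cmul (h (of_real t * cnj d)) (R (of_real t * cnj d)))))"
    by (rule integral_cong) (simp add: eq)
  also have "\<dots> = cmul (- \<i>) (integral {0<..} (\<lambda>t. cmul d (cmul (h (of_real t * d)) (R (of_real t * d))) - cmul (cnj d) (cmul (h (of_real t * cnj d)) (R (of_real t * cnj d)))))"
    using integral_linear[OF integrable_diff[OF ri[OF d(1)] ri[OF d(2)]] cm.bounded_linear_right] by (simp add: o_def)
  also have "\<dots> = cmul (- \<i>) (ray d (\<lambda>w. cmul (h w) (R w)) - ray (cnj d) (\<lambda>w. cmul (h w) (R w)))"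
    unfolding ray_def integral_diff[OF ri[OF d(1)] ri[OF d(2)]] ..
  finally show ?thesis .
qed

lemma SL_ray_Phi:
  assumes h: "h \<in> sector_null \<theta>" "sector_symmetric \<theta> h"
  shows "(1 / (2 * pi)) *\<^sub>R (\<Sum>\<epsilon>\<in>{1, -1 :: real}. integral {0<..} (SL_ray (of_real \<epsilon> * cis (- \<phi>)) h) - integral {0<..} (SL_ray (of_real \<epsilon> * cis \<phi>) h)) = Phi \<phi> h"
proof -
  have \<phi>': "0 < \<phi>" "\<phi> < pi / 2" using \<phi> angles by auto
  have c: "cnj (cis (- \<phi>)) = cis \<phi>" "cnj (- cis (- \<phi>)) = - cis \<phi>" by (simp_all add: complex_eq_iff)
  have d: "cis (- \<phi>) \<in> dirs \<phi>" "cis \<phi> \<in> dirs \<phi>" "- cis (- \<phi>) \<in> dirs \<phi>" "- cis \<phi> \<in> dirs \<phi>" unfolding dirs_def by blast+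
  define G where "G w = cmul (h w) (R w)" for w
  note 1 = SL_ray_pair[OF h, of "cis (- \<phi>)", unfolded c(1), OF d(1,2), folded G_def]
  note 2 = SL_ray_pair[OF h, of "- cis (- \<phi>)", unfolded c(2), OF d(3,4), folded G_def]
  have "(\<Sum>\<epsilon>\<in>{1, -1 :: real}. integral {0<..} (SL_ray (of_real \<epsilon> * cis (- \<phi>)) h) - integral {0<..} (SL_ray (of_real \<epsilon> * cis \<phi>) h))
    = cmul (- \<i>) (ray (cis (- \<phi>)) G - ray (cis \<phi>) G) + cmul (- \<i>) (ray (- cis (- \<phi>)) G - ray (- cis \<phi>) G)"
    unfolding 1[symmetric] 2[symmetric] by simp
  also have "\<dots> = cmul (- \<i>) (contour \<phi> G)"
    unfolding contour_expand[OF \<phi>'] cm.add_right[symmetric] ..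
  finally have *: "(\<Sum>\<epsilon>\<in>{1, -1 :: real}. integral {0<..} (SL_ray (of_real \<epsilon> * cis (- \<phi>)) h) - integral {0<..} (SL_ray (of_real \<epsilon> * cis \<phi>) h)) = cmul (- \<i>) (contour \<phi> G)" .
  have "(1 / (2 * pi)) *\<^sub>R cmul (- \<i>) (contour \<phi> G) = cmul (of_real (1 / (2 * pi)) * - \<i>) (contour \<phi> G)"
    unfolding cmul_cmul[symmetric] cmul_of_real ..
  also have "of_real (1 / (2 * pi)) * - \<i> = 1 / (of_real (2 * pi) * \<i>)" by (simp add: field_simps)
  finally show ?thesis unfolding * Phi_def G_def .
qed

end

end

text \<open>
  The components \<open>f\<^sub>0\<close> and \<open>f\<^sub>1\<close> of a slice function, combined into one complex function \<open>k A\<close> for each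
  basis element \<open>e\<^sub>A\<close>.
\<close>

definition sector_repr :: "real \<Rightarrow> ('n::{finite,linorder} clifford \<Rightarrow> 'n clifford) \<Rightarrow> ('n set \<Rightarrow> complex \<Rightarrow> complex) \<Rightarrow> bool" where
  "sector_repr \<theta> f k \<longleftrightarrow> (\<forall>J\<in>imag_units. \<forall>z\<in>bisector \<theta>.
     f (slice_pt J (Re z) (Im z)) = (\<chi> A. Re (k A z)) + J \<cdot> (\<chi> A. Im (k A z)))"

lemma cl_op_lmul: "cl_op (a \<cdot> b) = (cl_op a o\<^sub>L cl_op b :: ('v::real_normed_vector, 'n::{finite,linorder}) clmodule \<Rightarrow>\<^sub>L ('v, 'n) clmodule)"
  by (rule blinfun_eqI) (simp add: cl_op_apply lmul_assoc)

lemma cl_op_add: "cl_op (a + b) = (cl_op a + cl_op b :: ('v::real_normed_vector, 'n::{finite,linorder}) clmodule \<Rightarrow>\<^sub>L ('v, 'n) clmodule)"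
  by (rule blinfun_eqI) (simp add: cl_op_apply lmul_add_left blinfun.add_left)

lemma cl_op_scaleR: "cl_op (c *\<^sub>R a) = (c *\<^sub>R cl_op a :: ('v::real_normed_vector, 'n::{finite,linorder}) clmodule \<Rightarrow>\<^sub>L ('v, 'n) clmodule)"
  by (rule blinfun_eqI) (simp add: cl_op_apply lmul_scaleR_left blinfun.scaleR_left)

lemma cl_op_sum: "finite I \<Longrightarrow> cl_op (\<Sum>i\<in>I. a i) = (\<Sum>i\<in>I. cl_op (a i) :: ('v::real_normed_vector, 'n::{finite,linorder}) clmodule \<Rightarrow>\<^sub>L ('v, 'n) clmodule)"
  by (rule blinfun_eqI) (simp add: cl_op_apply lmul_sum_left blinfun.sum_left)

lemma axis_expansion_real: "(\<chi> A. c A) = (\<Sum>A\<in>UNIV. c A *\<^sub>R axis A (1::real))"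
  by (simp add: vec_eq_iff axis_def if_distrib cong: if_cong)

context bisectorial_operator
begin

section \<open>The slice integral of a Clifford-valued function in coordinates\<close>

lemma pt_scaleR: "pt (of_real r * z) = r *\<^sub>R pt z"
  by (simp add: pt_def slice_pt_def cl_real_def axis_def vec_eq_iff algebra_simps)

lemma cl_cis_pt: "cl_cis J \<phi> = pt (cis \<phi>)" by (simp add: cl_cis_def pt_def)

lemma cl_inv_J: "cl_inv J = pt (- \<i>)"
proof -
  have "J = slice_pt J 0 1" by (simp add: slice_pt_def cl_real_def axis_def vec_eq_iff)
  then have "cl_cnj J = slice_pt J 0 (- 1)" using cnj_slice_pt[OF J, of 0 1] by simp
  then show ?thesis using J by (simp add: cl_inv_def imag_units_def pt_def)
qed

lemma sector_repr_pt:
  assumes "sector_repr \<theta> f k" "z \<in> bisector \<theta>"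
  shows "f (pt z) = (\<Sum>A\<in>UNIV. pt (k A z) \<cdot> axis A 1)"
proof -
  have "f (pt z) = (\<chi> A. Re (k A z)) + J \<cdot> (\<chi> A. Im (k A z))"
    using assms J by (simp add: sector_repr_def pt_def)
  then show ?thesis
    unfolding axis_expansion_real by (simp add: lmul_sum_right lmul_scaleR_right pt_lmul sum.distrib)
qed

lemma sector_path_pt:
  "t > 0 \<Longrightarrow> sector_path \<epsilon> \<phi> J t = pt (of_real t * (of_real \<epsilon> * cis (- \<phi>)))"
  "t < 0 \<Longrightarrow> sector_path \<epsilon> \<phi> J t = pt (of_real (- t) * (of_real \<epsilon> * cis \<phi>))"
  unfolding pt_scaleR by (simp_all add: sector_path_def cl_cis_pt mult.commute)

lemma vector_derivative_sector_path:
  "t > 0 \<Longrightarrow> vector_derivative (sector_path \<epsilon> \<phi> J) (at t) = pt (of_real \<epsilon> * cis (- \<phi>))"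
  "t < 0 \<Longrightarrow> vector_derivative (sector_path \<epsilon> \<phi> J) (at t) = - pt (of_real \<epsilon> * cis \<phi>)"
proof -
  show "vector_derivative (sector_path \<epsilon> \<phi> J) (at t) = pt (of_real \<epsilon> * cis (- \<phi>))" if t: "t > 0"
  proof (rule vector_derivative_at, rule has_vector_derivative_transform_within_open)
    show "((\<lambda>t. t *\<^sub>R pt (of_real \<epsilon> * cis (- \<phi>))) has_vector_derivative pt (of_real \<epsilon> * cis (- \<phi>))) (at t)"
      by (auto intro!: derivative_eq_intros)
    show "open {0::real<..}" "t \<in> {0<..}" using t by auto
    show "u *\<^sub>R pt (of_real \<epsilon> * cis (- \<phi>)) = sector_path \<epsilon> \<phi> J u" if "u \<in> {0<..}" for u
      using that sector_path_pt(1)[of u \<epsilon> \<phi>] pt_scaleR by simp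
  qed
  show "vector_derivative (sector_path \<epsilon> \<phi> J) (at t) = - pt (of_real \<epsilon> * cis \<phi>)" if t: "t < 0"
  proof (rule vector_derivative_at, rule has_vector_derivative_transform_within_open)
    show "((\<lambda>t. (- t) *\<^sub>R pt (of_real \<epsilon> * cis \<phi>)) has_vector_derivative - pt (of_real \<epsilon> * cis \<phi>)) (at t)"
      by (auto intro!: derivative_eq_intros)
    show "open {..<0 :: real}" "t \<in> {..<0}" using t by auto
    show "(- u) *\<^sub>R pt (of_real \<epsilon> * cis \<phi>) = sector_path \<epsilon> \<phi> J u" if "u \<in> {..<0}" for u
    proof -
      have "u < 0" using that by simp
      then show ?thesis unfolding sector_path_pt(2)[OF \<open>u < 0\<close>] pt_scaleR by simp
    qed
  qed
qed

lemma omega_integrand: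
  assumes f: "sector_repr \<theta> f h" and z: "of_real t * d \<in> bisector \<theta>"
  shows "(SL_resolvent (pt (of_real t * d)) T o\<^sub>L cl_op ((pt d \<cdot> cl_inv J) \<cdot> f (pt (of_real t * d))))
    = (\<Sum>A\<in>UNIV. SL_ray d (h A) t o\<^sub>L cl_op (axis A 1))"
proof -
  have "(pt d \<cdot> cl_inv J) \<cdot> f (pt (of_real t * d)) = (\<Sum>A\<in>UNIV. pt (- \<i> * d * h A (of_real t * d)) \<cdot> axis A 1)"
    unfolding cl_inv_J pt_mult sector_repr_pt[OF f z] lmul_sum_right[OF finite] pt_lmul_lmul
    by (simp add: mult.commute)
  then show ?thesis
    by (simp add: cl_op_sum cl_op_lmul bounded_bilinear.sum_right[OF bounded_bilinear_blinfun_compose] SL_ray_def)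
       (intro sum.cong refl blinfun_eqI, simp)
qed

context
  fixes \<phi> assumes \<phi>: "\<omega> < \<phi>" "\<phi> < \<theta>"
begin

lemma has_integral_SL_ray_sum:
  assumes h: "\<And>A. h A \<in> sector_null \<theta>" and d: "d \<in> dirs \<phi>"
  shows "((\<lambda>t. \<Sum>A\<in>UNIV. SL_ray d (h A) t o\<^sub>L cl_op (axis A 1)) has_integral
    (\<Sum>A\<in>UNIV. integral {0<..} (SL_ray d (h A)) o\<^sub>L cl_op (axis A 1))) {0<..}"
proof (rule has_integral_sum)
  fix A
  show "((\<lambda>t. SL_ray d (h A) t o\<^sub>L cl_op (axis A 1)) has_integral (integral {0<..} (SL_ray d (h A)) o\<^sub>L cl_op (axis A 1))) {0<..}"
    using has_integral_linear[OF integrable_integral[OF SL_ray_integrable[OF \<phi> h d]]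
        bounded_bilinear.bounded_linear_left[OF bounded_bilinear_blinfun_compose]]
    unfolding o_def .
qed simp

text \<open>The path is split at t = 0 and its negative half is reflected; the sign that
  \<open>SL_ray_Phi\<close> expects there comes from the derivative of |t|. The constant e_A is
  applied first and leaves the integral by linearity.\<close>

lemma omega_integral_eq:
  assumes f: "sector_repr \<theta> f h" and h: "\<And>A. h A \<in> sector_null \<theta>" "\<And>A. sector_symmetric \<theta> (h A)"
  shows "omega_integral \<phi> J T f = (\<Sum>A\<in>UNIV. Phi \<phi> (h A) o\<^sub>L cl_op (axis A 1))"
proof -
  have \<phi>': "0 < \<phi>" "\<phi> < pi / 2" using \<phi> angles by auto
  define S where "S \<epsilon> A = integral {0<..} (SL_ray (of_real \<epsilon> * cis (- \<phi>)) (h A)) - integral {0<..} (SL_ray (of_real \<epsilon> * cis \<phi>) (h A))" for \<epsilon> :: real and A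
  define G where "G \<epsilon> t = (SL_resolvent (sector_path \<epsilon> \<phi> J t) T o\<^sub>L
       cl_op ((vector_derivative (sector_path \<epsilon> \<phi> J) (at t) \<cdot> cl_inv J) \<cdot> f (sector_path \<epsilon> \<phi> J t)) :: ('v, 'n) clmodule \<Rightarrow>\<^sub>L ('v, 'n) clmodule)" for \<epsilon> t
  have int: "integral UNIV (G \<epsilon>) = (\<Sum>A\<in>UNIV. S \<epsilon> A o\<^sub>L cl_op (axis A 1))" if \<epsilon>: "\<epsilon> \<in> {1, -1}" for \<epsilon> :: real
  proof -
    define d where "d = of_real \<epsilon> * cis (- \<phi>)"
    define d' where "d' = of_real \<epsilon> * cis \<phi>"
    have dd: "d \<in> dirs \<phi>" "d' \<in> dirs \<phi>" using \<epsilon> by (auto simp: d_def d'_def dirs_def)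
    have B: "of_real t * d \<in> bisector \<theta>" "of_real t * d' \<in> bisector \<theta>" if "t > 0" for t
      by (rule bisector_scaleI[OF dirs_bisector[OF \<phi>'(1) \<phi>(2) angles(3)] that], rule dd)+
    note pos = has_integral_SL_ray_sum[OF h(1) dd(1)]
    have im: "uminus ` {0<..} = {..<0::real}" by (auto intro!: image_eqI[where x="- _"])
    have neg: "((\<lambda>t. - (\<Sum>A\<in>UNIV. SL_ray d' (h A) (- t) o\<^sub>L cl_op (axis A 1))) has_integral
      - (\<Sum>A\<in>UNIV. integral {0<..} (SL_ray d' (h A)) o\<^sub>L cl_op (axis A 1))) {..<0}"
      by (rule has_integral_neg, rule has_integral_reflect_real_set[OF has_integral_SL_ray_sum[OF h(1) dd(2)], unfolded im])
    have 1: "(G \<epsilon> has_integral (\<Sum>A\<in>UNIV. integral {0<..} (SL_ray d (h A)) o\<^sub>L cl_op (axis A 1))) {0<..}"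
    proof (rule has_integral_eq[OF _ pos])
      fix t :: real assume "t \<in> {0<..}"
      then have t: "t > 0" by simp
      show "(\<Sum>A\<in>UNIV. SL_ray d (h A) t o\<^sub>L cl_op (axis A 1)) = G \<epsilon> t"
        unfolding G_def sector_path_pt(1)[OF t] vector_derivative_sector_path(1)[OF t] d_def[symmetric]
        by (rule omega_integrand[OF f B(1)[OF t], symmetric])
    qed
    have 2: "(G \<epsilon> has_integral - (\<Sum>A\<in>UNIV. integral {0<..} (SL_ray d' (h A)) o\<^sub>L cl_op (axis A 1))) {..<0}"
    proof (rule has_integral_eq[OF _ neg])
      fix t :: real assume "t \<in> {..<0}"
      then have t: "t < 0" "- t > 0" by auto
      have m: "cl_op ((- pt d' \<cdot> cl_inv J) \<cdot> x) = - (cl_op ((pt d' \<cdot> cl_inv J) \<cdot> x) :: ('v, 'n) clmodule \<Rightarrow>\<^sub>L ('v, 'n) clmodule)" for x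
        using cl_op_scaleR[of "-1" "(pt d' \<cdot> cl_inv J) \<cdot> x"] by (simp add: lmul_minus)
      show "- (\<Sum>A\<in>UNIV. SL_ray d' (h A) (- t) o\<^sub>L cl_op (axis A 1)) = G \<epsilon> t"
        unfolding G_def sector_path_pt(2)[OF t(1)] vector_derivative_sector_path(2)[OF t(1)] d'_def[symmetric] m
          bounded_bilinear.minus_right[OF bounded_bilinear_blinfun_compose] omega_integrand[OF f B(2)[OF t(2)]] ..
    qed
    have "(G \<epsilon> has_integral (\<Sum>A\<in>UNIV. integral {0<..} (SL_ray d (h A)) o\<^sub>L cl_op (axis A 1))
        + - (\<Sum>A\<in>UNIV. integral {0<..} (SL_ray d' (h A)) o\<^sub>L cl_op (axis A 1))) ({0<..} \<union> {..<0})"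
    proof (rule has_integral_Un[OF 1 2])
      have "{0<..} \<inter> {..<0::real} = {}" by auto
      then show "negligible ({0<..} \<inter> {..<0::real})" by simp
    qed
    then have "(G \<epsilon> has_integral (\<Sum>A\<in>UNIV. integral {0<..} (SL_ray d (h A)) o\<^sub>L cl_op (axis A 1))
        + - (\<Sum>A\<in>UNIV. integral {0<..} (SL_ray d' (h A)) o\<^sub>L cl_op (axis A 1))) UNIV"
      by (rule has_integral_spike_set_eq[THEN iffD1, rotated 2]) (auto intro!: negligible_subset[OF negligible_sing[of 0]])
    then show ?thesis
      by (simp add: integral_unique S_def d_def d'_def bounded_bilinear.diff_left[OF bounded_bilinear_blinfun_compose] sum_subtractf)
  qed
  have "omega_integral \<phi> J T f = (1 / (2 * pi)) *\<^sub>R (\<Sum>\<epsilon>\<in>{1, -1}. \<Sum>A\<in>UNIV. S \<epsilon> A o\<^sub>L cl_op (axis A 1))"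
    unfolding omega_integral_def G_def[symmetric]
    by (intro arg_cong[where f="(*\<^sub>R) (1 / (2 * pi))"] sum.cong refl) (use int in auto)
  also have "\<dots> = (\<Sum>A\<in>UNIV. ((1 / (2 * pi)) *\<^sub>R (\<Sum>\<epsilon>\<in>{1, -1}. S \<epsilon> A)) o\<^sub>L cl_op (axis A 1))"
    by (simp add: sum.distrib scaleR_sum_right bounded_bilinear.add_left[OF bounded_bilinear_blinfun_compose]
        bounded_bilinear.scaleR_left[OF bounded_bilinear_blinfun_compose] scaleR_add_right)
  also have "\<dots> = (\<Sum>A\<in>UNIV. Phi \<phi> (h A) o\<^sub>L cl_op (axis A 1))"
    unfolding S_def SL_ray_Phi[OF \<phi> h] ..
  finally show ?thesis .
qed

end

end

section \<open>Slice hyperholomorphic functions on a double sector\<close>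

lemma uminus_imag_units: "J \<in> imag_units \<Longrightarrow> - J \<in> imag_units"
  by (auto simp: imag_units_def paravectors_def)

lemma cl_inv_slice_pt:
  assumes "J \<in> imag_units"
  shows "cl_inv (slice_pt J (Re w) (Im w)) = slice_pt J (Re (1 / w)) (Im (1 / w))"
  unfolding cl_inv_def norm_slice_pt[OF assms] cnj_slice_pt[OF assms]
  by (simp add: Re_divide Im_divide) (simp add: slice_pt_def cl_real_def axis_def vec_eq_iff algebra_simps)

lemma one_plus_slice_pt: "cl_real 1 + slice_pt J (Re w) (Im w) = slice_pt J (Re (1 + w)) (Im (1 + w))"
  by (simp add: slice_pt_def cl_real_def axis_def vec_eq_iff)

lemma cl_inv_fB:
  assumes "J \<in> imag_units"
  shows "cl_inv (cl_real 1 + slice_pt J (Re z) (Im z) \<cdot> slice_pt J (Re z) (Im z)) = slice_pt J (Re (fB z)) (Im (fB z))"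
  unfolding slice_pt_mult[OF assms] one_plus_slice_pt cl_inv_slice_pt[OF assms] fB_def power2_eq_square ..

lemma cl_pow_slice_pt:
  assumes "J \<in> imag_units"
  shows "cl_pow (slice_pt J (Re z) (Im z)) k = slice_pt J (Re (z ^ k)) (Im (z ^ k))"
proof (induction k)
  case 0
  show ?case by (simp add: cl_pow_def slice_pt_def)
next
  case (Suc k)
  have "cl_pow (slice_pt J (Re z) (Im z)) (Suc k) = slice_pt J (Re z) (Im z) \<cdot> cl_pow (slice_pt J (Re z) (Im z)) k"
    by (simp add: cl_pow_def)
  then show ?case unfolding Suc slice_pt_mult[OF assms] by simp
qed

text \<open>The Clifford algebra is finite dimensional, so the linear map from a to left
  multiplication by a is bounded.\<close>

lemma lmul_norm_bound:
  obtains K where "K > 0" "\<And>a v. norm (a \<cdot> v :: 'n::{finite,linorder} clifford) \<le> K * norm a * norm v"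
proof -
  have "linear (\<lambda>a. cl_op a :: 'n clifford \<Rightarrow>\<^sub>L 'n clifford)"
    by (intro linearI cl_op_add cl_op_scaleR)
  then have "bounded_linear (\<lambda>a. cl_op a :: 'n clifford \<Rightarrow>\<^sub>L 'n clifford)" by (rule linear_conv_bounded_linear[THEN iffD1])
  then obtain K where K: "K > 0" "\<And>a. norm (cl_op a :: 'n clifford \<Rightarrow>\<^sub>L 'n clifford) \<le> norm a * K"
    using bounded_linear.pos_bounded by blast
  have "norm (a \<cdot> v) \<le> K * norm a * norm v" for a v :: "'n clifford"
  proof -
    have "norm (a \<cdot> v) \<le> norm (cl_op a :: 'n clifford \<Rightarrow>\<^sub>L 'n clifford) * norm v"
      using norm_blinfun[of "cl_op a" v] by (simp add: cl_op_apply)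
    also have "\<dots> \<le> norm a * K * norm v" by (rule mult_right_mono[OF K(2)]) simp
    finally show ?thesis by (simp add: mult_ac)
  qed
  with K(1) show ?thesis using that by blast
qed

text \<open>Evaluation at J and at -J separates the part that is independent of the imaginary unit
  from the part proportional to it. Uniqueness and norm bounds of the coordinates follow from
  this.\<close>

lemma sector_repr_components:
  assumes f: "sector_repr \<theta> f k" and J: "J \<in> imag_units" and z: "z \<in> bisector \<theta>"
  shows "(\<chi> A. Re (k A z)) = (1 / 2) *\<^sub>R (f (slice_pt J (Re z) (Im z)) + f (slice_pt (- J) (Re z) (Im z)))"
    and "(\<chi> A. Im (k A z)) = - (J \<cdot> ((1 / 2) *\<^sub>R (f (slice_pt J (Re z) (Im z)) - f (slice_pt (- J) (Re z) (Im z)))))"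
proof -
  define a b where "a = (\<chi> A. Re (k A z))" "b = (\<chi> A. Im (k A z))"
  have "f (slice_pt J (Re z) (Im z)) = a + J \<cdot> b" "f (slice_pt (- J) (Re z) (Im z)) = a - J \<cdot> b"
    using f J uminus_imag_units[OF J] z by (simp_all add: sector_repr_def a_b_def lmul_minus)
  then show "a = (1 / 2) *\<^sub>R (f (slice_pt J (Re z) (Im z)) + f (slice_pt (- J) (Re z) (Im z)))"
    "b = - (J \<cdot> ((1 / 2) *\<^sub>R (f (slice_pt J (Re z) (Im z)) - f (slice_pt (- J) (Re z) (Im z)))))"
    by (simp_all add: scaleR_2[symmetric] imag_unit_lmul_lmul[OF J])
qed

lemma sector_repr_unique:
  assumes "sector_repr \<theta> f k" "sector_repr \<theta> f k'" "z \<in> bisector \<theta>"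
  shows "k A z = k' A z"
proof -
  obtain J :: "'a clifford" where J: "J \<in> imag_units" using imag_units_nonempty by blast
  have "(\<chi> A. Re (k A z)) = (\<chi> A. Re (k' A z))" "(\<chi> A. Im (k A z)) = (\<chi> A. Im (k' A z))"
    using assms J by (simp_all only: sector_repr_components)
  then show ?thesis by (simp add: vec_eq_iff complex_eq_iff)
qed

lemma sector_repr_norm_component:
  assumes f: "sector_repr \<theta> f k" and J: "J \<in> imag_units"
  obtains C where "C > 0" "\<And>z A. z \<in> bisector \<theta> \<Longrightarrow> norm (k A z) \<le> C * (norm (f (slice_pt J (Re z) (Im z))) + norm (f (slice_pt (- J) (Re z) (Im z))))"
proof -
  obtain K where K: "K > 0" "\<And>a v. norm (a \<cdot> v :: 'a clifford) \<le> K * norm a * norm v" using lmul_norm_bound by blast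
  have "norm (k A z) \<le> (1 + K) * (norm (f (slice_pt J (Re z) (Im z))) + norm (f (slice_pt (- J) (Re z) (Im z))))"
    if z: "z \<in> bisector \<theta>" for A z
  proof -
    define F G where "F = f (slice_pt J (Re z) (Im z))" "G = f (slice_pt (- J) (Re z) (Im z))"
    note c = sector_repr_components[OF f J z, folded F_G_def]
    have "norm ((1 / 2) *\<^sub>R (F + G)) \<le> norm F + norm G"
      by simp (use norm_triangle_ineq[of F G] norm_ge_zero[of F] norm_ge_zero[of G] in linarith)
    moreover have "norm ((1 / 2) *\<^sub>R (F - G)) \<le> norm F + norm G"
      by simp (use norm_triangle_ineq4[of F G] norm_ge_zero[of F] norm_ge_zero[of G] in linarith)
    moreover have "norm (- (J \<cdot> ((1 / 2) *\<^sub>R (F - G)))) \<le> K * norm ((1 / 2) *\<^sub>R (F - G))"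
      using K(2)[of J "(1 / 2) *\<^sub>R (F - G)"] J by (simp add: imag_units_def)
    moreover have "K * norm ((1 / 2) *\<^sub>R (F - G)) \<le> K * (norm F + norm G)"
      using K calculation(2) by (intro mult_left_mono) auto
    ultimately have ab: "norm (\<chi> A. Re (k A z)) \<le> norm F + norm G" "norm (\<chi> A. Im (k A z)) \<le> K * (norm F + norm G)"
      unfolding c by linarith+
    have "\<bar>Re (k A z)\<bar> \<le> norm (\<chi> A. Re (k A z))" "\<bar>Im (k A z)\<bar> \<le> norm (\<chi> A. Im (k A z))"
      using component_le_norm_cart[of "\<chi> A. Re (k A z)" A] component_le_norm_cart[of "\<chi> A. Im (k A z)" A] by simp_all
    with ab have "\<bar>Re (k A z)\<bar> + \<bar>Im (k A z)\<bar> \<le> (1 + K) * (norm F + norm G)" by (simp add: distrib_right)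
    with cmod_le show ?thesis unfolding F_G_def by (rule order_trans)
  qed
  then show ?thesis using that[of "1 + K"] K by simp
qed

lemma sector_repr_norm:
  obtains C where "C > 0" "\<And>f k J z. sector_repr \<theta> f k \<Longrightarrow> J \<in> imag_units \<Longrightarrow> z \<in> bisector \<theta> \<Longrightarrow>
    norm (f (slice_pt J (Re z) (Im z)) :: 'n::{finite,linorder} clifford) \<le> C * (\<Sum>A\<in>UNIV. norm (k A z))"
proof -
  obtain K where K: "K > 0" "\<And>a v. norm (a \<cdot> v :: 'n clifford) \<le> K * norm a * norm v" using lmul_norm_bound by blast
  have "norm (f (slice_pt J (Re z) (Im z))) \<le> (1 + K) * (\<Sum>A\<in>UNIV. norm (k A z))"
    if f: "sector_repr \<theta> f k" and J: "J \<in> imag_units" and z: "z \<in> bisector \<theta>" for f k and J :: "'n clifford" and z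
  proof -
    define a b where "a = (\<chi> A. Re (k A z))" "b = (\<chi> A. Im (k A z))"
    have na: "norm a \<le> (\<Sum>A\<in>UNIV. norm (k A z))"
      by (rule order_trans[OF norm_le_l1_cart]) (auto simp: a_b_def intro!: sum_mono abs_Re_le_cmod)
    have nb: "norm b \<le> (\<Sum>A\<in>UNIV. norm (k A z))"
      by (rule order_trans[OF norm_le_l1_cart]) (auto simp: a_b_def intro!: sum_mono abs_Im_le_cmod)
    have "f (slice_pt J (Re z) (Im z)) = a + J \<cdot> b" using f J z by (simp add: sector_repr_def a_b_def)
    then have "norm (f (slice_pt J (Re z) (Im z))) \<le> norm a + norm (J \<cdot> b)" by (simp add: norm_triangle_ineq)
    also have "norm (J \<cdot> b) \<le> K * norm b" using K(2)[of J b] J by (simp add: imag_units_def)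
    also have "norm a + K * norm b \<le> (\<Sum>A\<in>UNIV. norm (k A z)) + K * (\<Sum>A\<in>UNIV. norm (k A z))"
      using K by (intro add_mono na mult_left_mono nb) auto
    finally show ?thesis by (simp add: distrib_right)
  qed
  then show ?thesis using that[of "1 + K"] K by simp
qed

lemma slice_dom_D_sector:
  assumes "0 < \<theta>" "\<theta> < pi / 2"
  shows "slice_dom (D_sector \<theta> :: 'n::{finite,linorder} clifford set) = {p. Complex (fst p) (snd p) \<in> bisector \<theta>}"
  using imag_units_nonempty[where 'n='n] slice_pt_D_sector[OF _ assms, where 'a='n] by (auto simp: slice_dom_def)

text \<open>In each coordinate the differential equations for \<open>f0\<close> and
  \<open>f1\<close> are the Cauchy-Riemann equations for real part \<open>f0\<close> and imaginary
  part \<open>f1\<close>. Total differentiability then gives the complex derivative, with value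
  \<open>m\<close> composed of the two partial derivatives in x.\<close>

lemma slice_components_holomorphic:
  fixes f :: "'n::{finite,linorder} clifford \<Rightarrow> 'n clifford" and f0 f1 :: "real \<times> real \<Rightarrow> 'n clifford"
  assumes sc: "slice_components (D_sector \<theta>) f f0 f1" and \<theta>: "0 < \<theta>" "\<theta> < pi / 2"
  defines "h \<equiv> \<lambda>A z. Complex (f0 (Re z, Im z) $ A) (f1 (Re z, Im z) $ A)"
  shows "sector_repr \<theta> f h" "sector_symmetric \<theta> (h A)" "h A holomorphic_on bisector \<theta>"
proof -
  have dom: "(Re z, Im z) \<in> slice_dom (D_sector \<theta> :: 'n clifford set)" if "z \<in> bisector \<theta>" for z
    using that by (simp add: slice_dom_D_sector[OF \<theta>])
  have D: "\<And>x y. (x, y) \<in> slice_dom (D_sector \<theta> :: 'n clifford set) \<Longrightarrow>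
      (\<forall>J\<in>imag_units. f (slice_pt J x y) = f0 (x, y) + J \<cdot> f1 (x, y)) \<and> f0 (x, -y) = f0 (x, y) \<and> f1 (x, -y) = - f1 (x, y)"
    using sc unfolding slice_components_def by blast
  show "sector_repr \<theta> f h"
    unfolding sector_repr_def h_def using D[OF dom] by simp
  show "sector_symmetric \<theta> (h A)"
    unfolding sector_symmetric_def h_def using D[OF dom] by (simp add: complex_eq_iff)
  from sc obtain D0 D1 :: "real \<times> real \<Rightarrow> (real \<times> real) \<Rightarrow>\<^sub>L 'n clifford" where
    der: "\<And>p. p \<in> slice_dom (D_sector \<theta> :: 'n clifford set) \<Longrightarrow>
           (f0 has_derivative blinfun_apply (D0 p)) (at p) \<and> (f1 has_derivative blinfun_apply (D1 p)) (at p) \<and>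
           D0 p (1, 0) = D1 p (0, 1) \<and> D0 p (0, 1) = - D1 p (1, 0)"
    unfolding slice_components_def by blast
  show "h A holomorphic_on bisector \<theta>"
  proof (subst holomorphic_on_open[OF open_bisector], intro ballI)
    fix z assume z: "z \<in> bisector \<theta>"
    define p where "p = (Re z, Im z)"
    note d = der[OF dom[OF z], folded p_def]
    have CR: "blinfun_apply (D1 p) (0, 1) = blinfun_apply (D0 p) (1, 0)" "blinfun_apply (D0 p) (0, 1) = - blinfun_apply (D1 p) (1, 0)"
      using d by simp_all
    define m where "m = Complex (D0 p (1, 0) $ A) (D1 p (1, 0) $ A)"
    have split: "blinfun_apply X (a, b) = a *\<^sub>R blinfun_apply X (1, 0) + b *\<^sub>R blinfun_apply X (0, 1)"
      for X :: "(real \<times> real) \<Rightarrow>\<^sub>L 'n clifford" and a b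
      unfolding blinfun.scaleR_right[symmetric] blinfun.add_right[symmetric] by simp
    have P: "((\<lambda>z. (Re z, Im z)) has_derivative (\<lambda>v. (Re v, Im v))) (at z)"
      by (intro bounded_linear_imp_has_derivative bounded_linear_Pair bounded_linear_Re bounded_linear_Im)
    have nth: "((\<lambda>z. F (Re z, Im z) $ A) has_derivative (\<lambda>v. blinfun_apply X (Re v, Im v) $ A)) (at z)"
      if "(F has_derivative blinfun_apply X) (at p)" for F and X :: "(real \<times> real) \<Rightarrow>\<^sub>L 'n clifford"
      using bounded_linear.has_derivative[OF bounded_linear_vec_nth diff_chain_at[OF P that[unfolded p_def]]]
      by (simp add: o_def)
    have "((\<lambda>z. of_real (f0 (Re z, Im z) $ A) + \<i> * of_real (f1 (Re z, Im z) $ A)) has_derivative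
        (\<lambda>v. of_real (blinfun_apply (D0 p) (Re v, Im v) $ A) + \<i> * of_real (blinfun_apply (D1 p) (Re v, Im v) $ A))) (at z)"
      by (intro has_derivative_add has_derivative_mult_right has_derivative_of_real nth d[THEN conjunct1] d[THEN conjunct2, THEN conjunct1])
    moreover have "(\<lambda>z. of_real (f0 (Re z, Im z) $ A) + \<i> * of_real (f1 (Re z, Im z) $ A)) = h A"
      by (rule ext) (simp add: h_def complex_eq_iff)
    moreover have "(\<lambda>v. of_real (blinfun_apply (D0 p) (Re v, Im v) $ A) + \<i> * of_real (blinfun_apply (D1 p) (Re v, Im v) $ A)) = (*) m"
    proof (rule ext)
      fix v
      show "of_real (blinfun_apply (D0 p) (Re v, Im v) $ A) + \<i> * of_real (blinfun_apply (D1 p) (Re v, Im v) $ A) = m * v"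
        unfolding split[of _ "Re v" "Im v"] by (simp add: CR complex_eq_iff m_def algebra_simps)
    qed
    ultimately have "(h A has_field_derivative m) (at z)" unfolding has_field_derivative_def by simp
    then show "\<exists>f'. (h A has_field_derivative f') (at z)" by blast
  qed
qed

lemma SHL0_repr:
  fixes f :: "'n::{finite,linorder} clifford \<Rightarrow> 'n clifford"
  assumes f: "f \<in> SHL0 \<theta>" and h: "sector_repr \<theta> f h" "h A holomorphic_on bisector \<theta>" and \<theta>: "0 < \<theta>" "\<theta> < pi / 2"
  shows "h A \<in> sector_null \<theta>"
proof -
  obtain J :: "'n clifford" where J: "J \<in> imag_units" using imag_units_nonempty by blast
  note J' = uminus_imag_units[OF J]
  obtain C where C: "C > 0" "\<And>z A. z \<in> bisector \<theta> \<Longrightarrow> norm (h A z) \<le> C * (norm (f (slice_pt J (Re z) (Im z))) + norm (f (slice_pt (- J) (Re z) (Im z))))"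
    using sector_repr_norm_component[OF h(1) J] by blast
  from f obtain B where B: "\<And>s. s \<in> D_sector \<theta> \<Longrightarrow> norm (f s) \<le> B" by (auto simp: SHL0_def bounded_iff)
  have bd: "bounded (h A ` bisector \<theta>)"
    unfolding bounded_iff
  proof (intro exI ballI)
    fix w assume "w \<in> h A ` bisector \<theta>"
    then obtain z where z: "z \<in> bisector \<theta>" "w = h A z" by blast
    have "norm (f (slice_pt J (Re z) (Im z))) + norm (f (slice_pt (- J) (Re z) (Im z))) \<le> B + B"
      by (intro add_mono B) (use z in \<open>simp_all add: slice_pt_D_sector[OF J \<theta>] slice_pt_D_sector[OF J' \<theta>]\<close>)
    then have "C * (norm (f (slice_pt J (Re z) (Im z))) + norm (f (slice_pt (- J) (Re z) (Im z)))) \<le> C * (B + B)"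
      using C by (intro mult_left_mono) auto
    with C(2)[OF z(1), of A] show "norm w \<le> C * (B + B)" unfolding z(2) by (rule order_trans)
  qed
  have int: "(\<lambda>t. norm (h A (of_real t * d)) / t) integrable_on {0<..}" if d: "d \<in> bisector \<theta>" "norm d = 1" for d
  proof -
    obtain r \<phi> where r: "r > 0" "\<phi> \<in> I_angles \<theta>" "d = of_real r * cis \<phi>" using bisector_polar[OF d(1) \<theta>] by blast
    then have "r = 1" using d(2) by (simp add: norm_mult)
    then have dc: "d = cis \<phi>" using r by simp
    have i: "(\<lambda>t. norm (f (t *\<^sub>R cl_cis I \<phi>)) / t) integrable_on {0<..}" if "I \<in> imag_units" for I
      using f that r(2) by (intro set_borel_integral_eq_integral(1)) (auto simp: SHL0_def)
    show ?thesis
    proof (rule continuous_dominated_on_ray)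
      show "(\<lambda>t. C * (norm (f (t *\<^sub>R cl_cis J \<phi>)) / t + norm (f (t *\<^sub>R cl_cis (- J) \<phi>)) / t)) integrable_on {0<..}"
        by (intro integrable_on_mult_right integrable_add i J J')
      show "continuous_on {0<..} (\<lambda>t. norm (h A (of_real t * d)) / t)"
        by (intro continuous_intros continuous_on_bisector_ray[OF holomorphic_on_imp_continuous_on[OF h(2)] d(1)]) auto
      fix t :: real assume t: "t > 0"
      have "norm (h A (of_real t * d)) \<le> C * (norm (f (t *\<^sub>R cl_cis J \<phi>)) + norm (f (t *\<^sub>R cl_cis (- J) \<phi>)))"
        using C(2)[OF bisector_scaleI[OF d(1) t], of A] unfolding dc slice_pt_polar .
      then have "norm (h A (of_real t * d)) / t \<le> C * (norm (f (t *\<^sub>R cl_cis J \<phi>)) + norm (f (t *\<^sub>R cl_cis (- J) \<phi>))) / t"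
        using t by (intro divide_right_mono) auto
      then show "norm (norm (h A (of_real t * d)) / t) \<le> C * (norm (f (t *\<^sub>R cl_cis J \<phi>)) / t + norm (f (t *\<^sub>R cl_cis (- J) \<phi>)) / t)"
        using t by (simp add: add_divide_distrib distrib_left)
    qed
  qed
  show ?thesis unfolding sector_null_def using h(2) bd int by blast
qed

text \<open>Connects the gauge integrals used throughout with the Lebesgue integrability in the
  definition of \<open>SHL0\<close>: they agree for nonnegative functions, and continuity on the
  half-line supplies Borel measurability.\<close>

lemma set_integrable_ray:
  fixes g :: "real \<Rightarrow> real"
  assumes "continuous_on {0<..} g" "\<And>t. t > 0 \<Longrightarrow> 0 \<le> g t" "g integrable_on {0<..}"
  shows "set_integrable lborel {0<..} g"
proof -
  have "set_integrable lebesgue {0<..} g"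
    using nonnegative_absolutely_integrable_1[OF assms(3)] assms(2) by simp
  moreover have "(\<lambda>x. indicator {0<..} x *\<^sub>R g x) \<in> borel_measurable lborel"
    using borel_measurable_continuous_on_indicator[OF _ assms(1)] by simp
  ultimately show ?thesis unfolding set_integrable_def by (simp add: integrable_completion)
qed

text \<open>The coordinates of an intrinsic function: real components mean that only the basis
  element for the empty set occurs.\<close>

definition scalar_components :: "(complex \<Rightarrow> complex) \<Rightarrow> 'n set \<Rightarrow> complex \<Rightarrow> complex" where
  "scalar_components k A = (if A = {} then k else (\<lambda>_. 0))"

lemma scalar_components_vec:
  "(\<chi> A. Re (scalar_components k A z)) = cl_real (Re (k z))"
  "(\<chi> A. Im (scalar_components k A z)) = cl_real (Im (k z))"
  by (simp_all add: vec_eq_iff cl_real_def axis_def scalar_components_def)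

lemma sector_repr_scalar:
  "sector_repr \<theta> f (scalar_components k) \<longleftrightarrow>
    (\<forall>J\<in>imag_units. \<forall>z\<in>bisector \<theta>. f (slice_pt J (Re z) (Im z)) = slice_pt J (Re (k z)) (Im (k z)))"
proof -
  have "J \<cdot> cl_real y = y *\<^sub>R J" for J :: "'a clifford" and y
    using rmul_cl_real[of J y] by (simp add: rmul_eq_lmul)
  then show ?thesis unfolding sector_repr_def scalar_components_vec slice_pt_def by simp
qed

text \<open>The intrinsic left factor takes values in the plane spanned by 1 and J at a point of
  that plane, so it acts on f0 + J f1 as complex multiplication in every coordinate. With two
  general factors J could not be moved past the coefficients.\<close>

lemma sector_repr_mult:
  assumes e: "sector_repr \<theta> e (scalar_components l)" and f: "sector_repr \<theta> f k"
  shows "sector_repr \<theta> (\<lambda>s. e s \<cdot> f s) (\<lambda>A z. l z * k A z)"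
  unfolding sector_repr_def
proof (intro ballI)
  fix J :: "'a clifford" and z assume J: "J \<in> imag_units" and z: "z \<in> bisector \<theta>"
  have v: "(\<chi> A. Re (l z * k A z)) = Re (l z) *\<^sub>R (\<chi> A. Re (k A z)) - Im (l z) *\<^sub>R (\<chi> A. Im (k A z))"
    "(\<chi> A. Im (l z * k A z)) = Re (l z) *\<^sub>R (\<chi> A. Im (k A z)) + Im (l z) *\<^sub>R (\<chi> A. Re (k A z))"
    by (simp_all add: vec_eq_iff)
  have e': "e (slice_pt J (Re z) (Im z)) = slice_pt J (Re (l z)) (Im (l z))" using e J z unfolding sector_repr_scalar by blast
  have f': "f (slice_pt J (Re z) (Im z)) = (\<chi> A. Re (k A z)) + J \<cdot> (\<chi> A. Im (k A z))"
    using f J z unfolding sector_repr_def by blast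
  show "e (slice_pt J (Re z) (Im z)) \<cdot> f (slice_pt J (Re z) (Im z)) = (\<chi> A. Re (l z * k A z)) + J \<cdot> (\<chi> A. Im (l z * k A z))"
    unfolding e' f' v by (simp add: slice_pt_lmul lmul_add_right lmul_scaleR_right imag_unit_lmul_lmul[OF J] algebra_simps)
qed

lemma sector_repr_cl_poly:
  "sector_repr \<theta> (cl_poly p) (scalar_components (\<lambda>z. \<Sum>k\<le>degree p. of_real (coeff p k) * z ^ k))"
  unfolding sector_repr_scalar
proof (intro ballI)
  fix J :: "'a clifford" and z assume J: "J \<in> imag_units"
  show "cl_poly p (slice_pt J (Re z) (Im z)) = slice_pt J (Re (\<Sum>k\<le>degree p. of_real (coeff p k) * z ^ k)) (Im (\<Sum>k\<le>degree p. of_real (coeff p k) * z ^ k))"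
    unfolding cl_poly_def cl_pow_slice_pt[OF J]
    by (simp add: slice_pt_def cl_real_def axis_def vec_eq_iff sum_distrib_right sum_distrib_left algebra_simps sum.distrib)
qed

lemma sector_repr_bnd:
  assumes f: "\<And>s. s \<in> D_sector \<theta> \<Longrightarrow> f s = finf + cl_inv (cl_real 1 + s \<cdot> s) \<cdot> d + ft s"
    and h: "sector_repr \<theta> ft h" and \<theta>: "0 < \<theta>" "\<theta> < pi / 2"
  shows "sector_repr \<theta> f (\<lambda>A z. of_real (finf $ A) + of_real (d $ A) * fB z + h A z)"
  unfolding sector_repr_def
proof (intro ballI)
  fix J :: "'a clifford" and z assume J: "J \<in> imag_units" and z: "z \<in> bisector \<theta>"
  have v: "(\<chi> A. Re (of_real (finf $ A) + of_real (d $ A) * fB z + h A z)) = finf + Re (fB z) *\<^sub>R d + (\<chi> A. Re (h A z))"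
    "(\<chi> A. Im (of_real (finf $ A) + of_real (d $ A) * fB z + h A z)) = Im (fB z) *\<^sub>R d + (\<chi> A. Im (h A z))"
    by (simp_all add: vec_eq_iff mult.commute)
  have s: "slice_pt J (Re z) (Im z) \<in> D_sector \<theta>" using z by (simp add: slice_pt_D_sector[OF J \<theta>])
  have ft: "ft (slice_pt J (Re z) (Im z)) = (\<chi> A. Re (h A z)) + J \<cdot> (\<chi> A. Im (h A z))"
    using h J z unfolding sector_repr_def by blast
  show "f (slice_pt J (Re z) (Im z)) = (\<chi> A. Re (of_real (finf $ A) + of_real (d $ A) * fB z + h A z))
      + J \<cdot> (\<chi> A. Im (of_real (finf $ A) + of_real (d $ A) * fB z + h A z))"
    unfolding f[OF s] ft v cl_inv_fB[OF J] by (simp add: slice_pt_lmul lmul_add_right lmul_scaleR_right)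
qed

section \<open>From holomorphic coordinates back to slice functions\<close>

lemma slice_componentsI:
  fixes f :: "'n::{finite,linorder} clifford \<Rightarrow> 'n clifford"
  assumes f: "sector_repr \<theta> f h" and h: "\<And>A. h A holomorphic_on bisector \<theta>" "\<And>A. sector_symmetric \<theta> (h A)"
    and \<theta>: "0 < \<theta>" "\<theta> < pi / 2"
  shows "slice_components (D_sector \<theta>) f (\<lambda>p. \<chi> A. Re (h A (Complex (fst p) (snd p)))) (\<lambda>p. \<chi> A. Im (h A (Complex (fst p) (snd p))))"
proof -
  define P where "P p = Complex (fst p) (snd p)" for p :: "real \<times> real"
  have Peq: "P = (\<lambda>p. of_real (fst p) + \<i> * of_real (snd p))" by (rule ext) (simp add: P_def complex_eq_iff)
  have blP: "bounded_linear P" unfolding Peq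
    by (intro bounded_linear_add bounded_linear_compose[OF bounded_linear_of_real] bounded_linear_fst
        bounded_linear_compose[OF bounded_linear_mult_right bounded_linear_compose[OF bounded_linear_of_real]] bounded_linear_snd)
  \<comment> \<open>\<open>D0\<close> and \<open>D1\<close> are combinations of the fixed operators
    \<open>X A\<close> and \<open>Y A\<close>, so their continuity in operator norm reduces to
    continuity of the complex derivatives.\<close>
  define X where "X A = Blinfun (\<lambda>q :: real \<times> real. fst q *\<^sub>R (axis A 1 :: 'n clifford))" for A
  define Y where "Y A = Blinfun (\<lambda>q :: real \<times> real. snd q *\<^sub>R (axis A 1 :: 'n clifford))" for A
  have XY: "blinfun_apply (X A) q = fst q *\<^sub>R axis A 1" "blinfun_apply (Y A) q = snd q *\<^sub>R axis A 1" for A q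
    unfolding X_def Y_def
    by (simp_all add: bounded_linear_Blinfun_apply bounded_linear_compose[OF bounded_linear_scaleR_left] bounded_linear_fst bounded_linear_snd)
  define D0 where "D0 p = (\<Sum>A\<in>UNIV. Re (deriv (h A) (P p)) *\<^sub>R X A - Im (deriv (h A) (P p)) *\<^sub>R Y A)" for p
  define D1 where "D1 p = (\<Sum>A\<in>UNIV. Im (deriv (h A) (P p)) *\<^sub>R X A + Re (deriv (h A) (P p)) *\<^sub>R Y A)" for p
  have D: "blinfun_apply (D0 p) q = (\<Sum>A\<in>UNIV. Re (deriv (h A) (P p) * P q) *\<^sub>R axis A 1)"
    "blinfun_apply (D1 p) q = (\<Sum>A\<in>UNIV. Im (deriv (h A) (P p) * P q) *\<^sub>R axis A 1)" for p q
    by (simp_all add: D0_def D1_def blinfun.sum_left blinfun.diff_left blinfun.add_left blinfun.scaleR_left XY P_def algebra_simps)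
  have cont: "continuous_on {p. P p \<in> bisector \<theta>} (\<lambda>p. deriv (h A) (P p))" for A
    by (rule continuous_on_compose2[OF holomorphic_on_imp_continuous_on[OF holomorphic_deriv[OF h(1) open_bisector]]
          bounded_linear.continuous_on[OF blP continuous_on_id]]) auto
  have der: "((\<lambda>p. h A (P p)) has_derivative (\<lambda>q. deriv (h A) (P p) * P q)) (at p)" if "P p \<in> bisector \<theta>" for A p
  proof -
    have "(h A has_derivative (*) (deriv (h A) (P p))) (at (P p))"
      using holomorphic_derivI[OF h(1) open_bisector that] by (simp add: has_field_derivative_def)
    from diff_chain_at[OF bounded_linear_imp_has_derivative[OF blP] this] show ?thesis by (simp add: o_def)
  qed
  have dom: "slice_dom (D_sector \<theta> :: 'n clifford set) = {p. P p \<in> bisector \<theta>}"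
    unfolding slice_dom_D_sector[OF \<theta>] P_def ..
  show ?thesis
    unfolding slice_components_def dom P_def[symmetric]
  proof (rule conjI[rotated], rule exI[of _ D0], rule exI[of _ D1])
    show "continuous_on {p. P p \<in> bisector \<theta>} D0 \<and> continuous_on {p. P p \<in> bisector \<theta>} D1 \<and>
      (\<forall>p\<in>{p. P p \<in> bisector \<theta>}. ((\<lambda>p. \<chi> A. Re (h A (P p))) has_derivative blinfun_apply (D0 p)) (at p) \<and>
        ((\<lambda>p. \<chi> A. Im (h A (P p))) has_derivative blinfun_apply (D1 p)) (at p) \<and>
        blinfun_apply (D0 p) (1, 0) = blinfun_apply (D1 p) (0, 1) \<and> blinfun_apply (D0 p) (0, 1) = - blinfun_apply (D1 p) (1, 0))"
    proof (intro conjI ballI)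
      show "continuous_on {p. P p \<in> bisector \<theta>} D0" unfolding D0_def
        by (intro continuous_on_sum continuous_on_diff continuous_on_scaleR continuous_on_Re continuous_on_Im cont continuous_on_const)
      show "continuous_on {p. P p \<in> bisector \<theta>} D1" unfolding D1_def
        by (intro continuous_on_sum continuous_on_add continuous_on_scaleR continuous_on_Re continuous_on_Im cont continuous_on_const)
      fix p assume "p \<in> {p. P p \<in> bisector \<theta>}"
      then have p: "P p \<in> bisector \<theta>" by simp
      show "((\<lambda>p. \<chi> A. Re (h A (P p))) has_derivative blinfun_apply (D0 p)) (at p)"
        unfolding axis_expansion_real D(1)[abs_def]
        by (intro has_derivative_sum has_derivative_scaleR_left bounded_linear.has_derivative[OF bounded_linear_Re] der p)
      show "((\<lambda>p. \<chi> A. Im (h A (P p))) has_derivative blinfun_apply (D1 p)) (at p)"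
        unfolding axis_expansion_real D(2)[abs_def]
        by (intro has_derivative_sum has_derivative_scaleR_left bounded_linear.has_derivative[OF bounded_linear_Im] der p)
      show "blinfun_apply (D0 p) (1, 0) = blinfun_apply (D1 p) (0, 1)" "blinfun_apply (D0 p) (0, 1) = - blinfun_apply (D1 p) (1, 0)"
        by (simp_all add: D P_def sum_negf)
    qed
  next
    show "\<forall>p\<in>{p. P p \<in> bisector \<theta>}. case p of (x, y) \<Rightarrow> (\<forall>J\<in>imag_units. f (slice_pt J x y) = (\<chi> A. Re (h A (P (x, y)))) + J \<cdot> (\<chi> A. Im (h A (P (x, y))))) \<and>
        (\<chi> A. Re (h A (P (x, - y)))) = (\<chi> A. Re (h A (P (x, y)))) \<and> (\<chi> A. Im (h A (P (x, - y)))) = - (\<chi> A. Im (h A (P (x, y))))"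
    proof
      fix p assume "p \<in> {p. P p \<in> bisector \<theta>}"
      then obtain x y where p: "p = (x, y)" "Complex x y \<in> bisector \<theta>" by (cases p) (auto simp: P_def)
      have c: "h A (Complex x (- y)) = cnj (h A (Complex x y))" for A
        using h(2)[of A] p(2) unfolding sector_symmetric_def by (metis complex_cnj)
      have "\<forall>J\<in>imag_units. f (slice_pt J x y) = (\<chi> A. Re (h A (Complex x y))) + J \<cdot> (\<chi> A. Im (h A (Complex x y)))"
        using f p(2) unfolding sector_repr_def by (metis complex.sel)
      then show "case p of (x, y) \<Rightarrow> (\<forall>J\<in>imag_units. f (slice_pt J x y) = (\<chi> A. Re (h A (P (x, y)))) + J \<cdot> (\<chi> A. Im (h A (P (x, y))))) \<and>
          (\<chi> A. Re (h A (P (x, - y)))) = (\<chi> A. Re (h A (P (x, y)))) \<and> (\<chi> A. Im (h A (P (x, - y)))) = - (\<chi> A. Im (h A (P (x, y))))"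
        unfolding p(1) by (simp add: P_def c vec_eq_iff)
    qed
  qed
qed

lemma SHL0_I:
  fixes f :: "'n::{finite,linorder} clifford \<Rightarrow> 'n clifford"
  assumes f: "sector_repr \<theta> f h" and h: "\<And>A. h A \<in> sector_null \<theta>" "\<And>A. sector_symmetric \<theta> (h A)"
    and \<theta>: "0 < \<theta>" "\<theta> < pi / 2"
    and dom: "openin (top_of_set paravectors) (D_sector \<theta> :: 'n clifford set)" "axially_symmetric (D_sector \<theta> :: 'n clifford set)"
  shows "f \<in> SHL0 \<theta>"
proof -
  have hol: "h A holomorphic_on bisector \<theta>" for A using h(1) by (simp add: sector_null_def)
  obtain C where "C > 0" and "\<And>f k J z. sector_repr \<theta> f k \<Longrightarrow> J \<in> imag_units \<Longrightarrow> z \<in> bisector \<theta> \<Longrightarrow>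
    norm (f (slice_pt J (Re z) (Im z)) :: 'n clifford) \<le> C * (\<Sum>A\<in>UNIV. norm (k A z))"
    using sector_repr_norm by blast
  then have C: "C > 0" "\<And>J z. J \<in> imag_units \<Longrightarrow> z \<in> bisector \<theta> \<Longrightarrow> norm (f (slice_pt J (Re z) (Im z))) \<le> C * (\<Sum>A\<in>UNIV. norm (h A z))"
    using f by blast+
  have polar: "of_real t * cis \<phi> \<in> bisector \<theta>" if "t > 0" "\<phi> \<in> I_angles \<theta>" for t \<phi>
    by (rule bisector_scaleI[OF _ that(1)]) (use I_angles_sin_cos[OF that(2) \<theta>] in \<open>simp add: bisector_def\<close>)
  have SHL: "f \<in> SHL (D_sector \<theta>)"
    unfolding SHL_def using dom slice_componentsI[OF f hol h(2) \<theta>] by blast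
  have "\<exists>B. \<forall>z\<in>bisector \<theta>. norm (h A z) \<le> B" for A using h(1)[of A] by (auto simp: sector_null_def bounded_iff)
  then obtain B where B: "\<And>A z. z \<in> bisector \<theta> \<Longrightarrow> norm (h A z) \<le> B A" by metis
  have bd: "bounded (f ` D_sector \<theta>)"
    unfolding bounded_iff
  proof (intro exI ballI)
    fix w assume "w \<in> f ` D_sector \<theta>"
    then obtain r I \<phi> where w: "w = f (r *\<^sub>R cl_cis I \<phi>)" "r > 0" "I \<in> imag_units" "\<phi> \<in> I_angles \<theta>"
      unfolding D_sector_def by blast
    have "norm w \<le> C * (\<Sum>A\<in>UNIV. norm (h A (of_real r * cis \<phi>)))"
      using C(2)[OF w(3) polar[OF w(2,4)]] unfolding slice_pt_polar w(1) .
    also have "\<dots> \<le> C * (\<Sum>A\<in>UNIV. B A)" using C(1) by (intro mult_left_mono sum_mono B polar w) auto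
    finally show "norm w \<le> C * (\<Sum>A\<in>UNIV. B A)" .
  qed
  have int: "set_integrable lborel {0<..} (\<lambda>t. norm (f (t *\<^sub>R cl_cis J \<phi>)) / t)"
    if J: "J \<in> imag_units" and \<phi>: "\<phi> \<in> I_angles \<theta>" for J \<phi>
  proof -
    have dB: "cis \<phi> \<in> bisector \<theta>" using polar[of 1, OF _ \<phi>] by simp
    have feq: "f (t *\<^sub>R cl_cis J \<phi>) = (\<Sum>A\<in>UNIV. Re (h A (of_real t * cis \<phi>)) *\<^sub>R axis A 1) + J \<cdot> (\<Sum>A\<in>UNIV. Im (h A (of_real t * cis \<phi>)) *\<^sub>R axis A 1)"
      if "t > 0" for t
      using f J polar[OF that \<phi>] unfolding sector_repr_def slice_pt_polar[symmetric] axis_expansion_real by blast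
    have ch: "continuous_on {0<..} (\<lambda>t. h A (of_real t * cis \<phi>))" for A
      by (rule continuous_on_bisector_ray[OF holomorphic_on_imp_continuous_on[OF hol] dB])
    have cf: "continuous_on {0<..} (\<lambda>t. f (t *\<^sub>R cl_cis J \<phi>))"
      by (rule continuous_on_eq[OF _ feq[symmetric]])
         (intro continuous_on_add continuous_on_sum continuous_on_scaleR continuous_on_Re continuous_on_Im continuous_on_const
           bounded_linear.continuous_on[OF bounded_linear_lmul] ch, simp)
    have c: "continuous_on {0<..} (\<lambda>t. norm (f (t *\<^sub>R cl_cis J \<phi>)) / t)"
      by (intro continuous_intros cf) auto
    have g: "(\<lambda>t. C * (\<Sum>A\<in>UNIV. norm (h A (of_real t * cis \<phi>)) / t)) integrable_on {0<..}"
      using h(1) dB by (intro integrable_on_mult_right integrable_sum) (auto simp: sector_null_def)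
    have "(\<lambda>t. norm (f (t *\<^sub>R cl_cis J \<phi>)) / t) integrable_on {0<..}"
    proof (rule continuous_dominated_on_ray[OF c g])
      fix t :: real assume t: "t > 0"
      have "norm (f (t *\<^sub>R cl_cis J \<phi>)) \<le> C * (\<Sum>A\<in>UNIV. norm (h A (of_real t * cis \<phi>)))"
        using C(2)[OF J polar[OF t \<phi>]] unfolding slice_pt_polar .
      then have "norm (f (t *\<^sub>R cl_cis J \<phi>)) / t \<le> C * (\<Sum>A\<in>UNIV. norm (h A (of_real t * cis \<phi>))) / t"
        using t by (intro divide_right_mono) auto
      then show "norm (norm (f (t *\<^sub>R cl_cis J \<phi>)) / t) \<le> C * (\<Sum>A\<in>UNIV. norm (h A (of_real t * cis \<phi>)) / t)"
        using t by (simp add: sum_divide_distrib[symmetric])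
    qed
    then show ?thesis by (intro set_integrable_ray c) auto
  qed
  show ?thesis unfolding SHL0_def using SHL bd int by blast
qed

lemma N0_I:
  fixes f :: "'n::{finite,linorder} clifford \<Rightarrow> 'n clifford"
  assumes f: "sector_repr \<theta> f (scalar_components h)" and h: "h \<in> sector_null \<theta>" "sector_symmetric \<theta> h"
    and z: "(\<lambda>_. 0) \<in> sector_null \<theta>" and \<theta>: "0 < \<theta>" "\<theta> < pi / 2"
    and dom: "openin (top_of_set paravectors) (D_sector \<theta> :: 'n clifford set)" "axially_symmetric (D_sector \<theta> :: 'n clifford set)"
  shows "f \<in> N0 \<theta>"
proof -
  have s: "scalar_components h A \<in> sector_null \<theta>" "sector_symmetric \<theta> (scalar_components h A)" for A :: "'n set"
    using h z by (auto simp: scalar_components_def sector_symmetric_def)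
  then have hol: "scalar_components h A holomorphic_on bisector \<theta>" for A :: "'n set" by (simp add: sector_null_def)
  have "f \<in> intrinsic (D_sector \<theta>)"
    using dom slice_componentsI[OF f hol s(2) \<theta>] unfolding intrinsic_def scalar_components_vec by blast
  then show ?thesis unfolding N0_def using SHL0_I[OF f s \<theta> dom] by blast
qed

section \<open>The calculus of Clifford-valued functions\<close>

lemma sector_repr_cong:
  assumes "sector_repr \<theta> f k" "\<And>A z. z \<in> bisector \<theta> \<Longrightarrow> k A z = k' A z" shows "sector_repr \<theta> f k'"
  using assms unfolding sector_repr_def by simp

lemma sector_repr_remainder:
  assumes f: "sector_repr \<theta> f (\<lambda>A z. of_real (finf $ A) + of_real (d $ A) * fB z + h A z)"
  shows "sector_repr \<theta> (\<lambda>s. f s - (finf + cl_inv (cl_real 1 + s \<cdot> s) \<cdot> d)) h"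
  unfolding sector_repr_def
proof (intro ballI)
  fix J :: "'a clifford" and z assume J: "J \<in> imag_units" and z: "z \<in> bisector \<theta>"
  have v: "(\<chi> A. Re (of_real (finf $ A) + of_real (d $ A) * fB z + h A z)) = finf + Re (fB z) *\<^sub>R d + (\<chi> A. Re (h A z))"
    "(\<chi> A. Im (of_real (finf $ A) + of_real (d $ A) * fB z + h A z)) = Im (fB z) *\<^sub>R d + (\<chi> A. Im (h A z))"
    by (simp_all add: vec_eq_iff mult.commute)
  have "f (slice_pt J (Re z) (Im z)) = finf + Re (fB z) *\<^sub>R d + (\<chi> A. Re (h A z)) + J \<cdot> (Im (fB z) *\<^sub>R d + (\<chi> A. Im (h A z)))"
    using f J z unfolding sector_repr_def v[symmetric] by blast
  then show "f (slice_pt J (Re z) (Im z)) - (finf + cl_inv (cl_real 1 + slice_pt J (Re z) (Im z) \<cdot> slice_pt J (Re z) (Im z)) \<cdot> d)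
      = (\<chi> A. Re (h A z)) + J \<cdot> (\<chi> A. Im (h A z))"
    unfolding cl_inv_fB[OF J] by (simp add: slice_pt_lmul lmul_add_right lmul_scaleR_right)
qed

lemma SHL_repr:
  fixes f :: "'n::{finite,linorder} clifford \<Rightarrow> 'n clifford"
  assumes "f \<in> SHL (D_sector \<theta>)" "0 < \<theta>" "\<theta> < pi / 2"
  obtains h where "sector_repr \<theta> f h" "\<And>A. sector_symmetric \<theta> (h A)" "\<And>A. h A holomorphic_on bisector \<theta>"
proof -
  from assms(1) obtain f0 f1 where "slice_components (D_sector \<theta>) f f0 f1" unfolding SHL_def by blast
  from slice_components_holomorphic[OF this assms(2,3)] show ?thesis using that by blast
qed

primrec blinfun_pow :: "('a::real_normed_vector \<Rightarrow>\<^sub>L 'a) \<Rightarrow> nat \<Rightarrow> 'a \<Rightarrow>\<^sub>L 'a" where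
  "blinfun_pow X 0 = id_blinfun"
| "blinfun_pow X (Suc n) = X o\<^sub>L blinfun_pow X n"

lemma blinfun_pow_apply: "blinfun_apply (blinfun_pow X n) v = (blinfun_apply X ^^ n) v"
  by (induction n) simp_all

lemma op_pow_dom: "op_pow T n w \<noteq> None \<Longrightarrow> k \<le> n \<Longrightarrow> op_pow T k w \<noteq> None"
proof (induction n)
  case (Suc n)
  then have "op_pow T n w \<noteq> None" by (auto simp: map_comp_def split: option.splits)
  with Suc show ?case by (cases "k = Suc n") auto
qed auto

text \<open>\<open>J\<close> and \<open>\<phi>\<close> are the very values that the choice operators
  in \<open>omega_calc\<close> select, so the angle and the imaginary unit never have to be changed.
  The topological facts about the sector are part of the membership of \<open>f\<close> in
  \<open>SHL\<close> and are supplied from there.\<close>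

locale calculus = bisectorial_operator T J \<omega> \<theta>
  for T :: "('v::banach, 'n::{finite,linorder}) clmodule \<rightharpoonup> ('v, 'n) clmodule" and J \<omega> \<theta> +
  fixes \<phi> :: real
  assumes J_some: "J = (SOME J. J \<in> imag_units)" and \<phi>_some: "\<phi> = (SOME \<phi>. \<omega> < \<phi> \<and> \<phi> < \<theta>)"
    and D_sector: "openin (top_of_set paravectors) (D_sector \<theta> :: 'n clifford set)" "axially_symmetric (D_sector \<theta> :: 'n clifford set)"
begin

lemma \<phi>: "\<omega> < \<phi>" "\<phi> < \<theta>"
proof -
  have "\<exists>\<phi>. \<omega> < \<phi> \<and> \<phi> < \<theta>" using dense[OF angles(2)] .
  from someI_ex[OF this] show "\<omega> < \<phi>" "\<phi> < \<theta>" unfolding \<phi>_some by auto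
qed

lemma omega_calc_eq:
  assumes "sector_repr \<theta> f h" "\<And>A. h A \<in> sector_null \<theta>" "\<And>A. sector_symmetric \<theta> (h A)"
  shows "omega_calc \<omega> \<theta> T f = (\<Sum>A\<in>UNIV. Phi \<phi> (h A) o\<^sub>L cl_op (axis A 1))"
  unfolding omega_calc_def J_some[symmetric] \<phi>_some[symmetric] by (rule omega_integral_eq[OF \<phi> assms])

section \<open>Clifford-valued functions and their operators\<close>

lemma i_\<Delta>: "\<i> \<in> \<Delta>" by (simp add: \<Delta>_def)

lemma Bop_apply: "blinfun_apply Bop v = Qi \<i> v"
  unfolding Qi_R[OF i_\<Delta>] Bop_def cmul_def by (simp add: blinfun.scaleR_left)

lemma Aop_apply: "blinfun_apply Aop v = TQi \<i> v"
  unfolding TQi_R[OF i_\<Delta>] Aop_def cmul_def by (simp add: blinfun.scaleR_left blinfun.minus_left)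

lemma Bop_T: "T u = Some u' \<Longrightarrow> blinfun_apply Bop u' = blinfun_apply Aop u"
  unfolding Bop_apply Aop_apply by (rule Qi_T(1)[OF i_\<Delta>])

lemma inj_Bop: "inj (blinfun_apply Bop)"
proof (rule injI)
  fix u v assume "blinfun_apply Bop u = blinfun_apply Bop v"
  then have "Qi \<i> u = Qi \<i> v" by (simp add: Bop_apply)
  then have "Some u = Some v" using Q_op_iff[OF i_\<Delta>, of "Qi \<i> u"] by metis
  then show "u = v" by simp
qed

text \<open>1 + T^2 is the second order operator at \<open>pt \<i>\<close>, whose scalar part is 0
  and whose norm is 1.\<close>

lemma one_plus_square_inverse: "to_blinfun (op_inv (one_plus_square T)) = Bop"
proof -
  have "one_plus_square T v = Q_op (pt \<i>) T v" for v
  proof (cases "op_pow T 2 v")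
    case None
    then have "v \<notin> dom (op_pow T 2)" by auto
    then show ?thesis using None by (simp add: one_plus_square_def Q_op_def)
  next
    case (Some a)
    then have "v \<in> dom (op_pow T 2)" by auto
    then show ?thesis using Some by (simp add: one_plus_square_def Q_op_def scal_pt norm_pt add.commute)
  qed
  then have e: "one_plus_square T = Q_op (pt \<i>) T" by (rule ext)
  have "(\<lambda>v. the (op_inv (one_plus_square T) v)) = blinfun_apply Bop"
    unfolding e op_inv_Q[OF i_\<Delta>] by (rule ext) (simp add: Bop_apply)
  then show ?thesis unfolding to_blinfun_def by (simp add: blinfun_apply_inverse)
qed

definition bnd_op :: "('n set \<Rightarrow> ('v, 'n) clmodule \<Rightarrow>\<^sub>L ('v, 'n) clmodule) \<Rightarrow> ('v, 'n) clmodule \<Rightarrow>\<^sub>L ('v, 'n) clmodule" where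
  "bnd_op X = (\<Sum>A\<in>UNIV. X A o\<^sub>L cl_op (axis A 1))"

lemma bnd_op_apply: "blinfun_apply (bnd_op X) v = (\<Sum>A\<in>UNIV. blinfun_apply (X A) (axis A 1 \<cdot> v))"
  by (simp add: bnd_op_def blinfun.sum_left cl_op_apply)

lemma cl_op_expansion: "cl_op a = (\<Sum>A\<in>UNIV. a $ A *\<^sub>R (cl_op (axis A 1) :: ('v, 'n) clmodule \<Rightarrow>\<^sub>L ('v, 'n) clmodule))"
proof -
  have "cl_op a = (cl_op (\<Sum>A\<in>UNIV. a $ A *\<^sub>R axis A 1) :: ('v, 'n) clmodule \<Rightarrow>\<^sub>L ('v, 'n) clmodule)"
    by (simp flip: axis_expansion_real)
  then show ?thesis by (simp add: cl_op_sum cl_op_scaleR)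
qed

lemma bnd_repr_value:
  assumes "sector_repr \<theta> ft h" "\<And>A. h A \<in> sector_null \<theta>" "\<And>A. sector_symmetric \<theta> (h A)"
  shows "cl_op finf + (to_blinfun (op_inv (one_plus_square T)) o\<^sub>L cl_op d) + omega_calc \<omega> \<theta> T ft
    = bnd_op (\<lambda>A. finf $ A *\<^sub>R id_blinfun + d $ A *\<^sub>R Bop + Phi \<phi> (h A))"
proof -
  have "cl_op finf = (\<Sum>A\<in>UNIV. (finf $ A *\<^sub>R id_blinfun) o\<^sub>L (cl_op (axis A 1) :: ('v, 'n) clmodule \<Rightarrow>\<^sub>L ('v, 'n) clmodule))"
    unfolding cl_op_expansion[of finf] by (intro sum.cong refl blinfun_eqI) (simp add: blinfun.scaleR_left)
  moreover have "(Bop o\<^sub>L cl_op d) = (\<Sum>A\<in>UNIV. (d $ A *\<^sub>R Bop) o\<^sub>L cl_op (axis A 1))"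
    unfolding cl_op_expansion[of d] bounded_bilinear.sum_right[OF bounded_bilinear_blinfun_compose]
    by (intro sum.cong refl blinfun_eqI) (simp add: blinfun.scaleR_left blinfun.scaleR_right)
  ultimately show ?thesis
    unfolding one_plus_square_inverse omega_calc_eq[OF assms] bnd_op_def
    by (simp add: sum.distrib bounded_bilinear.add_left[OF bounded_bilinear_blinfun_compose])
qed

lemma bnd_repr_calc:
  assumes "bnd_repr \<theta> f f0 finf ft"
  obtains k X where "sector_repr \<theta> f k" "\<And>A. calc \<phi> (k A) (X A)"
    "cl_op finf + (to_blinfun (op_inv (one_plus_square T)) o\<^sub>L cl_op (f0 - finf)) + omega_calc \<omega> \<theta> T ft = bnd_op X"
proof -
  have ft: "ft \<in> SHL0 \<theta>" and f: "\<And>s. s \<in> D_sector \<theta> \<Longrightarrow> f s = finf + cl_inv (cl_real 1 + s \<cdot> s) \<cdot> (f0 - finf) + ft s"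
    using assms unfolding bnd_repr_def by blast+
  obtain h where h: "sector_repr \<theta> ft h" "\<And>A. sector_symmetric \<theta> (h A)" "\<And>A. h A holomorphic_on bisector \<theta>"
    using SHL_repr[of ft \<theta>] ft \<theta>_bounds unfolding SHL0_def by blast
  have n: "h A \<in> sector_null \<theta>" for A by (rule SHL0_repr[OF ft h(1,3) \<theta>_bounds])
  show ?thesis
    by (rule that[OF sector_repr_bnd[OF f h(1) \<theta>_bounds] _ bnd_repr_value[OF h(1) n h(2)]])
       (assumption, rule calcI[OF \<phi> n h(2)])
qed

lemma SHLbnd_calc:
  fixes f :: "'n clifford \<Rightarrow> 'n clifford"
  assumes "f \<in> SHLbnd \<theta>"
  obtains k X where "sector_repr \<theta> f k" "\<And>A. calc \<phi> (k A) (X A)" "bnd_calc \<omega> \<theta> T f = bnd_op X"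
proof -
  have ex: "\<exists>r. (case r of (f0, finf, ft) \<Rightarrow> bnd_repr \<theta> f f0 finf ft)" using assms unfolding SHLbnd_def by auto
  obtain f0 finf ft where r: "(SOME (f0, finf, ft). bnd_repr \<theta> f f0 finf ft) = (f0, finf, ft)" by (metis prod_cases3)
  have b: "bnd_repr \<theta> f f0 finf ft" using someI_ex[OF ex] unfolding r by simp
  show ?thesis
  proof (rule bnd_repr_calc[OF b])
    fix k X assume "sector_repr \<theta> f k" "\<And>A. calc \<phi> (k A) (X A)"
      "cl_op finf + (to_blinfun (op_inv (one_plus_square T)) o\<^sub>L cl_op (f0 - finf)) + omega_calc \<omega> \<theta> T ft = bnd_op X"
    then show ?thesis by (intro that[of k X]) (simp_all add: bnd_calc_def r)
  qed
qed

text \<open>Independence of the chosen representation: the coordinates of \<open>f\<close> are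
  determined by its values, and \<open>calc\<close> assigns at most one operator to each of
  them.\<close>

lemma bnd_calc_eq:
  assumes "f \<in> SHLbnd \<theta>" "sector_repr \<theta> f k" "\<And>A. calc \<phi> (k A) (X A)" shows "bnd_calc \<omega> \<theta> T f = bnd_op X"
proof -
  obtain k' X' where k': "sector_repr \<theta> f k'" "\<And>A. calc \<phi> (k' A) (X' A)" "bnd_calc \<omega> \<theta> T f = bnd_op X'"
    using SHLbnd_calc[OF assms(1)] by blast
  have "X' A = X A" for A
    by (rule calc_unique[OF \<phi> k'(2) assms(3)]) (rule sector_repr_unique[OF k'(1) assms(2)])
  then have "X' = X" by (rule ext)
  with k'(3) show ?thesis by simp
qed

lemma SHLbndI:
  fixes f :: "'n clifford \<Rightarrow> 'n clifford"
  assumes f: "sector_repr \<theta> f k" and k: "\<And>A. calc \<phi> (k A) (X A)" shows "f \<in> SHLbnd \<theta>"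
proof -
  have "\<forall>A. \<exists>c d h. h \<in> sector_null \<theta> \<and> sector_symmetric \<theta> h \<and> (\<forall>w\<in>bisector \<theta>. k A w = of_real c + of_real d * fB w + h w)"
    using k unfolding calc_def by meson
  then obtain c d :: "'n set \<Rightarrow> real" and h where h: "\<And>A. h A \<in> sector_null \<theta>" "\<And>A. sector_symmetric \<theta> (h A)"
    "\<And>A w. w \<in> bisector \<theta> \<Longrightarrow> k A w = of_real (c A) + of_real (d A) * fB w + h A w" by metis
  \<comment> \<open>\<open>D\<close> stands for the difference of the values at the origin and at
    infinity, so the former is \<open>finf + D\<close>. The null part is defined as the remainder of
    \<open>f\<close>, and only its coordinates are identified with \<open>h\<close>.\<close>
  define finf D where "finf = (\<chi> A. c A)" "D = (\<chi> A. d A)"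
  define ft where "ft s = f s - (finf + cl_inv (cl_real 1 + s \<cdot> s) \<cdot> D)" for s
  have "sector_repr \<theta> f (\<lambda>A z. of_real (finf $ A) + of_real (D $ A) * fB z + h A z)"
    by (rule sector_repr_cong[OF f]) (simp add: h(3) finf_D_def)
  from sector_repr_remainder[OF this] have "sector_repr \<theta> ft h" unfolding ft_def[abs_def] .
  from SHL0_I[OF this h(1,2) \<theta>_bounds D_sector] have "bnd_repr \<theta> f (finf + D) finf ft" by (simp add: bnd_repr_def ft_def)
  then show ?thesis unfolding SHLbnd_def by blast
qed

lemma bnd_op_scalar: "bnd_op (\<lambda>A. if A = {} then X else 0) = X"
  by (rule blinfun_eqI)
     (simp add: bnd_op_apply if_distrib[of blinfun_apply] if_distribR cl_real_lmul[unfolded cl_real_def] cong: if_cong)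

lemma calc_scalar_components:
  assumes "calc \<phi> k X" shows "calc \<phi> (scalar_components k A) (if A = {} then X else 0)"
  using assms calc_const[OF \<phi>, of 0] by (simp add: scalar_components_def)

lemma Nbnd_SHLbnd: "e \<in> Nbnd \<theta> \<Longrightarrow> e \<in> SHLbnd \<theta>" unfolding Nbnd_def SHLbnd_def by blast

lemma Nbnd_calc:
  fixes e :: "'n clifford \<Rightarrow> 'n clifford"
  assumes "e \<in> Nbnd \<theta>"
  obtains k X where "sector_repr \<theta> e (scalar_components k)" "calc \<phi> k X" "bnd_calc \<omega> \<theta> T e = X"
proof -
  from assms obtain a b ft where e: "bnd_repr \<theta> e (cl_real a) (cl_real b) ft" and ft: "ft \<in> N0 \<theta>"
    unfolding Nbnd_def by blast
  then obtain g0 g1 where sc: "slice_components (D_sector \<theta>) ft g0 g1"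
    and re: "\<And>p. p \<in> slice_dom (D_sector \<theta> :: 'n clifford set) \<Longrightarrow> g0 p \<in> range cl_real \<and> g1 p \<in> range cl_real"
    unfolding N0_def intrinsic_def by blast
  have ft0: "ft \<in> SHL0 \<theta>" using ft by (simp add: N0_def)
  define h where "h A z = Complex (g0 (Re z, Im z) $ A) (g1 (Re z, Im z) $ A)" for A z
  note h = slice_components_holomorphic[OF sc \<theta>_bounds, folded h_def]
  have n: "h A \<in> sector_null \<theta>" for A by (rule SHL0_repr[OF ft0 h(1,3) \<theta>_bounds])
  define k where "k z = of_real b + of_real (a - b) * fB z + h {} z" for z
  have h0: "h A z = 0" if "A \<noteq> {}" "z \<in> bisector \<theta>" for A z
  proof -
    have "(Re z, Im z) \<in> slice_dom (D_sector \<theta> :: 'n clifford set)" using that by (simp add: slice_dom_D_sector[OF \<theta>_bounds])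
    from re[OF this] show ?thesis using that by (auto simp: h_def cl_real_def axis_def complex_eq_iff)
  qed
  have "\<And>s. s \<in> D_sector \<theta> \<Longrightarrow> e s = cl_real b + cl_inv (cl_real 1 + s \<cdot> s) \<cdot> (cl_real a - cl_real b) + ft s"
    using e unfolding bnd_repr_def by blast
  from sector_repr_bnd[OF this h(1) \<theta>_bounds]
  have r: "sector_repr \<theta> e (scalar_components k)"
    by (rule sector_repr_cong) (auto simp: scalar_components_def k_def h0 cl_real_def axis_def)
  have c: "calc \<phi> k (b *\<^sub>R id_blinfun + (a - b) *\<^sub>R Bop + Phi \<phi> (h {}))"
    unfolding k_def[abs_def] by (rule calcI[OF \<phi> n h(2)])
  show ?thesis
    by (rule that[OF r c]) (simp add: bnd_calc_eq[OF Nbnd_SHLbnd[OF assms] r calc_scalar_components[OF c]] bnd_op_scalar)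
qed

lemma NbndI:
  fixes e :: "'n clifford \<Rightarrow> 'n clifford"
  assumes e: "sector_repr \<theta> e (scalar_components k)" and k: "calc \<phi> k X"
  shows "e \<in> Nbnd \<theta>" "bnd_calc \<omega> \<theta> T e = X"
proof -
  obtain c d h where h: "h \<in> sector_null \<theta>" "sector_symmetric \<theta> h"
    "\<And>w. w \<in> bisector \<theta> \<Longrightarrow> k w = of_real c + of_real d * fB w + h w" using k unfolding calc_def by blast
  define ft where "ft s = e s - (cl_real c + cl_inv (cl_real 1 + s \<cdot> s) \<cdot> cl_real d)" for s
  have "sector_repr \<theta> e (\<lambda>A z. of_real (cl_real c $ A) + of_real (cl_real d $ A) * fB z + scalar_components h A z)"
    by (rule sector_repr_cong[OF e]) (auto simp: h(3) scalar_components_def cl_real_def axis_def)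
  from sector_repr_remainder[OF this] have r: "sector_repr \<theta> ft (scalar_components h)" unfolding ft_def[abs_def] .
  have N0: "ft \<in> N0 \<theta>" by (rule N0_I[OF r h(1,2) null_zero(1)[OF \<phi>] \<theta>_bounds D_sector])
  have d: "cl_real (c + d) - cl_real c = cl_real d" by (simp add: cl_real_def axis_def vec_eq_iff)
  have "bnd_repr \<theta> e (cl_real (c + d)) (cl_real c) ft"
    using N0 unfolding bnd_repr_def d by (simp add: ft_def N0_def)
  then show 1: "e \<in> Nbnd \<theta>" unfolding Nbnd_def using N0 by blast
  show "bnd_calc \<omega> \<theta> T e = X"
    by (simp add: bnd_calc_eq[OF Nbnd_SHLbnd[OF 1] e calc_scalar_components[OF k]] bnd_op_scalar)
qed

end

context calculus
begin

section \<open>Polynomials and the inclusion of operators\<close>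

lemma calc_power: "calc \<phi> k X \<Longrightarrow> calc \<phi> (\<lambda>z. k z ^ n) (blinfun_pow X n)"
proof (induction n)
  case 0
  show ?case using calc_const[OF \<phi>, of 1] by simp
next
  case (Suc n)
  from calc_mult[OF \<phi> Suc(2) Suc(1)[OF Suc(2)]] show ?case by simp
qed

lemma calc_scale: "calc \<phi> k X \<Longrightarrow> calc \<phi> (\<lambda>z. of_real c * k z) (c *\<^sub>R X)"
proof -
  assume "calc \<phi> k X"
  from calc_mult[OF \<phi> calc_const[OF \<phi>, of c] this]
  have "calc \<phi> (\<lambda>z. of_real c * k z) ((c *\<^sub>R id_blinfun) o\<^sub>L X)" .
  also have "((c *\<^sub>R id_blinfun) o\<^sub>L X) = c *\<^sub>R X" by (rule blinfun_eqI) (simp add: blinfun.scaleR_left)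
  finally show ?thesis .
qed

lemma calc_sum:
  assumes "finite I" "\<And>i. i \<in> I \<Longrightarrow> calc \<phi> (k i) (X i)"
  shows "calc \<phi> (\<lambda>z. \<Sum>i\<in>I. k i z) (\<Sum>i\<in>I. X i)"
  using assms
proof (induction rule: finite_induct)
  case empty
  show ?case using calc_const[OF \<phi>, of 0] by simp
next
  case (insert i I)
  then show ?case using calc_add[OF \<phi>, of "k i" "X i"] by simp
qed

definition reg_poly :: "real poly \<Rightarrow> ('v, 'n) clmodule \<Rightarrow>\<^sub>L ('v, 'n) clmodule" where
  "reg_poly p = (\<Sum>k\<le>degree p. coeff p k *\<^sub>R (blinfun_pow Bop (degree p - k) o\<^sub>L blinfun_pow Aop k))"

lemma calc_reg_poly:
  "calc \<phi> (\<lambda>z. fB z ^ degree p * (\<Sum>k\<le>degree p. of_real (coeff p k) * z ^ k)) (reg_poly p)"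
proof (rule calc_cong[OF \<phi>])
  show "calc \<phi> (\<lambda>z. \<Sum>k\<le>degree p. of_real (coeff p k) * (fB z ^ (degree p - k) * fA z ^ k)) (reg_poly p)"
    unfolding reg_poly_def
    by (intro calc_sum finite_atMost calc_scale calc_mult[OF \<phi>] calc_power calc_fB[OF \<phi>] calc_fA[OF \<phi>])
  fix z
  have "fA z = fB z * z" by (simp add: fA_def fB_def)
  then have "of_real (coeff p k) * (fB z ^ (degree p - k) * fA z ^ k) = fB z ^ degree p * (of_real (coeff p k) * z ^ k)"
    if "k \<le> degree p" for k
    using power_add[of "fB z" "degree p - k" k] that by (simp add: power_mult_distrib mult_ac)
  then show "(\<Sum>k\<le>degree p. of_real (coeff p k) * (fB z ^ (degree p - k) * fA z ^ k))
      = fB z ^ degree p * (\<Sum>k\<le>degree p. of_real (coeff p k) * z ^ k)"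
    unfolding sum_distrib_left by (intro sum.cong) auto
qed

lemma commute_apply:
  "calc \<phi> k X \<Longrightarrow> calc \<phi> l Y \<Longrightarrow> blinfun_apply X (blinfun_apply Y v) = blinfun_apply Y (blinfun_apply X v)"
  using calc_commute[OF \<phi>, of k X l Y] by (metis blinfun_apply_blinfun_compose)

text \<open>\<open>Aop\<close> extends \<open>Bop\<close> after \<open>T\<close>, so each
  application of \<open>T\<close> to w is traded for one \<open>Aop\<close>. \<open>Bop\<close> is
  moved past the remaining factors by commutativity of the calculus.\<close>

lemma Aop_pow: "op_pow T k w = Some x \<Longrightarrow> blinfun_apply (blinfun_pow Aop k) w = blinfun_apply (blinfun_pow Bop k) x"
proof (induction k arbitrary: x)
  case (Suc k)
  then obtain y where y: "op_pow T k w = Some y" "T y = Some x" by (auto simp: map_comp_Some_iff)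
  have "blinfun_apply (blinfun_pow Aop (Suc k)) w = blinfun_apply Aop (blinfun_apply (blinfun_pow Bop k) y)"
    using Suc.IH[OF y(1)] by simp
  also have "\<dots> = blinfun_apply (blinfun_pow Bop k) (blinfun_apply Bop x)"
    unfolding Bop_T[OF y(2)] by (rule commute_apply[OF calc_fA[OF \<phi>] calc_power[OF calc_fB[OF \<phi>]]])
  also have "\<dots> = blinfun_apply Bop (blinfun_apply (blinfun_pow Bop k) x)"
    by (rule commute_apply[OF calc_power[OF calc_fB[OF \<phi>]] calc_fB[OF \<phi>]])
  finally show ?case by simp
qed simp

lemma reg_poly_apply:
  assumes "op_poly p T w = Some y"
  shows "blinfun_apply (reg_poly p) w = blinfun_apply (blinfun_pow Bop (degree p)) y"
proof -
  from assms have w: "op_pow T (degree p) w \<noteq> None" and y: "y = (\<Sum>k\<le>degree p. coeff p k *\<^sub>R the (op_pow T k w))"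
    by (auto simp: op_poly_def dom_def split: if_splits)
  have "blinfun_apply (blinfun_pow Bop (degree p - k)) (blinfun_apply (blinfun_pow Aop k) w)
      = blinfun_apply (blinfun_pow Bop (degree p)) (the (op_pow T k w))" if k: "k \<le> degree p" for k
  proof -
    from op_pow_dom[OF w k] obtain x where x: "op_pow T k w = Some x" by auto
    have "(blinfun_apply Bop ^^ degree p) x = (blinfun_apply Bop ^^ (degree p - k)) ((blinfun_apply Bop ^^ k) x)"
      using funpow_add[of "degree p - k" k "blinfun_apply Bop"] k by simp
    then show ?thesis unfolding Aop_pow[OF x] x option.sel by (simp add: blinfun_pow_apply)
  qed
  then show ?thesis
    unfolding reg_poly_def y by (simp add: blinfun.sum_left blinfun.scaleR_left blinfun.sum_right blinfun.scaleR_right)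
qed

lemma inj_blinfun_pow_Bop: "inj (blinfun_apply (blinfun_pow Bop n))"
proof (induction n)
  case (Suc n)
  have "blinfun_apply (blinfun_pow Bop (Suc n)) = blinfun_apply Bop \<circ> blinfun_apply (blinfun_pow Bop n)" by (rule ext) simp
  then show ?case using inj_compose[OF inj_Bop Suc] by (simp only:)
qed (simp add: inj_on_def)

text \<open>Supplies a Clifford-valued function with the wanted coordinates, by repeated left
  multiplication with the inverse of 1 + s^2. Any function with these coordinates serves as the
  regularizer, hence the mere existence.\<close>

lemma sector_repr_fB_mult:
  fixes e :: "'n clifford \<Rightarrow> 'n clifford"
  assumes "sector_repr \<theta> e (scalar_components l)"
  obtains e' :: "'n clifford \<Rightarrow> 'n clifford" where "sector_repr \<theta> e' (scalar_components (\<lambda>z. fB z ^ n * l z))"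
proof -
  have "\<exists>e' :: 'n clifford \<Rightarrow> 'n clifford. sector_repr \<theta> e' (scalar_components (\<lambda>z. fB z ^ n * l z))"
  proof (induction n)
    case 0
    then show ?case using assms by auto
  next
    case (Suc n)
    then obtain e' :: "'n clifford \<Rightarrow> 'n clifford" where e': "sector_repr \<theta> e' (scalar_components (\<lambda>z. fB z ^ n * l z))" by blast
    have "sector_repr \<theta> (\<lambda>s :: 'n clifford. cl_inv (cl_real 1 + s \<cdot> s)) (scalar_components fB)"
      unfolding sector_repr_scalar using cl_inv_fB by blast
    from sector_repr_mult[OF this e']
    have "sector_repr \<theta> (\<lambda>s. cl_inv (cl_real 1 + s \<cdot> s) \<cdot> e' s) (scalar_components (\<lambda>z. fB z ^ Suc n * l z))"
      by (rule sector_repr_cong) (simp add: scalar_components_def mult.assoc)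
    then show ?case by blast
  qed
  then show ?thesis using that by blast
qed

text \<open>Turns the partial inverse into an equation between bounded operators. The regularizer
  \<open>e\<close> is the one fixed by the choice operator, so nothing more can be used about it
  than that it is a regularizer.\<close>

lemma Hinf_calc_Some:
  assumes "f \<in> SHLreg \<omega> \<theta> T \<or> (\<exists>e. regularizer \<omega> \<theta> T f e)"
  obtains e where "regularizer \<omega> \<theta> T f e"
    "\<And>v w. Hinf_calc \<omega> \<theta> T f v = Some w \<longleftrightarrow>
      blinfun_apply (bnd_calc \<omega> \<theta> T e) w = blinfun_apply (bnd_calc \<omega> \<theta> T (\<lambda>s. e s \<cdot> f s)) v"
proof -
  define e where "e = (SOME e. regularizer \<omega> \<theta> T f e)"
  have "\<exists>e. regularizer \<omega> \<theta> T f e" using assms by (auto simp: SHLreg_def)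
  then have e: "regularizer \<omega> \<theta> T f e" unfolding e_def by (rule someI_ex)
  have inj: "inj_on (of_blinfun (bnd_calc \<omega> \<theta> T e)) (dom (of_blinfun (bnd_calc \<omega> \<theta> T e)))"
    using e unfolding regularizer_def by (auto simp: of_blinfun_def dom_def inj_on_def)
  have "Hinf_calc \<omega> \<theta> T f v = op_inv (of_blinfun (bnd_calc \<omega> \<theta> T e)) (blinfun_apply (bnd_calc \<omega> \<theta> T (\<lambda>s. e s \<cdot> f s)) v)" for v
    unfolding Hinf_calc_def e_def[symmetric] Let_def map_comp_def by (simp add: of_blinfun_def)
  then have "Hinf_calc \<omega> \<theta> T f v = Some w \<longleftrightarrow>
      blinfun_apply (bnd_calc \<omega> \<theta> T e) w = blinfun_apply (bnd_calc \<omega> \<theta> T (\<lambda>s. e s \<cdot> f s)) v" for v w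
    using op_inv_Some[OF inj] by (simp add: of_blinfun_def)
  with e show ?thesis by (rule that)
qed

text \<open>The regularizers \<open>e1\<close> of \<open>f\<close> and \<open>e2\<close> of
  \<open>pf\<close> are chosen independently. The function \<open>e'\<close> built from
  \<open>e1\<close> shows that \<open>pf\<close> has a regularizer at all; it need not be the
  selected one. The two are linked by \<open>key\<close>: both sides belong to the function fB^m l1
  l2 P g_A, and \<open>calc_unique\<close> equates them.\<close>

theorem poly_Hinf_calc:
  assumes f: "f \<in> SHLreg \<omega> \<theta> T"
  shows "op_poly p T \<circ>\<^sub>m Hinf_calc \<omega> \<theta> T f \<subseteq>\<^sub>m Hinf_calc \<omega> \<theta> T (\<lambda>s. cl_poly p s \<cdot> f s)"
proof -
  let ?m = "degree p"
  define P where "P z = (\<Sum>k\<le>?m. of_real (coeff p k) * z ^ k)" for z :: complex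
  define pf where "pf = (\<lambda>s. cl_poly p s \<cdot> f s)"
  define Bm where "Bm = blinfun_pow Bop ?m"
  note Bm = calc_power[OF calc_fB[OF \<phi>], of ?m, folded Bm_def]
  note W = calc_reg_poly[of p, folded P_def]
  have "f \<in> SHL (D_sector \<theta>)" using f by (simp add: SHLreg_def)
  then obtain g where g: "sector_repr \<theta> f g" using SHL_repr[OF _ \<theta>_bounds] by metis
  have pg: "sector_repr \<theta> pf (\<lambda>A z. P z * g A z)"
    unfolding pf_def P_def by (rule sector_repr_mult[OF sector_repr_cl_poly g])
  obtain e1 where e1: "regularizer \<omega> \<theta> T f e1" and H1: "\<And>v w. Hinf_calc \<omega> \<theta> T f v = Some w \<longleftrightarrow>
      blinfun_apply (bnd_calc \<omega> \<theta> T e1) w = blinfun_apply (bnd_calc \<omega> \<theta> T (\<lambda>s. e1 s \<cdot> f s)) v"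
    using Hinf_calc_Some f by blast
  obtain l1 E1 where l1: "sector_repr \<theta> e1 (scalar_components l1)" "calc \<phi> l1 E1" "bnd_calc \<omega> \<theta> T e1 = E1"
    using Nbnd_calc e1 unfolding regularizer_def by blast
  obtain k1 K where k1: "sector_repr \<theta> (\<lambda>s. e1 s \<cdot> f s) k1" "\<And>A. calc \<phi> (k1 A) (K A)" "bnd_calc \<omega> \<theta> T (\<lambda>s. e1 s \<cdot> f s) = bnd_op K"
    using SHLbnd_calc e1 unfolding regularizer_def by blast
  have k1_eq: "k1 A z = l1 z * g A z" if "z \<in> bisector \<theta>" for A z
    by (rule sector_repr_unique[OF k1(1) sector_repr_mult[OF l1(1) g] that])
  have injE1: "inj (blinfun_apply (Bm o\<^sub>L E1))"
  proof -
    have "inj (blinfun_apply E1)" using e1 l1(3) by (simp add: regularizer_def)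
    from inj_compose[OF inj_blinfun_pow_Bop this, of ?m] show ?thesis by (simp add: Bm_def o_def inj_def)
  qed
  obtain e' :: "'n clifford \<Rightarrow> 'n clifford" where e': "sector_repr \<theta> e' (scalar_components (\<lambda>z. fB z ^ ?m * l1 z))"
    using sector_repr_fB_mult[OF l1(1)] by blast
  note ce' = calc_mult[OF \<phi> Bm l1(2)]
  have "regularizer \<omega> \<theta> T pf e'"
    unfolding regularizer_def
  proof (intro conjI)
    show "e' \<in> Nbnd \<theta>" by (rule NbndI(1)[OF e' ce'])
    show "inj (blinfun_apply (bnd_calc \<omega> \<theta> T e'))" unfolding NbndI(2)[OF e' ce'] by (rule injE1)
    show "(\<lambda>s. e' s \<cdot> pf s) \<in> SHLbnd \<theta>"
    proof (rule SHLbndI)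
      show "sector_repr \<theta> (\<lambda>s. e' s \<cdot> pf s) (\<lambda>A z. (fB z ^ ?m * P z) * k1 A z)"
        by (rule sector_repr_cong[OF sector_repr_mult[OF e' pg]]) (simp add: k1_eq mult_ac)
      show "calc \<phi> (\<lambda>z. (fB z ^ ?m * P z) * k1 A z) (reg_poly p o\<^sub>L K A)" for A
        by (rule calc_mult[OF \<phi> W k1(2)])
    qed
  qed
  then obtain e2 where e2: "regularizer \<omega> \<theta> T pf e2" and H2: "\<And>v w. Hinf_calc \<omega> \<theta> T pf v = Some w \<longleftrightarrow>
      blinfun_apply (bnd_calc \<omega> \<theta> T e2) w = blinfun_apply (bnd_calc \<omega> \<theta> T (\<lambda>s. e2 s \<cdot> pf s)) v"
    using Hinf_calc_Some by blast
  obtain l2 E2 where l2: "sector_repr \<theta> e2 (scalar_components l2)" "calc \<phi> l2 E2" "bnd_calc \<omega> \<theta> T e2 = E2"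
    using Nbnd_calc e2 unfolding regularizer_def by blast
  obtain k2 L where k2: "sector_repr \<theta> (\<lambda>s. e2 s \<cdot> pf s) k2" "\<And>A. calc \<phi> (k2 A) (L A)" "bnd_calc \<omega> \<theta> T (\<lambda>s. e2 s \<cdot> pf s) = bnd_op L"
    using SHLbnd_calc e2 unfolding regularizer_def by blast
  have k2_eq: "k2 A z = l2 z * (P z * g A z)" if "z \<in> bisector \<theta>" for A z
    by (rule sector_repr_unique[OF k2(1) sector_repr_mult[OF l2(1) pg] that])
  have key: "((Bm o\<^sub>L E1) o\<^sub>L L A) = (E2 o\<^sub>L (reg_poly p o\<^sub>L K A))" for A
    by (rule calc_unique[OF \<phi> calc_mult[OF \<phi> ce' k2(2)] calc_mult[OF \<phi> l2(2) calc_mult[OF \<phi> W k1(2)]]])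
       (simp add: k1_eq k2_eq mult_ac)
  have "Hinf_calc \<omega> \<theta> T pf v = Some y" if y: "(op_poly p T \<circ>\<^sub>m Hinf_calc \<omega> \<theta> T f) v = Some y" for v y
  proof -
    from y obtain w where w: "Hinf_calc \<omega> \<theta> T f v = Some w" "op_poly p T w = Some y" by (auto simp: map_comp_Some_iff)
    have Ew: "blinfun_apply E1 w = blinfun_apply (bnd_op K) v" using w(1) unfolding H1 l1(3) k1(3) .
    \<comment> \<open>By \<open>H2\<close> it suffices to compare \<open>E2 y\<close> with
      \<open>bnd_op L\<close> at \<open>v\<close>. This is done after applying the injective
      operator \<open>Bm o\<^sub>L E1\<close>, which makes both \<open>reg_poly_apply\<close> and
      \<open>key\<close> applicable.\<close>
    have "blinfun_apply (Bm o\<^sub>L E1) (blinfun_apply E2 y) = blinfun_apply E2 (blinfun_apply (Bm o\<^sub>L E1) y)"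
      by (rule commute_apply[OF ce' l2(2)])
    also have "blinfun_apply (Bm o\<^sub>L E1) y = blinfun_apply E1 (blinfun_apply Bm y)"
      using commute_apply[OF Bm l1(2)] by simp
    also have "blinfun_apply Bm y = blinfun_apply (reg_poly p) w" unfolding Bm_def by (rule reg_poly_apply[OF w(2), symmetric])
    also have "blinfun_apply E1 (blinfun_apply (reg_poly p) w) = blinfun_apply (reg_poly p) (blinfun_apply E1 w)"
      by (rule commute_apply[OF l1(2) W])
    also have "blinfun_apply E2 (blinfun_apply (reg_poly p) (blinfun_apply E1 w))
        = (\<Sum>A\<in>UNIV. blinfun_apply (E2 o\<^sub>L (reg_poly p o\<^sub>L K A)) (axis A 1 \<cdot> v))"
      unfolding Ew bnd_op_apply by (simp add: blinfun.sum_right)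
    also have "\<dots> = blinfun_apply (Bm o\<^sub>L E1) (blinfun_apply (bnd_op L) v)"
      unfolding key[symmetric] bnd_op_apply by (simp add: blinfun.sum_right)
    finally have "blinfun_apply E2 y = blinfun_apply (bnd_op L) v" by (rule injD[OF injE1])
    then show ?thesis unfolding H2 l2(3) k2(3) .
  qed
  then show ?thesis unfolding map_le_def pf_def by (auto simp: dom_def)
qed

end

theorem proposition5p10:
  fixes T :: "('v::banach, 'n::{finite,linorder}) clmodule \<rightharpoonup> ('v, 'n) clmodule"
    and f :: "'n clifford \<Rightarrow> 'n clifford"
    and p :: "real poly"
    and \<omega> \<theta> :: real
  assumes "0 < \<omega>" "\<omega> < pi / 2"
    and "T \<in> closed_ops" "bisectorial \<omega> T"
    and "\<omega> < \<theta>" "\<theta> < pi / 2"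
    and "p \<noteq> 0"
    and "f \<in> SHLreg \<omega> \<theta> T"
  shows "op_poly p T \<circ>\<^sub>m Hinf_calc \<omega> \<theta> T f \<subseteq>\<^sub>m Hinf_calc \<omega> \<theta> T (\<lambda>s. cl_poly p s \<cdot> f s)"
proof -
  have "(SOME J. J \<in> imag_units) \<in> (imag_units :: 'n clifford set)" by (rule someI_ex[OF imag_units_nonempty])
  \<comment> \<open>This membership carries the relative openness and the axial symmetry of the
    sector that the locale asks for.\<close>
  moreover have "f \<in> SHL (D_sector \<theta>)" using assms(8) by (simp add: SHLreg_def)
  ultimately interpret calculus T "SOME J. J \<in> imag_units" \<omega> \<theta> "SOME \<phi>. \<omega> < \<phi> \<and> \<phi> < \<theta>"
    using assms by unfold_locales (auto simp: SHL_def)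
  show ?thesis by (rule poly_Hinf_calc[OF assms(8)])
qed

end
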